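(* Let $m\ge1$ be an integer, $L_+=|\nabla|-\frac{2m}{1+x^2}$, $L_-=L_++R$, and consider the operator $$\mathcal{L}=\begin{bmatrix}0&-L_-\\L_+&0\end{bmatrix}$$ acting on $L^2(\mathbb{R})\times L^2(\mathbb{R})$ with domain $H^1(\mathbb{R})\times H^1(\mathbb{R})$. Then: (i) The spectrum is $\sigma(\mathcal{L})=i\mathbb{R}$. (ii) $E=0$ is the only eigenvalue of $\mathcal{L}$ and $\dim\ker(\mathcal{L})=2m+1$. In particular, $\mathcal{L}$ has no embedded eigenvalue $E\in i\mathbb{R}\setminus\{0\}$. (iii) The generalized nullspace of $\mathcal{L}$ acting on $L^2(\mathbb{R})\times L^2(\mathbb{R})$ is $$\bigcup_{n\ge1}\ker(\mathcal{L}^n)=\ker(\mathcal{L}^2)=\mathrm{span}\left\{\begin{bmatrix}\varphi_0\\0\end{bmatrix},\dots,\begin{bmatrix}\varphi_{2m-1}\\0\end{bmatrix},\begin{bmatrix}0\\\varphi_0\end{bmatrix},\dots,\begin{bmatrix}0\\\varphi_{2m-1}\end{bmatrix}\right\}.$$ (iv) $\mathcal{L}$ has two linearly independent resonances at $E=0$ given by $[\varphi,0]^T$ and $[0,\varphi]^T$, where $\varphi\in\dot H^{1/2}(\mathbb{R})\setminus L^2(\mathbb{R})$ is $\varphi=g_m$ if $m$ is odd and $\varphi=f_m$ if $m$ is even.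
   Context: $|\nabla|=\sqrt{-\Delta}$ on $\mathbb{R}$ (Fourier multiplier $|\xi|$); $L^2(\mathbb{R})$ is taken complex. $\dot H^{1/2}(\mathbb{R})$ is the space of $f\in L^1_{loc}$ with $\int\frac{|f(x)|}{1+x^2}dx<\infty$ and $\frac1{2\pi}\iint\frac{|f(x)-f(y)|^2}{|x-y|^2}dx\,dy<\infty$. $f_m(x)=\mathrm{Re}\left(i\cdot\frac{x-i}{x+i}\right)^m$, $g_m(x)=\mathrm{Im}\left(i\cdot\frac{x-i}{x+i}\right)^m$, $\mathbf{Q}_m=(f_m,g_m,0):\mathbb{R}\to\mathbb{S}^2$, and $$(Rf)(x)=\frac1{2\pi}\int_{\mathbb{R}}\frac{|\mathbf{Q}_m(x)-\mathbf{Q}_m(y)|^2}{|x-y|^2}f(y)\,dy .$$ As a self-adjoint operator on $L^2(\mathbb{R})$ with domain $H^1(\mathbb{R})$, $L_+$ has exactly $2m$ eigenvalues $E_0<\dots<E_{2m-2}<E_{2m-1}=0$, all simple, and $\varphi_0,\dots,\varphi_{2m-1}\in H^1(\mathbb{R})$ denote the corresponding normalized eigenfunctions. A resonance of $\mathcal{L}$ at $E=0$ is an element of $\dot H^{1/2}(\mathbb{R})\times\dot H^{1/2}(\mathbb{R})$ not lying in $L^2(\mathbb{R})\times L^2(\mathbb{R})$ that is annihilated by $\mathcal{L}$ (in the sense of distributions). *)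

theory Defs
  imports "HOL-Analysis.Analysis"
begin

section \<open>Complex normed spaces\<close>

class complex_normed_vector = real_normed_vector +
  fixes scaleC :: "complex \<Rightarrow> 'a \<Rightarrow> 'a" (infixr "*\<^sub>C" 75)
  assumes scaleC_add_right: "c *\<^sub>C (x + y) = c *\<^sub>C x + c *\<^sub>C y"
    and scaleC_add_left: "(c + d) *\<^sub>C x = c *\<^sub>C x + d *\<^sub>C x"
    and scaleC_scaleC: "c *\<^sub>C d *\<^sub>C x = (c * d) *\<^sub>C x"
    and scaleC_one: "1 *\<^sub>C x = x"
    and scaleR_scaleC: "r *\<^sub>R x = complex_of_real r *\<^sub>C x"
    and norm_scaleC: "norm (c *\<^sub>C x) = cmod c * norm x"

global_interpretation complex_vector:
  vector_space "scaleC :: complex \<Rightarrow> 'a \<Rightarrow> 'a::complex_normed_vector"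
  defines cspan = complex_vector.span
    and cdim = complex_vector.dim
  by unfold_locales
    (auto simp: scaleC_add_right scaleC_add_left scaleC_scaleC scaleC_one)

instantiation prod :: (complex_normed_vector, complex_normed_vector) complex_normed_vector
begin

definition scaleC_prod :: "complex \<Rightarrow> 'a \<times> 'b \<Rightarrow> 'a \<times> 'b"
  where "scaleC_prod c w = (c *\<^sub>C fst w, c *\<^sub>C snd w)"

instance
proof
  fix c d :: complex and r :: real and x y :: "'a \<times> 'b"
  show "norm (c *\<^sub>C x) = cmod c * norm x"
    by (simp add: scaleC_prod_def norm_prod_def norm_scaleC power_mult_distrib
        flip: distrib_left) (simp add: real_sqrt_mult)
qed (auto simp: scaleC_prod_def scaleC_add_right scaleC_add_left scaleC_scaleC scaleC_one
    scaleR_scaleC prod_eq_iff)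

end


section \<open>The complex Hilbert space of square-integrable functions on the line\<close>

definition square_integrable :: "(real \<Rightarrow> complex) \<Rightarrow> bool" where
  "square_integrable f \<longleftrightarrow>
     f \<in> borel_measurable lborel \<and> integrable lborel (\<lambda>x. (cmod (f x))\<^sup>2)"

definition ae_eq :: "(real \<Rightarrow> complex) \<Rightarrow> (real \<Rightarrow> complex) \<Rightarrow> bool" where
  "ae_eq f g \<longleftrightarrow>
     square_integrable f \<and> square_integrable g \<and> (AE x in lborel. f x = g x)"

lemma integrable_dominated:
  fixes f g :: "real \<Rightarrow> real"
  assumes "integrable lborel g" "f \<in> borel_measurable lborel"
    and "\<And>x. 0 \<le> f x" "\<And>x. f x \<le> g x"
  shows "integrable lborel f"
proof (rule Bochner_Integration.integrable_bound[OF assms(1,2)])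
  show "AE x in lborel. norm (f x) \<le> norm (g x)"
    by (rule AE_I2) (use assms(3,4) in \<open>simp add: order_trans[OF _ abs_ge_self]\<close>)
qed

lemma square_integrable_zero: "square_integrable (\<lambda>x. 0)"
  by (simp add: square_integrable_def)

lemma square_integrable_bound:
  assumes g: "square_integrable g" and f: "f \<in> borel_measurable lborel"
    and le: "\<And>x. cmod (f x) \<le> C * cmod (g x)"
  shows "square_integrable f"
proof -
  have "integrable lborel (\<lambda>x. (cmod (f x))\<^sup>2)"
  proof (rule integrable_dominated)
    show "integrable lborel (\<lambda>x. C\<^sup>2 * (cmod (g x))\<^sup>2)"
      using g by (simp add: square_integrable_def)
    show "(cmod (f x))\<^sup>2 \<le> C\<^sup>2 * (cmod (g x))\<^sup>2" for x
      using power_mono[OF le[of x], of 2] by (simp add: power_mult_distrib)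
    show "(\<lambda>x. (cmod (f x))\<^sup>2) \<in> borel_measurable lborel"
      using f by measurable
  qed simp
  then show ?thesis using f by (simp add: square_integrable_def)
qed

lemma square_integrable_cmult:
  assumes "square_integrable f" shows "square_integrable (\<lambda>x. c * f x)"
proof (rule square_integrable_bound[OF assms])
  have [measurable]: "f \<in> borel_measurable borel"
    using assms by (simp add: square_integrable_def)
  show "(\<lambda>x. c * f x) \<in> borel_measurable lborel"
    by simp
  show "cmod (c * f x) \<le> cmod c * cmod (f x)" for x
    by (simp add: norm_mult)
qed

lemma square_integrable_add:
  assumes f: "square_integrable f" and g: "square_integrable g"
  shows "square_integrable (\<lambda>x. f x + g x)"
proof -
  have [measurable]: "f \<in> borel_measurable borel" "g \<in> borel_measurable borel"
    using f g by (simp_all add: square_integrable_def)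
  have "integrable lborel (\<lambda>x. (cmod (f x + g x))\<^sup>2)"
  proof (rule integrable_dominated)
    show "integrable lborel (\<lambda>x. 2 * (cmod (f x))\<^sup>2 + 2 * (cmod (g x))\<^sup>2)"
      using f g by (simp add: square_integrable_def)
    fix x
    have "(cmod (f x + g x))\<^sup>2 \<le> (cmod (f x) + cmod (g x))\<^sup>2"
      by (intro power_mono norm_triangle_ineq) simp
    also have "\<dots> \<le> 2 * (cmod (f x))\<^sup>2 + 2 * (cmod (g x))\<^sup>2"
      using sum_squares_bound[of "cmod (f x)" "cmod (g x)"] by (simp add: power2_sum)
    finally show "(cmod (f x + g x))\<^sup>2 \<le> 2 * (cmod (f x))\<^sup>2 + 2 * (cmod (g x))\<^sup>2" .
  qed simp_all
  then show ?thesis by (simp add: square_integrable_def)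
qed

lemma square_integrable_mult:
  assumes f: "square_integrable f" and g: "square_integrable g"
  shows "integrable lborel (\<lambda>x. cmod (f x) * cmod (g x))"
proof (rule integrable_dominated)
  have [measurable]: "f \<in> borel_measurable borel" "g \<in> borel_measurable borel"
    using f g by (simp_all add: square_integrable_def)
  show "(\<lambda>x. cmod (f x) * cmod (g x)) \<in> borel_measurable lborel"
    by simp
  show "integrable lborel (\<lambda>x. (cmod (f x))\<^sup>2 + (cmod (g x))\<^sup>2)"
    using f g by (simp add: square_integrable_def)
  show "cmod (f x) * cmod (g x) \<le> (cmod (f x))\<^sup>2 + (cmod (g x))\<^sup>2" for x
    using sum_squares_bound[of "cmod (f x)" "cmod (g x)"]
      mult_nonneg_nonneg[OF norm_ge_zero[of "f x"] norm_ge_zero[of "g x"]] by linarith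
qed simp

lemma square_integrable_inner:
  assumes f: "square_integrable f" and g: "square_integrable g"
  shows "integrable lborel (\<lambda>x. f x \<bullet> g x)"
proof (rule Bochner_Integration.integrable_bound[OF square_integrable_mult[OF f g]])
  have [measurable]: "f \<in> borel_measurable borel" "g \<in> borel_measurable borel"
    using f g by (simp_all add: square_integrable_def)
  show "(\<lambda>x. f x \<bullet> g x) \<in> borel_measurable lborel"
    by simp
  show "AE x in lborel. norm (f x \<bullet> g x) \<le> norm (cmod (f x) * cmod (g x))"
    by (rule AE_I2) (simp add: Cauchy_Schwarz_ineq2 abs_mult)
qed

quotient_type L2 = "real \<Rightarrow> complex" / partial: ae_eq
proof (rule part_equivpI)
  show "\<exists>f. ae_eq f f"
    using square_integrable_zero by (auto simp: ae_eq_def)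
  show "symp ae_eq"
    by (auto simp: symp_def ae_eq_def)
  show "transp ae_eq"
  proof (rule transpI)
    fix f g h assume fg: "ae_eq f g" and gh: "ae_eq g h"
    then have "AE x in lborel. f x = g x" "AE x in lborel. g x = h x"
      by (simp_all add: ae_eq_def)
    then have "AE x in lborel. f x = h x"
      by (rule eventually_elim2) simp
    with fg gh show "ae_eq f h"
      by (simp add: ae_eq_def)
  qed
qed

instantiation L2 :: real_inner
begin

lift_definition zero_L2 :: L2 is "\<lambda>x. 0"
  by (simp add: ae_eq_def square_integrable_zero)

lift_definition plus_L2 :: "L2 \<Rightarrow> L2 \<Rightarrow> L2" is "\<lambda>f g x. f x + g x"
  unfolding ae_eq_def by (intro conjI square_integrable_add) auto

lift_definition uminus_L2 :: "L2 \<Rightarrow> L2" is "\<lambda>f x. - f x"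
  using square_integrable_cmult[of _ "-1"] by (auto simp: ae_eq_def)

definition minus_L2 :: "L2 \<Rightarrow> L2 \<Rightarrow> L2" where "minus_L2 u v = u + - v"

lift_definition scaleR_L2 :: "real \<Rightarrow> L2 \<Rightarrow> L2" is "\<lambda>r f x. complex_of_real r * f x"
  using square_integrable_cmult by (auto simp: ae_eq_def)

lift_definition inner_L2 :: "L2 \<Rightarrow> L2 \<Rightarrow> real" is "\<lambda>f g. LINT x|lborel. f x \<bullet> g x"
  by (rule integral_cong_AE)
    (auto simp: ae_eq_def square_integrable_def)

definition norm_L2 :: "L2 \<Rightarrow> real" where "norm_L2 u = sqrt (u \<bullet> u)"

definition dist_L2 :: "L2 \<Rightarrow> L2 \<Rightarrow> real" where "dist_L2 u v = norm (u - v)"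

definition sgn_L2 :: "L2 \<Rightarrow> L2" where "sgn_L2 u = inverse (norm u) *\<^sub>R u"

definition uniformity_L2 :: "(L2 \<times> L2) filter"
  where "uniformity_L2 = (INF e\<in>{0<..}. principal {(u, v). dist u v < e})"

definition open_L2 :: "L2 set \<Rightarrow> bool"
  where "open_L2 U = (\<forall>u\<in>U. \<forall>\<^sub>F (u', v) in uniformity. u' = u \<longrightarrow> v \<in> U)"

instance
proof
  fix u v w :: L2 and a b :: real
  show "u + v + w = u + (v + w)"
    by transfer (auto simp: ae_eq_def algebra_simps intro!: square_integrable_add)
  show "u + v = v + u"
    by transfer (auto simp: ae_eq_def algebra_simps intro!: square_integrable_add)
  show "0 + u = u"
    by transfer (auto simp: ae_eq_def)
  show "- u + u = 0"
    by transfer (auto simp: ae_eq_def square_integrable_zero)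
  show "u - v = u + - v" by (rule minus_L2_def)
  show "a *\<^sub>R (u + v) = a *\<^sub>R u + a *\<^sub>R v"
    by transfer (auto simp: ae_eq_def distrib_left distrib_right
        intro!: square_integrable_add square_integrable_cmult)
  show "(a + b) *\<^sub>R u = a *\<^sub>R u + b *\<^sub>R u"
    by transfer (auto simp: ae_eq_def distrib_left distrib_right
        intro!: square_integrable_add square_integrable_cmult)
  show "a *\<^sub>R b *\<^sub>R u = (a * b) *\<^sub>R u"
    by transfer (use square_integrable_cmult in \<open>auto simp: ae_eq_def mult.assoc\<close>)
  show "1 *\<^sub>R u = u"
    by transfer (auto simp: ae_eq_def)
  show "u \<bullet> v = v \<bullet> u"
    by transfer (simp add: inner_commute)
  show "(u + v) \<bullet> w = u \<bullet> w + v \<bullet> w"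
    by transfer (auto simp: ae_eq_def inner_add_left square_integrable_inner)
  show "(a *\<^sub>R u) \<bullet> v = a * (u \<bullet> v)"
    by transfer (simp flip: scaleR_conv_of_real)
  show "0 \<le> u \<bullet> u"
    by transfer simp
  show "u \<bullet> u = 0 \<longleftrightarrow> u = 0"
  proof transfer
    fix f :: "real \<Rightarrow> complex" assume "ae_eq f f"
    then have f: "square_integrable f" by (simp add: ae_eq_def)
    have "(LINT x|lborel. f x \<bullet> f x) = 0 \<longleftrightarrow> (AE x in lborel. f x \<bullet> f x = 0)"
      by (rule integral_nonneg_eq_0_iff_AE[OF square_integrable_inner[OF f f]]) auto
    then show "(LINT x|lborel. f x \<bullet> f x) = 0 \<longleftrightarrow> ae_eq f (\<lambda>x. 0)"
      using f by (simp add: ae_eq_def square_integrable_zero)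
  qed
qed (fact norm_L2_def dist_L2_def sgn_L2_def uniformity_L2_def open_L2_def)+

end

instantiation L2 :: complex_normed_vector
begin

lift_definition scaleC_L2 :: "complex \<Rightarrow> L2 \<Rightarrow> L2" is "\<lambda>c f x. c * f x"
  using square_integrable_cmult by (auto simp: ae_eq_def)

instance
proof
  fix c d :: complex and r :: real and u v :: L2
  show "c *\<^sub>C (u + v) = c *\<^sub>C u + c *\<^sub>C v"
    by transfer (auto simp: ae_eq_def distrib_left distrib_right
        intro!: square_integrable_add square_integrable_cmult)
  show "(c + d) *\<^sub>C u = c *\<^sub>C u + d *\<^sub>C u"
    by transfer (auto simp: ae_eq_def distrib_left distrib_right
        intro!: square_integrable_add square_integrable_cmult)
  show "c *\<^sub>C d *\<^sub>C u = (c * d) *\<^sub>C u"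
    by transfer (use square_integrable_cmult in \<open>auto simp: ae_eq_def mult.assoc\<close>)
  show "1 *\<^sub>C u = u"
    by transfer (auto simp: ae_eq_def)
  show "r *\<^sub>R u = complex_of_real r *\<^sub>C u"
    by transfer (use square_integrable_cmult in \<open>auto simp: ae_eq_def\<close>)
  have "(c *\<^sub>C u) \<bullet> (c *\<^sub>C u) = (cmod c)\<^sup>2 * (u \<bullet> u)"
    by transfer (simp add: dot_square_norm norm_mult power_mult_distrib)
  then show "norm (c *\<^sub>C u) = cmod c * norm u"
    by (simp add: norm_L2_def real_sqrt_mult)
qed

end


section \<open>Unbounded operators\<close>

text \<open>An operator is a total function \<open>T\<close> together with its domain \<open>D\<close>; values of \<open>T\<close>
  outside \<open>D\<close> are never used.\<close>

definition resolvent_set :: "'a::complex_normed_vector set \<Rightarrow> ('a \<Rightarrow> 'a) \<Rightarrow> complex set" where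
  "resolvent_set D T =
     {z. bij_betw (\<lambda>u. T u - z *\<^sub>C u) D UNIV \<and>
         (\<exists>C. \<forall>u\<in>D. norm u \<le> C * norm (T u - z *\<^sub>C u))}"

definition spectrum :: "'a::complex_normed_vector set \<Rightarrow> ('a \<Rightarrow> 'a) \<Rightarrow> complex set" where
  "spectrum D T = - resolvent_set D T"

definition eigenspace :: "'a::complex_normed_vector set \<Rightarrow> ('a \<Rightarrow> 'a) \<Rightarrow> complex \<Rightarrow> 'a set" where
  "eigenspace D T z = {u\<in>D. T u = z *\<^sub>C u}"

definition eigenvalues :: "'a::complex_normed_vector set \<Rightarrow> ('a \<Rightarrow> 'a) \<Rightarrow> complex set" where
  "eigenvalues D T = {z. \<exists>u\<in>eigenspace D T z. u \<noteq> 0}"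

primrec power_domain :: "'a set \<Rightarrow> ('a \<Rightarrow> 'a) \<Rightarrow> nat \<Rightarrow> 'a set" where
  "power_domain D T 0 = UNIV"
| "power_domain D T (Suc n) = {u\<in>D. T u \<in> power_domain D T n}"

definition power_kernel :: "'a::zero set \<Rightarrow> ('a \<Rightarrow> 'a) \<Rightarrow> nat \<Rightarrow> 'a set" where
  "power_kernel D T n = {u\<in>power_domain D T n. (T ^^ n) u = 0}"


section \<open>Fourier transform, the Sobolev space and the half-Laplacian\<close>

text \<open>Plancherel's definition: the transform of \<open>f\<close> is the mean-square limit of the
  transforms of the truncations of \<open>f\<close> to \<open>[-N, N]\<close>. The integral below is a nonnegative
  extended integral, so it cannot vanish for lack of integrability.\<close>

lift_definition is_fourier_transform :: "L2 \<Rightarrow> L2 \<Rightarrow> bool" is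
  "\<lambda>f g. ((\<lambda>N::real. \<integral>\<^sup>+ \<xi>. ennreal ((cmod (g \<xi> -
       (LINT x:{-N..N}|lborel. f x * exp (- (\<i> * complex_of_real (x * \<xi>))))))\<^sup>2) \<partial>lborel)
     \<longlongrightarrow> 0) at_top"
proof -
  fix f f' g g' :: "real \<Rightarrow> complex"
  assume f: "ae_eq f f'" and g: "ae_eq g g'"
  have [measurable]: "f \<in> borel_measurable borel" "f' \<in> borel_measurable borel"
    using f by (auto simp: ae_eq_def square_integrable_def)
  have "(LINT x:{-N..N}|lborel. f x * exp (- (\<i> * complex_of_real (x * \<xi>)))) =
      (LINT x:{-N..N}|lborel. f' x * exp (- (\<i> * complex_of_real (x * \<xi>))))" for N \<xi> :: real
    unfolding set_lebesgue_integral_def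
    by (rule integral_cong_AE) (use f in \<open>auto simp: ae_eq_def\<close>)
  moreover have "(\<integral>\<^sup>+ \<xi>. ennreal ((cmod (g \<xi> - h \<xi>))\<^sup>2) \<partial>lborel) =
      (\<integral>\<^sup>+ \<xi>. ennreal ((cmod (g' \<xi> - h \<xi>))\<^sup>2) \<partial>lborel)" for h
    by (rule nn_integral_cong_AE) (use g in \<open>auto simp: ae_eq_def\<close>)
  ultimately show "?thesis f f' g g'" by simp
qed

definition fourier :: "L2 \<Rightarrow> L2" where
  "fourier u = (THE v. is_fourier_transform u v)"

lift_definition bessel_weight_integral :: "L2 \<Rightarrow> ennreal" is
  "\<lambda>g. \<integral>\<^sup>+ \<xi>. ennreal ((1 + \<xi>\<^sup>2) * (cmod (g \<xi>))\<^sup>2) \<partial>lborel"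
  by (rule nn_integral_cong_AE) (auto simp: ae_eq_def)

definition H1 :: "L2 set" where
  "H1 = {u. bessel_weight_integral (fourier u) < \<infinity>}"

lift_definition is_abs_multiple :: "L2 \<Rightarrow> L2 \<Rightarrow> bool" is
  "\<lambda>g h. AE \<xi> in lborel. h \<xi> = complex_of_real \<bar>\<xi>\<bar> * g \<xi>"
  unfolding ae_eq_def by auto

definition abs_nabla :: "L2 \<Rightarrow> L2" where
  "abs_nabla u = (THE v. is_abs_multiple (fourier u) (fourier v))"


section \<open>The linearized operator\<close>

definition f_comp :: "nat \<Rightarrow> real \<Rightarrow> real" where
  "f_comp m x = Re ((\<i> * ((complex_of_real x - \<i>) / (complex_of_real x + \<i>))) ^ m)"

definition g_comp :: "nat \<Rightarrow> real \<Rightarrow> real" where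
  "g_comp m x = Im ((\<i> * ((complex_of_real x - \<i>) / (complex_of_real x + \<i>))) ^ m)"

definition Q_map :: "nat \<Rightarrow> real \<Rightarrow> real \<times> real \<times> real" where
  "Q_map m x = (f_comp m x, g_comp m x, 0)"

definition R_kernel :: "nat \<Rightarrow> real \<Rightarrow> real \<Rightarrow> real" where
  "R_kernel m x y = (norm (Q_map m x - Q_map m y))\<^sup>2 / \<bar>x - y\<bar>\<^sup>2"

definition R_fun :: "nat \<Rightarrow> (real \<Rightarrow> complex) \<Rightarrow> real \<Rightarrow> complex" where
  "R_fun m f x = complex_of_real (1 / (2 * pi)) *
     (LINT y|lborel. complex_of_real (R_kernel m x y) * f y)"

definition potential :: "nat \<Rightarrow> real \<Rightarrow> complex" where
  "potential m x = complex_of_real (2 * real m / (1 + x\<^sup>2))"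

lemma power_diff_norm_le:
  fixes z w :: complex
  assumes "cmod z = 1" "cmod w = 1"
  shows "cmod (z ^ m - w ^ m) \<le> real m * cmod (z - w)"
  using norm_power_diff[of z w m] assms by simp

lemma R_kernel_bounds:
  "0 \<le> R_kernel m x y" "R_kernel m x y \<le> 4 * (real m)\<^sup>2 / ((1 + x\<^sup>2) * (1 + y\<^sup>2))"
proof -
  show "0 \<le> R_kernel m x y" by (simp add: R_kernel_def)
  define c :: "real \<Rightarrow> complex" where "c x = \<i> * ((of_real x - \<i>) / (of_real x + \<i>))" for x
  have nz: "complex_of_real t + \<i> \<noteq> 0" for t
    by (auto simp: complex_eq_iff)
  have cm: "(cmod (complex_of_real t + \<i>))\<^sup>2 = 1 + t\<^sup>2" for t
    by (simp add: cmod_power2)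
  have "cmod (complex_of_real t - \<i>) = cmod (complex_of_real t + \<i>)" for t
    by (simp add: cmod_def)
  then have c1: "cmod (c t) = 1" for t
    using nz[of t] by (simp add: c_def norm_mult norm_divide)
  have Q: "(norm (Q_map m x - Q_map m y))\<^sup>2 = (cmod (c x ^ m - c y ^ m))\<^sup>2"
    by (simp add: Q_map_def f_comp_def g_comp_def c_def norm_prod_def cmod_def)
  have "c x - c y = - 2 * of_real (x - y) / ((of_real x + \<i>) * (of_real y + \<i>))"
    using nz[of x] nz[of y] by (simp add: c_def field_simps)
  then have "(cmod (c x - c y))\<^sup>2 = 4 * \<bar>x - y\<bar>\<^sup>2 / ((1 + x\<^sup>2) * (1 + y\<^sup>2))"
    by (simp add: norm_mult norm_divide power_divide power_mult_distrib cm del: of_real_diff)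
  moreover have "(cmod (c x ^ m - c y ^ m))\<^sup>2 \<le> (real m * cmod (c x - c y))\<^sup>2"
    by (intro power_mono power_diff_norm_le c1) auto
  ultimately have "(norm (Q_map m x - Q_map m y))\<^sup>2
      \<le> 4 * (real m)\<^sup>2 / ((1 + x\<^sup>2) * (1 + y\<^sup>2)) * \<bar>x - y\<bar>\<^sup>2"
    by (simp add: Q power_mult_distrib field_simps)
  then show "R_kernel m x y \<le> 4 * (real m)\<^sup>2 / ((1 + x\<^sup>2) * (1 + y\<^sup>2))"
    by (cases "x = y") (auto simp: R_kernel_def divide_le_eq)
qed

lemma R_kernel_measurable [measurable]:
  "(\<lambda>(x, y). R_kernel m x y) \<in> borel_measurable (borel \<Otimes>\<^sub>M borel)"
  by (simp add: R_kernel_def Q_map_def f_comp_def g_comp_def norm_prod_def case_prod_beta)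

lemma integrable_inverse_1_plus_square: "integrable lborel (\<lambda>x::real. 1 / (1 + x\<^sup>2))"
proof -
  have "set_integrable lborel (einterval (-\<infinity>) \<infinity>) (\<lambda>x::real. 1 / (1 + x\<^sup>2))"
  proof (rule interval_integral_FTC_nonneg(1))
    show "(arctan has_real_derivative 1 / (1 + x\<^sup>2)) (at x)" for x
      using DERIV_arctan[of x] by (simp add: inverse_eq_divide)
    show "isCont (\<lambda>x::real. 1 / (1 + x\<^sup>2)) x" for x
      by (intro continuous_intros) (simp add: add_nonneg_eq_0_iff)
    show "((arctan \<circ> real_of_ereal) \<longlongrightarrow> pi / 2) (at_left \<infinity>)"
      by (simp add: ereal_tendsto_simps tendsto_arctan_at_top)
    show "((arctan \<circ> real_of_ereal) \<longlongrightarrow> - (pi / 2)) (at_right (-\<infinity>))"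
      by (simp add: ereal_tendsto_simps tendsto_arctan_at_bot)
  qed simp_all
  then show ?thesis by (simp add: set_integrable_def)
qed

lemma square_integrable_weight:
  "square_integrable (\<lambda>x. complex_of_real (1 / (1 + x\<^sup>2)))"
  unfolding square_integrable_def
proof
  show "integrable lborel (\<lambda>x. (cmod (complex_of_real (1 / (1 + x\<^sup>2))))\<^sup>2)"
  proof (rule integrable_dominated[OF integrable_inverse_1_plus_square])
    fix x :: real
    have "1 / (1 + x\<^sup>2) \<le> 1"
      by (rule mult_imp_div_pos_le) (use zero_le_power2[of x] in linarith, simp)
    then have "(1 / (1 + x\<^sup>2))\<^sup>2 \<le> 1 / (1 + x\<^sup>2)"
      using power_decreasing[of 1 2 "1 / (1 + x\<^sup>2)"] by simp
    then show "(cmod (complex_of_real (1 / (1 + x\<^sup>2))))\<^sup>2 \<le> 1 / (1 + x\<^sup>2)"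
      by (simp only: norm_of_real power2_abs)
  qed simp_all
qed simp

lemma square_integrable_R_fun:
  assumes f: "square_integrable f"
  shows "square_integrable (R_fun m f)"
proof -
  have [measurable]: "f \<in> borel_measurable borel"
    using f by (simp add: square_integrable_def)
  define I where "I = (LINT y|lborel. cmod (complex_of_real (1 / (1 + y\<^sup>2))) * cmod (f y))"
  have int: "integrable lborel (\<lambda>y. cmod (complex_of_real (1 / (1 + y\<^sup>2))) * cmod (f y))"
    by (rule square_integrable_mult[OF square_integrable_weight f])
  have R: "cmod (LINT y|lborel. complex_of_real (R_kernel m x y) * f y)
      \<le> 4 * (real m)\<^sup>2 / (1 + x\<^sup>2) * I" for x
  proof -
    have le: "cmod (complex_of_real (R_kernel m x y) * f y) \<le> 4 * (real m)\<^sup>2 / (1 + x\<^sup>2) *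
        (cmod (complex_of_real (1 / (1 + y\<^sup>2))) * cmod (f y))" for y
    proof -
      have w: "cmod (complex_of_real (1 / (1 + y\<^sup>2))) = 1 / (1 + y\<^sup>2)"
        by (simp only: norm_of_real) simp
      have "R_kernel m x y * cmod (f y)
          \<le> 4 * (real m)\<^sup>2 / ((1 + x\<^sup>2) * (1 + y\<^sup>2)) * cmod (f y)"
        by (intro mult_right_mono R_kernel_bounds) simp
      then show ?thesis
        by (simp only: w norm_mult norm_of_real abs_of_nonneg[OF R_kernel_bounds(1)])
          (simp add: mult_ac)
    qed
    have "integrable lborel (\<lambda>y. complex_of_real (R_kernel m x y) * f y)"
    proof (rule Bochner_Integration.integrable_bound[OF integrable_mult_right[OF int]])
      show "AE y in lborel. norm (complex_of_real (R_kernel m x y) * f y) \<le>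
          norm (4 * (real m)\<^sup>2 / (1 + x\<^sup>2) *
            (cmod (complex_of_real (1 / (1 + y\<^sup>2))) * cmod (f y)))"
        unfolding real_norm_def by (rule AE_I2) (rule order_trans[OF le abs_ge_self])
    qed simp
    then have "cmod (LINT y|lborel. complex_of_real (R_kernel m x y) * f y)
        \<le> (LINT y|lborel. 4 * (real m)\<^sup>2 / (1 + x\<^sup>2) *
             (cmod (complex_of_real (1 / (1 + y\<^sup>2))) * cmod (f y)))"
      by (rule Bochner_Integration.integral_norm_bound_integral
          [OF _ integrable_mult_right[OF int] le])
    also have "\<dots> = 4 * (real m)\<^sup>2 / (1 + x\<^sup>2) * I"
      unfolding I_def by (rule integral_mult_right_zero)
    finally show ?thesis .
  qed
  show ?thesis
  proof (rule square_integrable_bound[OF square_integrable_weight])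
    show "R_fun m f \<in> borel_measurable lborel"
      unfolding R_fun_def by measurable
    fix x
    have w: "cmod (complex_of_real (1 / (1 + x\<^sup>2))) = 1 / (1 + x\<^sup>2)"
      by (simp only: norm_of_real) simp
    have "cmod (R_fun m f x) =
        1 / (2 * pi) * cmod (LINT y|lborel. complex_of_real (R_kernel m x y) * f y)"
      unfolding R_fun_def norm_mult norm_of_real by simp
    also have "\<dots> \<le> 1 / (2 * pi) * (4 * (real m)\<^sup>2 / (1 + x\<^sup>2) * I)"
      by (intro mult_left_mono R) simp
    finally show "cmod (R_fun m f x) \<le>
        (1 / (2 * pi) * 4 * (real m)\<^sup>2 * I) * cmod (complex_of_real (1 / (1 + x\<^sup>2)))"
      unfolding w by (simp add: mult_ac)
  qed
qed

lemma square_integrable_potential: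
  assumes f: "square_integrable f"
  shows "square_integrable (\<lambda>x. potential m x * f x)"
proof (rule square_integrable_bound[OF f])
  have [measurable]: "f \<in> borel_measurable borel"
    using f by (simp add: square_integrable_def)
  show "(\<lambda>x. potential m x * f x) \<in> borel_measurable lborel"
    unfolding potential_def by measurable
  fix x
  have "2 * real m / (1 + x\<^sup>2) \<le> 2 * real m"
  proof (rule mult_imp_div_pos_le)
    show "0 < 1 + x\<^sup>2"
      using zero_le_power2[of x] by linarith
    show "2 * real m \<le> 2 * real m * (1 + x\<^sup>2)"
      by (simp add: distrib_left)
  qed
  then have "cmod (potential m x) \<le> 2 * real m"
    unfolding potential_def norm_of_real by simp
  then show "cmod (potential m x * f x) \<le> (2 * real m) * cmod (f x)"
    unfolding norm_mult by (rule mult_right_mono) simp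
qed

lift_definition R_op :: "nat \<Rightarrow> L2 \<Rightarrow> L2" is R_fun
proof -
  fix m and f f' :: "real \<Rightarrow> complex" assume f: "ae_eq f f'"
  have [measurable]: "f \<in> borel_measurable borel" "f' \<in> borel_measurable borel"
    using f by (auto simp: ae_eq_def square_integrable_def)
  have "R_fun m f = R_fun m f'"
    unfolding R_fun_def
    by (intro ext arg_cong2[where f = "(*)"] refl integral_cong_AE)
      (use f in \<open>auto simp: ae_eq_def\<close>)
  then show "ae_eq (R_fun m f) (R_fun m f')"
    using f square_integrable_R_fun by (auto simp: ae_eq_def)
qed

lift_definition potential_op :: "nat \<Rightarrow> L2 \<Rightarrow> L2" is "\<lambda>m f x. potential m x * f x"
  by (auto simp: ae_eq_def square_integrable_potential)

definition L_plus :: "nat \<Rightarrow> L2 \<Rightarrow> L2" where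
  "L_plus m u = abs_nabla u - potential_op m u"

definition L_minus :: "nat \<Rightarrow> L2 \<Rightarrow> L2" where
  "L_minus m u = L_plus m u + R_op m u"

definition L_op :: "nat \<Rightarrow> L2 \<times> L2 \<Rightarrow> L2 \<times> L2" where
  "L_op m w = (- L_minus m (snd w), L_plus m (fst w))"

definition L_dom :: "(L2 \<times> L2) set" where
  "L_dom = H1 \<times> H1"

text \<open>As \<open>L_plus\<close> is self-adjoint, an eigenvalue is simple iff its eigenspace has dimension one.
  The unit vectors \<open>\<phi> k\<close> are determined up to a phase.\<close>

definition L_plus_eigensystem :: "nat \<Rightarrow> (nat \<Rightarrow> real) \<Rightarrow> (nat \<Rightarrow> L2) \<Rightarrow> bool" where
  "L_plus_eigensystem m E \<phi> \<longleftrightarrow>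
     strict_mono_on {..<2 * m} E \<and> E (2 * m - 1) = 0 \<and>
     eigenvalues H1 (L_plus m) = (\<lambda>k. complex_of_real (E k)) ` {..<2 * m} \<and>
     (\<forall>k<2 * m. cdim (eigenspace H1 (L_plus m) (complex_of_real (E k))) = 1 \<and>
        \<phi> k \<in> eigenspace H1 (L_plus m) (complex_of_real (E k)) \<and> norm (\<phi> k) = 1)"


section \<open>Resonances\<close>

definition H_half_dot :: "(real \<Rightarrow> complex) set" where
  "H_half_dot = {f. f \<in> borel_measurable lborel \<and>
     (\<forall>r. set_integrable lborel {-r..r} f) \<and>
     integrable lborel (\<lambda>x. cmod (f x) / (1 + x\<^sup>2)) \<and>
     ennreal (1 / (2 * pi)) *
       (\<integral>\<^sup>+ x. \<integral>\<^sup>+ y. ennreal ((cmod (f x - f y))\<^sup>2 / \<bar>x - y\<bar>\<^sup>2) \<partial>lborel \<partial>lborel) < \<infinity>}"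

definition test_function :: "(real \<Rightarrow> complex) \<Rightarrow> bool" where
  "test_function \<psi> \<longleftrightarrow>
     (\<exists>D :: nat \<Rightarrow> real \<Rightarrow> complex.
        D 0 = \<psi> \<and> (\<forall>n x. (D n has_vector_derivative D (Suc n) x) (at x))) \<and>
     (\<exists>r. \<forall>x. \<bar>x\<bar> > r \<longrightarrow> \<psi> x = 0)"

definition abs_nabla_test :: "(real \<Rightarrow> complex) \<Rightarrow> real \<Rightarrow> complex" where
  "abs_nabla_test \<psi> x = complex_of_real (1 / (2 * pi)) *
     (LINT \<xi>|lborel. complex_of_real \<bar>\<xi>\<bar> * exp (\<i> * complex_of_real (x * \<xi>)) *
        (LINT t|lborel. \<psi> t * exp (- (\<i> * complex_of_real (t * \<xi>)))))"

text \<open>The distribution \<open>|\<nabla>|f\<close> is \<open>\<psi> \<mapsto> \<integral> f |\<nabla>|\<psi>\<close>. For a test function \<open>\<psi>\<close>, the function \<open>|\<nabla>|\<psi>\<close>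
  is continuous and of order \<open>1/x\<^sup>2\<close> at infinity, and \<open>R_kernel m x y\<close> is at most a constant
  times \<open>1/((1+x\<^sup>2)(1+y\<^sup>2))\<close>; so all integrals below converge absolutely for \<open>f\<close> in
  \<open>H_half_dot\<close>. The pairing is bilinear, without conjugation.\<close>

definition L_plus_distr :: "nat \<Rightarrow> (real \<Rightarrow> complex) \<Rightarrow> (real \<Rightarrow> complex) \<Rightarrow> complex" where
  "L_plus_distr m f \<psi> = (LINT x|lborel. f x * abs_nabla_test \<psi> x)
     - (LINT x|lborel. potential m x * f x * \<psi> x)"

definition L_minus_distr :: "nat \<Rightarrow> (real \<Rightarrow> complex) \<Rightarrow> (real \<Rightarrow> complex) \<Rightarrow> complex" where
  "L_minus_distr m f \<psi> = L_plus_distr m f \<psi> + (LINT x|lborel. R_fun m f x * \<psi> x)"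

definition is_resonance_at_0 ::
    "nat \<Rightarrow> (real \<Rightarrow> complex) \<times> (real \<Rightarrow> complex) \<Rightarrow> bool" where
  "is_resonance_at_0 m w \<longleftrightarrow>
     w \<in> H_half_dot \<times> H_half_dot \<and>
     w \<notin> Collect square_integrable \<times> Collect square_integrable \<and>
     (\<forall>\<psi>. test_function \<psi> \<longrightarrow>
        - L_minus_distr m (snd w) \<psi> = 0 \<and> L_plus_distr m (fst w) \<psi> = 0)"

text \<open>Linear independence of two pairs of functions, modulo equality almost everywhere.\<close>

definition ae_independent ::
    "(real \<Rightarrow> complex) \<times> (real \<Rightarrow> complex) \<Rightarrow>
     (real \<Rightarrow> complex) \<times> (real \<Rightarrow> complex) \<Rightarrow> bool" where
  "ae_independent v w \<longleftrightarrow>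
     (\<forall>a b. (AE x in lborel. a * fst v x + b * fst w x = 0 \<and>
                             a * snd v x + b * snd w x = 0) \<longrightarrow> a = 0 \<and> b = 0)"

end

theory Submission
  imports Defs
begin

text \<open>Under the Cayley transform \<open>z = (x - \<i>)/(x + \<i>)\<close> the operator \<open>|\<nabla>|\<close> becomes \<open>2/(1 + x\<^sup>2)\<close> times
  the multiplier \<open>|k|\<close> on Fourier modes \<open>z\<^sup>k\<close>, and \<open>R\<close> becomes the Fejer multiplier
  \<open>(m - |k|)\<^sub>+\<close>, so that \<open>L\<^sub>-\<close> is the multiplier \<open>(|k| - m)\<^sub>+\<close>. Hence \<open>L\<^sup>2\<close> splits orthogonally into
  \<open>K = ker L\<^sub>-\<close>, spanned by the \<open>2m\<close> functions \<open>z\<^sup>n/(x + \<i>)\<close> with \<open>-m \<le> n < m\<close>, and the image of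
  the isometry \<open>W\<close> that multiplies the upper Hardy component by \<open>z\<^sup>m\<close> and the lower one by
  \<open>z\<^sup>-\<^sup>m\<close>. On \<open>K\<close> the operator \<open>L\<^sub>+ = -R\<close> has a one-dimensional kernel and the linearization is
  nilpotent; on the image of \<open>W\<close> both \<open>L\<^sub>+\<close> and \<open>L\<^sub>-\<close> are conjugate to \<open>|\<nabla>|\<close>, so that the
  linearization is conjugate to \<open>\<i>|\<nabla>| \<oplus> -\<i>|\<nabla>|\<close>, which has spectrum \<open>\<i>\<real>\<close> and no eigenvalue.
  The resonances are real and imaginary parts of multiples of \<open>z\<^sup>m\<close>.\<close>

section \<open>Square-integrable functions and their classes\<close>

text \<open>Why powers of \<open>zeta\<close> absorb the potential: on a Hardy space
  \<open>|nabla|\<close> is \<open>s\<close> times the derivation \<open>-\<i> d/dx\<close>, and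
  that derivation sends \<open>zeta s\<close> to \<open>s * omega * zeta s\<close>. The two signs
  cancel, so the m-th power contributes exactly \<open>m * omega\<close>, which is the potential.
  The obstacle is that \<open>|nabla|\<close> is nonlocal and has no product rule across the two
  halves of frequency space; dividing by \<open>zeta\<close> stays inside a Hardy space only after
  removing one vector, and m such removals in each half account for the \<open>2 * m\<close>
  dimensions of \<open>Kspace\<close>. The linearization is not normal, so its resolvent is bounded
  block by block. All of this rests on Plancherel's theorem for a transform given as a mean-square
  limit, which is obtained by Abel summation with the Poisson kernel. The resonances are bounded but
  tend to a nonzero constant at infinity: \<open>zeta ^ m - 1\<close> is square integrable, and the
  remaining constant is annihilated because \<open>|nabla|\<close> of a test function is integrable
  with integral zero.\<close>

lemma square_integrable_measurable [measurable_dest]: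
  "square_integrable f \<Longrightarrow> f \<in> borel_measurable borel"
  by (simp add: square_integrable_def)

lemma borel_measurable_cnj [measurable]:
  "f \<in> borel_measurable M \<Longrightarrow> (\<lambda>x. cnj (f x)) \<in> borel_measurable M"
  by (rule measurable_compose[OF _ borel_measurable_continuous_onI[of cnj]]) (auto intro: continuous_intros)

lemma square_integrable_norm_square:
  "square_integrable f \<Longrightarrow> integrable lborel (\<lambda>x. (cmod (f x))\<^sup>2)"
  by (simp add: square_integrable_def)

lemma square_integrable_iff_nn:
  assumes "f \<in> borel_measurable borel"
  shows "square_integrable f \<longleftrightarrow> (\<integral>\<^sup>+x. ennreal ((cmod (f x))\<^sup>2) \<partial>lborel) < \<infinity>"
  using assms by (simp add: square_integrable_def integrable_iff_bounded)

lemma square_integrable_diff: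
  assumes "square_integrable f" "square_integrable g"
  shows "square_integrable (\<lambda>x. f x - g x)"
  using square_integrable_add[OF assms(1) square_integrable_cmult[OF assms(2), of "-1"]] by simp

lemma square_integrable_cnj:
  "square_integrable f \<Longrightarrow> square_integrable (\<lambda>x. cnj (f x))"
  by (rule square_integrable_bound[where C = 1]) auto

lemma square_integrable_mult_bounded:
  assumes "square_integrable f" "b \<in> borel_measurable borel" "\<And>x. cmod (b x) \<le> C"
  shows "square_integrable (\<lambda>x. b x * f x)"
proof (rule square_integrable_bound[OF assms(1)])
  show "(\<lambda>x. b x * f x) \<in> borel_measurable lborel"
    using assms by measurable
  show "cmod (b x * f x) \<le> C * cmod (f x)" for x
    using assms(3) by (simp add: norm_mult mult_right_mono)
qed

lemma square_integrable_cong_AE: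
  assumes "square_integrable f" "g \<in> borel_measurable borel" "AE x in lborel. f x = g x"
  shows "square_integrable g"
proof -
  have "(\<integral>\<^sup>+x. ennreal ((cmod (f x))\<^sup>2) \<partial>lborel) = (\<integral>\<^sup>+x. ennreal ((cmod (g x))\<^sup>2) \<partial>lborel)"
    by (rule nn_integral_cong_AE) (use assms(3) in auto)
  then show ?thesis
    using assms(1) square_integrable_iff_nn[OF square_integrable_measurable[OF assms(1)]]
      square_integrable_iff_nn[OF assms(2)] by (simp only:)
qed

lemma square_integrable_product:
  assumes "square_integrable f" "square_integrable g"
  shows "integrable lborel (\<lambda>x. f x * g x)"
proof (rule Bochner_Integration.integrable_bound[OF square_integrable_mult[OF assms]])
  show "(\<lambda>x. f x * g x) \<in> borel_measurable lborel"
    using assms by measurable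
qed (simp add: norm_mult)

lemma square_integrable_rep_L2: "square_integrable (rep_L2 u)"
  using Quotient_rep_reflp[OF Quotient_L2, of u] by (simp add: ae_eq_def)

lemma rep_L2_measurable [measurable]: "rep_L2 u \<in> borel_measurable borel"
  using square_integrable_rep_L2 by measurable

lemma abs_rep_L2 [simp]: "abs_L2 (rep_L2 u) = u"
  by (rule Quotient_abs_rep[OF Quotient_L2])

lemma ae_eq_refl_iff: "ae_eq f f \<longleftrightarrow> square_integrable f"
  by (auto simp: ae_eq_def)

lemma abs_L2_eq_iff:
  assumes "square_integrable f" "square_integrable g"
  shows "abs_L2 f = abs_L2 g \<longleftrightarrow> (AE x in lborel. f x = g x)"
  using Quotient_rel[OF Quotient_L2, of f g] assms
  by (auto simp: ae_eq_refl_iff) (auto simp: ae_eq_def)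

lemma AE_rep_abs_L2:
  "square_integrable f \<Longrightarrow> AE x in lborel. rep_L2 (abs_L2 f) x = f x"
  using Quotient_rep_abs[OF Quotient_L2, of f] by (auto simp: ae_eq_refl_iff) (simp add: ae_eq_def)

lemma L2_eq_iff: "u = v \<longleftrightarrow> (AE x in lborel. rep_L2 u x = rep_L2 v x)"
  using abs_L2_eq_iff[OF square_integrable_rep_L2[of u] square_integrable_rep_L2[of v]] by simp

lemma L2_eqI_abs:
  assumes "square_integrable f" "AE x in lborel. rep_L2 u x = f x"
  shows "u = abs_L2 f"
  using abs_L2_eq_iff[OF square_integrable_rep_L2[of u] assms(1)] assms(2) by simp

lemma L2_cases:
  obtains f where "square_integrable f" "u = abs_L2 f"
  using square_integrable_rep_L2[of u] abs_rep_L2[of u] by metis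

lemma abs_L2_zero: "abs_L2 (\<lambda>x. 0) = 0"
  by (simp add: zero_L2_def)

lemma abs_L2_add:
  "square_integrable f \<Longrightarrow> square_integrable g \<Longrightarrow> abs_L2 (\<lambda>x. f x + g x) = abs_L2 f + abs_L2 g"
  by (simp add: plus_L2.abs_eq ae_eq_refl_iff)

lemma abs_L2_scaleC:
  "square_integrable f \<Longrightarrow> abs_L2 (\<lambda>x. c * f x) = c *\<^sub>C abs_L2 f"
  by (simp add: scaleC_L2.abs_eq ae_eq_refl_iff)

lemma scaleC_minus1: "(- 1) *\<^sub>C (u :: 'a::complex_normed_vector) = - u"
  using scaleR_scaleC[of "-1" u] by simp

lemma abs_L2_uminus:
  "square_integrable f \<Longrightarrow> abs_L2 (\<lambda>x. - f x) = - abs_L2 f"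
  using abs_L2_scaleC[of f "-1"] by (simp add: scaleC_minus1)

lemma abs_L2_diff:
  assumes "square_integrable f" "square_integrable g"
  shows "abs_L2 (\<lambda>x. f x - g x) = abs_L2 f - abs_L2 g"
  using abs_L2_add[OF assms(1) square_integrable_cmult[OF assms(2), of "-1"]] abs_L2_uminus[OF assms(2)]
  by simp

lemma square_integrable_sum:
  "(\<And>i. i \<in> I \<Longrightarrow> square_integrable (f i)) \<Longrightarrow> square_integrable (\<lambda>x. \<Sum>i\<in>I. f i x)"
  by (induction I rule: infinite_finite_induct)
    (auto simp: square_integrable_zero square_integrable_add)

lemma abs_L2_sum:
  "(\<And>i. i \<in> I \<Longrightarrow> square_integrable (f i)) \<Longrightarrow>
    abs_L2 (\<lambda>x. \<Sum>i\<in>I. f i x) = (\<Sum>i\<in>I. abs_L2 (f i))"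
  by (induction I rule: infinite_finite_induct)
    (auto simp: abs_L2_zero abs_L2_add square_integrable_sum)

lemma AE_rep_L2_add: "AE x in lborel. rep_L2 (u + v) x = rep_L2 u x + rep_L2 v x"
  using AE_rep_abs_L2[OF square_integrable_add[OF square_integrable_rep_L2[of u] square_integrable_rep_L2[of v]]]
  by (simp add: abs_L2_add square_integrable_rep_L2)

lemma AE_rep_L2_diff: "AE x in lborel. rep_L2 (u - v) x = rep_L2 u x - rep_L2 v x"
  using AE_rep_abs_L2[OF square_integrable_diff[OF square_integrable_rep_L2[of u] square_integrable_rep_L2[of v]]]
  by (simp add: abs_L2_diff square_integrable_rep_L2)

lemma AE_rep_L2_scaleC: "AE x in lborel. rep_L2 (c *\<^sub>C u) x = c * rep_L2 u x"
  using AE_rep_abs_L2[OF square_integrable_cmult[OF square_integrable_rep_L2[of u], of c]]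
  by (simp add: abs_L2_scaleC square_integrable_rep_L2)

lemma AE_rep_L2_zero: "AE x in lborel. rep_L2 0 x = 0"
  using AE_rep_abs_L2[OF square_integrable_zero] by (simp add: abs_L2_zero)

lemma norm_abs_L2_square:
  assumes "square_integrable f"
  shows "(norm (abs_L2 f))\<^sup>2 = (LINT x|lborel. (cmod (f x))\<^sup>2)"
  using assms by (simp add: power2_norm_eq_inner inner_L2.abs_eq ae_eq_refl_iff)

lemma norm_abs_L2_nn:
  assumes "square_integrable f"
  shows "ennreal ((norm (abs_L2 f))\<^sup>2) = (\<integral>\<^sup>+x. ennreal ((cmod (f x))\<^sup>2) \<partial>lborel)"
  using assms by (simp add: norm_abs_L2_square nn_integral_eq_integral square_integrable_norm_square)

lemma norm_L2_le_pointwise: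
  assumes "square_integrable f" "square_integrable g" "0 \<le> C"
    "AE x in lborel. cmod (f x) \<le> C * cmod (g x)"
  shows "norm (abs_L2 f) \<le> C * norm (abs_L2 g)"
proof -
  have "(norm (abs_L2 f))\<^sup>2 \<le> (LINT x|lborel. C\<^sup>2 * (cmod (g x))\<^sup>2)"
    unfolding norm_abs_L2_square[OF assms(1)]
  proof (rule integral_mono_AE)
    show "AE x in lborel. (cmod (f x))\<^sup>2 \<le> C\<^sup>2 * (cmod (g x))\<^sup>2"
      using assms(4) by eventually_elim (metis norm_ge_zero power_mono power_mult_distrib)
  qed (use assms in \<open>auto intro: square_integrable_norm_square\<close>)
  also have "\<dots> = (C * norm (abs_L2 g))\<^sup>2"
    using assms by (simp add: norm_abs_L2_square power_mult_distrib)
  finally show ?thesis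
    using assms(3) by (simp add: power2_le_iff_abs_le)
qed

text \<open>The type class carries only the real inner product, which is the real part of this form
  (\<open>inner_Re_cinner\<close>). Orthogonality over complex scalars needs the Hermitian form; it
  is linear in the first argument.\<close>

lift_definition cinner :: "L2 \<Rightarrow> L2 \<Rightarrow> complex" is
  "\<lambda>f g. LINT x|lborel. f x * cnj (g x)"
  by (rule integral_cong_AE) (auto simp: ae_eq_def square_integrable_def)

lemma cinner_abs:
  "square_integrable f \<Longrightarrow> square_integrable g \<Longrightarrow>
    cinner (abs_L2 f) (abs_L2 g) = (LINT x|lborel. f x * cnj (g x))"
  by (simp add: cinner.abs_eq ae_eq_refl_iff)

lemma cinner_rep:
  "cinner u v = (LINT x|lborel. rep_L2 u x * cnj (rep_L2 v x))"
  using cinner_abs[OF square_integrable_rep_L2[of u] square_integrable_rep_L2[of v]] by simp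

lemma cinner_add_left: "cinner (u + v) w = cinner u w + cinner v w"
proof -
  obtain f g h where *: "square_integrable f" "square_integrable g" "square_integrable h"
    "u = abs_L2 f" "v = abs_L2 g" "w = abs_L2 h" by (metis L2_cases)
  have "integrable lborel (\<lambda>x. f x * cnj (h x))" "integrable lborel (\<lambda>x. g x * cnj (h x))"
    using * by (auto intro!: square_integrable_product square_integrable_cnj)
  then show ?thesis
    using * by (simp add: abs_L2_add[symmetric] cinner_abs square_integrable_add distrib_right)
qed

lemma cinner_scaleC_left: "cinner (c *\<^sub>C u) w = c * cinner u w"
proof -
  obtain f h where *: "square_integrable f" "square_integrable h"
    "u = abs_L2 f" "w = abs_L2 h" by (metis L2_cases)
  then show ?thesis
    by (simp add: abs_L2_scaleC[symmetric] cinner_abs square_integrable_cmult mult.assoc)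
qed

lemma cinner_commute: "cinner u v = cnj (cinner v u)"
proof -
  have "cnj (cinner v u) = (LINT x|lborel. cnj (rep_L2 v x * cnj (rep_L2 u x)))"
    unfolding cinner_rep by (rule Bochner_Integration.integral_cnj[symmetric])
  then show ?thesis unfolding cinner_rep by (simp add: mult.commute)
qed

lemma cinner_add_right: "cinner w (u + v) = cinner w u + cinner w v"
  using cinner_add_left[of u v w] cinner_commute[of w] by (metis complex_cnj_add)

lemma cinner_scaleC_right: "cinner w (c *\<^sub>C u) = cnj c * cinner w u"
  using cinner_scaleC_left[of c u w] cinner_commute[of w] by (metis complex_cnj_mult)

lemma cinner_zero [simp]: "cinner 0 u = 0" "cinner u 0 = 0"
  using cinner_add_left[of 0 0 u] cinner_add_right[of u 0 0] by simp_all

lemma cinner_minus_left: "cinner (- u) w = - cinner u w"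
  using cinner_add_left[of u "-u" w] by (simp add: eq_neg_iff_add_eq_0 add.commute)

lemma cinner_minus_right: "cinner w (- u) = - cinner w u"
  using cinner_add_right[of w u "-u"] by (simp add: eq_neg_iff_add_eq_0 add.commute)

lemma cinner_diff_left: "cinner (u - v) w = cinner u w - cinner v w"
  using cinner_add_left[of u "-v" w] by (simp add: cinner_minus_left)

lemma cinner_diff_right: "cinner w (u - v) = cinner w u - cinner w v"
  using cinner_add_right[of w u "-v"] by (simp add: cinner_minus_right)

lemma cinner_sum_left: "cinner (\<Sum>i\<in>I. f i) w = (\<Sum>i\<in>I. cinner (f i) w)"
  by (induction I rule: infinite_finite_induct) (auto simp: cinner_add_left)

lemma cinner_sum_right: "cinner w (\<Sum>i\<in>I. f i) = (\<Sum>i\<in>I. cinner w (f i))"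
  by (induction I rule: infinite_finite_induct) (auto simp: cinner_add_right)

lemma cinner_self: "cinner u u = of_real ((norm u)\<^sup>2)"
proof -
  obtain f where *: "square_integrable f" "u = abs_L2 f" by (metis L2_cases)
  then show ?thesis
    by (simp add: cinner_abs norm_abs_L2_square complex_norm_square[symmetric] del: of_real_power flip: integral_complex_of_real)
qed

lemma cinner_self_eq_0 [simp]: "cinner u u = 0 \<longleftrightarrow> u = 0"
  by (simp add: cinner_self)

lemma inner_Re_cinner: "u \<bullet> v = Re (cinner u v)"
proof -
  obtain f g where *: "square_integrable f" "square_integrable g" "u = abs_L2 f" "v = abs_L2 g"
    by (metis L2_cases)
  have "Re (cinner u v) = (LINT x|lborel. Re (f x * cnj (g x)))"
    using * by (simp only: cinner_abs) (rule integral_Re[symmetric], intro square_integrable_product square_integrable_cnj)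
  then show ?thesis
    using * by (simp add: inner_L2.abs_eq ae_eq_refl_iff inner_complex_def[abs_def])
qed

text \<open>Rotating \<open>u\<close> by the conjugate phase makes the product real and nonnegative,
  so the real Cauchy-Schwarz inequality applies.\<close>

lemma cinner_Cauchy_Schwarz: "cmod (cinner u v) \<le> norm u * norm v"
proof (cases "cinner u v = 0")
  case False
  define c where "c = cnj (sgn (cinner u v))"
  have c: "cmod c = 1" using False by (simp add: c_def norm_sgn)
  have "c * cinner u v = of_real (cmod (cinner u v))"
    using False by (simp add: c_def sgn_div_norm scaleR_conv_of_real divide_simps complex_norm_square[symmetric] mult.commute[of "cnj _"] power2_eq_square)
  then have "cmod (cinner u v) = (c *\<^sub>C u) \<bullet> v"
    by (simp add: inner_Re_cinner cinner_scaleC_left)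
  also have "\<dots> \<le> norm (c *\<^sub>C u) * norm v"
    by (rule norm_cauchy_schwarz)
  finally show ?thesis by (simp add: norm_scaleC c)
qed simp

lemma norm_add_square_L2: "(norm (u + v))\<^sup>2 = (norm u)\<^sup>2 + 2 * Re (cinner u v) + (norm (v::L2))\<^sup>2"
  by (simp add: power2_norm_eq_inner inner_add_left inner_add_right inner_commute inner_Re_cinner[symmetric])

lemma norm_add_orthogonal:
  assumes "cinner u v = 0"
  shows "(norm (u + v))\<^sup>2 = (norm u)\<^sup>2 + (norm v)\<^sup>2"
  by (simp add: norm_add_square_L2 assms)

lemma tendsto_cinner_left:
  assumes "(f \<longlongrightarrow> u) F"
  shows "((\<lambda>n. cinner (f n) v) \<longlongrightarrow> cinner u v) F"
proof -
  have "((\<lambda>n. cinner (f n) v - cinner u v) \<longlongrightarrow> 0) F"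
  proof (rule Lim_null_comparison)
    show "\<forall>\<^sub>F n in F. norm (cinner (f n) v - cinner u v) \<le> norm (f n - u) * norm v"
      by (rule always_eventually) (metis cinner_Cauchy_Schwarz cinner_diff_left)
    have "((\<lambda>n. f n - u) \<longlongrightarrow> 0) F" using assms by (simp add: LIM_zero)
    then show "((\<lambda>n. norm (f n - u) * norm v) \<longlongrightarrow> 0) F"
      by (auto intro: tendsto_mult_left_zero tendsto_norm_zero)
  qed
  then show ?thesis by (simp add: LIM_zero_iff)
qed

subsection \<open>Completeness\<close>

text \<open>Along a fast subsequence \<open>\<Sum> 2\<^sup>k |f\<^sub>k\<^sub>+\<^sub>1 - f\<^sub>k|\<^sup>2\<close> is integrable, hence finite almost everywhere,
  which forces pointwise convergence; Fatou's lemma identifies the limit.\<close>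

lemma L2_Cauchy_convergent:
  fixes X :: "nat \<Rightarrow> L2"
  assumes X: "Cauchy X"
  shows "convergent X"
proof -
  have "\<exists>N. \<forall>m\<ge>N. \<forall>n\<ge>N. norm (X m - X n) < (1/2)^k" for k
    using X unfolding Cauchy_iff by auto
  then obtain N where N: "\<And>k m n. m \<ge> N k \<Longrightarrow> n \<ge> N k \<Longrightarrow> norm (X m - X n) < (1/2)^k"
    by metis
  \<comment> \<open>Summing all thresholds makes the chosen indices monotone and keeps the k-th one
    above \<open>N k\<close>.\<close>
  define r where "r k = (\<Sum>i\<le>k. N i) + k" for k
  have rmono: "r k \<le> r (Suc k)" for k by (simp add: r_def)
  have rN: "N k \<le> r k" for k
    by (simp add: r_def trans_le_add1 member_le_sum)
  have rk: "r k \<ge> k" for k by (simp add: r_def)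
  define f where "f k = rep_L2 (X (r k))" for k
  have Sf: "square_integrable (f k)" for k by (simp add: f_def square_integrable_rep_L2)
  have Xf: "X (r k) = abs_L2 (f k)" for k by (simp add: f_def)
  have fm [measurable]: "f k \<in> borel_measurable borel" for k
    using Sf by measurable
  define d where "d k x = f (Suc k) x - f k x" for k x
  have dm [measurable]: "d k \<in> borel_measurable borel" for k
    unfolding d_def by measurable
  \<comment> \<open>Squared gaps are at most \<open>(1/4)^k\<close>. The weight \<open>2^k\<close>
    still leaves a summable series, and it is what later yields geometric pointwise decay of
    \<open>d k x\<close>.\<close>
  have nd: "(\<integral>\<^sup>+x. ennreal (2^k * (cmod (d k x))\<^sup>2) \<partial>lborel) \<le> ennreal ((1/2)^k)" for k
  proof -
    have "abs_L2 (d k) = X (r (Suc k)) - X (r k)"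
      unfolding Xf d_def by (rule abs_L2_diff) (auto intro: Sf)
    then have "norm (abs_L2 (d k)) \<le> (1/2)^k"
      using N[of k "r (Suc k)" "r k"] rN rmono by (simp add: order_trans[OF rN rmono] less_imp_le)
    then have le: "2^k * (norm (abs_L2 (d k)))\<^sup>2 \<le> 2^k * ((1/2)^k)\<^sup>2"
      by (intro mult_left_mono power_mono) auto
    have "square_integrable (d k)" unfolding d_def by (intro square_integrable_diff Sf)
    then have "(\<integral>\<^sup>+x. ennreal (2^k * (cmod (d k x))\<^sup>2) \<partial>lborel) = ennreal (2^k * (norm (abs_L2 (d k)))\<^sup>2)"
      by (simp add: ennreal_mult nn_integral_cmult norm_abs_L2_nn[symmetric])
    also have "\<dots> \<le> ennreal (2^k * ((1/2)^k)\<^sup>2)" using le by (rule ennreal_leI)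
    also have "2^k * ((1/2)^k)\<^sup>2 = (1/2::real)^k"
      by (simp add: power2_eq_square power_divide)
    finally show ?thesis .
  qed
  have "(\<integral>\<^sup>+x. (\<Sum>k. ennreal (2^k * (cmod (d k x))\<^sup>2)) \<partial>lborel) =
      (\<Sum>k. \<integral>\<^sup>+x. ennreal (2^k * (cmod (d k x))\<^sup>2) \<partial>lborel)"
    by (rule nn_integral_suminf) measurable
  also have "\<dots> \<le> (\<Sum>k. ennreal ((1/2)^k))"
    by (intro suminf_le nd) auto
  also have "\<dots> = ennreal (\<Sum>k. (1/2)^k)"
    by (rule suminf_ennreal2) (auto intro: summable_geometric)
  also have "\<dots> < \<infinity>" by simp
  finally have "AE x in lborel. (\<Sum>k. ennreal (2^k * (cmod (d k x))\<^sup>2)) \<noteq> \<infinity>"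
    by (intro nn_integral_PInf_AE) auto
  then have conv: "AE x in lborel. convergent (\<lambda>k. f k x)"
  proof eventually_elim
    fix x assume fin: "(\<Sum>k. ennreal (2^k * (cmod (d k x))\<^sup>2)) \<noteq> \<infinity>"
    obtain B where B: "(\<Sum>k. ennreal (2^k * (cmod (d k x))\<^sup>2)) = ennreal B" "B \<ge> 0"
      using ennreal_cases[of "\<Sum>k. ennreal (2^k * (cmod (d k x))\<^sup>2)"] fin
      by (metis infinity_ennreal_def)
    have "cmod (d k x) \<le> sqrt B * (sqrt (1/2))^k" for k
    proof -
      have "ennreal (2^k * (cmod (d k x))\<^sup>2) \<le> ennreal B"
        unfolding B(1)[symmetric]
        by (rule order_trans[OF _ sum_le_suminf[of _ "{k}"]]) (simp_all only: sum.insert sum.empty finite.emptyI finite.insertI empty_iff not_False_eq_True add_0_right order_refl summableI zero_le)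
      then have "2^k * (cmod (d k x))\<^sup>2 \<le> B" using B by simp
      then have "(cmod (d k x))\<^sup>2 \<le> B * (1/2)^k"
        by (simp add: field_simps)
      then have "sqrt ((cmod (d k x))\<^sup>2) \<le> sqrt (B * (1/2)^k)" by (rule real_sqrt_le_mono)
      then show ?thesis by (simp only: real_sqrt_mult real_sqrt_power[of "1/2"] real_sqrt_abs abs_norm_cancel)
    qed
    then have le: "norm (d k x) \<le> sqrt B * (sqrt (1/2))^k" for k
      by blast
    have "sqrt (1/2) < (1::real)" "0 \<le> sqrt (1/2::real)"
      by simp_all
    then have "norm (sqrt (1/2) :: real) < 1"
      unfolding real_norm_def by linarith
    then have "summable (\<lambda>k. sqrt B * (sqrt (1/2))^k)"
      by (intro summable_mult summable_geometric)
    then have "summable (\<lambda>k. d k x)"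
      by (rule summable_comparison_test'[where N = 0]) (rule le)
    then show "convergent (\<lambda>k. f k x)"
      unfolding d_def summable_iff_convergent
      by (simp add: sum_lessThan_telescope[of "\<lambda>k. f k x"] convergent_diff_const_right_iff)
  qed
  define g where "g x = lim (\<lambda>k. f k x)" for x
  have gm [measurable]: "g \<in> borel_measurable borel"
    unfolding g_def by measurable
  have lim: "AE x in lborel. (\<lambda>k. f k x) \<longlonglongrightarrow> g x"
    using conv by eventually_elim (simp add: g_def convergent_LIMSEQ_iff)
  have fatou: "(\<integral>\<^sup>+x. ennreal ((cmod (g x - f n x))\<^sup>2) \<partial>lborel) \<le> ennreal (((1/2)^n)\<^sup>2)" for n
  proof -
    have "(\<integral>\<^sup>+x. ennreal ((cmod (g x - f n x))\<^sup>2) \<partial>lborel) =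
        (\<integral>\<^sup>+x. liminf (\<lambda>k. ennreal ((cmod (f k x - f n x))\<^sup>2)) \<partial>lborel)"
    proof (rule nn_integral_cong_AE)
      show "AE x in lborel. ennreal ((cmod (g x - f n x))\<^sup>2) =
          liminf (\<lambda>k. ennreal ((cmod (f k x - f n x))\<^sup>2))"
        using lim
      proof eventually_elim
        fix x assume "(\<lambda>k. f k x) \<longlonglongrightarrow> g x"
        then have "(\<lambda>k. ennreal ((cmod (f k x - f n x))\<^sup>2)) \<longlonglongrightarrow> ennreal ((cmod (g x - f n x))\<^sup>2)"
          by (intro tendsto_intros) auto
        then show "ennreal ((cmod (g x - f n x))\<^sup>2) = liminf (\<lambda>k. ennreal ((cmod (f k x - f n x))\<^sup>2))"
          by (rule lim_imp_Liminf[OF sequentially_bot, symmetric])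
      qed
    qed
    also have "\<dots> \<le> liminf (\<lambda>k. \<integral>\<^sup>+x. ennreal ((cmod (f k x - f n x))\<^sup>2) \<partial>lborel)"
      by (rule nn_integral_liminf) measurable
    also have "\<dots> \<le> ennreal (((1/2)^n)\<^sup>2)"
    proof (rule Liminf_le)
      show "\<forall>\<^sub>F k in sequentially. (\<integral>\<^sup>+x. ennreal ((cmod (f k x - f n x))\<^sup>2) \<partial>lborel) \<le> ennreal (((1/2)^n)\<^sup>2)"
        using eventually_ge_at_top[of n]
      proof eventually_elim
        fix k assume "n \<le> k"
        then have rr: "r n \<le> r k" using rmono by (rule lift_Suc_mono_le[rotated])
        have "abs_L2 (\<lambda>x. f k x - f n x) = X (r k) - X (r n)"
          unfolding Xf by (rule abs_L2_diff) (auto intro: Sf)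
        then have "norm (abs_L2 (\<lambda>x. f k x - f n x)) \<le> (1/2)^n"
          using N[of n "r k" "r n"] rN[of n] rr by simp
        then show "(\<integral>\<^sup>+x. ennreal ((cmod (f k x - f n x))\<^sup>2) \<partial>lborel) \<le> ennreal (((1/2)^n)\<^sup>2)"
          by (subst norm_abs_L2_nn[symmetric]) (auto intro!: square_integrable_diff Sf ennreal_leI power_mono)
      qed
    qed simp
    finally show ?thesis .
  qed
  have Sd: "square_integrable (\<lambda>x. g x - f n x)" for n
    by (subst square_integrable_iff_nn) (auto intro: le_less_trans[OF fatou])
  have Sg: "square_integrable g"
    using square_integrable_add[OF Sd[of 0] Sf[of 0]] by simp
  have lim_r: "norm (abs_L2 g - X (r n)) \<le> (1/2)^n" for n
  proof -
    have "(norm (abs_L2 (\<lambda>x. g x - f n x)))\<^sup>2 \<le> ((1/2)^n)\<^sup>2"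
      using fatou[of n] unfolding norm_abs_L2_nn[OF Sd, symmetric] by (simp add: ennreal_le_iff)
    then show ?thesis
      unfolding Xf abs_L2_diff[OF Sg Sf] by (simp add: power2_le_iff_abs_le)
  qed
  have "norm (X n - abs_L2 g) \<le> 2 * (1/2)^k" if "n \<ge> N k" for n k
  proof -
    have "norm (X n - X (r k)) \<le> (1/2)^k"
      using N[of k n "r k"] that rN[of k] by simp
    then show ?thesis
      using lim_r[of k] norm_triangle_ineq[of "X n - X (r k)" "X (r k) - abs_L2 g"]
      by (simp add: norm_minus_commute)
  qed
  note bnd = this
  have "X \<longlonglongrightarrow> abs_L2 g"
  proof (rule LIMSEQ_I)
    fix e :: real assume "e > 0"
    then obtain k where "(1/2)^k < e / 2"
      using real_arch_pow_inv[of "e/2" "1/2"] by auto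
    then show "\<exists>no. \<forall>n\<ge>no. norm (X n - abs_L2 g) < e"
      using bnd[where k = k] by (intro exI[of _ "N k"] allI impI le_less_trans[OF bnd[where k = k]]) simp_all
  qed
  then show ?thesis by (rule convergentI)
qed

subsection \<open>Totality of indicator functions of intervals\<close>

lemma square_integrable_indicator: "square_integrable (indicator {a..b})"
proof -
  have "(\<lambda>x. (cmod (indicator {a..b} x :: complex))\<^sup>2) = (indicator {a..b} :: real \<Rightarrow> real)"
    by (auto simp: indicator_def)
  then show ?thesis
    by (simp only: square_integrable_def) (auto intro!: integrable_real_indicator simp: emeasure_lborel_Icc_eq)
qed

text \<open>Closed intervals form an intersection-stable generator of the Borel sets, so vanishing
  integrals spread to all Borel sets by a Dynkin argument. Truncating to \<open>[-n, n]\<close>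
  provides the integrability and the value on the whole line that the complement step
  requires.\<close>

lemma AE_zero_if_interval_integrals_zero:
  fixes f :: "real \<Rightarrow> complex"
  assumes int: "\<And>a b. set_integrable lborel {a..b} f"
    and zero: "\<And>a b. (LINT x:{a..b}|lborel. f x) = 0"
  shows "AE x in lborel. f x = 0"
proof -
  have *: "AE x in lborel. indicator {- real n..real n} x * f x = 0" for n :: nat
  proof (rule sigma_finite_measure.density_zero[OF lborel.sigma_finite_measure_axioms])
    define h where "h x = indicator {- real n..real n} x * f x" for x
    have hi: "integrable lborel h"
      using int[of "- real n" "real n"] unfolding set_integrable_def h_def
      by (simp add: scaleR_conv_of_real of_real_indicator)
    have hs: "set_integrable lborel A h" if "A \<in> sets borel" for A
      unfolding set_integrable_def using that hi by (intro integrable_mult_indicator) auto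
    have I: "(LINT x:{a..b}|lborel. h x) = 0" for a b
    proof -
      have "(LINT x:{a..b}|lborel. h x) = (LINT x:{max a (- real n)..min b (real n)}|lborel. f x)"
        unfolding set_lebesgue_integral_def h_def
        by (rule Bochner_Integration.integral_cong) (auto simp: indicator_def)
      then show ?thesis by (simp add: zero)
    qed
    have whole: "(LINT x|lborel. h x) = 0"
    proof -
      have "(LINT x|lborel. h x) = (LINT x:{- real n..real n}|lborel. f x)"
        unfolding set_lebesgue_integral_def h_def
        by (rule Bochner_Integration.integral_cong) (auto simp: indicator_def)
      then show ?thesis by (simp add: zero)
    qed
    show "integrable lborel (\<lambda>x. indicator {- real n..real n} x * f x)"
      using hi by (simp add: h_def[abs_def])
    fix A :: "real set" assume "A \<in> sets lborel"
    then have "A \<in> sigma_sets UNIV (range (\<lambda>(a,b). {a..b::real}))"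
      by (simp add: borel_eq_atLeastAtMost)
    have stable: "Int_stable (range (\<lambda>(a,b). {a..b::real}))"
      by (auto simp: Int_stable_def)
    have closed: "range (\<lambda>(a,b). {a..b::real}) \<subseteq> Pow UNIV" by simp
    from \<open>A \<in> sigma_sets UNIV (range (\<lambda>(a,b). {a..b::real}))\<close>
    have "(LINT x:A|lborel. h x) = 0"
    proof (induction rule: sigma_sets_induct_disjoint[OF stable closed, consumes 1, case_names basic empty compl union])
      case (basic A) then show ?case by (auto simp: I)
    next
      case (compl A)
      then have A: "A \<in> sets borel" by (simp add: borel_eq_atLeastAtMost)
      have "(LINT x|lborel. h x) = (LINT x:(UNIV - A) \<union> A|lborel. h x)"
        by (simp add: set_lebesgue_integral_def)
      also have "\<dots> = (LINT x:UNIV - A|lborel. h x) + (LINT x:A|lborel. h x)"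
        using A by (intro set_integral_Un hs) auto
      finally show ?case using compl whole by simp
    next
      case (union A)
      then have A: "A i \<in> sets borel" for i by (auto simp: borel_eq_atLeastAtMost)
      have "(LINT x:(\<Union>i. A i)|lborel. h x) = (\<Sum>i. (LINT x:(A i)|lborel. h x))"
        by (rule lebesgue_integral_countable_add) (use union A hs in \<open>auto simp: disjoint_family_on_def\<close>)
      then show ?case using union by simp
    qed (auto simp: set_lebesgue_integral_def)
    then show "(LINT x:A|lborel. indicator {- real n..real n} x * f x) = 0"
      by (simp add: h_def[abs_def])
  qed
  have "AE x in lborel. \<forall>n::nat. indicator {- real n..real n} x * f x = 0"
    using * by (simp only: AE_all_countable) blast
  then show ?thesis
  proof eventually_elim
    fix x assume *: "\<forall>n::nat. indicator {- real n..real n} x * f x = 0"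
    obtain n :: nat where "\<bar>x\<bar> \<le> real n" using real_arch_simple by blast
    then have "x \<in> {- real n..real n}" by auto
    then show "f x = 0" using *[rule_format, of n] by (simp add: indicator_def)
  qed
qed

lemma set_integral_eq_cinner:
  assumes "square_integrable f"
  shows "set_integrable lborel {a..b} f"
    "(LINT x:{a..b}|lborel. f x) = cinner (abs_L2 f) (abs_L2 (indicator {a..b}))"
proof -
  show "set_integrable lborel {a..b} f"
    using square_integrable_product[OF square_integrable_indicator[of a b] assms]
    by (simp add: set_integrable_def scaleR_conv_of_real of_real_indicator)
  have "f x * cnj (indicator {a..b} x) = indicat_real {a..b} x *\<^sub>R f x" for x
    by (simp add: indicator_def)
  then show "(LINT x:{a..b}|lborel. f x) = cinner (abs_L2 f) (abs_L2 (indicator {a..b}))"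
    using assms by (simp add: cinner_abs square_integrable_indicator set_lebesgue_integral_def)
qed

text \<open>A weak test for equality: it lets Fourier inversion be checked against interval
  indicators, where Poisson integrals are explicit arctangents.\<close>

lemma L2_eq_zeroI:
  assumes "\<And>a b. cinner u (abs_L2 (indicator {a..b})) = 0"
  shows "u = 0"
proof -
  have "AE x in lborel. rep_L2 u x = 0"
    by (rule AE_zero_if_interval_integrals_zero)
      (use assms set_integral_eq_cinner[OF square_integrable_rep_L2[of u]] in auto)
  then show ?thesis
    using L2_eqI_abs[OF square_integrable_zero, of u] by (simp add: abs_L2_zero)
qed

section \<open>The Fourier integral\<close>

text \<open>Same sign and the same absence of a normalizing factor as in
  \<open>is_fourier_transform\<close>; hence the factors \<open>2 * pi\<close> in Plancherel's
  theorem and in inversion.\<close>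

definition FT :: "(real \<Rightarrow> complex) \<Rightarrow> real \<Rightarrow> complex" where
  "FT f \<xi> = (LINT x|lborel. f x * exp (- (\<i> * complex_of_real (x * \<xi>))))"

lemma cmod_exp_i [simp]: "cmod (exp (\<i> * complex_of_real t)) = 1"
  "cmod (exp (- (\<i> * complex_of_real t))) = 1"
  by simp_all

lemma FT_measurable [measurable]:
  assumes [measurable]: "f \<in> borel_measurable borel"
  shows "FT f \<in> borel_measurable borel"
  unfolding FT_def by measurable

lemma integrable_mult_unimodular:
  fixes f g :: "real \<Rightarrow> complex"
  assumes "integrable lborel f" "g \<in> borel_measurable borel" "\<And>x. cmod (g x) \<le> C"
  shows "integrable lborel (\<lambda>x. f x * g x)" "integrable lborel (\<lambda>x. g x * f x)"
proof -
  have [measurable]: "f \<in> borel_measurable borel"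
    using assms(1) by (simp add: borel_measurable_integrable)
  show "integrable lborel (\<lambda>x. f x * g x)"
  proof (rule Bochner_Integration.integrable_bound)
    show "integrable lborel (\<lambda>x. C * cmod (f x))"
      using assms(1) by (intro integrable_mult_right integrable_norm)
    have "cmod (f x * g x) \<le> norm (C * cmod (f x))" for x
    proof -
      have "cmod (f x * g x) \<le> cmod (f x) * C"
        unfolding norm_mult by (rule mult_left_mono[OF assms(3)]) simp
      also have "\<dots> \<le> norm (C * cmod (f x))" by (simp add: abs_le_iff mult.commute)
      finally show ?thesis .
    qed
    then show "AE x in lborel. norm (f x * g x) \<le> norm (C * cmod (f x))" by (rule AE_I2)
    show "(\<lambda>x. f x * g x) \<in> borel_measurable lborel" using assms(2) by measurable
  qed
  then show "integrable lborel (\<lambda>x. g x * f x)" by (simp add: mult.commute)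
qed

lemma integrable_FT_kernel:
  assumes "integrable lborel f"
  shows "integrable lborel (\<lambda>x. f x * exp (- (\<i> * complex_of_real (x * \<xi>))))"
  by (rule integrable_mult_unimodular(1)[OF assms, where C = 1]) auto

lemma FT_bound:
  assumes "integrable lborel f"
  shows "cmod (FT f \<xi>) \<le> (LINT x|lborel. cmod (f x))"
proof -
  have "cmod (FT f \<xi>) \<le> (LINT x|lborel. cmod (f x * exp (- (\<i> * complex_of_real (x * \<xi>)))))"
    unfolding FT_def by (rule integral_norm_bound)
  then show ?thesis by (simp add: norm_mult del: of_real_mult)
qed

lemma FT_diff:
  assumes "integrable lborel f" "integrable lborel g"
  shows "FT (\<lambda>x. f x - g x) \<xi> = FT f \<xi> - FT g \<xi>"
  using integrable_FT_kernel[OF assms(1)] integrable_FT_kernel[OF assms(2)]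
  unfolding FT_def left_diff_distrib by (rule Bochner_Integration.integral_diff)

lemma FT_add:
  assumes "integrable lborel f" "integrable lborel g"
  shows "FT (\<lambda>x. f x + g x) \<xi> = FT f \<xi> + FT g \<xi>"
  using integrable_FT_kernel[OF assms(1)] integrable_FT_kernel[OF assms(2)]
  unfolding FT_def distrib_right by (rule Bochner_Integration.integral_add)

lemma FT_cmult: "FT (\<lambda>x. c * f x) \<xi> = c * FT f \<xi>"
  unfolding FT_def mult.assoc by (rule integral_mult_right_zero)

lemma FT_cnj: "FT (\<lambda>x. cnj (f x)) \<xi> = cnj (FT f (- \<xi>))"
  unfolding FT_def Bochner_Integration.integral_cnj[symmetric]
  by (simp add: exp_cnj)

lemma FT_reflect: "FT (\<lambda>x. f (- x)) \<xi> = FT f (- \<xi>)"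
  unfolding FT_def
  by (subst lborel_integral_real_affine[where c = "-1" and t = 0]) simp_all

lemma FT_shift: "FT (\<lambda>x. f (x - a)) \<xi> = exp (- (\<i> * complex_of_real (a * \<xi>))) * FT f \<xi>"
proof -
  have "FT (\<lambda>x. f (x - a)) \<xi> = (LINT x|lborel. f x * exp (- (\<i> * complex_of_real ((a + x) * \<xi>))))"
    unfolding FT_def by (subst lborel_integral_real_affine[where c = 1 and t = a]) simp_all
  also have "\<dots> = (LINT x|lborel. exp (- (\<i> * complex_of_real (a * \<xi>))) * (f x * exp (- (\<i> * complex_of_real (x * \<xi>)))))"
    by (rule Bochner_Integration.integral_cong) (simp_all add: algebra_simps flip: exp_add)
  also have "\<dots> = exp (- (\<i> * complex_of_real (a * \<xi>))) * FT f \<xi>"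
    unfolding FT_def by (rule integral_mult_right_zero)
  finally show ?thesis .
qed

lemma FT_modulate: "FT (\<lambda>x. f x * exp (\<i> * complex_of_real (a * x))) \<xi> = FT f (\<xi> - a)"
  unfolding FT_def
  by (rule Bochner_Integration.integral_cong) (simp_all add: algebra_simps flip: exp_add)

text \<open>Fubini for the kernel \<open>exp (-\<i> x \<xi>)\<close>, which is symmetric in its two
  variables. With an Abel factor as \<open>g\<close> it is the source of both the energy bound and
  inversion.\<close>

lemma FT_multiplication:
  assumes f: "integrable lborel f" and g: "integrable lborel g"
  shows "(LINT \<xi>|lborel. FT f \<xi> * g \<xi>) = (LINT x|lborel. f x * FT g x)"
proof -
  have [measurable]: "f \<in> borel_measurable borel" "g \<in> borel_measurable borel"
    using f g by (simp_all add: borel_measurable_integrable)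
  define F where "F x \<xi> = f x * exp (- (\<i> * complex_of_real (x * \<xi>))) * g \<xi>" for x \<xi>
  have nF: "cmod (F x \<xi>) = cmod (f x) * cmod (g \<xi>)" for x \<xi>
    unfolding F_def by (simp add: norm_mult del: of_real_mult)
  have "integrable (lborel \<Otimes>\<^sub>M lborel) (case_prod F)"
  proof (rule lborel_pair.Fubini_integrable)
    show "case_prod F \<in> borel_measurable (lborel \<Otimes>\<^sub>M lborel)"
      unfolding F_def by measurable
    show "integrable lborel (\<lambda>x. LINT y|lborel. norm (case (x, y) of (x, xa) \<Rightarrow> F x xa))"
      using f by (simp add: nF)
    have "integrable lborel (F x)" for x
    proof (rule Bochner_Integration.integrable_bound)
      show "integrable lborel (\<lambda>\<xi>. cmod (f x) * cmod (g \<xi>))"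
        using g by (intro integrable_mult_right integrable_norm)
      show "F x \<in> borel_measurable lborel" unfolding F_def by measurable
    qed (simp add: nF)
    then show "AE x in lborel. integrable lborel (\<lambda>y. case (x, y) of (x, xa) \<Rightarrow> F x xa)" by simp
  qed
  then have "(LINT \<xi>|lborel. LINT x|lborel. F x \<xi>) = (LINT x|lborel. LINT \<xi>|lborel. F x \<xi>)"
    by (rule lborel_pair.Fubini_integral)
  moreover have "(LINT x|lborel. F x \<xi>) = FT f \<xi> * g \<xi>" for \<xi>
    unfolding F_def FT_def by (rule integral_mult_left_zero)
  moreover have "(LINT \<xi>|lborel. F x \<xi>) = f x * FT g x" for x
    unfolding F_def FT_def by (simp add: mult_ac)
  ultimately show ?thesis by simp
qed

subsection \<open>One-sided exponentials\<close>

lemma tendsto_exp_neg_at_top: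
  fixes r :: real assumes "r > 0"
  shows "((\<lambda>\<xi>. exp (- (r * \<xi>))) \<longlongrightarrow> 0) at_top"
  using assms by (auto intro!: filterlim_compose[OF exp_at_bot] filterlim_tendsto_pos_mult_at_top
      simp: filterlim_uminus_at_bot filterlim_ident)

lemma integrable_exp_halfline:
  fixes r :: real assumes "r > 0"
  shows "integrable lborel (\<lambda>\<xi>. indicator {0<..} \<xi> * exp (- (r * \<xi>)))"
proof -
  have "set_integrable lborel (einterval 0 \<infinity>) (\<lambda>\<xi>. exp (- (r * \<xi>)))"
  proof (rule interval_integral_FTC_nonneg(1))
    show "((\<lambda>\<xi>. - exp (- (r * \<xi>)) / r) has_real_derivative exp (- (r * x))) (at x)" for x
      using assms by (auto intro!: derivative_eq_intros)
    show "(((\<lambda>\<xi>. - exp (- (r * \<xi>)) / r) \<circ> real_of_ereal) \<longlongrightarrow> - 1 / r) (at_right 0)"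
      unfolding zero_ereal_def ereal_tendsto_simps using assms
      by (auto intro!: tendsto_eq_intros)
    show "(((\<lambda>\<xi>. - exp (- (r * \<xi>)) / r) \<circ> real_of_ereal) \<longlongrightarrow> 0) (at_left \<infinity>)"
      unfolding ereal_tendsto_simps
      by (intro tendsto_divide_zero) (use tendsto_minus[OF tendsto_exp_neg_at_top[OF assms]] in simp)
  qed (auto intro!: continuous_intros)
  moreover have "einterval 0 \<infinity> = {0::real<..}" by (auto simp: einterval_def)
  ultimately show ?thesis by (simp add: set_integrable_def)
qed

text \<open>Half of the exponential absorbs the linear factor, since
  \<open>r * t / 2 \<le> exp (r * t / 2)\<close>.\<close>

lemma times_exp_le:
  fixes r t :: real assumes "r > 0" "t \<ge> 0"
  shows "t * exp (- (r * t)) \<le> 2 / r * exp (- (r / 2 * t))"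
proof -
  have "r * t / 2 \<le> exp (r * t / 2)" using exp_ge_add_one_self[of "r * t / 2"] by linarith
  then have "t \<le> 2 / r * exp (r * t / 2)" using assms by (simp add: field_simps)
  then have "t * exp (- (r * t)) \<le> 2 / r * exp (r * t / 2) * exp (- (r * t))"
    by (rule mult_right_mono) simp
  also have "\<dots> = 2 / r * exp (- (r / 2 * t))"
    by (simp add: mult.assoc flip: exp_add)
  finally show ?thesis .
qed

lemma integrable_times_exp_halfline:
  fixes r :: real assumes "r > 0"
  shows "integrable lborel (\<lambda>\<xi>. indicator {0<..} \<xi> * (\<xi> * exp (- (r * \<xi>))))"
proof (rule Bochner_Integration.integrable_bound)
  show "integrable lborel (\<lambda>\<xi>. 2 / r * (indicator {0<..} \<xi> * exp (- (r / 2 * \<xi>))))"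
    using integrable_exp_halfline[of "r/2"] assms by (intro integrable_mult_right) simp
  show "AE \<xi> in lborel. norm (indicator {0<..} \<xi> * (\<xi> * exp (- (r * \<xi>)))) \<le>
      norm (2 / r * (indicator {0<..} \<xi> * exp (- (r / 2 * \<xi>))))"
    using times_exp_le[OF assms] assms
    by (intro AE_I2) (auto simp: indicator_def abs_mult)
qed measurable

lemma integral_exp_halfline:
  fixes a :: complex assumes a: "Re a > 0"
  shows "integrable lborel (\<lambda>\<xi>. indicator {0<..} \<xi> * exp (- (a * of_real \<xi>)))"
    "(LINT \<xi>|lborel. indicator {0<..} \<xi> * exp (- (a * of_real \<xi>))) = 1 / a"
proof -
  have nrm: "cmod (indicator {0<..} \<xi> * exp (- (a * of_real \<xi>))) = indicator {0<..} \<xi> * exp (- (Re a * \<xi>))" for \<xi>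
    by (simp add: norm_mult indicator_def)
  show int: "integrable lborel (\<lambda>\<xi>. indicator {0<..} \<xi> * exp (- (a * of_real \<xi>)))"
    by (rule integrable_norm_cancel) (use integrable_exp_halfline[OF a] nrm in \<open>auto\<close>)
  have a0: "a \<noteq> 0" using a by auto
  have ei: "einterval 0 \<infinity> = {0::real<..}" by (auto simp: einterval_def)
  have set: "set_integrable lborel {0<..} (\<lambda>\<xi>. exp (- (a * of_real \<xi>)))"
    using int by (simp add: set_integrable_def scaleR_conv_of_real of_real_indicator)
  have "(LBINT \<xi>=0..\<infinity>. exp (- (a * of_real \<xi>))) = 0 - (- 1 / a)"
  proof (rule interval_integral_FTC_integrable)
    show "((\<lambda>\<xi>. - exp (- (a * of_real \<xi>)) / a) has_vector_derivative exp (- (a * of_real x))) (at x)" for x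
      using a0 by (auto intro!: derivative_eq_intros has_vector_derivative_real_field)
    show "(((\<lambda>\<xi>. - exp (- (a * complex_of_real \<xi>)) / a) \<circ> real_of_ereal) \<longlongrightarrow> - 1 / a) (at_right 0)"
      unfolding zero_ereal_def ereal_tendsto_simps using a0
      by (auto intro!: tendsto_eq_intros)
    have "((\<lambda>\<xi>. exp (- (a * complex_of_real \<xi>))) \<longlongrightarrow> 0) at_top"
      using tendsto_exp_neg_at_top[OF a] by (subst tendsto_norm_zero_iff[symmetric]) simp
    then have "((\<lambda>\<xi>. - exp (- (a * complex_of_real \<xi>))) \<longlongrightarrow> 0) at_top"
      using tendsto_minus by force
    then show "(((\<lambda>\<xi>. - exp (- (a * complex_of_real \<xi>)) / a) \<circ> real_of_ereal) \<longlongrightarrow> 0) (at_left \<infinity>)"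
      unfolding ereal_tendsto_simps by (rule tendsto_divide_zero)
  qed (auto intro!: continuous_intros simp: ei set)
  then show "(LINT \<xi>|lborel. indicator {0<..} \<xi> * exp (- (a * of_real \<xi>))) = 1 / a"
    by (simp add: interval_lebesgue_integral_def ei set_lebesgue_integral_def scaleR_conv_of_real of_real_indicator)
qed

lemma integral_times_exp_halfline:
  fixes a :: complex assumes a: "Re a > 0"
  shows "integrable lborel (\<lambda>\<xi>. indicator {0<..} \<xi> * (of_real \<xi> * exp (- (a * of_real \<xi>))))"
    "(LINT \<xi>|lborel. indicator {0<..} \<xi> * (of_real \<xi> * exp (- (a * of_real \<xi>)))) = 1 / a\<^sup>2"
proof -
  have nrm: "cmod (indicator {0<..} \<xi> * (of_real \<xi> * exp (- (a * of_real \<xi>)))) =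
      indicator {0<..} \<xi> * (\<xi> * exp (- (Re a * \<xi>)))" for \<xi>
    by (simp add: norm_mult indicator_def)
  show int: "integrable lborel (\<lambda>\<xi>. indicator {0<..} \<xi> * (of_real \<xi> * exp (- (a * of_real \<xi>))))"
    by (rule integrable_norm_cancel) (use integrable_times_exp_halfline[OF a] nrm in \<open>auto\<close>)
  have a0: "a \<noteq> 0" using a by auto
  have ei: "einterval 0 \<infinity> = {0::real<..}" by (auto simp: einterval_def)
  have set: "set_integrable lborel {0<..} (\<lambda>\<xi>. of_real \<xi> * exp (- (a * of_real \<xi>)))"
    using int by (simp add: set_integrable_def scaleR_conv_of_real of_real_indicator)
  define F where "F \<xi> = - (of_real \<xi> * exp (- (a * of_real \<xi>))) / a - exp (- (a * of_real \<xi>)) / a\<^sup>2" for \<xi> :: real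
  have "(LBINT \<xi>=0..\<infinity>. of_real \<xi> * exp (- (a * of_real \<xi>))) = 0 - (- 1 / a\<^sup>2)"
  proof (rule interval_integral_FTC_integrable)
    show "(F has_vector_derivative of_real x * exp (- (a * of_real x))) (at x)" for x
    proof -
      have "((\<lambda>z. - (z * exp (- (a * z))) / a - exp (- (a * z)) / a\<^sup>2) has_field_derivative
          of_real x * exp (- (a * of_real x))) (at (of_real x))"
        by (rule derivative_eq_intros refl | use a0 in \<open>simp add: field_simps power2_eq_square\<close>)+
      then show ?thesis unfolding F_def by (rule has_vector_derivative_real_field)
    qed
    show "((F \<circ> real_of_ereal) \<longlongrightarrow> - 1 / a\<^sup>2) (at_right 0)"
      unfolding zero_ereal_def ereal_tendsto_simps F_def using a0
      by (auto intro!: tendsto_eq_intros)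
    have e1: "((\<lambda>\<xi>. exp (- (a * complex_of_real \<xi>))) \<longlongrightarrow> 0) at_top"
      using tendsto_exp_neg_at_top[OF a] by (subst tendsto_norm_zero_iff[symmetric]) simp
    have e2: "((\<lambda>\<xi>. complex_of_real \<xi> * exp (- (a * complex_of_real \<xi>))) \<longlongrightarrow> 0) at_top"
    proof (rule Lim_null_comparison)
      show "\<forall>\<^sub>F \<xi> in at_top. norm (complex_of_real \<xi> * exp (- (a * complex_of_real \<xi>))) \<le> 2 / Re a * exp (- (Re a / 2 * \<xi>))"
        using eventually_ge_at_top[of 0]
        by eventually_elim (use times_exp_le[OF a] in \<open>simp add: norm_mult\<close>)
      show "((\<lambda>\<xi>. 2 / Re a * exp (- (Re a / 2 * \<xi>))) \<longlongrightarrow> 0) at_top"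
        using tendsto_exp_neg_at_top[of "Re a / 2"] a by (intro tendsto_mult_right_zero) simp
    qed
    show "((F \<circ> real_of_ereal) \<longlongrightarrow> 0) (at_left \<infinity>)"
      unfolding ereal_tendsto_simps F_def
      using tendsto_diff[OF tendsto_divide_zero[OF tendsto_minus[OF e2, simplified]] tendsto_divide_zero[OF e1]]
      by simp
  qed (auto intro!: continuous_intros simp: ei set)
  then show "(LINT \<xi>|lborel. indicator {0<..} \<xi> * (of_real \<xi> * exp (- (a * of_real \<xi>)))) = 1 / a\<^sup>2"
    by (simp add: interval_lebesgue_integral_def ei set_lebesgue_integral_def scaleR_conv_of_real of_real_indicator)
qed

subsection \<open>The Poisson kernel\<close>

text \<open>Abel's convergence factor: transforms of square-integrable functions need not be
  integrable, and this damping makes the inversion integral absolutely convergent.\<close>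

definition abel :: "real \<Rightarrow> real \<Rightarrow> real" where "abel \<epsilon> \<xi> = exp (- (\<epsilon> * \<bar>\<xi>\<bar>))"

text \<open>The transform of \<open>abel \<epsilon>\<close>, that is the Poisson kernel scaled to
  total mass \<open>2 * pi\<close> instead of 1.\<close>

definition poisson :: "real \<Rightarrow> real \<Rightarrow> real" where "poisson \<epsilon> t = 2 * \<epsilon> / (\<epsilon>\<^sup>2 + t\<^sup>2)"

lemma abel_measurable [measurable]: "abel \<epsilon> \<in> borel_measurable borel"
  unfolding abel_def by measurable

lemma poisson_measurable [measurable]: "poisson \<epsilon> \<in> borel_measurable borel"
  unfolding poisson_def by measurable

lemma abel_bounds: "0 < abel \<epsilon> \<xi>" "\<epsilon> > 0 \<Longrightarrow> abel \<epsilon> \<xi> \<le> 1"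
  by (simp_all add: abel_def)

lemma abel_split:
  "AE \<xi> in lborel. complex_of_real (abel \<epsilon> \<xi>) =
     indicator {0<..} \<xi> * exp (- (of_real \<epsilon> * of_real \<xi>)) + indicator {0<..} (- \<xi>) * exp (- (of_real \<epsilon> * of_real (- \<xi>)))"
  using AE_lborel_singleton[of 0]
  by eventually_elim (auto simp: abel_def indicator_def exp_of_real[symmetric])

lemma integrable_reflect:
  fixes f :: "real \<Rightarrow> 'a::{banach, second_countable_topology}"
  shows "integrable lborel f \<Longrightarrow> integrable lborel (\<lambda>x. f (- x))"
  using lborel_integrable_real_affine[of f "-1" 0] by simp

lemma integrable_abel:
  assumes "\<epsilon> > 0" shows "integrable lborel (\<lambda>\<xi>. complex_of_real (abel \<epsilon> \<xi>))"
proof -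
  have *: "integrable lborel (\<lambda>\<xi>. indicator {0<..} \<xi> * exp (- (complex_of_real \<epsilon> * of_real \<xi>)))"
    using integral_exp_halfline(1)[of "of_real \<epsilon>"] assms by simp
  have "integrable lborel (\<lambda>\<xi>. indicator {0<..} \<xi> * exp (- (complex_of_real \<epsilon> * of_real \<xi>))
      + indicator {0<..} (- \<xi>) * exp (- (of_real \<epsilon> * of_real (- \<xi>))))"
    using * integrable_reflect[OF *] by (intro Bochner_Integration.integrable_add) auto
  then show ?thesis
    by (subst integrable_cong_AE[OF _ _ abel_split]) measurable
qed

lemma FT_exp_halfline:
  assumes "\<epsilon> > 0"
  shows "FT (\<lambda>\<xi>. indicator {0<..} \<xi> * exp (- (complex_of_real \<epsilon> * of_real \<xi>))) t = 1 / (of_real \<epsilon> + \<i> * of_real t)"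
proof -
  have "FT (\<lambda>\<xi>. indicator {0<..} \<xi> * exp (- (complex_of_real \<epsilon> * of_real \<xi>))) t =
      (LINT \<xi>|lborel. indicator {0<..} \<xi> * exp (- ((of_real \<epsilon> + \<i> * of_real t) * of_real \<xi>)))"
    unfolding FT_def
    by (rule Bochner_Integration.integral_cong) (simp_all add: algebra_simps flip: exp_add)
  also have "\<dots> = 1 / (of_real \<epsilon> + \<i> * of_real t)"
    by (rule integral_exp_halfline(2)) (use assms in simp)
  finally show ?thesis .
qed

lemma FT_abel:
  assumes "\<epsilon> > 0"
  shows "FT (\<lambda>\<xi>. complex_of_real (abel \<epsilon> \<xi>)) t = of_real (poisson \<epsilon> t)"
proof -
  define g where "g \<xi> = indicator {0<..} \<xi> * exp (- (complex_of_real \<epsilon> * of_real \<xi>))" for \<xi> :: real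
  have g: "integrable lborel g"
    unfolding g_def using integral_exp_halfline(1)[of "of_real \<epsilon>"] assms by simp
  have gm [measurable]: "g \<in> borel_measurable borel" unfolding g_def by measurable
  have "FT (\<lambda>\<xi>. complex_of_real (abel \<epsilon> \<xi>)) t = FT (\<lambda>\<xi>. g \<xi> + g (- \<xi>)) t"
    unfolding FT_def
  proof (rule integral_cong_AE)
    show "AE x in lborel. complex_of_real (abel \<epsilon> x) * exp (- (\<i> * complex_of_real (x * t))) =
        (g x + g (- x)) * exp (- (\<i> * complex_of_real (x * t)))"
      using abel_split[of \<epsilon>] by eventually_elim (simp only: g_def)
  qed measurable
  also have "\<dots> = FT g t + FT g (- t)"
    using FT_add[OF g integrable_reflect[OF g]] FT_reflect[of g t] by simp
  also have "\<dots> = 1 / (of_real \<epsilon> + \<i> * of_real t) + 1 / (of_real \<epsilon> + \<i> * of_real (- t))"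
    unfolding g_def FT_exp_halfline[OF assms] ..
  also have "\<dots> = of_real (poisson \<epsilon> t)"
  proof -
    have "of_real \<epsilon> + \<i> * of_real t \<noteq> 0" "of_real \<epsilon> + \<i> * of_real (- t) \<noteq> 0"
      using assms by (auto simp: complex_eq_iff)
    moreover have "(of_real \<epsilon> + \<i> * of_real t) * (of_real \<epsilon> + \<i> * of_real (- t)) = of_real (\<epsilon>\<^sup>2 + t\<^sup>2)"
      by (simp add: algebra_simps power2_eq_square)
    moreover have "1 / z + 1 / w = (z + w) / (z * w)" if "z \<noteq> 0" "w \<noteq> 0" for z w :: complex
      using that by (simp add: field_simps)
    ultimately have "1 / (of_real \<epsilon> + \<i> * of_real t) + 1 / (of_real \<epsilon> + \<i> * of_real (- t)) =
        2 * of_real \<epsilon> / complex_of_real (\<epsilon>\<^sup>2 + t\<^sup>2)"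
      by (simp del: of_real_add of_real_power)
    then show ?thesis by (simp add: poisson_def)
  qed
  finally show ?thesis .
qed

lemma poisson_nonneg: "\<epsilon> > 0 \<Longrightarrow> 0 \<le> poisson \<epsilon> t"
  by (simp add: poisson_def)

lemma poisson_pos_denom: "\<epsilon> > 0 \<Longrightarrow> 0 < \<epsilon>\<^sup>2 + (t::real)\<^sup>2"
  by (simp add: add_pos_nonneg)

lemma poisson_le: "\<epsilon> > 0 \<Longrightarrow> poisson \<epsilon> t \<le> 2 / \<epsilon>"
  using poisson_pos_denom[of \<epsilon> t]
  by (simp add: poisson_def divide_simps power2_eq_square) 

lemma poisson_deriv:
  assumes "\<epsilon> > 0"
  shows "((\<lambda>t. 2 * arctan (t / \<epsilon>)) has_real_derivative poisson \<epsilon> t) (at t)"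
  unfolding poisson_def using assms poisson_pos_denom[OF assms, of t]
  by (auto intro!: derivative_eq_intros simp: field_simps power2_eq_square)

lemma poisson_isCont: "\<epsilon> > 0 \<Longrightarrow> isCont (poisson \<epsilon>) t"
  unfolding poisson_def using poisson_pos_denom[of \<epsilon> t] by (intro continuous_intros) auto

lemma integrable_poisson:
  assumes "\<epsilon> > 0"
  shows "integrable lborel (poisson \<epsilon>)" "(LINT t|lborel. poisson \<epsilon> t) = 2 * pi"
proof -
  have top: "((\<lambda>t. 2 * arctan (t / \<epsilon>)) \<longlongrightarrow> pi) at_top"
  proof -
    have "((\<lambda>t. 2 * arctan (t / \<epsilon>)) \<longlongrightarrow> 2 * (pi/2)) at_top"
      using assms
      by (intro tendsto_mult tendsto_const filterlim_compose[OF tendsto_arctan_at_top]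
          filterlim_at_top_mult_tendsto_pos[where c = "1/\<epsilon>" and g = "\<lambda>x. x", simplified]) 
        (auto simp: divide_inverse intro!: filterlim_at_top_mult_tendsto_pos[OF tendsto_const] filterlim_ident)
    then show ?thesis by simp
  qed
  have bot: "((\<lambda>t. 2 * arctan (t / \<epsilon>)) \<longlongrightarrow> - pi) at_bot"
    using tendsto_minus[OF top] unfolding filterlim_at_bot_mirror by (simp add: arctan_minus)
  have *: "set_integrable lborel (einterval (-\<infinity>) \<infinity>) (poisson \<epsilon>)"
    "(LBINT t=-\<infinity>..\<infinity>. poisson \<epsilon> t) = pi - (- pi)"
    by (rule interval_integral_FTC_nonneg[where F = "\<lambda>t. 2 * arctan (t / \<epsilon>)"];
        use assms top bot poisson_deriv poisson_isCont poisson_nonneg in \<open>simp add: ereal_tendsto_simps\<close>)+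
  show "integrable lborel (poisson \<epsilon>)" using *(1) by (simp add: set_integrable_def)
  show "(LINT t|lborel. poisson \<epsilon> t) = 2 * pi"
    using *(2) by (simp add: interval_lebesgue_integral_def set_lebesgue_integral_def)
qed

lemma integral_poisson_interval:
  assumes "\<epsilon> > 0" "a \<le> b"
  shows "(LINT x:{a..b}|lborel. poisson \<epsilon> (y - x)) = 2 * arctan ((b - y) / \<epsilon>) - 2 * arctan ((a - y) / \<epsilon>)"
proof -
  have eq: "poisson \<epsilon> (y - x) = poisson \<epsilon> (x - y)" for x
    by (simp add: poisson_def power2_commute)
  have d: "((\<lambda>x. 2 * arctan ((x - y) / \<epsilon>)) has_real_derivative poisson \<epsilon> (y - x)) (at x)" for x
    unfolding eq using poisson_deriv[OF assms(1), of "x + - y"] unfolding DERIV_shift by simp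
  have c: "isCont (\<lambda>x. poisson \<epsilon> (y - x)) x" for x
    by (rule isCont_o2[OF _ poisson_isCont[OF assms(1)]]) (intro continuous_intros)
  show ?thesis
    unfolding set_lebesgue_integral_def
    using integral_FTC_Icc_real[OF assms(2) d c] by (simp add: mult.commute)
qed

definition poisson_int :: "real \<Rightarrow> (real \<Rightarrow> complex) \<Rightarrow> real \<Rightarrow> complex" where
  "poisson_int \<epsilon> f x = (LINT y|lborel. f y * of_real (poisson \<epsilon> (y - x)))"

lemma poisson_int_measurable [measurable]:
  assumes [measurable]: "f \<in> borel_measurable borel"
  shows "poisson_int \<epsilon> f \<in> borel_measurable borel"
  unfolding poisson_int_def by measurable

lemma integrable_poisson_product:
  assumes "\<epsilon> > 0" "integrable lborel f"
  shows "integrable lborel (\<lambda>y. f y * complex_of_real (poisson \<epsilon> (y - x)))"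
proof (rule integrable_mult_unimodular(1)[OF assms(2)])
  show "cmod (complex_of_real (poisson \<epsilon> (y - x))) \<le> 2 / \<epsilon>" for y
    using poisson_le[OF assms(1)] poisson_nonneg[OF assms(1)] by simp
qed measurable

text \<open>\<open>FT_multiplication\<close> applied to \<open>f\<close> and a modulated Abel
  factor. Conjugating the transform turns the inversion integral into another forward transform, so
  one transform serves both directions.\<close>

lemma abel_FT:
  assumes "\<epsilon> > 0" and f: "integrable lborel f"
  shows "FT (\<lambda>\<xi>. of_real (abel \<epsilon> \<xi>) * cnj (FT f \<xi>)) x = cnj (poisson_int \<epsilon> f x)"
proof -
  define g where "g \<xi> = of_real (abel \<epsilon> \<xi>) * exp (\<i> * complex_of_real (x * \<xi>))" for \<xi>
  have g: "integrable lborel g"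
    unfolding g_def by (rule integrable_mult_unimodular(1)[OF integrable_abel[OF assms(1)], where C = 1]) auto
  have "FT (\<lambda>\<xi>. of_real (abel \<epsilon> \<xi>) * cnj (FT f \<xi>)) x = cnj (LINT \<xi>|lborel. FT f \<xi> * g \<xi>)"
    unfolding FT_def[of "\<lambda>\<xi>. of_real (abel \<epsilon> \<xi>) * cnj (FT f \<xi>)"] Bochner_Integration.integral_cnj[symmetric]
    by (rule Bochner_Integration.integral_cong) (simp_all add: g_def exp_cnj mult_ac)
  also have "(LINT \<xi>|lborel. FT f \<xi> * g \<xi>) = (LINT y|lborel. f y * FT g y)"
    by (rule FT_multiplication[OF f g])
  also have "FT g = (\<lambda>y. of_real (poisson \<epsilon> (y - x)))"
    unfolding g_def FT_modulate FT_abel[OF assms(1)] ..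
  finally show ?thesis by (simp add: poisson_int_def)
qed

lemma nn_integral_poisson:
  assumes "\<epsilon> > 0"
  shows "(\<integral>\<^sup>+t. ennreal (poisson \<epsilon> (t - x)) \<partial>lborel) = ennreal (2 * pi)"
    "(\<integral>\<^sup>+t. ennreal (poisson \<epsilon> (x - t)) \<partial>lborel) = ennreal (2 * pi)"
proof -
  have *: "(\<integral>\<^sup>+t. ennreal (poisson \<epsilon> t) \<partial>lborel) = ennreal (2 * pi)"
    using integrable_poisson[OF assms] poisson_nonneg[OF assms] by (simp add: nn_integral_eq_integral)
  show "(\<integral>\<^sup>+t. ennreal (poisson \<epsilon> (t - x)) \<partial>lborel) = ennreal (2 * pi)"
    using nn_integral_real_affine[of "\<lambda>t. ennreal (poisson \<epsilon> t)" 1 "-x"] * by simp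
  then show "(\<integral>\<^sup>+t. ennreal (poisson \<epsilon> (x - t)) \<partial>lborel) = ennreal (2 * pi)"
    by (simp add: poisson_def power2_commute)
qed

text \<open>The damped energy equals the pairing of \<open>f\<close> with its Poisson integral. A
  Schur test bounds that pairing: the kernel is symmetric and has mass \<open>2 * pi\<close> in
  either variable.\<close>

lemma abel_energy_le:
  assumes "\<epsilon> > 0" and f: "integrable lborel f" and sq: "square_integrable f"
  shows "(\<integral>\<^sup>+\<xi>. ennreal (abel \<epsilon> \<xi> * (cmod (FT f \<xi>))\<^sup>2) \<partial>lborel) \<le>
    ennreal (2 * pi) * (\<integral>\<^sup>+x. ennreal ((cmod (f x))\<^sup>2) \<partial>lborel)"
proof -
  have [measurable]: "f \<in> borel_measurable borel" using sq by measurable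
  define C where "C = (LINT x|lborel. cmod (f x))"
  define h where "h \<xi> = of_real (abel \<epsilon> \<xi>) * cnj (FT f \<xi>)" for \<xi>
  have h: "integrable lborel h"
    unfolding h_def
    by (rule integrable_mult_unimodular(1)[OF integrable_abel[OF assms(1)], where C = C])
      (measurable, simp add: FT_bound[OF f] C_def)
  have FTh: "integrable lborel (\<lambda>\<xi>. FT f \<xi> * h \<xi>)"
    by (rule integrable_mult_unimodular(2)[OF h, where C = C])
      (measurable, simp add: FT_bound[OF f] C_def)
  have eq: "FT f \<xi> * h \<xi> = of_real (abel \<epsilon> \<xi> * (cmod (FT f \<xi>))\<^sup>2)" for \<xi>
    by (simp add: h_def complex_norm_square[symmetric] mult.left_commute flip: of_real_power)
  then have int: "integrable lborel (\<lambda>\<xi>. abel \<epsilon> \<xi> * (cmod (FT f \<xi>))\<^sup>2)"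
    using FTh by (simp only: complex_of_real_integrable_eq)
  have nn: "0 \<le> abel \<epsilon> \<xi> * (cmod (FT f \<xi>))\<^sup>2" for \<xi>
    using abel_bounds(1)[of \<epsilon> \<xi>] by simp
  have "complex_of_real (LINT \<xi>|lborel. abel \<epsilon> \<xi> * (cmod (FT f \<xi>))\<^sup>2) = (LINT \<xi>|lborel. FT f \<xi> * h \<xi>)"
    unfolding eq by (rule integral_complex_of_real[symmetric])
  also have "\<dots> = (LINT x|lborel. f x * FT h x)"
    by (rule FT_multiplication[OF f h])
  also have "FT h = (\<lambda>x. cnj (poisson_int \<epsilon> f x))"
    unfolding h_def using abel_FT[OF assms(1) f] by blast
  finally have E: "complex_of_real (LINT \<xi>|lborel. abel \<epsilon> \<xi> * (cmod (FT f \<xi>))\<^sup>2) =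
      (LINT x|lborel. f x * cnj (poisson_int \<epsilon> f x))" .
  have "(LINT \<xi>|lborel. abel \<epsilon> \<xi> * (cmod (FT f \<xi>))\<^sup>2) = cmod (LINT x|lborel. f x * cnj (poisson_int \<epsilon> f x))"
    unfolding E[symmetric] norm_of_real using nn by (simp add: integral_nonneg_AE)
  \<comment> \<open>Integrability of the product is not known here; if it fails, the Bochner
    integral is 0 by convention and the bound is trivial.\<close>
  moreover have "ennreal (cmod (LINT x|lborel. f x * cnj (poisson_int \<epsilon> f x))) \<le>
      (\<integral>\<^sup>+x. ennreal (cmod (f x * cnj (poisson_int \<epsilon> f x))) \<partial>lborel)"
    by (cases "integrable lborel (\<lambda>x. f x * cnj (poisson_int \<epsilon> f x))")
      (simp_all add: integral_norm_bound_ennreal not_integrable_integral_eq)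
  ultimately have "(\<integral>\<^sup>+\<xi>. ennreal (abel \<epsilon> \<xi> * (cmod (FT f \<xi>))\<^sup>2) \<partial>lborel) \<le>
      (\<integral>\<^sup>+x. ennreal (cmod (f x * cnj (poisson_int \<epsilon> f x))) \<partial>lborel)"
    using int nn by (simp add: nn_integral_eq_integral)
  also have "\<dots> \<le> (\<integral>\<^sup>+x. \<integral>\<^sup>+y. ennreal (cmod (f x)) * (ennreal (cmod (f y)) * ennreal (poisson \<epsilon> (y - x))) \<partial>lborel \<partial>lborel)"
  proof (rule nn_integral_mono)
    fix x :: real
    have "ennreal (cmod (poisson_int \<epsilon> f x)) \<le>
        (\<integral>\<^sup>+y. ennreal (cmod (f y * of_real (poisson \<epsilon> (y - x)))) \<partial>lborel)"
      unfolding poisson_int_def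
      by (rule integral_norm_bound_ennreal[OF integrable_poisson_product[OF assms(1) f]])
    also have "\<dots> = (\<integral>\<^sup>+y. ennreal (cmod (f y)) * ennreal (poisson \<epsilon> (y - x)) \<partial>lborel)"
      using poisson_nonneg[OF assms(1)] by (intro nn_integral_cong) (simp add: norm_mult ennreal_mult)
    finally show "ennreal (cmod (f x * cnj (poisson_int \<epsilon> f x))) \<le>
        (\<integral>\<^sup>+y. ennreal (cmod (f x)) * (ennreal (cmod (f y)) * ennreal (poisson \<epsilon> (y - x))) \<partial>lborel)"
      by (simp add: norm_mult ennreal_mult nn_integral_cmult mult_left_mono)
  qed
  \<comment> \<open>Splitting \<open>|f x| |f y|\<close> into half squares leaves one free variable
    in each term, over which the Poisson kernel integrates to its mass.\<close>
  also have "\<dots> \<le> (\<integral>\<^sup>+x. \<integral>\<^sup>+y. ennreal ((cmod (f x))\<^sup>2 / 2) * ennreal (poisson \<epsilon> (y - x)) +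
      ennreal ((cmod (f y))\<^sup>2 / 2) * ennreal (poisson \<epsilon> (y - x)) \<partial>lborel \<partial>lborel)"
  proof (intro nn_integral_mono)
    fix x y :: real
    have "cmod (f x) * cmod (f y) \<le> (cmod (f x))\<^sup>2 / 2 + (cmod (f y))\<^sup>2 / 2"
      using sum_squares_bound[of "cmod (f x)" "cmod (f y)"] by (simp add: field_simps)
    then have "ennreal (cmod (f x)) * ennreal (cmod (f y)) \<le> ennreal ((cmod (f x))\<^sup>2 / 2) + ennreal ((cmod (f y))\<^sup>2 / 2)"
      by (simp add: ennreal_mult[symmetric] ennreal_plus[symmetric] ennreal_leI del: ennreal_plus)
    then show "ennreal (cmod (f x)) * (ennreal (cmod (f y)) * ennreal (poisson \<epsilon> (y - x))) \<le>
        ennreal ((cmod (f x))\<^sup>2 / 2) * ennreal (poisson \<epsilon> (y - x)) +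
        ennreal ((cmod (f y))\<^sup>2 / 2) * ennreal (poisson \<epsilon> (y - x))"
      unfolding distrib_right[symmetric] mult.assoc[symmetric] by (rule mult_right_mono) simp
  qed
  also have "\<dots> = (\<integral>\<^sup>+x. \<integral>\<^sup>+y. ennreal ((cmod (f x))\<^sup>2 / 2) * ennreal (poisson \<epsilon> (y - x)) \<partial>lborel \<partial>lborel) +
      (\<integral>\<^sup>+x. \<integral>\<^sup>+y. ennreal ((cmod (f y))\<^sup>2 / 2) * ennreal (poisson \<epsilon> (y - x)) \<partial>lborel \<partial>lborel)"
    by (simp add: nn_integral_add)
  also have "(\<integral>\<^sup>+x. \<integral>\<^sup>+y. ennreal ((cmod (f y))\<^sup>2 / 2) * ennreal (poisson \<epsilon> (y - x)) \<partial>lborel \<partial>lborel) =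
      (\<integral>\<^sup>+y. \<integral>\<^sup>+x. ennreal ((cmod (f y))\<^sup>2 / 2) * ennreal (poisson \<epsilon> (y - x)) \<partial>lborel \<partial>lborel)"
    by (rule lborel_pair.Fubini') measurable
  also have "(\<integral>\<^sup>+x. \<integral>\<^sup>+y. ennreal ((cmod (f x))\<^sup>2 / 2) * ennreal (poisson \<epsilon> (y - x)) \<partial>lborel \<partial>lborel) +
      (\<integral>\<^sup>+y. \<integral>\<^sup>+x. ennreal ((cmod (f y))\<^sup>2 / 2) * ennreal (poisson \<epsilon> (y - x)) \<partial>lborel \<partial>lborel) =
      (\<integral>\<^sup>+x. ennreal ((cmod (f x))\<^sup>2 / 2) * ennreal (2 * pi) \<partial>lborel) +
      (\<integral>\<^sup>+x. ennreal ((cmod (f x))\<^sup>2 / 2) * ennreal (2 * pi) \<partial>lborel)"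
    by (simp add: nn_integral_cmult nn_integral_poisson[OF assms(1)])
  also have "\<dots> = (\<integral>\<^sup>+x. ennreal ((cmod (f x))\<^sup>2 / 2) * ennreal (2 * pi) + ennreal ((cmod (f x))\<^sup>2 / 2) * ennreal (2 * pi) \<partial>lborel)"
    by (rule nn_integral_add[symmetric]) measurable
  also have "\<dots> = (\<integral>\<^sup>+x. ennreal (2 * pi) * ennreal ((cmod (f x))\<^sup>2) \<partial>lborel)"
    by (intro nn_integral_cong) (simp add: ennreal_mult[symmetric] ennreal_plus[symmetric] del: ennreal_plus)
  also have "\<dots> = ennreal (2 * pi) * (\<integral>\<^sup>+x. ennreal ((cmod (f x))\<^sup>2) \<partial>lborel)"
    by (rule nn_integral_cmult) measurable
  finally show ?thesis .
qed

lemma abel_tendsto_1: "(\<lambda>n. abel (1 / real (Suc n)) \<xi>) \<longlonglongrightarrow> 1"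
proof -
  have "(\<lambda>n. 1 / real (Suc n) * \<bar>\<xi>\<bar>) \<longlonglongrightarrow> 0"
    using LIMSEQ_inverse_real_of_nat by (intro tendsto_mult_left_zero) (simp add: inverse_eq_divide)
  then have "(\<lambda>n. exp (- (1 / real (Suc n) * \<bar>\<xi>\<bar>))) \<longlonglongrightarrow> exp (- 0)"
    by (intro tendsto_intros)
  then show ?thesis unfolding abel_def by simp
qed

text \<open>Fatou's lemma removes the Abel factor from \<open>abel_energy_le\<close>. This gives
  Plancherel only as an inequality; equality follows later from inversion.\<close>

lemma FT_square_integrable:
  assumes f: "integrable lborel f" and sq: "square_integrable f"
  shows "square_integrable (FT f)"
    "(norm (abs_L2 (FT f)))\<^sup>2 \<le> 2 * pi * (norm (abs_L2 f))\<^sup>2"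
proof -
  have [measurable]: "f \<in> borel_measurable borel" using sq by measurable
  let ?\<epsilon> = "\<lambda>n. 1 / real (Suc n)"
  have "(\<integral>\<^sup>+\<xi>. ennreal ((cmod (FT f \<xi>))\<^sup>2) \<partial>lborel) =
      (\<integral>\<^sup>+\<xi>. liminf (\<lambda>n. ennreal (abel (?\<epsilon> n) \<xi> * (cmod (FT f \<xi>))\<^sup>2)) \<partial>lborel)"
  proof (rule nn_integral_cong)
    fix \<xi> :: real
    have "(\<lambda>n. ennreal (abel (?\<epsilon> n) \<xi> * (cmod (FT f \<xi>))\<^sup>2)) \<longlonglongrightarrow> ennreal (1 * (cmod (FT f \<xi>))\<^sup>2)"
      by (intro tendsto_ennrealI tendsto_mult abel_tendsto_1 tendsto_const)
    then show "ennreal ((cmod (FT f \<xi>))\<^sup>2) = liminf (\<lambda>n. ennreal (abel (?\<epsilon> n) \<xi> * (cmod (FT f \<xi>))\<^sup>2))"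
      using lim_imp_Liminf[OF sequentially_bot] by force
  qed
  also have "\<dots> \<le> liminf (\<lambda>n. \<integral>\<^sup>+\<xi>. ennreal (abel (?\<epsilon> n) \<xi> * (cmod (FT f \<xi>))\<^sup>2) \<partial>lborel)"
    by (rule nn_integral_liminf) measurable
  also have "\<dots> \<le> ennreal (2 * pi) * (\<integral>\<^sup>+x. ennreal ((cmod (f x))\<^sup>2) \<partial>lborel)"
    by (rule Liminf_le) (auto intro!: always_eventually abel_energy_le f sq)
  also have "\<dots> = ennreal (2 * pi * (norm (abs_L2 f))\<^sup>2)"
    by (simp add: norm_abs_L2_nn[OF sq, symmetric] ennreal_mult)
  finally have le: "(\<integral>\<^sup>+\<xi>. ennreal ((cmod (FT f \<xi>))\<^sup>2) \<partial>lborel) \<le> ennreal (2 * pi * (norm (abs_L2 f))\<^sup>2)" .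
  show S: "square_integrable (FT f)"
    by (subst square_integrable_iff_nn) (auto intro: le_less_trans[OF le])
  show "(norm (abs_L2 (FT f)))\<^sup>2 \<le> 2 * pi * (norm (abs_L2 f))\<^sup>2"
    using le unfolding norm_abs_L2_nn[OF S, symmetric] by (subst (asm) ennreal_le_iff) simp_all
qed

section \<open>The Fourier transform on square-integrable classes\<close>

definition truncate :: "real \<Rightarrow> (real \<Rightarrow> complex) \<Rightarrow> real \<Rightarrow> complex" where
  "truncate N f x = indicator {-N..N} x * f x"

lemma truncate_square_integrable:
  assumes "square_integrable f"
  shows "square_integrable (truncate N f)" "integrable lborel (truncate N f)"
proof -
  show "square_integrable (truncate N f)"
    unfolding truncate_def
    by (rule square_integrable_mult_bounded[OF assms, where C = 1]) (auto simp: indicator_def)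
  show "integrable lborel (truncate N f)"
    unfolding truncate_def by (rule square_integrable_product[OF square_integrable_indicator assms])
qed

lemma set_integral_FT_truncate:
  "(LINT x:{-N..N}|lborel. f x * exp (- (\<i> * complex_of_real (x * \<xi>)))) = FT (truncate N f) \<xi>"
  unfolding FT_def set_lebesgue_integral_def truncate_def
  by (rule Bochner_Integration.integral_cong) (auto simp: indicator_def)

lemma L2_dominated_convergence:
  assumes "\<And>n. square_integrable (f n)" "square_integrable g" "square_integrable w"
    and lim: "AE x in lborel. (\<lambda>n. f n x) \<longlonglongrightarrow> g x"
    and le: "\<And>n. AE x in lborel. cmod (f n x - g x) \<le> cmod (w x)"
  shows "(\<lambda>n. abs_L2 (f n)) \<longlonglongrightarrow> abs_L2 g"
proof -
  have [measurable]: "f n \<in> borel_measurable borel" "g \<in> borel_measurable borel" for n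
    using assms(1,2) by measurable
  have "(\<lambda>n. LINT x|lborel. (cmod (f n x - g x))\<^sup>2) \<longlonglongrightarrow> (LINT x::real|lborel. 0)"
  proof (rule integral_dominated_convergence)
    show "integrable lborel (\<lambda>x. (cmod (w x))\<^sup>2)" by (rule square_integrable_norm_square[OF assms(3)])
    show "AE x in lborel. (\<lambda>n. (cmod (f n x - g x))\<^sup>2) \<longlonglongrightarrow> 0"
      using lim
    proof eventually_elim
      case (elim x)
      then have "(\<lambda>n. (cmod (f n x - g x))\<^sup>2) \<longlonglongrightarrow> (cmod (g x - g x))\<^sup>2"
        by (intro tendsto_intros)
      then show ?case by simp
    qed
    show "AE x in lborel. norm ((cmod (f n x - g x))\<^sup>2) \<le> (cmod (w x))\<^sup>2" for n
      using le[of n] by eventually_elim (simp add: power_mono)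
  qed measurable
  then have "(\<lambda>n. (norm (abs_L2 (f n) - abs_L2 g))\<^sup>2) \<longlonglongrightarrow> 0"
    using assms(1,2)
    by (simp add: norm_abs_L2_square square_integrable_diff abs_L2_diff[symmetric])
  then have "(\<lambda>n. norm (abs_L2 (f n) - abs_L2 g)) \<longlonglongrightarrow> 0"
    using tendsto_real_sqrt by force
  then show ?thesis by (simp add: LIM_zero_iff tendsto_norm_zero_iff)
qed

lemma truncate_tendsto:
  assumes "square_integrable f"
  shows "((\<lambda>N. abs_L2 (truncate N f)) \<longlongrightarrow> abs_L2 f) at_top"
proof (rule tendsto_at_topI_sequentially)
  fix X :: "nat \<Rightarrow> real" assume X: "filterlim X at_top sequentially"
  show "(\<lambda>n. abs_L2 (truncate (X n) f)) \<longlonglongrightarrow> abs_L2 f"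
  proof (rule L2_dominated_convergence)
    show "AE x in lborel. (\<lambda>n. truncate (X n) f x) \<longlonglongrightarrow> f x"
    proof (rule AE_I2)
      fix x
      have "\<forall>\<^sub>F n in sequentially. X n \<ge> \<bar>x\<bar>" using X by (simp add: filterlim_at_top)
      then have "\<forall>\<^sub>F n in sequentially. truncate (X n) f x = f x"
        by eventually_elim (auto simp: truncate_def indicator_def)
      then show "(\<lambda>n. truncate (X n) f x) \<longlonglongrightarrow> f x" by (rule tendsto_eventually)
    qed
    show "AE x in lborel. cmod (truncate (X n) f x - f x) \<le> cmod (f x)" for n
      by (rule AE_I2) (simp add: truncate_def indicator_def)
  qed (auto intro: assms truncate_square_integrable)
qed

lemma FT_diff_norm_le:
  assumes "integrable lborel f" "square_integrable f" "integrable lborel g" "square_integrable g"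
  shows "norm (abs_L2 (FT f) - abs_L2 (FT g)) \<le> sqrt (2 * pi) * norm (abs_L2 f - abs_L2 g)"
proof -
  have "FT (\<lambda>x. f x - g x) = (\<lambda>x. FT f x - FT g x)" using FT_diff[OF assms(1,3)] by blast
  then have "(norm (abs_L2 (FT f) - abs_L2 (FT g)))\<^sup>2 \<le> 2 * pi * (norm (abs_L2 f - abs_L2 g))\<^sup>2"
    using FT_square_integrable(2)[of "\<lambda>x. f x - g x"] FT_square_integrable(1)[OF assms(1,2)]
      FT_square_integrable(1)[OF assms(3,4)] assms
    by (simp add: abs_L2_diff square_integrable_diff)
  then have "sqrt ((norm (abs_L2 (FT f) - abs_L2 (FT g)))\<^sup>2) \<le> sqrt (2 * pi * (norm (abs_L2 f - abs_L2 g))\<^sup>2)"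
    by (rule real_sqrt_le_mono)
  then show ?thesis by (simp add: real_sqrt_mult)
qed

text \<open>The extended integral in the definition is a squared norm, so the definition amounts to
  norm convergence of the transforms of truncations.\<close>

lemma is_fourier_transform_iff:
  assumes f: "square_integrable f" and g: "square_integrable g"
  shows "is_fourier_transform (abs_L2 f) (abs_L2 g) \<longleftrightarrow>
    ((\<lambda>N. abs_L2 (FT (truncate N f))) \<longlongrightarrow> abs_L2 g) at_top"
proof -
  have S: "square_integrable (FT (truncate N f))" for N
    using FT_square_integrable(1) truncate_square_integrable[OF f] by blast
  have "(\<integral>\<^sup>+ \<xi>. ennreal ((cmod (g \<xi> - FT (truncate N f) \<xi>))\<^sup>2) \<partial>lborel) =
      ennreal ((norm (abs_L2 g - abs_L2 (FT (truncate N f))))\<^sup>2)" for N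
    by (simp add: abs_L2_diff[OF g S, symmetric] norm_abs_L2_nn[OF square_integrable_diff[OF g S]])
  then have "is_fourier_transform (abs_L2 f) (abs_L2 g) \<longleftrightarrow>
      ((\<lambda>N. ennreal ((norm (abs_L2 g - abs_L2 (FT (truncate N f))))\<^sup>2)) \<longlongrightarrow> ennreal 0) at_top"
    using f g by (simp add: is_fourier_transform.abs_eq ae_eq_refl_iff set_integral_FT_truncate del: of_real_mult)
  also have "\<dots> \<longleftrightarrow> ((\<lambda>N. (norm (abs_L2 g - abs_L2 (FT (truncate N f))))\<^sup>2) \<longlongrightarrow> 0) at_top"
    by (rule tendsto_ennreal_iff) auto
  also have "\<dots> \<longleftrightarrow> ((\<lambda>N. norm (abs_L2 g - abs_L2 (FT (truncate N f)))) \<longlongrightarrow> 0) at_top"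
  proof
    assume "((\<lambda>N. (norm (abs_L2 g - abs_L2 (FT (truncate N f))))\<^sup>2) \<longlongrightarrow> 0) at_top"
    from tendsto_real_sqrt[OF this]
    show "((\<lambda>N. norm (abs_L2 g - abs_L2 (FT (truncate N f)))) \<longlongrightarrow> 0) at_top" by simp
  next
    assume "((\<lambda>N. norm (abs_L2 g - abs_L2 (FT (truncate N f)))) \<longlongrightarrow> 0) at_top"
    from tendsto_power[OF this, of 2]
    show "((\<lambda>N. (norm (abs_L2 g - abs_L2 (FT (truncate N f))))\<^sup>2) \<longlongrightarrow> 0) at_top" by simp
  qed
  also have "\<dots> \<longleftrightarrow> ((\<lambda>N. abs_L2 (FT (truncate N f))) \<longlongrightarrow> abs_L2 g) at_top"
    by (simp add: tendsto_dist_iff[of _ "abs_L2 g"] dist_norm norm_minus_commute)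
  finally show ?thesis .
qed

text \<open>By the Plancherel inequality the transforms of truncations inherit the Cauchy property
  from the truncations themselves, and the space is complete.\<close>

lemma fourier_exists:
  assumes f: "square_integrable f"
  shows "\<exists>v. ((\<lambda>N. abs_L2 (FT (truncate N f))) \<longlongrightarrow> v) at_top"
proof -
  note T = truncate_square_integrable[OF f]
  define X where "X n = abs_L2 (FT (truncate (real n) f))" for n
  have lim: "(\<lambda>n. abs_L2 (truncate (real n) f)) \<longlonglongrightarrow> abs_L2 f"
    by (rule filterlim_compose[OF truncate_tendsto[OF f] filterlim_real_sequentially])
  have "Cauchy X"
  proof (rule CauchyI)
    fix e :: real assume e: "e > 0"
    have "Cauchy (\<lambda>n. abs_L2 (truncate (real n) f))" using lim by (rule LIMSEQ_imp_Cauchy)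
    then obtain M where M: "\<And>m n. m \<ge> M \<Longrightarrow> n \<ge> M \<Longrightarrow>
        norm (abs_L2 (truncate (real m) f) - abs_L2 (truncate (real n) f)) < e / sqrt (2 * pi)"
      using CauchyD[of _ "e / sqrt (2 * pi)"] e by force
    show "\<exists>M. \<forall>m\<ge>M. \<forall>n\<ge>M. norm (X m - X n) < e"
    proof (intro exI[of _ M] allI impI)
      fix m n assume "m \<ge> M" "n \<ge> M"
      have "norm (X m - X n) \<le> sqrt (2 * pi) * norm (abs_L2 (truncate (real m) f) - abs_L2 (truncate (real n) f))"
        unfolding X_def by (rule FT_diff_norm_le[OF T(2) T(1) T(2) T(1)])
      also have "\<dots> < sqrt (2 * pi) * (e / sqrt (2 * pi))"
        by (rule mult_strict_left_mono[OF M]) (use \<open>m \<ge> M\<close> \<open>n \<ge> M\<close> in auto)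
      finally show "norm (X m - X n) < e" by simp
    qed
  qed
  then obtain v where v: "X \<longlonglongrightarrow> v" using L2_Cauchy_convergent unfolding convergent_def by blast
  \<comment> \<open>Letting \<open>n\<close> tend to infinity for fixed \<open>N\<close> gives a
    bound for every real \<open>N\<close>, which upgrades convergence along integers to convergence
    along \<open>at_top\<close>.\<close>
  have le: "norm (abs_L2 (FT (truncate N f)) - v) \<le> sqrt (2 * pi) * norm (abs_L2 (truncate N f) - abs_L2 f)" for N
  proof (rule LIMSEQ_le)
    show "(\<lambda>n. norm (abs_L2 (FT (truncate N f)) - X n)) \<longlonglongrightarrow> norm (abs_L2 (FT (truncate N f)) - v)"
      by (intro tendsto_intros v)
    show "(\<lambda>n. sqrt (2 * pi) * norm (abs_L2 (truncate N f) - abs_L2 (truncate (real n) f))) \<longlonglongrightarrow>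
        sqrt (2 * pi) * norm (abs_L2 (truncate N f) - abs_L2 f)"
      by (intro tendsto_intros lim)
    show "\<exists>M. \<forall>n\<ge>M. norm (abs_L2 (FT (truncate N f)) - X n) \<le>
        sqrt (2 * pi) * norm (abs_L2 (truncate N f) - abs_L2 (truncate (real n) f))"
      unfolding X_def using FT_diff_norm_le[OF T(2) T(1) T(2) T(1)] by blast
  qed
  have "((\<lambda>N. abs_L2 (FT (truncate N f)) - v) \<longlongrightarrow> 0) at_top"
  proof (rule Lim_null_comparison)
    show "\<forall>\<^sub>F N in at_top. norm (abs_L2 (FT (truncate N f)) - v) \<le> sqrt (2 * pi) * norm (abs_L2 (truncate N f) - abs_L2 f)"
      using le by simp
    have "((\<lambda>N. abs_L2 (truncate N f) - abs_L2 f) \<longlongrightarrow> 0) at_top"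
      using truncate_tendsto[OF f] by (simp add: LIM_zero_iff)
    then show "((\<lambda>N. sqrt (2 * pi) * norm (abs_L2 (truncate N f) - abs_L2 f)) \<longlongrightarrow> 0) at_top"
      by (intro tendsto_mult_right_zero tendsto_norm_zero)
  qed
  then show ?thesis by (auto simp: LIM_zero_iff)
qed

text \<open>Discharges the definite description in \<open>fourier\<close>: the limit exists by
  \<open>fourier_exists\<close> and is unique.\<close>

lemma fourier_tendsto:
  assumes f: "square_integrable f"
  shows "((\<lambda>N. abs_L2 (FT (truncate N f))) \<longlongrightarrow> fourier (abs_L2 f)) at_top"
proof -
  have iff: "is_fourier_transform (abs_L2 f) v \<longleftrightarrow> ((\<lambda>N. abs_L2 (FT (truncate N f))) \<longlongrightarrow> v) at_top" for v
    using is_fourier_transform_iff[OF f square_integrable_rep_L2[of v]] by simp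
  obtain v where v: "((\<lambda>N. abs_L2 (FT (truncate N f))) \<longlongrightarrow> v) at_top"
    using fourier_exists[OF f] by blast
  have "fourier (abs_L2 f) = v"
    unfolding fourier_def iff
    using v by (rule the_equality) (rule tendsto_unique[OF trivial_limit_at_top_linorder _ v])
  then show ?thesis using v by simp
qed

lemma fourier_add: "fourier (u + v) = fourier u + fourier v"
proof -
  obtain f g where *: "square_integrable f" "square_integrable g" "u = abs_L2 f" "v = abs_L2 g"
    by (metis L2_cases)
  have "FT (truncate N (\<lambda>x. f x + g x)) = (\<lambda>\<xi>. FT (truncate N f) \<xi> + FT (truncate N g) \<xi>)" for N
    using FT_add[OF truncate_square_integrable(2)[OF *(1)] truncate_square_integrable(2)[OF *(2)]]
    by (auto simp: truncate_def[abs_def] distrib_left)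
  then have eq: "abs_L2 (FT (truncate N (\<lambda>x. f x + g x))) = abs_L2 (FT (truncate N f)) + abs_L2 (FT (truncate N g))" for N
    using * by (simp add: abs_L2_add FT_square_integrable truncate_square_integrable)
  have "((\<lambda>N. abs_L2 (FT (truncate N (\<lambda>x. f x + g x)))) \<longlongrightarrow> fourier u + fourier v) at_top"
    unfolding eq *(3,4) by (intro tendsto_intros fourier_tendsto *)
  moreover have "((\<lambda>N. abs_L2 (FT (truncate N (\<lambda>x. f x + g x)))) \<longlongrightarrow> fourier (u + v)) at_top"
    using fourier_tendsto[OF square_integrable_add[OF *(1,2)]] * by (simp add: abs_L2_add)
  ultimately show ?thesis by (rule tendsto_unique[OF trivial_limit_at_top_linorder, rotated])
qed

lemma tendsto_scaleC:
  fixes c :: complex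
  assumes "(f \<longlongrightarrow> (u :: 'a::complex_normed_vector)) F"
  shows "((\<lambda>n. c *\<^sub>C f n) \<longlongrightarrow> c *\<^sub>C u) F"
proof -
  have "((\<lambda>n. cmod c * norm (f n - u)) \<longlongrightarrow> 0) F"
    using assms by (intro tendsto_mult_right_zero tendsto_norm_zero) (simp add: LIM_zero_iff)
  then have "((\<lambda>n. norm (c *\<^sub>C f n - c *\<^sub>C u)) \<longlongrightarrow> 0) F"
    by (simp add: norm_scaleC[symmetric] complex_vector.scale_right_diff_distrib)
  then show ?thesis by (simp add: tendsto_norm_zero_iff LIM_zero_iff)
qed

lemma fourier_scaleC: "fourier (c *\<^sub>C u) = c *\<^sub>C fourier u"
proof -
  obtain f where *: "square_integrable f" "u = abs_L2 f" by (metis L2_cases)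
  have "FT (truncate N (\<lambda>x. c * f x)) = (\<lambda>\<xi>. c * FT (truncate N f) \<xi>)" for N
    unfolding FT_cmult[symmetric] by (simp add: truncate_def[abs_def] mult.left_commute)
  then have eq: "abs_L2 (FT (truncate N (\<lambda>x. c * f x))) = c *\<^sub>C abs_L2 (FT (truncate N f))" for N
    using * by (simp add: abs_L2_scaleC FT_square_integrable truncate_square_integrable)
  have "((\<lambda>N. abs_L2 (FT (truncate N (\<lambda>x. c * f x)))) \<longlongrightarrow> c *\<^sub>C fourier u) at_top"
    unfolding eq *(2) by (intro tendsto_scaleC fourier_tendsto *)
  moreover have "((\<lambda>N. abs_L2 (FT (truncate N (\<lambda>x. c * f x)))) \<longlongrightarrow> fourier (c *\<^sub>C u)) at_top"
    using fourier_tendsto[OF square_integrable_cmult[OF *(1)]] * by (simp add: abs_L2_scaleC)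
  ultimately show ?thesis by (rule tendsto_unique[OF trivial_limit_at_top_linorder, rotated])
qed

lemma fourier_minus: "fourier (- u) = - fourier u"
  using fourier_scaleC[of "-1" u] by (simp add: scaleC_minus1)

lemma fourier_diff: "fourier (u - v) = fourier u - fourier v"
  using fourier_add[of u "-v"] by (simp add: fourier_minus)

lemma fourier_zero [simp]: "fourier 0 = 0"
  using fourier_diff[of 0 0] by simp

lemma fourier_norm_le: "norm (fourier u) \<le> sqrt (2 * pi) * norm u"
proof -
  obtain f where *: "square_integrable f" "u = abs_L2 f" by (metis L2_cases)
  have "FT (truncate 0 (\<lambda>x. 0)) = (\<lambda>x. 0)" unfolding FT_def truncate_def by simp
  then have *: "norm (abs_L2 (FT (truncate N f))) \<le> sqrt (2 * pi) * norm (abs_L2 (truncate N f))" for N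
    using FT_diff_norm_le[OF truncate_square_integrable(2,1)[OF *(1), of N] truncate_square_integrable(2,1)[OF square_integrable_zero, of 0]]
    by (simp add: abs_L2_zero truncate_def[of 0 "\<lambda>x. 0", abs_def])
  show ?thesis
    unfolding \<open>u = _\<close>
    by (rule tendsto_le[OF trivial_limit_at_top_linorder
          tendsto_mult[OF tendsto_const tendsto_norm[OF truncate_tendsto]] tendsto_norm[OF fourier_tendsto]])
      (use \<open>square_integrable f\<close> * in auto)
qed

lemma tendsto_fourier:
  assumes "(f \<longlongrightarrow> u) F"
  shows "((\<lambda>n. fourier (f n)) \<longlongrightarrow> fourier u) F"
proof -
  have "((\<lambda>n. fourier (f n) - fourier u) \<longlongrightarrow> 0) F"
  proof (rule Lim_null_comparison)
    show "\<forall>\<^sub>F n in F. norm (fourier (f n) - fourier u) \<le> sqrt (2 * pi) * norm (f n - u)"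
      by (rule always_eventually) (metis fourier_diff fourier_norm_le)
    show "((\<lambda>n. sqrt (2 * pi) * norm (f n - u)) \<longlongrightarrow> 0) F"
      using assms by (intro tendsto_mult_right_zero tendsto_norm_zero) (simp add: LIM_zero_iff)
  qed
  then show ?thesis by (simp add: LIM_zero_iff)
qed

lemma fourier_eq_FT:
  assumes "integrable lborel f" "square_integrable f"
  shows "fourier (abs_L2 f) = abs_L2 (FT f)"
proof -
  have "((\<lambda>N. abs_L2 (FT (truncate N f)) - abs_L2 (FT f)) \<longlongrightarrow> 0) at_top"
  proof (rule Lim_null_comparison)
    show "\<forall>\<^sub>F N in at_top. norm (abs_L2 (FT (truncate N f)) - abs_L2 (FT f)) \<le> sqrt (2 * pi) * norm (abs_L2 (truncate N f) - abs_L2 f)"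
      by (rule always_eventually) (intro allI FT_diff_norm_le truncate_square_integrable assms)
    show "((\<lambda>N. sqrt (2 * pi) * norm (abs_L2 (truncate N f) - abs_L2 f)) \<longlongrightarrow> 0) at_top"
      using truncate_tendsto[OF assms(2)] by (intro tendsto_mult_right_zero tendsto_norm_zero) (simp add: LIM_zero_iff)
  qed
  then have "((\<lambda>N. abs_L2 (FT (truncate N f))) \<longlongrightarrow> abs_L2 (FT f)) at_top" by (simp add: LIM_zero_iff)
  then show ?thesis
    by (rule tendsto_unique[OF trivial_limit_at_top_linorder fourier_tendsto[OF assms(2)]])
qed

subsection \<open>Inversion and Plancherel's theorem\<close>

text \<open>Conjugating before and after the transform reverses the sign of the exponent, so
  inversion can be stated without a second transform.\<close>

lift_definition cnj_L2 :: "L2 \<Rightarrow> L2" is "\<lambda>f x. cnj (f x)"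
  by (auto simp: ae_eq_def square_integrable_cnj)

lemma cnj_L2_abs: "square_integrable f \<Longrightarrow> cnj_L2 (abs_L2 f) = abs_L2 (\<lambda>x. cnj (f x))"
  by (simp add: cnj_L2.abs_eq ae_eq_refl_iff)

lemma cnj_L2_cnj_L2 [simp]: "cnj_L2 (cnj_L2 u) = u"
proof -
  obtain f where *: "square_integrable f" "u = abs_L2 f" by (metis L2_cases)
  then show ?thesis by (simp add: cnj_L2_abs square_integrable_cnj)
qed

lemma cnj_L2_diff: "cnj_L2 (u - v) = cnj_L2 u - cnj_L2 v"
proof -
  obtain f g where *: "square_integrable f" "square_integrable g" "u = abs_L2 f" "v = abs_L2 g"
    by (metis L2_cases)
  then show ?thesis
    by (simp add: abs_L2_diff[symmetric] cnj_L2_abs square_integrable_cnj square_integrable_diff)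
qed

lemma norm_cnj_L2 [simp]: "norm (cnj_L2 u) = norm u"
proof -
  obtain f where *: "square_integrable f" "u = abs_L2 f" by (metis L2_cases)
  then have "(norm (cnj_L2 u))\<^sup>2 = (norm u)\<^sup>2"
    by (simp add: cnj_L2_abs norm_abs_L2_square square_integrable_cnj)
  then show ?thesis by simp
qed

lemma tendsto_cnj_L2:
  assumes "(f \<longlongrightarrow> u) F"
  shows "((\<lambda>n. cnj_L2 (f n)) \<longlongrightarrow> cnj_L2 u) F"
proof -
  have "((\<lambda>n. norm (f n - u)) \<longlongrightarrow> 0) F"
    using assms by (intro tendsto_norm_zero) (simp add: LIM_zero_iff)
  then have "((\<lambda>n. norm (cnj_L2 (f n) - cnj_L2 u)) \<longlongrightarrow> 0) F"
    by (simp add: cnj_L2_diff[symmetric])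
  then show ?thesis by (simp add: tendsto_norm_zero_iff LIM_zero_iff)
qed

lemma arctan_limit:
  "(\<lambda>n. arctan (t * real (Suc n))) \<longlonglongrightarrow> pi / 2 * sgn t"
proof -
  have *: "(\<lambda>n. arctan (t * real (Suc n))) \<longlonglongrightarrow> pi / 2" if "t > 0" for t
    using that
    by (intro filterlim_compose[OF tendsto_arctan_at_top] filterlim_tendsto_pos_mult_at_top[OF tendsto_const]
        filterlim_compose[OF filterlim_real_sequentially filterlim_Suc]) auto
  consider "t > 0" | "t = 0" | "t < 0" by linarith
  then show ?thesis
  proof cases
    case 3
    then show ?thesis using tendsto_minus[OF *[of "- t"]] by (simp add: arctan_minus)
  qed (use * in auto)
qed

text \<open>Fubini moves the integral over the interval onto the Poisson kernel, whose
  antiderivative is an arctangent.\<close>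

lemma set_integral_poisson_int:
  assumes "\<epsilon> > 0" "a \<le> b" and f: "integrable lborel f"
  shows "(LINT x:{a..b}|lborel. poisson_int \<epsilon> f x) =
    (LINT y|lborel. f y * of_real (2 * arctan ((b - y) / \<epsilon>) - 2 * arctan ((a - y) / \<epsilon>)))"
proof -
  have [measurable]: "f \<in> borel_measurable borel" using f by (simp add: borel_measurable_integrable)
  define F where "F x y = indicator {a..b} x * (f y * complex_of_real (poisson \<epsilon> (y - x)))" for x y
  have int: "integrable (lborel \<Otimes>\<^sub>M lborel) (case_prod (\<lambda>y x. F x y))"
  proof (rule lborel_pair.Fubini_integrable)
    show "(case_prod (\<lambda>y x. F x y)) \<in> borel_measurable (lborel \<Otimes>\<^sub>M lborel)"
      unfolding F_def by measurable
    have b: "integrable lborel (\<lambda>x. indicator {a..b} x * (2 / \<epsilon>))" for a b :: real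
      by (intro integrable_mult_left integrable_real_indicator) (auto simp: emeasure_lborel_Icc_eq)
    have nF: "cmod (F x y) \<le> cmod (f y) * (indicator {a..b} x * (2 / \<epsilon>))" for x y
      using poisson_le[OF assms(1), of "y - x"] poisson_nonneg[OF assms(1), of "y - x"]
        mult_left_mono[of "poisson \<epsilon> (y - x)" "2 / \<epsilon>" "cmod (f y)"]
      by (auto simp: F_def norm_mult indicator_def)
    have intx: "integrable lborel (\<lambda>x. F x y)" for y
    proof (rule Bochner_Integration.integrable_bound)
      show "integrable lborel (\<lambda>x. cmod (f y) * (indicator {a..b} x * (2 / \<epsilon>)))"
        using b by (rule integrable_mult_right)
      show "AE x in lborel. norm (F x y) \<le> norm (cmod (f y) * (indicator {a..b} x * (2 / \<epsilon>)))"
        by (rule AE_I2) (rule order_trans[OF nF], use assms(1) in simp)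
      show "(\<lambda>x. F x y) \<in> borel_measurable lborel" unfolding F_def by measurable
    qed
    then show "AE y in lborel. integrable lborel (\<lambda>x. case (y, x) of (y, x) \<Rightarrow> F x y)" by simp
    show "integrable lborel (\<lambda>y. LINT x|lborel. norm (case (y, x) of (y, x) \<Rightarrow> F x y))"
    proof (rule Bochner_Integration.integrable_bound)
      show "integrable lborel (\<lambda>y. cmod (f y) * (LINT x|lborel. indicator {a..b} x * (2 / \<epsilon>)))"
        using f by (intro integrable_mult_left integrable_norm)
      show "(\<lambda>y. LINT x|lborel. norm (case (y, x) of (y, x) \<Rightarrow> F x y)) \<in> borel_measurable lborel"
        unfolding F_def by measurable
      have "(LINT x|lborel. cmod (F x y)) \<le> cmod (f y) * (LINT x|lborel. indicator {a..b} x * (2 / \<epsilon>))" for y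
        unfolding integral_mult_right_zero[symmetric]
        by (rule integral_mono[OF integrable_norm[OF intx] integrable_mult_right[OF b] nF])
      then show "AE y in lborel. norm (LINT x|lborel. norm (case (y, x) of (y, x) \<Rightarrow> F x y)) \<le>
          norm (cmod (f y) * (LINT x|lborel. indicator {a..b} x * (2 / \<epsilon>)))"
        unfolding prod.case real_norm_def
        by (intro AE_I2) (subst abs_of_nonneg, simp, rule order_trans[OF _ abs_ge_self])
    qed
  qed
  have "(LINT x:{a..b}|lborel. poisson_int \<epsilon> f x) = (LINT x|lborel. LINT y|lborel. F x y)"
    unfolding set_lebesgue_integral_def poisson_int_def F_def
    by (simp add: scaleR_conv_of_real of_real_indicator)
  also have "\<dots> = (LINT y|lborel. LINT x|lborel. F x y)"
    by (rule lborel_pair.Fubini_integral[OF int])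
  also have "\<dots> = (LINT y|lborel. f y * of_real (2 * arctan ((b - y) / \<epsilon>) - 2 * arctan ((a - y) / \<epsilon>)))"
  proof (rule Bochner_Integration.integral_cong)
    fix y
    have "(LINT x|lborel. F x y) = (LINT x|lborel. f y * complex_of_real (indicator {a..b} x * poisson \<epsilon> (y - x)))"
      unfolding F_def by (simp add: mult_ac of_real_indicator)
    also have "\<dots> = f y * of_real (LINT x|lborel. indicator {a..b} x * poisson \<epsilon> (y - x))"
      unfolding integral_mult_right_zero integral_complex_of_real ..
    also have "(LINT x|lborel. indicator {a..b} x * poisson \<epsilon> (y - x)) =
        2 * arctan ((b - y) / \<epsilon>) - 2 * arctan ((a - y) / \<epsilon>)"
      using integral_poisson_interval[OF assms(1,2), of y] by (simp add: set_lebesgue_integral_def)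
    finally show "(LINT x|lborel. F x y) = f y * of_real (2 * arctan ((b - y) / \<epsilon>) - 2 * arctan ((a - y) / \<epsilon>))" .
  qed simp
  finally show ?thesis .
qed

text \<open>The arctangent difference tends to \<open>2 * pi\<close> inside the interval and to 0
  outside. This weak form of the approximate identity avoids pointwise convergence of Poisson
  integrals.\<close>

lemma poisson_int_interval_limit:
  fixes f :: "real \<Rightarrow> complex"
  assumes "a \<le> b" and f: "integrable lborel f"
  shows "(\<lambda>n. LINT x:{a..b}|lborel. poisson_int (1 / real (Suc n)) f x) \<longlonglongrightarrow> 2 * pi * (LINT x:{a..b}|lborel. f x)"
proof -
  have [measurable]: "f \<in> borel_measurable borel" using f by (simp add: borel_measurable_integrable)
  have "(\<lambda>n. LINT y|lborel. f y * of_real (2 * arctan ((b - y) * real (Suc n)) - 2 * arctan ((a - y) * real (Suc n)))) \<longlonglongrightarrow>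
      (LINT y|lborel. 2 * pi * (indicator {a..b} y * f y))"
  proof (rule integral_dominated_convergence)
    show "integrable lborel (\<lambda>y. 2 * pi * cmod (f y))" using f by (intro integrable_mult_right integrable_norm)
    show "AE y in lborel. (\<lambda>n. f y * of_real (2 * arctan ((b - y) * real (Suc n)) - 2 * arctan ((a - y) * real (Suc n)))) \<longlonglongrightarrow>
        2 * pi * (indicator {a..b} y * f y)"
      \<comment> \<open>At an endpoint the limit of the arctangent difference is not
        \<open>2 * pi\<close>, so both endpoints are discarded as null sets.\<close>
      using AE_lborel_singleton[of a] AE_lborel_singleton[of b]
    proof eventually_elim
      case (elim y)
      have "(\<lambda>n. f y * of_real (2 * arctan ((b - y) * real (Suc n)) - 2 * arctan ((a - y) * real (Suc n)))) \<longlonglongrightarrow>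
          f y * of_real (2 * (pi / 2 * sgn (b - y)) - 2 * (pi / 2 * sgn (a - y)))"
        by (intro tendsto_intros arctan_limit)
      also have "f y * of_real (2 * (pi / 2 * sgn (b - y)) - 2 * (pi / 2 * sgn (a - y))) = 2 * pi * (indicator {a..b} y * f y)"
        using elim assms(1) by (auto simp: indicator_def sgn_if)
      finally show ?case .
    qed
    show "AE y in lborel. norm (f y * of_real (2 * arctan ((b - y) * real (Suc n)) - 2 * arctan ((a - y) * real (Suc n)))) \<le> 2 * pi * cmod (f y)" for n
    proof (rule AE_I2)
      fix y
      have "\<bar>2 * arctan ((b - y) * real (Suc n)) - 2 * arctan ((a - y) * real (Suc n))\<bar> \<le> 2 * pi"
        using arctan_bounded[of "(b - y) * real (Suc n)"] arctan_bounded[of "(a - y) * real (Suc n)"] by linarith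
      then show "norm (f y * of_real (2 * arctan ((b - y) * real (Suc n)) - 2 * arctan ((a - y) * real (Suc n)))) \<le> 2 * pi * cmod (f y)"
        unfolding norm_mult norm_of_real by (subst mult.commute) (rule mult_right_mono, auto)
    qed
  qed measurable
  also have "(LINT y|lborel. 2 * pi * (indicator {a..b} y * f y)) = 2 * pi * (LINT x:{a..b}|lborel. f x)"
    unfolding integral_mult_right_zero set_lebesgue_integral_def
    by (simp add: scaleR_conv_of_real of_real_indicator)
  finally show ?thesis
    using set_integral_poisson_int[OF _ assms] by simp
qed

text \<open>Damp the conjugated transform by Abel factors. By \<open>abel_FT\<close> its transform
  is a conjugated Poisson integral, whose pairing with interval indicators has a known limit; the
  damping itself converges in norm.\<close>

lemma fourier_inversion_integrable:
  assumes f: "integrable lborel f" and sq: "square_integrable f"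
  shows "fourier (cnj_L2 (fourier (abs_L2 f))) = (2 * pi) *\<^sub>C cnj_L2 (abs_L2 f)"
proof -
  define g where "g n \<xi> = of_real (abel (1 / real (Suc n)) \<xi>) * cnj (FT f \<xi>)" for n \<xi>
  have Sf: "square_integrable (\<lambda>\<xi>. cnj (FT f \<xi>))"
    by (intro square_integrable_cnj FT_square_integrable f sq)
  have ab: "cmod (of_real (abel (1 / real (Suc n)) \<xi>)) \<le> 1" for n \<xi>
    using abel_bounds[of "1 / real (Suc n)" \<xi>] by simp
  have [measurable]: "f \<in> borel_measurable borel" using sq by measurable
  have Sg: "square_integrable (g n)" for n
    unfolding g_def by (rule square_integrable_mult_bounded[OF Sf _ ab]) measurable
  have g: "integrable lborel (g n)" for n
    unfolding g_def
    by (rule integrable_mult_unimodular(1)[OF integrable_abel, where C = "LINT x|lborel. cmod (f x)"])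
      (simp, measurable, simp add: FT_bound[OF f])
  have "(\<lambda>n. abs_L2 (g n)) \<longlonglongrightarrow> abs_L2 (\<lambda>\<xi>. cnj (FT f \<xi>))"
  proof (rule L2_dominated_convergence[OF Sg Sf Sf])
    show "AE \<xi> in lborel. (\<lambda>n. g n \<xi>) \<longlonglongrightarrow> cnj (FT f \<xi>)"
    proof (rule AE_I2)
      fix \<xi>
      have "(\<lambda>n. of_real (abel (1 / real (Suc n)) \<xi>) * cnj (FT f \<xi>)) \<longlonglongrightarrow> of_real 1 * cnj (FT f \<xi>)"
        by (intro tendsto_intros abel_tendsto_1)
      then show "(\<lambda>n. g n \<xi>) \<longlonglongrightarrow> cnj (FT f \<xi>)" by (simp add: g_def)
    qed
    fix n
    show "AE \<xi> in lborel. cmod (g n \<xi> - cnj (FT f \<xi>)) \<le> cmod (cnj (FT f \<xi>))"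
    proof (rule AE_I2)
      fix \<xi>
      have "g n \<xi> - cnj (FT f \<xi>) = of_real (abel (1 / real (Suc n)) \<xi> - 1) * cnj (FT f \<xi>)"
        by (simp add: g_def algebra_simps)
      moreover have "\<bar>abel (1 / real (Suc n)) \<xi> - 1\<bar> \<le> 1"
        using abel_bounds[of "1 / real (Suc n)" \<xi>] by simp
      ultimately show "cmod (g n \<xi> - cnj (FT f \<xi>)) \<le> cmod (cnj (FT f \<xi>))"
        by (simp only: norm_mult norm_of_real) (simp add: mult_left_le_one_le)
    qed
  qed
  then have "(\<lambda>n. fourier (abs_L2 (g n))) \<longlonglongrightarrow> fourier (abs_L2 (\<lambda>\<xi>. cnj (FT f \<xi>)))"
    by (rule tendsto_fourier)
  also have "abs_L2 (\<lambda>\<xi>. cnj (FT f \<xi>)) = cnj_L2 (fourier (abs_L2 f))"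
    by (simp add: fourier_eq_FT[OF f sq] cnj_L2_abs FT_square_integrable f sq)
  finally have lim: "(\<lambda>n. fourier (abs_L2 (g n))) \<longlonglongrightarrow> fourier (cnj_L2 (fourier (abs_L2 f)))" .
  have "fourier (cnj_L2 (fourier (abs_L2 f))) - (2 * pi) *\<^sub>C cnj_L2 (abs_L2 f) = 0"
  proof (rule L2_eq_zeroI)
    fix a b :: real
    let ?I = "abs_L2 (indicator {a..b})"
    show "cinner (fourier (cnj_L2 (fourier (abs_L2 f))) - (2 * pi) *\<^sub>C cnj_L2 (abs_L2 f)) ?I = 0"
    proof (cases "a \<le> b")
      case True
      have SF: "square_integrable (FT (g n))" for n by (rule FT_square_integrable[OF g Sg])
      have "cinner (fourier (abs_L2 (g n))) ?I = cnj (LINT x:{a..b}|lborel. poisson_int (1 / real (Suc n)) f x)" for n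
      proof -
        have "cinner (fourier (abs_L2 (g n))) ?I = (LINT x:{a..b}|lborel. FT (g n) x)"
          unfolding fourier_eq_FT[OF g Sg] by (rule set_integral_eq_cinner(2)[OF SF, symmetric])
        also have "FT (g n) = (\<lambda>x. cnj (poisson_int (1 / real (Suc n)) f x))"
          unfolding g_def by (rule ext, rule abel_FT[OF _ f]) simp
        finally show ?thesis
          by (simp add: set_lebesgue_integral_def scaleR_conv_of_real flip: Bochner_Integration.integral_cnj)
      qed
      then have "(\<lambda>n. cinner (fourier (abs_L2 (g n))) ?I) \<longlonglongrightarrow> cnj (2 * pi * (LINT x:{a..b}|lborel. f x))"
        using tendsto_cnj[OF poisson_int_interval_limit[OF True f]] by simp
      then have "cinner (fourier (cnj_L2 (fourier (abs_L2 f)))) ?I = cnj (2 * pi * (LINT x:{a..b}|lborel. f x))"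
        using tendsto_cinner_left[OF lim, of ?I] LIMSEQ_unique by blast
      also have "\<dots> = 2 * pi * (LINT x:{a..b}|lborel. cnj (f x))"
        by (simp add: set_lebesgue_integral_def scaleR_conv_of_real flip: Bochner_Integration.integral_cnj)
      also have "\<dots> = cinner ((2 * pi) *\<^sub>C cnj_L2 (abs_L2 f)) ?I"
        by (simp add: cinner_scaleC_left cnj_L2_abs sq set_integral_eq_cinner(2)[OF square_integrable_cnj[OF sq]])
      finally show ?thesis by (simp add: cinner_diff_left)
    next
      case False
      then have "indicator {a..b} = (\<lambda>x. 0 :: complex)" by (auto simp: indicator_def)
      then show ?thesis by (simp add: abs_L2_zero)
    qed
  qed
  then show ?thesis by simp
qed

theorem fourier_inversion: "fourier (cnj_L2 (fourier u)) = (2 * pi) *\<^sub>C cnj_L2 u"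
proof -
  obtain f where f: "square_integrable f" "u = abs_L2 f" by (metis L2_cases)
  note lim = truncate_tendsto[OF f(1)]
  have "((\<lambda>N. fourier (cnj_L2 (fourier (abs_L2 (truncate N f))))) \<longlongrightarrow> fourier (cnj_L2 (fourier u))) at_top"
    unfolding f(2) by (intro tendsto_fourier tendsto_cnj_L2 lim)
  moreover have "((\<lambda>N. fourier (cnj_L2 (fourier (abs_L2 (truncate N f))))) \<longlongrightarrow> (2 * pi) *\<^sub>C cnj_L2 u) at_top"
    unfolding fourier_inversion_integrable[OF truncate_square_integrable(2,1)[OF f(1)]] f(2)
    by (intro tendsto_scaleC tendsto_cnj_L2 lim)
  ultimately show ?thesis by (rule tendsto_unique[OF trivial_limit_at_top_linorder])
qed

text \<open>Inversion composes two transforms into \<open>2 * pi\<close> times a conjugation, so a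
  strict inequality in one of the two bounds by \<open>sqrt (2 * pi)\<close> is impossible.\<close>

theorem norm_fourier: "norm (fourier u) = sqrt (2 * pi) * norm u"
proof (rule antisym[OF fourier_norm_le])
  have "2 * pi * norm u = norm (fourier (cnj_L2 (fourier u)))"
    by (simp add: fourier_inversion norm_scaleC)
  also have "\<dots> \<le> sqrt (2 * pi) * norm (fourier u)"
    using fourier_norm_le[of "cnj_L2 (fourier u)"] by simp
  finally have "sqrt (2 * pi) * (sqrt (2 * pi) * norm u) \<le> sqrt (2 * pi) * norm (fourier u)"
    by (simp add: mult.assoc[symmetric] del: real_sqrt_mult)
  then show "sqrt (2 * pi) * norm u \<le> norm (fourier u)"
    by (rule mult_left_le_imp_le) simp
qed

theorem parseval: "cinner (fourier u) (fourier v) = 2 * pi * cinner u v"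
proof -
  have Re: "Re (cinner (fourier u) (fourier v)) = 2 * pi * Re (cinner u v)" for u v
  proof -
    have "(norm (fourier (u + v)))\<^sup>2 = 2 * pi * (norm (u + v))\<^sup>2"
      by (simp add: norm_fourier power_mult_distrib)
    then show ?thesis
      by (simp add: fourier_add norm_add_square_L2 norm_fourier power_mult_distrib algebra_simps)
  qed
  \<comment> \<open>Polarization gave the real part; the imaginary part of a number is the real part
    of \<open>- \<i>\<close> times it.\<close>
  have "Im (cinner (fourier u) (fourier v)) = 2 * pi * Im (cinner u v)"
    using Re[of "(- \<i>) *\<^sub>C u" v] by (simp add: fourier_scaleC cinner_scaleC_left del: complex_vector.scale_minus_left)
  then show ?thesis using Re[of u v] by (simp add: complex_eq_iff)
qed

definition inv_fourier :: "L2 \<Rightarrow> L2" where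
  "inv_fourier v = complex_of_real (1 / (2 * pi)) *\<^sub>C cnj_L2 (fourier (cnj_L2 v))"

lemma fourier_inv_fourier [simp]: "fourier (inv_fourier v) = v"
  using fourier_inversion[of "cnj_L2 v"]
  by (simp add: inv_fourier_def fourier_scaleC scaleC_scaleC scaleC_one)

lemma fourier_inject [simp]: "fourier u = fourier v \<longleftrightarrow> u = v"
  using norm_fourier[of "u - v"] by (auto simp: fourier_diff)

lemma inv_fourier_fourier [simp]: "inv_fourier (fourier u) = u"
  using fourier_inv_fourier[of "fourier u"] by (simp only: fourier_inject)

section \<open>Bounded multipliers\<close>

definition bounded_multiplier :: "(real \<Rightarrow> complex) \<Rightarrow> bool" where
  "bounded_multiplier b \<longleftrightarrow> b \<in> borel_measurable borel \<and> (\<exists>C. \<forall>x. cmod (b x) \<le> C)"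

lemma bounded_multiplierI:
  "b \<in> borel_measurable borel \<Longrightarrow> (\<And>x. cmod (b x) \<le> C) \<Longrightarrow> bounded_multiplier b"
  by (auto simp: bounded_multiplier_def)

lemma bounded_multiplier_const [simp]: "bounded_multiplier (\<lambda>x. c)"
  by (rule bounded_multiplierI[where C = "cmod c"]) auto

lemma bounded_multiplier_add:
  assumes "bounded_multiplier b" "bounded_multiplier c"
  shows "bounded_multiplier (\<lambda>x. b x + c x)"
proof -
  obtain B C where *: "\<And>x. cmod (b x) \<le> B" "\<And>x. cmod (c x) \<le> C"
    using assms by (auto simp: bounded_multiplier_def)
  show ?thesis
    by (rule bounded_multiplierI[where C = "B + C"])
      (use assms * in \<open>auto simp: bounded_multiplier_def intro!: norm_triangle_le add_mono\<close>)
qed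

lemma bounded_multiplier_mult:
  assumes "bounded_multiplier b" "bounded_multiplier c"
  shows "bounded_multiplier (\<lambda>x. b x * c x)"
proof -
  obtain B C where *: "\<And>x. cmod (b x) \<le> B" "\<And>x. cmod (c x) \<le> C"
    using assms by (auto simp: bounded_multiplier_def)
  have "cmod (b x * c x) \<le> B * C" for x
    unfolding norm_mult by (rule mult_mono[OF *]) (use order_trans[OF norm_ge_zero *(1)] in auto)
  then show ?thesis
    by (intro bounded_multiplierI[where C = "B * C"]) (use assms in \<open>auto simp: bounded_multiplier_def\<close>)
qed

lemma bounded_multiplier_cmult: "bounded_multiplier b \<Longrightarrow> bounded_multiplier (\<lambda>x. c * b x)"
  by (intro bounded_multiplier_mult) auto

lemma bounded_multiplier_power: "bounded_multiplier b \<Longrightarrow> bounded_multiplier (\<lambda>x. b x ^ n)"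
  by (induction n) (auto intro!: bounded_multiplier_mult)

lemma bounded_multiplier_cnj: "bounded_multiplier b \<Longrightarrow> bounded_multiplier (\<lambda>x. cnj (b x))"
  by (auto simp: bounded_multiplier_def)

lemma square_integrable_multiplier:
  "bounded_multiplier b \<Longrightarrow> square_integrable f \<Longrightarrow> square_integrable (\<lambda>x. b x * f x)"
  by (auto simp: bounded_multiplier_def intro: square_integrable_mult_bounded)

text \<open>Total in \<open>b\<close>, but meaningful for bounded multipliers: an unbounded factor
  can leave the square-integrable functions, where \<open>abs_L2\<close> has no content.\<close>

definition mul_L2 :: "(real \<Rightarrow> complex) \<Rightarrow> L2 \<Rightarrow> L2" where
  "mul_L2 b u = abs_L2 (\<lambda>x. b x * rep_L2 u x)"

lemma mul_L2_abs:
  assumes "bounded_multiplier b" "square_integrable f"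
  shows "mul_L2 b (abs_L2 f) = abs_L2 (\<lambda>x. b x * f x)"
  unfolding mul_L2_def
  by (subst abs_L2_eq_iff) (use AE_rep_abs_L2[OF assms(2)] in
      \<open>auto intro!: square_integrable_multiplier square_integrable_rep_L2 assms\<close>)

lemma AE_rep_mul_L2:
  "bounded_multiplier b \<Longrightarrow> AE x in lborel. rep_L2 (mul_L2 b u) x = b x * rep_L2 u x"
  unfolding mul_L2_def
  by (rule AE_rep_abs_L2) (intro square_integrable_multiplier square_integrable_rep_L2)

lemma mul_L2_mul_L2:
  assumes "bounded_multiplier b" "bounded_multiplier c"
  shows "mul_L2 b (mul_L2 c u) = mul_L2 (\<lambda>x. b x * c x) u"
  unfolding mul_L2_def[of c] mul_L2_def[of "\<lambda>x. b x * c x"]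
  by (subst mul_L2_abs) (auto simp: mult.assoc intro!: assms square_integrable_multiplier square_integrable_rep_L2)

lemma mul_L2_plus_left:
  assumes "bounded_multiplier b" "bounded_multiplier c"
  shows "mul_L2 (\<lambda>x. b x + c x) u = mul_L2 b u + mul_L2 c u"
  unfolding mul_L2_def distrib_right
  by (rule abs_L2_add) (auto intro!: assms square_integrable_multiplier square_integrable_rep_L2)

lemma mul_L2_cmult_left:
  assumes "bounded_multiplier b"
  shows "mul_L2 (\<lambda>x. c * b x) u = c *\<^sub>C mul_L2 b u"
  unfolding mul_L2_def mult.assoc
  by (rule abs_L2_scaleC) (auto intro!: assms square_integrable_multiplier square_integrable_rep_L2)

lemma mul_L2_diff_left:
  assumes "bounded_multiplier b" "bounded_multiplier c"
  shows "mul_L2 (\<lambda>x. b x - c x) u = mul_L2 b u - mul_L2 c u"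
  unfolding mul_L2_def left_diff_distrib
  by (rule abs_L2_diff) (auto intro!: assms square_integrable_multiplier square_integrable_rep_L2)

lemma mul_L2_const: "mul_L2 (\<lambda>x. c) u = c *\<^sub>C u"
  unfolding mul_L2_def by (simp add: abs_L2_scaleC square_integrable_rep_L2)

lemma mul_L2_one [simp]: "mul_L2 (\<lambda>x. 1) u = u"
  by (simp add: mul_L2_const scaleC_one)

lemma mul_L2_add:
  assumes "bounded_multiplier b"
  shows "mul_L2 b (u + v) = mul_L2 b u + mul_L2 b v"
proof -
  obtain f g where *: "square_integrable f" "square_integrable g" "u = abs_L2 f" "v = abs_L2 g"
    by (metis L2_cases)
  then show ?thesis
    using assms by (simp add: abs_L2_add[symmetric] mul_L2_abs square_integrable_multiplier square_integrable_add distrib_left)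
qed

lemma mul_L2_scaleC:
  assumes "bounded_multiplier b"
  shows "mul_L2 b (c *\<^sub>C u) = c *\<^sub>C mul_L2 b u"
  using mul_L2_mul_L2[OF assms, of "\<lambda>x. c" u] mul_L2_cmult_left[OF assms, of c u]
  by (simp add: mul_L2_const mult.commute)

lemma mul_L2_minus:
  assumes "bounded_multiplier b"
  shows "mul_L2 b (- u) = - mul_L2 b u"
  using mul_L2_scaleC[OF assms, of "-1" u] by (simp add: scaleC_minus1)

lemma mul_L2_diff:
  assumes "bounded_multiplier b"
  shows "mul_L2 b (u - v) = mul_L2 b u - mul_L2 b v"
  using mul_L2_add[OF assms, of u "-v"] by (simp add: mul_L2_minus[OF assms])

lemma mul_L2_zero [simp]: "bounded_multiplier b \<Longrightarrow> mul_L2 b 0 = 0"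
  using mul_L2_diff[of b 0 0] by simp

lemma cinner_mul_L2:
  assumes "bounded_multiplier b"
  shows "cinner (mul_L2 b u) v = cinner u (mul_L2 (\<lambda>x. cnj (b x)) v)"
proof -
  obtain f g where *: "square_integrable f" "square_integrable g" "u = abs_L2 f" "v = abs_L2 g"
    by (metis L2_cases)
  then show ?thesis
    using assms bounded_multiplier_cnj[OF assms]
    by (simp add: mul_L2_abs cinner_abs square_integrable_multiplier) (simp add: mult_ac)
qed

section \<open>Convolution form of multipliers\<close>

lemma square_integrable_of_bounded:
  assumes "integrable lborel f" "\<And>x. cmod (f x) \<le> C"
  shows "square_integrable f"
proof -
  have [measurable]: "f \<in> borel_measurable borel"
    using assms(1) by (simp add: borel_measurable_integrable)
  have "integrable lborel (\<lambda>x. (cmod (f x))\<^sup>2)"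
  proof (rule integrable_dominated)
    show "integrable lborel (\<lambda>x. C * cmod (f x))" using assms(1) by (intro integrable_mult_right integrable_norm)
    show "(cmod (f x))\<^sup>2 \<le> C * cmod (f x)" for x
      unfolding power2_eq_square by (rule mult_right_mono[OF assms(2)]) simp
  qed simp_all
  then show ?thesis by (simp add: square_integrable_def)
qed

lemma square_integrable_shift:
  assumes "square_integrable k"
  shows "square_integrable (\<lambda>x. k (x - a))"
proof -
  have [measurable]: "k \<in> borel_measurable borel" using assms by measurable
  have "(\<lambda>x. k (x - a)) \<in> borel_measurable borel" by measurable
  then show ?thesis
    using lborel_integrable_real_affine[OF square_integrable_norm_square[OF assms], of 1 "- a"]
    by (simp add: square_integrable_def)
qed

text \<open>Explicit integrals lead from half-line exponentials to rational functions. For a real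
  kernel, inversion turns each of them around into the transform of a rational function.\<close>

lemma fourier_cnj_FT:
  assumes "integrable lborel k" "square_integrable k" "\<And>x. cnj (k x) = k x"
  shows "fourier (abs_L2 (\<lambda>x. cnj (FT k x))) = (2 * pi) *\<^sub>C abs_L2 k"
  using fourier_inversion[of "abs_L2 k"] assms
  by (simp add: fourier_eq_FT cnj_L2_abs FT_square_integrable)

text \<open>Parseval applied to \<open>u\<close> and a modulation of \<open>\<F>k\<close>: the transform of the product is an
  absolutely convergent integral, so no convolution theorem is needed.\<close>

lemma fourier_mul_FT:
  assumes k: "integrable lborel k" "square_integrable k" "\<And>x. cnj (k x) = k x"
  shows "square_integrable (\<lambda>\<xi>. LINT \<eta>|lborel. rep_L2 (fourier u) \<eta> * k (\<eta> - \<xi>))"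
    "fourier (mul_L2 (FT k) u) = abs_L2 (\<lambda>\<xi>. LINT \<eta>|lborel. rep_L2 (fourier u) \<eta> * k (\<eta> - \<xi>))"
proof -
  have km [measurable]: "k \<in> borel_measurable borel" using k(2) by measurable
  define f where "f x = FT k x * rep_L2 u x" for x
  have bm: "bounded_multiplier (FT k)"
    by (rule bounded_multiplierI[OF _ FT_bound[OF k(1)]]) measurable
  have SFk: "square_integrable (FT k)" by (rule FT_square_integrable[OF k(1,2)])
  have Sf: "square_integrable f"
    unfolding f_def by (rule square_integrable_multiplier[OF bm square_integrable_rep_L2])
  have f: "integrable lborel f"
    unfolding f_def by (rule square_integrable_product[OF SFk square_integrable_rep_L2])
  have shift: "integrable lborel (\<lambda>x. k (x - \<xi>))" "square_integrable (\<lambda>x. k (x - \<xi>))" for \<xi>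
    using lborel_integrable_real_affine[OF k(1), of 1 "-\<xi>"] square_integrable_shift[OF k(2)] by simp_all
  have "FT f \<xi> = (LINT \<eta>|lborel. rep_L2 (fourier u) \<eta> * k (\<eta> - \<xi>))" for \<xi>
  proof -
    define q where "q x = cnj (FT (\<lambda>\<eta>. k (\<eta> - \<xi>)) x)" for x
    have Sq: "square_integrable q"
      unfolding q_def by (intro square_integrable_cnj FT_square_integrable shift)
    have "FT f \<xi> = (LINT x|lborel. rep_L2 u x * cnj (q x))"
      unfolding FT_def[of f] f_def q_def FT_shift
      by (rule Bochner_Integration.integral_cong) (simp_all add: mult_ac)
    also have "\<dots> = cinner u (abs_L2 q)"
      using cinner_abs[OF square_integrable_rep_L2[of u] Sq] by simp
    also have "\<dots> = 1 / (2 * pi) * cinner (fourier u) (fourier (abs_L2 q))"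
      by (simp add: parseval)
    also have "fourier (abs_L2 q) = (2 * pi) *\<^sub>C abs_L2 (\<lambda>\<eta>. k (\<eta> - \<xi>))"
      unfolding q_def by (rule fourier_cnj_FT[OF shift]) (simp add: k(3))
    also have "1 / (2 * pi) * cinner (fourier u) ((2 * pi) *\<^sub>C abs_L2 (\<lambda>\<eta>. k (\<eta> - \<xi>))) =
        cinner (abs_L2 (rep_L2 (fourier u))) (abs_L2 (\<lambda>\<eta>. k (\<eta> - \<xi>)))"
      by (simp add: cinner_scaleC_right)
    also have "\<dots> = (LINT \<eta>|lborel. rep_L2 (fourier u) \<eta> * k (\<eta> - \<xi>))"
      by (simp only: cinner_abs[OF square_integrable_rep_L2 shift(2)] k(3))
    finally show ?thesis .
  qed
  then have eq: "FT f = (\<lambda>\<xi>. LINT \<eta>|lborel. rep_L2 (fourier u) \<eta> * k (\<eta> - \<xi>))" by blast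
  show "square_integrable (\<lambda>\<xi>. LINT \<eta>|lborel. rep_L2 (fourier u) \<eta> * k (\<eta> - \<xi>))"
    unfolding eq[symmetric] by (rule FT_square_integrable[OF f Sf])
  show "fourier (mul_L2 (FT k) u) = abs_L2 (\<lambda>\<xi>. LINT \<eta>|lborel. rep_L2 (fourier u) \<eta> * k (\<eta> - \<xi>))"
    unfolding eq[symmetric] using fourier_eq_FT[OF f Sf] by (simp add: mul_L2_def f_def[abs_def])
qed

section \<open>The rational functions and their transforms\<close>

text \<open>Throughout, the sign \<open>s = \<plusminus>1\<close> selects the upper or the lower half-plane; \<open>zeta s\<close> is the Cayley
  transform \<open>(x - \<i>)/(x + \<i>)\<close> for \<open>s = 1\<close> and its conjugate for \<open>s = -1\<close>.\<close>

definition rho :: "real \<Rightarrow> real \<Rightarrow> complex" where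
  "rho s x = 1 / (1 - \<i> * of_real (s * x))"

definition zeta :: "real \<Rightarrow> real \<Rightarrow> complex" where
  "zeta s x = 1 - 2 * rho s x"

text \<open>The modulus of the logarithmic derivative of \<open>zeta s\<close>, and at the same time
  the potential of \<open>L_plus\<close> for \<open>m = 1\<close>.\<close>

definition omega :: "real \<Rightarrow> complex" where
  "omega x = of_real (2 / (1 + x\<^sup>2))"

text \<open>Up to the factor \<open>2 * pi\<close> this is the transform of \<open>rho s\<close>;
  its support shows that \<open>rho s\<close> belongs to \<open>hardy s\<close>.\<close>

definition half_exp :: "real \<Rightarrow> real \<Rightarrow> real" where
  "half_exp s \<xi> = (if s * \<xi> > 0 then exp (- \<bar>\<xi>\<bar>) else 0)"

lemma rho_denom_nonzero: "1 - \<i> * complex_of_real t \<noteq> 0" "1 + \<i> * complex_of_real t \<noteq> 0"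
  by (auto simp: complex_eq_iff)

lemma rho_measurable [measurable]: "rho s \<in> borel_measurable borel"
  unfolding rho_def by measurable

lemma zeta_measurable [measurable]: "zeta s \<in> borel_measurable borel"
  unfolding zeta_def by measurable

lemma omega_measurable [measurable]: "omega \<in> borel_measurable borel"
  unfolding omega_def by measurable

lemma cnj_rho: "cnj (rho s x) = rho (- s) x"
  by (simp add: rho_def)

lemma cnj_zeta: "cnj (zeta s x) = zeta (- s) x"
  by (simp add: zeta_def cnj_rho)

lemma zeta_alt: "zeta s x = - (1 + \<i> * of_real (s * x)) / (1 - \<i> * of_real (s * x))"
  using rho_denom_nonzero(1)[of "s * x"] by (simp add: zeta_def rho_def divide_simps)

lemma zeta_zeta_minus [simp]: "zeta s x * zeta (- s) x = 1" "zeta (- s) x * zeta s x = 1"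
proof -
  have "zeta s x = - (1 + \<i> * of_real (s * x)) / (1 - \<i> * of_real (s * x))"
    "zeta (- s) x = - (1 - \<i> * of_real (s * x)) / (1 + \<i> * of_real (s * x))"
    by (simp_all add: zeta_alt)
  moreover have "(- b / a) * (- a / b) = 1" if "a \<noteq> 0" "b \<noteq> 0" for a b :: complex
    using that by simp
  ultimately show "zeta s x * zeta (- s) x = 1" using rho_denom_nonzero by metis
  then show "zeta (- s) x * zeta s x = 1" by (simp add: mult.commute)
qed

lemma cmod_zeta [simp]: "cmod (zeta s x) = 1"
proof -
  have "(cmod (zeta s x))\<^sup>2 = 1"
    using zeta_zeta_minus[of s x] unfolding cnj_zeta[symmetric]
    by (metis complex_norm_square of_real_eq_1_iff)
  then show ?thesis by (simp add: power2_eq_1_iff) (use norm_ge_zero[of "zeta s x"] in linarith)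
qed

lemma zeta_nonzero [simp]: "zeta s x \<noteq> 0"
  using cmod_zeta[of s x] by (metis norm_zero zero_neq_one)

lemma cmod_rho_le: "cmod (rho s x) \<le> 1"
proof -
  have "2 * cmod (rho s x) = cmod (1 - zeta s x)" by (simp add: zeta_def norm_mult)
  also have "\<dots> \<le> 2" using norm_triangle_ineq4[of 1 "zeta s x"] by simp
  finally show ?thesis by simp
qed

text \<open>The bridge between the two half-planes: dividing \<open>rho 1\<close> by
  \<open>zeta 1\<close> crosses over to \<open>- rho (- 1)\<close>, which makes a single two-sided
  sequence of basis vectors possible.\<close>

lemma zeta_rho_minus: "zeta s x * rho (- s) x = - rho s x"
  using rho_denom_nonzero[of "s * x"] by (simp add: zeta_alt rho_def divide_simps)

lemma omega_eq_rho:
  assumes "s = 1 \<or> s = -1"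
  shows "omega x = 2 * rho s x * rho (- s) x"
proof -
  have "(1 - \<i> * complex_of_real (s * x)) * (1 + \<i> * complex_of_real (s * x)) = of_real (1 + x\<^sup>2)"
    using assms by (auto simp: algebra_simps power2_eq_square)
  then show ?thesis
    by (simp add: omega_def rho_def del: of_real_mult of_real_add)
qed

text \<open>Both sides are the derivative of \<open>zeta s\<close> up to the factor
  \<open>\<i> * s\<close>, because \<open>zeta s = 1 - 2 * rho s\<close> and the derivative of
  \<open>rho s\<close> is \<open>\<i> * s\<close> times its square.\<close>

lemma omega_zeta:
  assumes "s = 1 \<or> s = -1"
  shows "omega x * zeta s x = - 2 * (rho s x)\<^sup>2"
  using zeta_rho_minus[of s x] by (simp add: omega_eq_rho[OF assms] power2_eq_square mult_ac)

lemma bounded_multiplier_rho [simp]: "bounded_multiplier (rho s)"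
  by (rule bounded_multiplierI[OF rho_measurable cmod_rho_le])

lemma bounded_multiplier_zeta [simp]: "bounded_multiplier (zeta s)"
  by (rule bounded_multiplierI[where C = 1]) auto

lemma bounded_multiplier_omega [simp]: "bounded_multiplier omega"
proof -
  have eq: "omega = (\<lambda>x. 2 * (rho 1 x * rho (- 1) x))" using omega_eq_rho[of 1] by (auto simp: mult.assoc)
  show ?thesis
    unfolding eq by (intro bounded_multiplier_cmult bounded_multiplier_mult bounded_multiplier_rho)
qed

lemma bounded_multiplier_rho_square [simp]: "bounded_multiplier (\<lambda>x. (rho s x)\<^sup>2)"
  by (rule bounded_multiplier_power) simp

lemma bounded_multiplier_zeta_power [simp]: "bounded_multiplier (\<lambda>x. zeta s x ^ n)"
  by (rule bounded_multiplier_power) simp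

lemma half_exp_minus: "half_exp (- s) \<xi> = half_exp s (- \<xi>)"
  by (simp add: half_exp_def)

lemma half_exp_measurable [measurable]: "half_exp s \<in> borel_measurable borel"
  unfolding half_exp_def by measurable

lemma half_exp_one: "complex_of_real (half_exp 1 \<xi>) = indicator {0<..} \<xi> * exp (- (of_real 1 * of_real \<xi>))"
  by (simp add: half_exp_def indicator_def exp_of_real[symmetric])

lemma half_exp_bounds: "0 \<le> half_exp s \<xi>" "half_exp s \<xi> \<le> 1" "\<bar>\<xi>\<bar> * half_exp s \<xi> \<le> 2"
proof -
  show "0 \<le> half_exp s \<xi>" "half_exp s \<xi> \<le> 1" by (simp_all add: half_exp_def)
  have "\<bar>\<xi>\<bar> * exp (- (1 * \<bar>\<xi>\<bar>)) \<le> 2 / 1 * exp (- (1 / 2 * \<bar>\<xi>\<bar>))"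
    by (rule times_exp_le) auto
  also have "\<dots> \<le> 2" by simp
  finally show "\<bar>\<xi>\<bar> * half_exp s \<xi> \<le> 2" by (simp add: half_exp_def)
qed

lemma half_exp_transform:
  assumes s: "s = 1 \<or> s = -1"
  shows "integrable lborel (\<lambda>\<xi>. complex_of_real (half_exp s \<xi>))"
    "square_integrable (\<lambda>\<xi>. complex_of_real (half_exp s \<xi>))"
    "FT (\<lambda>\<xi>. complex_of_real (half_exp s \<xi>)) t = rho (- s) t"
proof -
  have i1: "integrable lborel (\<lambda>\<xi>. complex_of_real (half_exp 1 \<xi>))"
    using integral_exp_halfline(1)[of 1] by (simp add: half_exp_one)
  have t1: "FT (\<lambda>\<xi>. complex_of_real (half_exp 1 \<xi>)) t = 1 / (1 + \<i> * of_real t)" for t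
    unfolding half_exp_one using FT_exp_halfline[of 1 t] by simp
  show i: "integrable lborel (\<lambda>\<xi>. complex_of_real (half_exp s \<xi>))"
    using s i1 integrable_reflect[OF i1] by (auto simp: half_exp_minus)
  show "square_integrable (\<lambda>\<xi>. complex_of_real (half_exp s \<xi>))"
    by (rule square_integrable_of_bounded[OF i, where C = 1]) (use half_exp_bounds[of s] in auto)
  show "FT (\<lambda>\<xi>. complex_of_real (half_exp s \<xi>)) t = rho (- s) t"
    using s t1 FT_reflect[of "\<lambda>\<xi>. complex_of_real (half_exp 1 \<xi>)" t] by (auto simp: half_exp_minus rho_def)
qed

lemma half_exp2_transform:
  assumes s: "s = 1 \<or> s = -1"
  shows "integrable lborel (\<lambda>\<xi>. complex_of_real (\<bar>\<xi>\<bar> * half_exp s \<xi>))"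
    "square_integrable (\<lambda>\<xi>. complex_of_real (\<bar>\<xi>\<bar> * half_exp s \<xi>))"
    "FT (\<lambda>\<xi>. complex_of_real (\<bar>\<xi>\<bar> * half_exp s \<xi>)) t = (rho (- s) t)\<^sup>2"
proof -
  let ?k = "\<lambda>s \<xi>. complex_of_real (\<bar>\<xi>\<bar> * half_exp s \<xi>)"
  have eq: "?k 1 \<xi> = indicator {0<..} \<xi> * (of_real \<xi> * exp (- (1 * of_real \<xi>)))" for \<xi>
    by (simp add: half_exp_def indicator_def exp_of_real[symmetric])
  have i1: "integrable lborel (?k 1)"
    unfolding eq by (rule integral_times_exp_halfline(1)) simp
  have t1: "FT (?k 1) t = (1 / (1 + \<i> * of_real t))\<^sup>2" for t
  proof -
    have "FT (?k 1) t = (LINT \<xi>|lborel. indicator {0<..} \<xi> * (of_real \<xi> * exp (- ((1 + \<i> * of_real t) * of_real \<xi>))))"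
      unfolding FT_def eq
      by (rule Bochner_Integration.integral_cong) (simp_all add: algebra_simps flip: exp_add)
    also have "\<dots> = 1 / (1 + \<i> * of_real t)\<^sup>2"
      by (rule integral_times_exp_halfline(2)) simp
    finally show ?thesis by (simp add: power_divide)
  qed
  have m: "?k (- 1) = (\<lambda>\<xi>. ?k 1 (- \<xi>))" by (simp add: half_exp_minus)
  show i: "integrable lborel (?k s)"
    using s i1 integrable_reflect[OF i1] m by auto
  show "square_integrable (?k s)"
    by (rule square_integrable_of_bounded[OF i, where C = 2])
      (simp only: norm_of_real abs_mult abs_abs abs_of_nonneg[OF half_exp_bounds(1)] half_exp_bounds(3))
  show "FT (?k s) t = (rho (- s) t)\<^sup>2"
    using s t1 FT_reflect[of "?k 1" t] m by (auto simp: rho_def)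
qed

lemma square_integrable_rho:
  assumes s: "s = 1 \<or> s = -1" shows "square_integrable (rho s)"
proof -
  have s': "- s = 1 \<or> - s = -1" using s by auto
  have "FT (\<lambda>\<xi>. complex_of_real (half_exp (- s) \<xi>)) = rho s"
    using half_exp_transform(3)[OF s'] by auto
  then show ?thesis using FT_square_integrable(1)[OF half_exp_transform(1,2)[OF s']] by simp
qed

definition rho_L2 :: "real \<Rightarrow> L2" where "rho_L2 s = abs_L2 (rho s)"

lemma fourier_rho:
  assumes s: "s = 1 \<or> s = -1"
  shows "fourier (rho_L2 s) = (2 * pi) *\<^sub>C abs_L2 (\<lambda>\<xi>. of_real (half_exp s \<xi>))"
  using fourier_cnj_FT[OF half_exp_transform(1,2)[OF s]]
  by (simp add: half_exp_transform(3)[OF s] cnj_rho rho_L2_def cong: arg_cong[where f = fourier])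

lemma fourier_mul_rho:
  assumes s: "s = 1 \<or> s = -1"
  shows "square_integrable (\<lambda>\<xi>. LINT \<eta>|lborel. rep_L2 (fourier u) \<eta> * of_real (half_exp (- s) (\<eta> - \<xi>)))"
    "fourier (mul_L2 (rho s) u) = abs_L2 (\<lambda>\<xi>. LINT \<eta>|lborel. rep_L2 (fourier u) \<eta> * of_real (half_exp (- s) (\<eta> - \<xi>)))"
proof -
  have s': "- s = 1 \<or> - s = -1" using s by auto
  have "FT (\<lambda>\<xi>. complex_of_real (half_exp (- s) \<xi>)) = rho s"
    using half_exp_transform(3)[OF s'] by auto
  then show "square_integrable (\<lambda>\<xi>. LINT \<eta>|lborel. rep_L2 (fourier u) \<eta> * of_real (half_exp (- s) (\<eta> - \<xi>)))"
    "fourier (mul_L2 (rho s) u) = abs_L2 (\<lambda>\<xi>. LINT \<eta>|lborel. rep_L2 (fourier u) \<eta> * of_real (half_exp (- s) (\<eta> - \<xi>)))"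
    using fourier_mul_FT[OF half_exp_transform(1,2)[OF s'], of u] by simp_all
qed

lemma fourier_mul_rho_square:
  assumes s: "s = 1 \<or> s = -1"
  shows "square_integrable (\<lambda>\<xi>. LINT \<eta>|lborel. rep_L2 (fourier u) \<eta> * of_real (\<bar>\<eta> - \<xi>\<bar> * half_exp (- s) (\<eta> - \<xi>)))"
    "fourier (mul_L2 (\<lambda>x. (rho s x)\<^sup>2) u) =
      abs_L2 (\<lambda>\<xi>. LINT \<eta>|lborel. rep_L2 (fourier u) \<eta> * of_real (\<bar>\<eta> - \<xi>\<bar> * half_exp (- s) (\<eta> - \<xi>)))"
proof -
  have s': "- s = 1 \<or> - s = -1" using s by auto
  have "FT (\<lambda>\<xi>. complex_of_real (\<bar>\<xi>\<bar> * half_exp (- s) \<xi>)) = (\<lambda>x. (rho s x)\<^sup>2)"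
    using half_exp2_transform(3)[OF s'] by auto
  then show "square_integrable (\<lambda>\<xi>. LINT \<eta>|lborel. rep_L2 (fourier u) \<eta> * of_real (\<bar>\<eta> - \<xi>\<bar> * half_exp (- s) (\<eta> - \<xi>)))"
    "fourier (mul_L2 (\<lambda>x. (rho s x)\<^sup>2) u) =
      abs_L2 (\<lambda>\<xi>. LINT \<eta>|lborel. rep_L2 (fourier u) \<eta> * of_real (\<bar>\<eta> - \<xi>\<bar> * half_exp (- s) (\<eta> - \<xi>)))"
    using fourier_mul_FT[OF half_exp2_transform(1,2)[OF s'], of u] by simp_all
qed

lemma mul_zeta_eq: "mul_L2 (zeta s) u = u - 2 *\<^sub>C mul_L2 (rho s) u"
  unfolding zeta_def[abs_def]
  by (simp add: mul_L2_diff_left mul_L2_cmult_left bounded_multiplier_cmult)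

section \<open>Hardy spaces\<close>

text \<open>The Hardy space of the upper (\<open>s = 1\<close>) or lower half-plane in its
  Paley-Wiener description; holomorphic extensions never appear.\<close>

definition hardy :: "real \<Rightarrow> L2 set" where
  "hardy s = {u. AE \<xi> in lborel. s * \<xi> < 0 \<longrightarrow> rep_L2 (fourier u) \<xi> = 0}"

lemma hardyD: "u \<in> hardy s \<Longrightarrow> AE \<xi> in lborel. s * \<xi> < 0 \<longrightarrow> rep_L2 (fourier u) \<xi> = 0"
  by (simp add: hardy_def)

lemma hardyI:
  assumes "fourier u = abs_L2 f" "square_integrable f" "AE \<xi> in lborel. s * \<xi> < 0 \<longrightarrow> f \<xi> = 0"
  shows "u \<in> hardy s"
  unfolding hardy_def mem_Collect_eq assms(1)
  using AE_rep_abs_L2[OF assms(2)] assms(3) by eventually_elim simp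

lemma hardy_add: "u \<in> hardy s \<Longrightarrow> v \<in> hardy s \<Longrightarrow> u + v \<in> hardy s"
  unfolding hardy_def mem_Collect_eq fourier_add
  using AE_rep_L2_add[of "fourier u" "fourier v"] by (auto elim: eventually_elim2)

lemma hardy_scaleC: "u \<in> hardy s \<Longrightarrow> c *\<^sub>C u \<in> hardy s"
  unfolding hardy_def mem_Collect_eq fourier_scaleC
  using AE_rep_L2_scaleC[of c "fourier u"] by (auto elim: eventually_elim2)

lemma hardy_diff: "u \<in> hardy s \<Longrightarrow> v \<in> hardy s \<Longrightarrow> u - v \<in> hardy s"
  using hardy_add[of u s "- v"] hardy_scaleC[of v s "-1"] by (simp add: scaleC_minus1)

lemma rho_in_hardy: "s = 1 \<or> s = -1 \<Longrightarrow> rho_L2 s \<in> hardy s"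
  by (rule hardyI[where f = "\<lambda>\<xi>. (2 * pi) * of_real (half_exp s \<xi>)"])
    (simp_all add: fourier_rho abs_L2_scaleC half_exp_transform square_integrable_cmult, simp add: half_exp_def)

text \<open>On the Fourier side the value at \<open>\<xi>\<close> only sees \<open>\<eta>\<close>
  with \<open>s * \<eta> < s * \<xi>\<close>. For \<open>s * \<xi> < 0\<close> the transform of
  \<open>u\<close> vanishes there.\<close>

lemma hardy_mul_rho:
  assumes s: "s = 1 \<or> s = -1" and u: "u \<in> hardy s"
  shows "mul_L2 (rho s) u \<in> hardy s"
proof (rule hardyI[OF fourier_mul_rho(2,1)[OF s]], rule AE_I2, rule impI)
  fix \<xi> assume \<xi>: "s * \<xi> < 0"
  have "AE \<eta> in lborel. rep_L2 (fourier u) \<eta> * of_real (half_exp (- s) (\<eta> - \<xi>)) = 0"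
    using hardyD[OF u]
  proof eventually_elim
    fix \<eta> assume *: "s * \<eta> < 0 \<longrightarrow> rep_L2 (fourier u) \<eta> = 0"
    show "rep_L2 (fourier u) \<eta> * of_real (half_exp (- s) (\<eta> - \<xi>)) = 0"
      using * \<xi> by (auto simp: half_exp_def algebra_simps)
  qed
  then show "(LINT \<eta>|lborel. rep_L2 (fourier u) \<eta> * of_real (half_exp (- s) (\<eta> - \<xi>))) = 0"
    by (rule integral_eq_zero_AE)
qed

lemma hardy_mul_zeta:
  assumes s: "s = 1 \<or> s = -1" and u: "u \<in> hardy s"
  shows "mul_L2 (zeta s) u \<in> hardy s"
proof -
  show ?thesis
    unfolding mul_zeta_eq using u hardy_mul_rho[OF s u] by (simp add: hardy_diff hardy_scaleC)
qed

lemma cinner_rho: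
  assumes s: "s = 1 \<or> s = -1"
  shows "cinner u (rho_L2 s) = (LINT \<eta>|lborel. rep_L2 (fourier u) \<eta> * of_real (half_exp s \<eta>))"
proof -
  have "2 * pi * cinner u (rho_L2 s) = cinner (fourier u) (fourier (rho_L2 s))"
    by (simp add: parseval)
  also have "\<dots> = 2 * pi * cinner (abs_L2 (rep_L2 (fourier u))) (abs_L2 (\<lambda>\<xi>. of_real (half_exp s \<xi>)))"
    by (simp add: fourier_rho[OF s] cinner_scaleC_right)
  finally show ?thesis
    by (simp only: cinner_abs[OF square_integrable_rep_L2 half_exp_transform(2)[OF s]]) simp
qed

text \<open>\<open>rho (- s)\<close> has its pole at \<open>\<i> * s\<close>, on the wrong side. For
  \<open>s * \<xi> < 0\<close> the exponential factors as \<open>exp (s * \<xi>)\<close> times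
  \<open>half_exp s \<eta>\<close>, so the whole defect is a multiple of the pairing with
  \<open>rho_L2 s\<close>, that is of the value of \<open>u\<close> at the pole.\<close>

lemma hardy_mul_rho_minus:
  assumes s: "s = 1 \<or> s = -1" and u: "u \<in> hardy s" and orth: "cinner u (rho_L2 s) = 0"
  shows "mul_L2 (rho (- s)) u \<in> hardy s"
proof -
  have s': "- s = 1 \<or> - s = -1" using s by auto
  show ?thesis
  proof (rule hardyI[OF fourier_mul_rho(2,1)[OF s']], rule AE_I2, rule impI)
    fix \<xi> assume \<xi>: "s * \<xi> < 0"
    have "(LINT \<eta>|lborel. rep_L2 (fourier u) \<eta> * of_real (half_exp s (\<eta> - \<xi>))) =
        (LINT \<eta>|lborel. of_real (exp (s * \<xi>)) * (rep_L2 (fourier u) \<eta> * of_real (half_exp s \<eta>)))"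
    proof (rule integral_cong_AE)
      show "AE \<eta> in lborel. rep_L2 (fourier u) \<eta> * of_real (half_exp s (\<eta> - \<xi>)) =
          of_real (exp (s * \<xi>)) * (rep_L2 (fourier u) \<eta> * of_real (half_exp s \<eta>))"
        using hardyD[OF u] AE_lborel_singleton[of 0]
      proof eventually_elim
        fix \<eta> :: real assume *: "s * \<eta> < 0 \<longrightarrow> rep_L2 (fourier u) \<eta> = 0" "\<eta> \<noteq> 0"
        show "rep_L2 (fourier u) \<eta> * of_real (half_exp s (\<eta> - \<xi>)) =
          of_real (exp (s * \<xi>)) * (rep_L2 (fourier u) \<eta> * of_real (half_exp s \<eta>))"
        proof (cases "s * \<eta> < 0")
          case True then show ?thesis using * by simp
        next
          case False
          then have pos: "s * \<eta> > 0" using * s by auto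
          then have "s * (\<eta> - \<xi>) > 0" using \<xi> by (simp add: algebra_simps)
          moreover have "- \<bar>\<eta> - \<xi>\<bar> = s * \<xi> + - \<bar>\<eta>\<bar>" using s pos \<xi> by auto
          ultimately have "half_exp s (\<eta> - \<xi>) = exp (s * \<xi>) * half_exp s \<eta>"
            using pos by (simp add: half_exp_def exp_add[symmetric])
          then show ?thesis by simp
        qed
      qed
    qed measurable
    also have "\<dots> = 0"
      unfolding integral_mult_right_zero cinner_rho[OF s, symmetric] orth by simp
    finally show "(LINT \<eta>|lborel. rep_L2 (fourier u) \<eta> * of_real (half_exp (- (- s)) (\<eta> - \<xi>))) = 0" by simp
  qed
qed

lemma hardy_mul_zeta_minus:
  assumes s: "s = 1 \<or> s = -1" and u: "u \<in> hardy s" and orth: "cinner u (rho_L2 s) = 0"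
  shows "mul_L2 (zeta (- s)) u \<in> hardy s"
proof -
  show ?thesis
    unfolding mul_zeta_eq using u hardy_mul_rho_minus[OF s u orth] by (simp add: hardy_diff hardy_scaleC)
qed

lemma hardy_orthogonal:
  assumes s: "s = 1 \<or> s = -1" and u: "u \<in> hardy s" and v: "v \<in> hardy (- s)"
  shows "cinner u v = 0"
proof -
  have "cinner (fourier u) (fourier v) = 0"
    unfolding cinner_rep
  proof (rule integral_eq_zero_AE)
    show "AE x in lborel. rep_L2 (fourier u) x * cnj (rep_L2 (fourier v) x) = 0"
      using hardyD[OF u] hardyD[OF v] AE_lborel_singleton[of 0]
      by eventually_elim (use s in \<open>auto simp: not_less_iff_gr_or_eq\<close>)
  qed
  then show ?thesis by (simp add: parseval)
qed

section \<open>Orthogonal projections onto the two Hardy spaces\<close>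

definition half_proj :: "real \<Rightarrow> L2 \<Rightarrow> L2" where
  "half_proj s u = inv_fourier (mul_L2 (\<lambda>\<xi>. if s * \<xi> > 0 then 1 else 0) (fourier u))"

lemma bounded_multiplier_half [simp]: "bounded_multiplier (\<lambda>\<xi>. if s * \<xi> > 0 then 1 else 0)"
  by (rule bounded_multiplierI[where C = 1]) auto

lemma half_proj_in_hardy: "half_proj s u \<in> hardy s"
  unfolding hardy_def mem_Collect_eq half_proj_def fourier_inv_fourier
  using AE_rep_mul_L2[OF bounded_multiplier_half, of s "fourier u"] by eventually_elim auto

lemma half_proj_add: "half_proj s (u + v) = half_proj s u + half_proj s v"
proof -
  have "fourier (half_proj s (u + v)) = fourier (half_proj s u + half_proj s v)"
    by (simp add: half_proj_def fourier_add mul_L2_add)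
  then show ?thesis by (simp only: fourier_inject)
qed

lemma half_proj_scaleC: "half_proj s (c *\<^sub>C u) = c *\<^sub>C half_proj s u"
proof -
  have "fourier (half_proj s (c *\<^sub>C u)) = fourier (c *\<^sub>C half_proj s u)"
    by (simp add: half_proj_def fourier_scaleC mul_L2_scaleC)
  then show ?thesis by (simp only: fourier_inject)
qed

lemma half_proj_sum: "half_proj 1 u + half_proj (- 1) u = u"
proof -
  have "fourier (half_proj 1 u + half_proj (- 1) u) =
      mul_L2 (\<lambda>\<xi>. (if 1 * \<xi> > 0 then 1 else 0) + (if (- 1) * \<xi> > 0 then 1 else 0)) (fourier u)"
    unfolding half_proj_def fourier_add fourier_inv_fourier
    by (rule mul_L2_plus_left[symmetric]) (rule bounded_multiplier_half)+
  also have "\<dots> = abs_L2 (rep_L2 (fourier u))"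
    unfolding mul_L2_def
  proof (subst abs_L2_eq_iff)
    show "square_integrable (\<lambda>x. ((if 1 * x > 0 then 1 else 0) + (if (- 1) * x > 0 then 1 else 0)) * rep_L2 (fourier u) x)"
      by (rule square_integrable_multiplier[OF bounded_multiplier_add square_integrable_rep_L2])
        (rule bounded_multiplier_half)+
    show "AE x in lborel. ((if 1 * x > 0 then 1 else 0) + (if (- 1) * x > 0 then 1 else 0)) * rep_L2 (fourier u) x = rep_L2 (fourier u) x"
      using AE_lborel_singleton[of 0] by eventually_elim auto
  qed (auto intro: square_integrable_rep_L2)
  finally have "fourier (half_proj 1 u + half_proj (- 1) u) = fourier u" by simp
  then show ?thesis by (simp only: fourier_inject)
qed

section \<open>The Sobolev space and the derivative\<close>

lemma H1_iff: "u \<in> H1 \<longleftrightarrow> square_integrable (\<lambda>\<xi>. of_real \<xi> * rep_L2 (fourier u) \<xi>)"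
proof -
  have "bessel_weight_integral (fourier u) =
      (\<integral>\<^sup>+ \<xi>. ennreal ((1 + \<xi>\<^sup>2) * (cmod (rep_L2 (fourier u) \<xi>))\<^sup>2) \<partial>lborel)"
    using bessel_weight_integral.abs_eq[of "rep_L2 (fourier u)"] square_integrable_rep_L2[of "fourier u"]
    by (simp add: ae_eq_refl_iff)
  also have "\<dots> = (\<integral>\<^sup>+ \<xi>. ennreal ((cmod (rep_L2 (fourier u) \<xi>))\<^sup>2) + ennreal ((cmod (of_real \<xi> * rep_L2 (fourier u) \<xi>))\<^sup>2) \<partial>lborel)"
    by (intro nn_integral_cong)
      (simp add: norm_mult power_mult_distrib distrib_right ennreal_plus[symmetric] del: ennreal_plus)
  also have "\<dots> = (\<integral>\<^sup>+ \<xi>. ennreal ((cmod (rep_L2 (fourier u) \<xi>))\<^sup>2) \<partial>lborel) +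
      (\<integral>\<^sup>+ \<xi>. ennreal ((cmod (of_real \<xi> * rep_L2 (fourier u) \<xi>))\<^sup>2) \<partial>lborel)"
    by (rule nn_integral_add) measurable
  finally have "bessel_weight_integral (fourier u) =
      ennreal ((norm (fourier u))\<^sup>2) + (\<integral>\<^sup>+ \<xi>. ennreal ((cmod (of_real \<xi> * rep_L2 (fourier u) \<xi>))\<^sup>2) \<partial>lborel)"
    using norm_abs_L2_nn[OF square_integrable_rep_L2[of "fourier u"]] by simp
  then show ?thesis
    by (simp add: H1_def square_integrable_iff_nn)
qed

lemma H1I:
  assumes "fourier u = abs_L2 f" "square_integrable f" "square_integrable (\<lambda>\<xi>. of_real \<xi> * f \<xi>)"
  shows "u \<in> H1"
  unfolding H1_iff
proof (rule square_integrable_cong_AE[OF assms(3)])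
  show "AE x in lborel. complex_of_real x * f x = complex_of_real x * rep_L2 (fourier u) x"
    unfolding assms(1) using AE_rep_abs_L2[OF assms(2)] by eventually_elim simp
qed measurable

text \<open>The operator \<open>-\<i> d/dx\<close>. Unlike \<open>|nabla|\<close> it is a
  derivation, and on each Hardy space the two differ by a sign only.\<close>

definition D_op :: "L2 \<Rightarrow> L2" where
  "D_op u = inv_fourier (abs_L2 (\<lambda>\<xi>. of_real \<xi> * rep_L2 (fourier u) \<xi>))"

lemma fourier_D_op: "fourier (D_op u) = abs_L2 (\<lambda>\<xi>. of_real \<xi> * rep_L2 (fourier u) \<xi>)"
  by (simp add: D_op_def)

lemma AE_fourier_D_op:
  "u \<in> H1 \<Longrightarrow> AE \<xi> in lborel. rep_L2 (fourier (D_op u)) \<xi> = of_real \<xi> * rep_L2 (fourier u) \<xi>"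
  unfolding fourier_D_op H1_iff by (rule AE_rep_abs_L2)

lemma D_op_eqI:
  assumes "fourier u = abs_L2 f" "square_integrable f" "square_integrable (\<lambda>\<xi>. of_real \<xi> * f \<xi>)"
  shows "fourier (D_op u) = abs_L2 (\<lambda>\<xi>. of_real \<xi> * f \<xi>)"
  unfolding fourier_D_op
proof (subst abs_L2_eq_iff)
  show "square_integrable (\<lambda>\<xi>. of_real \<xi> * rep_L2 (fourier u) \<xi>)"
    using H1I[OF assms] by (simp add: H1_iff)
  show "AE x in lborel. complex_of_real x * rep_L2 (fourier u) x = complex_of_real x * f x"
    unfolding assms(1) using AE_rep_abs_L2[OF assms(2)] by eventually_elim simp
qed fact+

lemma H1_add:
  assumes "u \<in> H1" "v \<in> H1"
  shows "u + v \<in> H1" "D_op (u + v) = D_op u + D_op v"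
proof -
  let ?f = "\<lambda>\<xi>. rep_L2 (fourier u) \<xi> + rep_L2 (fourier v) \<xi>"
  have *: "fourier (u + v) = abs_L2 ?f"
    by (simp add: fourier_add abs_L2_add square_integrable_rep_L2)
  have S: "square_integrable ?f" by (intro square_integrable_add square_integrable_rep_L2)
  have S': "square_integrable (\<lambda>\<xi>. of_real \<xi> * ?f \<xi>)"
    using assms unfolding H1_iff distrib_left by (rule square_integrable_add)
  show "u + v \<in> H1" by (rule H1I[OF * S S'])
  have "fourier (D_op (u + v)) = fourier (D_op u + D_op v)"
    using assms unfolding D_op_eqI[OF * S S'] unfolding fourier_add[of "D_op u"] fourier_D_op distrib_left H1_iff by (rule abs_L2_add)
  then show "D_op (u + v) = D_op u + D_op v" by (simp only: fourier_inject)
qed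

lemma H1_scaleC:
  assumes "u \<in> H1"
  shows "c *\<^sub>C u \<in> H1" "D_op (c *\<^sub>C u) = c *\<^sub>C D_op u"
proof -
  let ?f = "\<lambda>\<xi>. c * rep_L2 (fourier u) \<xi>"
  have *: "fourier (c *\<^sub>C u) = abs_L2 ?f"
    by (simp add: fourier_scaleC abs_L2_scaleC square_integrable_rep_L2)
  have S: "square_integrable ?f" by (intro square_integrable_cmult square_integrable_rep_L2)
  have eq: "of_real \<xi> * ?f \<xi> = c * (of_real \<xi> * rep_L2 (fourier u) \<xi>)" for \<xi> by simp
  have S': "square_integrable (\<lambda>\<xi>. of_real \<xi> * ?f \<xi>)"
    using assms unfolding H1_iff eq by (rule square_integrable_cmult)
  show "c *\<^sub>C u \<in> H1" by (rule H1I[OF * S S'])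
  have "fourier (D_op (c *\<^sub>C u)) = fourier (c *\<^sub>C D_op u)"
    using assms unfolding D_op_eqI[OF * S S'] unfolding fourier_scaleC[of c "D_op u"] fourier_D_op H1_iff eq by (rule abs_L2_scaleC)
  then show "D_op (c *\<^sub>C u) = c *\<^sub>C D_op u" by (simp only: fourier_inject)
qed

lemma H1_minus: "u \<in> H1 \<Longrightarrow> - u \<in> H1"
  using H1_scaleC(1)[of u "-1"] by (simp add: scaleC_minus1)

lemma H1_diff: "u \<in> H1 \<Longrightarrow> v \<in> H1 \<Longrightarrow> u - v \<in> H1"
  using H1_add(1)[of u "- v"] H1_minus[of v] by simp

lemma H1_zero: "0 \<in> H1"
  using H1_scaleC(1)[of 0 0] by (simp add: H1_iff) (rule square_integrable_cong_AE[OF square_integrable_zero],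
     measurable, use AE_rep_L2_zero in \<open>auto elim: eventually_mono\<close>)

text \<open>The product rule read off from the convolution: write \<open>\<xi>\<close> as
  \<open>\<eta>\<close> plus \<open>\<xi> - \<eta>\<close>. The first part falls on
  \<open>u\<close>, the second on the kernel, where it produces the kernel of the square of
  \<open>rho s\<close>.\<close>

lemma H1_mul_rho:
  assumes s: "s = 1 \<or> s = -1" and u: "u \<in> H1"
  shows "mul_L2 (rho s) u \<in> H1"
    "D_op (mul_L2 (rho s) u) = mul_L2 (rho s) (D_op u) + complex_of_real s *\<^sub>C mul_L2 (\<lambda>x. (rho s x)\<^sup>2) u"
proof -
  define U where "U = rep_L2 (fourier u)"
  define G where "G \<xi> = (LINT \<eta>|lborel. U \<eta> * of_real (half_exp (- s) (\<eta> - \<xi>)))" for \<xi>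
  define G1 where "G1 \<xi> = (LINT \<eta>|lborel. rep_L2 (fourier (D_op u)) \<eta> * of_real (half_exp (- s) (\<eta> - \<xi>)))" for \<xi>
  define G2 where "G2 \<xi> = (LINT \<eta>|lborel. U \<eta> * of_real (\<bar>\<eta> - \<xi>\<bar> * half_exp (- s) (\<eta> - \<xi>)))" for \<xi>
  have s': "- s = 1 \<or> - s = -1" using s by auto
  note F = fourier_mul_rho[OF s, of u, folded U_def, folded G_def]
  note F1 = fourier_mul_rho[OF s, of "D_op u", folded G1_def]
  note F2 = fourier_mul_rho_square[OF s, of u, folded U_def, folded G2_def]
  have SU: "square_integrable U" unfolding U_def by (rule square_integrable_rep_L2)
  have eq: "of_real \<xi> * G \<xi> = G1 \<xi> + of_real s * G2 \<xi>" for \<xi>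
  proof -
    have i1: "integrable lborel (\<lambda>\<eta>. rep_L2 (fourier (D_op u)) \<eta> * of_real (half_exp (- s) (\<eta> - \<xi>)))"
      by (rule square_integrable_product[OF square_integrable_rep_L2 square_integrable_shift[OF half_exp_transform(2)[OF s']]])
    have i2: "integrable lborel (\<lambda>\<eta>. U \<eta> * of_real (\<bar>\<eta> - \<xi>\<bar> * half_exp (- s) (\<eta> - \<xi>)))"
      by (rule square_integrable_product[OF SU square_integrable_shift[OF half_exp2_transform(2)[OF s']]])
    have "of_real \<xi> * G \<xi> = (LINT \<eta>|lborel. of_real \<xi> * (U \<eta> * of_real (half_exp (- s) (\<eta> - \<xi>))))"
      unfolding G_def by (rule integral_mult_right_zero[symmetric])
    also have "\<dots> = (LINT \<eta>|lborel. rep_L2 (fourier (D_op u)) \<eta> * of_real (half_exp (- s) (\<eta> - \<xi>)) +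
        of_real s * (U \<eta> * of_real (\<bar>\<eta> - \<xi>\<bar> * half_exp (- s) (\<eta> - \<xi>))))"
    proof (rule integral_cong_AE)
      show "AE \<eta> in lborel. of_real \<xi> * (U \<eta> * of_real (half_exp (- s) (\<eta> - \<xi>))) =
          rep_L2 (fourier (D_op u)) \<eta> * of_real (half_exp (- s) (\<eta> - \<xi>)) +
          of_real s * (U \<eta> * of_real (\<bar>\<eta> - \<xi>\<bar> * half_exp (- s) (\<eta> - \<xi>)))"
        using AE_fourier_D_op[OF u]
      proof eventually_elim
        fix \<eta> assume *: "rep_L2 (fourier (D_op u)) \<eta> = of_real \<eta> * rep_L2 (fourier u) \<eta>"
        \<comment> \<open>The kernel lives where \<open>s * (\<eta> - \<xi>) < 0\<close>, and there
          \<open>s\<close> times the absolute value is \<open>\<xi> - \<eta>\<close>.\<close>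
        have "s * (\<bar>\<eta> - \<xi>\<bar> * half_exp (- s) (\<eta> - \<xi>)) = (\<xi> - \<eta>) * half_exp (- s) (\<eta> - \<xi>)"
          using s by (auto simp: half_exp_def)
        then have E: "of_real s * complex_of_real (\<bar>\<eta> - \<xi>\<bar> * half_exp (- s) (\<eta> - \<xi>)) =
            of_real ((\<xi> - \<eta>) * half_exp (- s) (\<eta> - \<xi>))"
          by (simp only: of_real_mult[symmetric])
        show "of_real \<xi> * (U \<eta> * of_real (half_exp (- s) (\<eta> - \<xi>))) =
          rep_L2 (fourier (D_op u)) \<eta> * of_real (half_exp (- s) (\<eta> - \<xi>)) +
          of_real s * (U \<eta> * of_real (\<bar>\<eta> - \<xi>\<bar> * half_exp (- s) (\<eta> - \<xi>)))"
          unfolding * U_def[symmetric] mult.left_commute[of "complex_of_real s" "U \<eta>"] E by (simp add: algebra_simps)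
      qed
    qed (unfold U_def, measurable)
    also have "\<dots> = G1 \<xi> + of_real s * G2 \<xi>"
      unfolding G1_def G2_def integral_mult_right_zero[symmetric]
      by (rule Bochner_Integration.integral_add[OF i1]) (intro integrable_mult_right i2)
    finally show ?thesis .
  qed
  have S': "square_integrable (\<lambda>\<xi>. of_real \<xi> * G \<xi>)"
    unfolding eq by (intro square_integrable_add square_integrable_cmult F1(1) F2(1))
  show "mul_L2 (rho s) u \<in> H1" by (rule H1I[OF F(2,1) S'])
  have "fourier (D_op (mul_L2 (rho s) u)) = abs_L2 (\<lambda>\<xi>. G1 \<xi> + of_real s * G2 \<xi>)"
    using D_op_eqI[OF F(2,1) S'] by (simp only: eq)
  also have "\<dots> = fourier (mul_L2 (rho s) (D_op u) + of_real s *\<^sub>C mul_L2 (\<lambda>x. (rho s x)\<^sup>2) u)"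
    by (simp add: abs_L2_add abs_L2_scaleC square_integrable_cmult F1 F2 fourier_add fourier_scaleC)
  finally show "D_op (mul_L2 (rho s) u) = mul_L2 (rho s) (D_op u) + complex_of_real s *\<^sub>C mul_L2 (\<lambda>x. (rho s x)\<^sup>2) u"
    by (simp only: fourier_inject)
qed

text \<open>The product rule again, with the derivative of \<open>zeta s\<close> rewritten by
  \<open>omega_zeta\<close>. Having \<open>zeta s\<close> itself in the correction term is what
  allows iteration to arbitrary powers.\<close>

lemma H1_mul_zeta:
  assumes s: "s = 1 \<or> s = -1" and u: "u \<in> H1"
  shows "mul_L2 (zeta s) u \<in> H1"
    "D_op (mul_L2 (zeta s) u) = mul_L2 (zeta s) (D_op u) + complex_of_real s *\<^sub>C mul_L2 omega (mul_L2 (zeta s) u)"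
proof -
  note R = H1_mul_rho[OF s u]
  show "mul_L2 (zeta s) u \<in> H1"
    unfolding mul_zeta_eq by (intro H1_diff u H1_scaleC R)
  have "mul_L2 (zeta s) v = v + (- 2) *\<^sub>C mul_L2 (rho s) v" for v
    by (simp add: mul_zeta_eq complex_vector.scale_minus_left)
  note eq = this
  have "D_op (mul_L2 (zeta s) u) = D_op u + (- 2) *\<^sub>C D_op (mul_L2 (rho s) u)"
    unfolding eq H1_add(2)[OF u H1_scaleC(1)[OF R(1)]] H1_scaleC(2)[OF R(1)] ..
  also have "\<dots> = mul_L2 (zeta s) (D_op u) + (of_real s * (- 2)) *\<^sub>C mul_L2 (\<lambda>x. (rho s x)\<^sup>2) u"
    unfolding R(2) eq by (simp only: scaleC_add_right scaleC_scaleC mult.commute add.assoc)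
  also have "(of_real s * (- 2)) *\<^sub>C mul_L2 (\<lambda>x. (rho s x)\<^sup>2) u = of_real s *\<^sub>C mul_L2 omega (mul_L2 (zeta s) u)"
    using mul_L2_cmult_left[OF bounded_multiplier_rho_square, of "- 2" s u]
    by (simp only: mul_L2_mul_L2[OF bounded_multiplier_omega bounded_multiplier_zeta] omega_zeta[OF s] scaleC_scaleC)
  finally show "D_op (mul_L2 (zeta s) u) = mul_L2 (zeta s) (D_op u) + complex_of_real s *\<^sub>C mul_L2 omega (mul_L2 (zeta s) u)" .
qed

abbreviation zeta_pow :: "real \<Rightarrow> nat \<Rightarrow> L2 \<Rightarrow> L2" where
  "zeta_pow s n \<equiv> mul_L2 (\<lambda>x. zeta s x ^ n)"

lemma zeta_pow_Suc: "zeta_pow s (Suc n) u = mul_L2 (zeta s) (zeta_pow s n u)"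
  by (simp add: mul_L2_mul_L2)

lemma hardy_zeta_pow:
  "s = 1 \<or> s = -1 \<Longrightarrow> u \<in> hardy s \<Longrightarrow> zeta_pow s n u \<in> hardy s"
  by (induction n) (simp_all add: zeta_pow_Suc hardy_mul_zeta del: power_Suc)

lemma H1_zeta_pow:
  assumes s: "s = 1 \<or> s = -1" and u: "u \<in> H1"
  shows "zeta_pow s n u \<in> H1 \<and>
    D_op (zeta_pow s n u) = zeta_pow s n (D_op u) + (of_real s * of_nat n) *\<^sub>C mul_L2 omega (zeta_pow s n u)"
proof (induction n)
  case 0 then show ?case using u by simp
next
  case (Suc n)
  note Z = H1_mul_zeta[OF s conjunct1[OF Suc.IH]]
  have comm: "mul_L2 (zeta s) (mul_L2 omega v) = mul_L2 omega (mul_L2 (zeta s) v)" for v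
    by (simp add: mul_L2_mul_L2 mult.commute)
  have "D_op (zeta_pow s (Suc n) u) = mul_L2 (zeta s) (zeta_pow s n (D_op u)) +
      (of_real s * of_nat n) *\<^sub>C mul_L2 omega (mul_L2 (zeta s) (zeta_pow s n u)) +
      of_real s *\<^sub>C mul_L2 omega (mul_L2 (zeta s) (zeta_pow s n u))"
    unfolding zeta_pow_Suc Z(2) Suc.IH[THEN conjunct2]
    by (simp add: mul_L2_add mul_L2_scaleC comm)
  also have "\<dots> = zeta_pow s (Suc n) (D_op u) + (of_real s * of_nat (Suc n)) *\<^sub>C mul_L2 omega (zeta_pow s (Suc n) u)"
    unfolding zeta_pow_Suc by (simp add: scaleC_add_left[symmetric] add.assoc distrib_left add.commute)
  finally show ?case using Z(1) by (simp add: zeta_pow_Suc del: power_Suc)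
qed

text \<open>Discharges the definite description in \<open>abs_nabla\<close>: the transform is a
  bijection, so the multiple of the transform has exactly one preimage.\<close>

lemma fourier_abs_nabla:
  assumes "u \<in> H1"
  shows "square_integrable (\<lambda>\<xi>. of_real \<bar>\<xi>\<bar> * rep_L2 (fourier u) \<xi>)"
    "fourier (abs_nabla u) = abs_L2 (\<lambda>\<xi>. of_real \<bar>\<xi>\<bar> * rep_L2 (fourier u) \<xi>)"
proof -
  let ?f = "\<lambda>\<xi>. of_real \<bar>\<xi>\<bar> * rep_L2 (fourier u) \<xi>"
  show S: "square_integrable ?f"
    by (rule square_integrable_bound[OF assms[unfolded H1_iff], where C = 1]) (auto simp: norm_mult)
  have iff: "is_abs_multiple (fourier u) w \<longleftrightarrow> w = abs_L2 ?f" for w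
    using is_abs_multiple.abs_eq[of "rep_L2 (fourier u)" "rep_L2 w"] abs_L2_eq_iff[OF square_integrable_rep_L2[of w] S]
    by (simp add: ae_eq_refl_iff square_integrable_rep_L2)
  have "abs_nabla u = inv_fourier (abs_L2 ?f)"
    unfolding abs_nabla_def iff
  proof (rule the_equality)
    fix v assume "fourier v = abs_L2 ?f"
    then show "v = inv_fourier (abs_L2 ?f)" by (metis inv_fourier_fourier)
  qed simp
  then show "fourier (abs_nabla u) = abs_L2 ?f" by simp
qed

lemma AE_fourier_abs_nabla:
  assumes "u \<in> H1"
  shows "AE \<xi> in lborel. rep_L2 (fourier (abs_nabla u)) \<xi> = of_real \<bar>\<xi>\<bar> * rep_L2 (fourier u) \<xi>"
  unfolding fourier_abs_nabla(2)[OF assms] by (rule AE_rep_abs_L2[OF fourier_abs_nabla(1)[OF assms]])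

lemma abs_nabla_eqI:
  assumes "u \<in> H1" "AE \<xi> in lborel. rep_L2 (fourier v) \<xi> = of_real \<bar>\<xi>\<bar> * rep_L2 (fourier u) \<xi>"
  shows "abs_nabla u = v"
proof -
  have "fourier v = fourier (abs_nabla u)"
    unfolding fourier_abs_nabla(2)[OF assms(1)]
    by (rule L2_eqI_abs[OF fourier_abs_nabla(1)[OF assms(1)] assms(2)])
  then show ?thesis by simp
qed

lemma abs_nabla_add:
  assumes "u \<in> H1" "v \<in> H1"
  shows "abs_nabla (u + v) = abs_nabla u + abs_nabla v"
proof (rule abs_nabla_eqI[OF H1_add(1)[OF assms]])
  show "AE \<xi> in lborel. rep_L2 (fourier (abs_nabla u + abs_nabla v)) \<xi> = of_real \<bar>\<xi>\<bar> * rep_L2 (fourier (u + v)) \<xi>"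
    unfolding fourier_add
    using AE_fourier_abs_nabla[OF assms(1)] AE_fourier_abs_nabla[OF assms(2)] AE_rep_L2_add[of "fourier u" "fourier v"]
      AE_rep_L2_add[of "fourier (abs_nabla u)" "fourier (abs_nabla v)"]
    by eventually_elim (simp add: distrib_left)
qed

lemma abs_nabla_scaleC:
  assumes "u \<in> H1"
  shows "abs_nabla (c *\<^sub>C u) = c *\<^sub>C abs_nabla u"
proof (rule abs_nabla_eqI[OF H1_scaleC(1)[OF assms]])
  show "AE \<xi> in lborel. rep_L2 (fourier (c *\<^sub>C abs_nabla u)) \<xi> = of_real \<bar>\<xi>\<bar> * rep_L2 (fourier (c *\<^sub>C u)) \<xi>"
    unfolding fourier_scaleC
    using AE_fourier_abs_nabla[OF assms] AE_rep_L2_scaleC[of c "fourier u"]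
      AE_rep_L2_scaleC[of c "fourier (abs_nabla u)"]
    by eventually_elim (simp add: mult.left_commute)
qed

text \<open>On the support of the transform \<open>\<bar>\<xi>\<bar> = s * \<xi>\<close>. This is
  what makes the nonlocal operator obey a product rule within one Hardy space.\<close>

lemma abs_nabla_hardy:
  assumes s: "s = 1 \<or> s = -1" and u: "u \<in> hardy s" "u \<in> H1"
  shows "abs_nabla u = complex_of_real s *\<^sub>C D_op u"
proof (rule abs_nabla_eqI[OF u(2)])
  show "AE \<xi> in lborel. rep_L2 (fourier (of_real s *\<^sub>C D_op u)) \<xi> = of_real \<bar>\<xi>\<bar> * rep_L2 (fourier u) \<xi>"
    unfolding fourier_scaleC
    using AE_fourier_D_op[OF u(2)] AE_rep_L2_scaleC[of "of_real s" "fourier (D_op u)"] hardyD[OF u(1)]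
  proof eventually_elim
    case (elim \<xi>)
    show ?case
    proof (cases "s * \<xi> < 0")
      case False
      then have "of_real s * of_real \<xi> = complex_of_real \<bar>\<xi>\<bar>"
        unfolding of_real_mult[symmetric] of_real_eq_iff using s by auto
      then show ?thesis using elim(1,2) by (simp add: mult.assoc[symmetric])
    qed (use elim in simp)
  qed
qed

lemma abs_nabla_in_hardy:
  assumes "u \<in> hardy s" "u \<in> H1" shows "abs_nabla u \<in> hardy s"
  unfolding hardy_def mem_Collect_eq
  using hardyD[OF assms(1)] AE_fourier_abs_nabla[OF assms(2)] by eventually_elim auto

lemma abs_nabla_symmetric:
  assumes "u \<in> H1" "v \<in> H1"
  shows "cinner (abs_nabla u) v = cinner u (abs_nabla v)"
proof -
  have "cinner (fourier (abs_nabla u)) (fourier v) = cinner (fourier u) (fourier (abs_nabla v))"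
    unfolding cinner_rep
  proof (rule integral_cong_AE)
    show "AE x in lborel. rep_L2 (fourier (abs_nabla u)) x * cnj (rep_L2 (fourier v) x) =
        rep_L2 (fourier u) x * cnj (rep_L2 (fourier (abs_nabla v)) x)"
      using AE_fourier_abs_nabla[OF assms(1)] AE_fourier_abs_nabla[OF assms(2)]
      by eventually_elim simp
  qed measurable
  then show ?thesis by (simp add: parseval)
qed

section \<open>The orthogonal basis of rational functions\<close>

definition cay :: "int \<Rightarrow> real \<Rightarrow> complex" where
  "cay n x = zeta 1 x powi n"

text \<open>The Malmquist-Takenaka functions of the line without normalization: each has squared
  norm \<open>pi\<close>. Nonnegative indices lie in the upper Hardy space, negative ones in the
  lower.\<close>

definition basis :: "int \<Rightarrow> L2" where
  "basis n = mul_L2 (cay n) (rho_L2 1)"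

lemma cay_measurable [measurable]: "cay n \<in> borel_measurable borel"
  unfolding cay_def power_int_def by measurable

lemma cmod_cay [simp]: "cmod (cay n x) = 1"
  by (simp add: cay_def norm_power_int)

lemma bounded_multiplier_cay [simp]: "bounded_multiplier (cay n)"
  by (rule bounded_multiplierI[where C = 1]) auto

lemma cay_add: "cay (a + b) x = cay a x * cay b x"
  by (simp add: cay_def power_int_add)

lemma zeta_minus_inverse: "zeta (- 1) x = inverse (zeta 1 x)"
  using zeta_zeta_minus[of 1 x] by (simp add: inverse_eq_divide nonzero_eq_divide_eq mult.commute)

lemma cay_nat: "cay (int n) x = zeta 1 x ^ n" "cay (- int n) x = zeta (- 1) x ^ n"
  by (simp_all add: cay_def power_int_minus zeta_minus_inverse power_inverse)

lemma cnj_cay: "cnj (cay n x) = cay (- n) x"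
proof -
  show ?thesis
    by (cases n rule: int_cases2) (simp_all add: cay_nat cnj_zeta)
qed

lemma cay_0 [simp]: "cay 0 x = 1" by (simp add: cay_def)

lemma cay_1: "cay 1 = zeta 1" "cay (- 1) = zeta (- 1)"
  using cay_nat[of 1] by auto

lemma mul_cay_basis: "mul_L2 (cay k) (basis n) = basis (n + k)"
  unfolding basis_def by (simp add: mul_L2_mul_L2 cay_add[symmetric] add.commute)

lemma zeta_pow_basis:
  "zeta_pow 1 k (basis n) = basis (n + int k)" "zeta_pow (- 1) k (basis n) = basis (n - int k)"
  using mul_cay_basis[of "int k" n] mul_cay_basis[of "- int k" n] by (simp_all add: cay_nat[abs_def])

lemma mul_cay_isometry: "cinner (mul_L2 (cay k) u) (mul_L2 (cay k) v) = cinner u v"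
proof -
  have "(\<lambda>x. cnj (cay k x) * cay k x) = (\<lambda>x. 1)"
    by (simp add: cnj_cay cay_add[symmetric])
  then show ?thesis by (simp add: cinner_mul_L2 mul_L2_mul_L2 bounded_multiplier_cnj)
qed

lemma norm_zeta_pow: 
  assumes "s = 1 \<or> s = -1" shows "norm (zeta_pow s k u) = norm u"
proof -
  have "norm (mul_L2 (cay n) u) = norm u" for n
    using mul_cay_isometry[of n u u] by (simp add: cinner_self del: of_real_power)
  from this[of "int k"] this[of "- int k"] show ?thesis
    using assms by (auto simp: cay_nat[abs_def])
qed

lemma basis_nonneg: "basis (int n) = zeta_pow 1 n (rho_L2 1)"
  by (simp add: basis_def cay_nat[abs_def])

lemma basis_0: "basis 0 = rho_L2 1"
  using basis_nonneg[of 0] by simp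

lemma rho_minus_basis: "rho_L2 (- 1) = - basis (- 1)"
proof -
  have "basis (- 1) = abs_L2 (\<lambda>x. zeta (- 1) x * rho 1 x)"
    unfolding basis_def rho_L2_def cay_1 by (rule mul_L2_abs) (auto intro: square_integrable_rho)
  also have "\<dots> = abs_L2 (\<lambda>x. - rho (- 1) x)" using zeta_rho_minus[of "-1"] by simp
  finally show ?thesis by (simp add: abs_L2_uminus rho_L2_def square_integrable_rho)
qed

text \<open>The offset by one comes from \<open>rho_L2 (- 1) = - basis (- 1)\<close>: the lower half
  starts at index -1, not at 0.\<close>

lemma zeta_pow_rho_minus: "zeta_pow (- 1) n (rho_L2 (- 1)) = - basis (- 1 - int n)"
  unfolding rho_minus_basis by (simp add: mul_L2_minus zeta_pow_basis)

lemma basis_hardy: "n \<ge> 0 \<Longrightarrow> basis n \<in> hardy 1" "n < 0 \<Longrightarrow> basis n \<in> hardy (- 1)"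
proof -
  show "n \<ge> 0 \<Longrightarrow> basis n \<in> hardy 1"
    using basis_nonneg[of "nat n"] hardy_zeta_pow[OF _ rho_in_hardy, of 1 "nat n"] by simp
  assume "n < 0"
  then have "basis n = - zeta_pow (- 1) (nat (- n - 1)) (rho_L2 (- 1))"
    unfolding zeta_pow_rho_minus by simp
  then show "basis n \<in> hardy (- 1)"
    using hardy_scaleC[OF hardy_zeta_pow[OF _ rho_in_hardy, of "-1" "nat (- n - 1)"], of "-1"]
    by (simp add: scaleC_minus1)
qed

text \<open>Multiplication by powers of \<open>zeta\<close> is an isometry that shifts indices.
  Orthogonality therefore reduces to that of the two Hardy spaces, and the norm to a single
  exponential integral for \<open>basis 0\<close>.\<close>

lemma cinner_basis: "cinner (basis j) (basis k) = (if j = k then of_real pi else 0)"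
proof -
  have shift: "cinner (basis j) (basis k) = cinner (basis (j + n)) (basis (k + n))" for j k n
    by (simp add: mul_cay_basis[symmetric] mul_cay_isometry)
  \<comment> \<open>Shifting by \<open>- k - 1\<close> puts the smaller index at -1 and the larger
    one at a nonnegative position, hence into opposite Hardy spaces.\<close>
  have less: "cinner (basis j) (basis k) = 0" if "k < j" for j k
    unfolding shift[of j k "- k - 1"]
    by (rule hardy_orthogonal[of 1]) (use that in \<open>auto intro: basis_hardy\<close>)
  have "cinner (basis 0) (basis 0) = of_real pi"
  proof -
    have "2 * pi * cinner (basis 0) (basis 0) = cinner (fourier (rho_L2 1)) (fourier (rho_L2 1))"
      by (simp add: parseval basis_0)
    also have "\<dots> = 4 * pi\<^sup>2 * cinner (abs_L2 (\<lambda>\<xi>. of_real (half_exp 1 \<xi>))) (abs_L2 (\<lambda>\<xi>. of_real (half_exp 1 \<xi>)))"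
      by (simp add: fourier_rho cinner_scaleC_left cinner_scaleC_right power2_eq_square)
    also have "cinner (abs_L2 (\<lambda>\<xi>. of_real (half_exp 1 \<xi>))) (abs_L2 (\<lambda>\<xi>. of_real (half_exp 1 \<xi>))) =
        (LINT \<xi>|lborel. complex_of_real (half_exp 1 \<xi>) * cnj (of_real (half_exp 1 \<xi>)))"
      by (rule cinner_abs) (simp_all add: half_exp_transform)
    also have "\<dots> = (LINT \<xi>|lborel. indicator {0<..} \<xi> * exp (- (2 * complex_of_real \<xi>)))"
      by (rule Bochner_Integration.integral_cong)
        (simp_all add: half_exp_def indicator_def exp_of_real[symmetric] exp_add[symmetric])
    also have "\<dots> = 1 / 2" by (rule integral_exp_halfline(2)) simp
    finally have "complex_of_real (2 * pi) * cinner (basis 0) (basis 0) = of_real (2 * pi) * of_real pi"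
      by (simp add: power2_eq_square)
    then show ?thesis unfolding mult_cancel_left by simp
  qed
  then have "cinner (basis j) (basis j) = of_real pi" using shift[of j j "- j"] by simp
  then show ?thesis
    using less[of k j] less[of j k] cinner_commute[of "basis j" "basis k"]
    by (cases j k rule: linorder_cases) auto
qed

text \<open>\<open>omega\<close> is 1 minus the real part of \<open>zeta 1\<close>, so on the basis
  it acts as a second difference.\<close>

lemma mul_omega_eq: "mul_L2 omega u = u - (1/2) *\<^sub>C (mul_L2 (zeta 1) u + mul_L2 (zeta (- 1)) u)"
proof -
  have eq: "omega = (\<lambda>x. 1 - (1/2) * (zeta 1 x + zeta (- 1) x))"
  proof
    fix x
    have r: "rho s x = (1 - zeta s x) / 2" for s by (simp add: zeta_def)
    show "omega x = 1 - (1/2) * (zeta 1 x + zeta (- 1) x)"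
      using zeta_zeta_minus(1)[of 1 x] unfolding omega_eq_rho[of 1 x, simplified] r by (simp add: field_simps)
  qed
  show ?thesis
    unfolding eq
    by (simp add: mul_L2_diff_left mul_L2_cmult_left mul_L2_plus_left bounded_multiplier_cmult bounded_multiplier_add
        del: times_divide_eq_left)
qed

lemma mul_omega_basis: "mul_L2 omega (basis n) = basis n - (1/2) *\<^sub>C (basis (n + 1) + basis (n - 1))"
  unfolding mul_omega_eq cay_1[symmetric] mul_cay_basis by simp

text \<open>The factor \<open>\<bar>\<xi>\<bar>\<close> turns the transform of \<open>rho s\<close>
  into that of its square, and \<open>rho s = (1 - zeta s) / 2\<close> converts one factor of the
  square into a shift.\<close>

lemma rho_H1:
  assumes s: "s = 1 \<or> s = -1"
  shows "rho_L2 s \<in> H1" "abs_nabla (rho_L2 s) = (1/2) *\<^sub>C (rho_L2 s - mul_L2 (zeta s) (rho_L2 s))"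
proof -
  let ?g = "\<lambda>\<xi>. 2 * pi * complex_of_real (half_exp s \<xi>)"
  note T = half_exp_transform[OF s] half_exp2_transform[OF s]
  have F: "fourier (rho_L2 s) = abs_L2 ?g"
    by (simp add: fourier_rho[OF s] abs_L2_scaleC T)
  have Sg: "square_integrable ?g" by (rule square_integrable_cmult[OF T(2)])
  have eq: "of_real \<bar>\<xi>\<bar> * ?g \<xi> = 2 * pi * complex_of_real (\<bar>\<xi>\<bar> * half_exp s \<xi>)" for \<xi> by simp
  have S2: "square_integrable (\<lambda>\<xi>. of_real \<bar>\<xi>\<bar> * ?g \<xi>)"
    unfolding eq by (rule square_integrable_cmult[OF T(5)])
  show H: "rho_L2 s \<in> H1"
  proof (rule H1I[OF F Sg])
    show "square_integrable (\<lambda>\<xi>. of_real \<xi> * ?g \<xi>)"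
      by (rule square_integrable_bound[OF S2, where C = 1]) (measurable, simp add: norm_mult)
  qed
  define q where "q x = (rho s x)\<^sup>2" for x
  have q: "q = (\<lambda>x. cnj (FT (\<lambda>\<xi>. complex_of_real (\<bar>\<xi>\<bar> * half_exp s \<xi>)) x))"
    by (simp add: T(6) q_def[abs_def] cnj_rho del: of_real_mult)
  have Fq: "fourier (abs_L2 q) = (2 * pi) *\<^sub>C abs_L2 (\<lambda>\<xi>. complex_of_real (\<bar>\<xi>\<bar> * half_exp s \<xi>))"
    unfolding q by (rule fourier_cnj_FT[OF T(4,5)]) simp
  have Fq': "fourier (abs_L2 q) = abs_L2 (\<lambda>\<xi>. of_real \<bar>\<xi>\<bar> * ?g \<xi>)"
    unfolding eq Fq by (rule abs_L2_scaleC[OF T(5), symmetric])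
  have "abs_nabla (rho_L2 s) = abs_L2 q"
  proof (rule abs_nabla_eqI[OF H])
    show "AE \<xi> in lborel. rep_L2 (fourier (abs_L2 q)) \<xi> = of_real \<bar>\<xi>\<bar> * rep_L2 (fourier (rho_L2 s)) \<xi>"
      unfolding F Fq' using AE_rep_abs_L2[OF Sg] AE_rep_abs_L2[OF S2] by eventually_elim simp
  qed
  also have "\<dots> = abs_L2 (\<lambda>x. (1/2) * (rho s x - zeta s x * rho s x))"
  proof -
    have "q = (\<lambda>x. (1/2) * (rho s x - zeta s x * rho s x))"
      by (simp add: q_def[abs_def] zeta_def algebra_simps power2_eq_square)
    then show ?thesis by (rule arg_cong)
  qed
  also have "\<dots> = (1/2) *\<^sub>C (rho_L2 s - mul_L2 (zeta s) (rho_L2 s))"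
    unfolding rho_L2_def mul_L2_abs[OF bounded_multiplier_zeta square_integrable_rho[OF s]]
    by (subst abs_L2_scaleC) (auto simp: abs_L2_diff square_integrable_rho[OF s] square_integrable_multiplier square_integrable_diff)
  finally show "abs_nabla (rho_L2 s) = (1/2) *\<^sub>C (rho_L2 s - mul_L2 (zeta s) (rho_L2 s))" .
qed

text \<open>One sign \<open>s\<close> comes from \<open>|nabla| = s * D_op\<close>, the other from
  the derivative of \<open>zeta s\<close>. Their product is 1, so both halves gain the same term, of
  the shape of the potential.\<close>

lemma abs_nabla_zeta_pow:
  assumes s: "s = 1 \<or> s = -1" and u: "u \<in> hardy s" "u \<in> H1"
  shows "abs_nabla (zeta_pow s n u) = zeta_pow s n (abs_nabla u) + of_nat n *\<^sub>C mul_L2 omega (zeta_pow s n u)"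
proof -
  note Z = H1_zeta_pow[OF s u(2), of n]
  have ss: "complex_of_real s * of_real s = 1" using s by auto
  have "abs_nabla (zeta_pow s n u) = of_real s *\<^sub>C D_op (zeta_pow s n u)"
    by (rule abs_nabla_hardy[OF s hardy_zeta_pow[OF s u(1)]]) (use Z in simp)
  also have "\<dots> = zeta_pow s n (of_real s *\<^sub>C D_op u) + of_nat n *\<^sub>C mul_L2 omega (zeta_pow s n u)"
    unfolding Z[THEN conjunct2]
    by (simp add: scaleC_add_right mul_L2_scaleC scaleC_scaleC mult.assoc[symmetric] ss)
  finally show ?thesis by (simp add: abs_nabla_hardy[OF s u])
qed

lemma basis_H1: "basis n \<in> H1"
proof (cases "n \<ge> 0")
  case True
  then show ?thesis
    using basis_nonneg[of "nat n"] H1_zeta_pow[OF _ rho_H1(1), of 1 1 "nat n"] by simp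
next
  case False
  then have "basis n = - zeta_pow (- 1) (nat (- n - 1)) (rho_L2 (- 1))"
    unfolding zeta_pow_rho_minus by simp
  then show ?thesis
    using H1_zeta_pow[OF _ rho_H1(1), of "-1" "-1" "nat (- n - 1)"] by (simp add: H1_minus)
qed

lemma abs_nabla_basis_nonneg:
  "abs_nabla (basis (int n)) =
    (1/2) *\<^sub>C (basis (int n) - basis (int n + 1)) + of_nat n *\<^sub>C mul_L2 omega (basis (int n))"
proof -
  have "mul_L2 (zeta 1) (rho_L2 1) = basis 1" by (simp add: basis_def cay_1)
  then have r: "abs_nabla (rho_L2 1) = (1/2) *\<^sub>C (basis 0 - basis 1)"
    using rho_H1(2)[of 1] by (simp add: basis_0)
  have "abs_nabla (zeta_pow 1 n (rho_L2 1)) =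
      zeta_pow 1 n ((1/2) *\<^sub>C (basis 0 - basis 1)) + of_nat n *\<^sub>C mul_L2 omega (zeta_pow 1 n (rho_L2 1))"
    unfolding r[symmetric] by (rule abs_nabla_zeta_pow) (simp_all add: rho_in_hardy rho_H1)
  then show ?thesis
    by (simp only: basis_nonneg[symmetric] mul_L2_scaleC[OF bounded_multiplier_zeta_power]
        mul_L2_diff[OF bounded_multiplier_zeta_power] zeta_pow_basis add_0 add.commute[of 1])
qed

lemma abs_nabla_basis_neg:
  "abs_nabla (basis (- 1 - int n)) =
    (1/2) *\<^sub>C (basis (- 1 - int n) - basis (- 2 - int n)) + of_nat n *\<^sub>C mul_L2 omega (basis (- 1 - int n))"
proof -
  have "mul_L2 (zeta (- 1)) (rho_L2 (- 1)) = - basis (- 2)"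
    using zeta_pow_rho_minus[of 1] by simp
  then have r: "abs_nabla (rho_L2 (- 1)) = (1/2) *\<^sub>C (basis (- 2) - basis (- 1))"
    using rho_H1(2)[of "-1"] by (simp add: rho_minus_basis)
  have "abs_nabla (zeta_pow (- 1) n (rho_L2 (- 1))) =
      zeta_pow (- 1) n ((1/2) *\<^sub>C (basis (- 2) - basis (- 1))) + of_nat n *\<^sub>C mul_L2 omega (zeta_pow (- 1) n (rho_L2 (- 1)))"
    unfolding r[symmetric] by (rule abs_nabla_zeta_pow) (simp_all add: rho_in_hardy rho_H1)
  also have "\<dots> =
      (1/2) *\<^sub>C (basis (- 2 - int n) - basis (- 1 - int n)) - of_nat n *\<^sub>C mul_L2 omega (basis (- 1 - int n))"
    by (simp add: mul_L2_scaleC mul_L2_diff zeta_pow_basis zeta_pow_rho_minus mul_L2_minus complex_vector.scale_minus_right)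
  finally have "abs_nabla (zeta_pow (- 1) n (rho_L2 (- 1))) =
      (1/2) *\<^sub>C (basis (- 2 - int n) - basis (- 1 - int n)) - of_nat n *\<^sub>C mul_L2 omega (basis (- 1 - int n))" .
  moreover have "basis (- 1 - int n) = (- 1) *\<^sub>C zeta_pow (- 1) n (rho_L2 (- 1))"
    by (simp add: zeta_pow_rho_minus scaleC_minus1)
  ultimately have "abs_nabla (basis (- 1 - int n)) = - ((1/2) *\<^sub>C (basis (- 2 - int n) - basis (- 1 - int n)) - of_nat n *\<^sub>C mul_L2 omega (basis (- 1 - int n)))"
    using abs_nabla_scaleC[of "zeta_pow (- 1) n (rho_L2 (- 1))" "-1"] H1_zeta_pow[OF _ rho_H1(1), of "-1" "-1" n]
    by (simp add: scaleC_minus1)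
  then show ?thesis by (simp add: complex_vector.scale_right_diff_distrib)
qed

section \<open>The operators on the basis\<close>

lemma potential_op_eq: "potential_op m u = of_nat m *\<^sub>C mul_L2 omega u"
proof -
  have p: "potential m = (\<lambda>x. of_nat m * omega x)"
    by (auto simp: potential_def omega_def)
  have "potential_op m u = mul_L2 (potential m) u"
    using potential_op.abs_eq[of "rep_L2 u" m] by (simp add: ae_eq_refl_iff square_integrable_rep_L2 mul_L2_def)
  then show ?thesis unfolding p by (simp add: mul_L2_cmult_left)
qed

text \<open>As a function it is \<open>omega x * cay p x\<close> (\<open>beta_alt\<close>), the mode
  out of which the kernel of \<open>R\<close> is built; as a difference of neighbours it is visible
  on the basis.\<close>

definition beta :: "int \<Rightarrow> L2" where
  "beta p = basis p - basis (p - 1)"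

lemma beta_alt:
  "square_integrable (\<lambda>x. omega x * cay p x)" "beta p = abs_L2 (\<lambda>x. omega x * cay p x)"
proof -
  have eq: "omega x * cay p x = cay p x * rho 1 x - cay (p - 1) x * rho 1 x" for x
  proof -
    have "cay (p - 1) x = cay p x * zeta (- 1) x" using cay_add[of p "-1" x] cay_1 by simp
    moreover have o: "omega x = rho 1 x * (1 - zeta (- 1) x)"
      by (simp add: omega_eq_rho[of 1] zeta_def)
    ultimately show ?thesis unfolding o by (simp add: algebra_simps)
  qed
  have S: "square_integrable (\<lambda>x. cay p x * rho 1 x)" for p
    by (rule square_integrable_multiplier) (auto intro: square_integrable_rho)
  show "square_integrable (\<lambda>x. omega x * cay p x)" unfolding eq by (intro square_integrable_diff S)
  show "beta p = abs_L2 (\<lambda>x. omega x * cay p x)"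
    unfolding eq abs_L2_diff[OF S S] beta_def basis_def rho_L2_def
    by (simp add: mul_L2_abs square_integrable_rho)
qed

text \<open>The difference of m-th powers is \<open>c x - c y\<close> times a geometric sum. The
  first factor accounts for the quotient \<open>|x - y|\<close> and both weights
  \<open>omega\<close>; the squared modulus of the sum is a Fejer kernel. On the diagonal the
  quotient is 0 by convention, whence the hypothesis.\<close>

lemma R_kernel_expansion:
  assumes "x \<noteq> y"
  shows "complex_of_real (R_kernel m x y) =
    (\<Sum>j<m. \<Sum>k<m. omega x * cay (int j - int k) x * cnj (omega y * cay (int j - int k) y))"
proof -
  define c where "c t = \<i> * zeta 1 t" for t
  have cz: "\<i> * ((complex_of_real t - \<i>) / (of_real t + \<i>)) = c t" for t
  proof -
    have "complex_of_real t + \<i> \<noteq> 0" by (auto simp: complex_eq_iff)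
    then show ?thesis
      using rho_denom_nonzero(1)[of t] by (simp add: c_def zeta_alt field_simps)
  qed
  have c1: "cmod (c t) = 1" for t by (simp add: c_def norm_mult)
  have cc: "c t * cnj (c t) = 1" for t using c1[of t] complex_norm_square[of "c t"] by simp
  have Q: "(norm (Q_map m x - Q_map m y))\<^sup>2 = (cmod (c x ^ m - c y ^ m))\<^sup>2"
    unfolding Q_map_def f_comp_def g_comp_def cz by (simp add: norm_prod_def cmod_def)
  have "c x - c y = - 2 * \<i> * (rho 1 x - rho 1 y)" by (simp add: c_def zeta_def algebra_simps)
  also have "rho 1 x - rho 1 y = \<i> * of_real (x - y) * rho 1 x * rho 1 y"
    using rho_denom_nonzero(1)[of x] rho_denom_nonzero(1)[of y] by (simp add: rho_def field_simps)
  also have "- 2 * \<i> * \<dots> = (\<i> * \<i>) * (- 2) * (of_real (x - y) * rho 1 x * rho 1 y)" by (simp only: mult_ac)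
  finally have cd: "c x - c y = 2 * of_real (x - y) * rho 1 x * rho 1 y" by (simp add: mult.assoc)
  have rr: "of_real ((cmod (rho 1 t))\<^sup>2) = omega t / 2" for t
    using complex_norm_square[of "rho 1 t"] by (simp add: omega_eq_rho[of 1] cnj_rho)
  have "complex_of_real ((cmod (c x - c y))\<^sup>2) = of_real (\<bar>x - y\<bar>\<^sup>2) * omega x * omega y"
    unfolding cd by (simp add: norm_mult power_mult_distrib rr[unfolded of_real_power] del: of_real_diff)
  note c2 = this
  define w where "w = zeta 1 x * cnj (zeta 1 y)"
  have "c x * cnj (c y) = (\<i> * cnj \<i>) * w"
    unfolding c_def w_def complex_cnj_mult by (simp only: mult_ac)
  then have cw: "c x * cnj (c y) = w" by simp
  \<comment> \<open>Pulling out the unimodular \<open>c y ^ (m - 1)\<close> leaves powers of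
    \<open>w = c x * cnj (c y)\<close>, in which the factor \<open>\<i>\<close> has
    cancelled.\<close>
  have "c x ^ m - c y ^ m = (c x - c y) * (\<Sum>j<m. c y ^ (m - Suc j) * c x ^ j)"
    by (rule power_diff_sumr2)
  also have "(\<Sum>j<m. c y ^ (m - Suc j) * c x ^ j) = (\<Sum>j<m. c y ^ (m - 1) * w ^ j)"
  proof (rule sum.cong[OF refl])
    fix j assume "j \<in> {..<m}"
    then have e: "m - 1 = m - Suc j + j" by auto
    have "c y ^ j * w ^ j = c x ^ j"
      unfolding cw[symmetric] power_mult_distrib[symmetric] using cc[of y] by (simp add: mult.left_commute)
    then show "c y ^ (m - Suc j) * c x ^ j = c y ^ (m - 1) * w ^ j"
      unfolding e power_add by (simp add: mult.assoc)
  qed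
  also have "\<dots> = c y ^ (m - 1) * (\<Sum>j<m. w ^ j)" by (rule sum_distrib_left[symmetric])
  finally have "cmod (c x ^ m - c y ^ m) = cmod (c x - c y) * cmod (\<Sum>j<m. w ^ j)"
    by (simp add: norm_mult norm_power c1)
  then have "complex_of_real ((norm (Q_map m x - Q_map m y))\<^sup>2) =
      of_real (\<bar>x - y\<bar>\<^sup>2) * (omega x * omega y * of_real ((cmod (\<Sum>j<m. w ^ j))\<^sup>2))"
    unfolding Q power_mult_distrib by (simp only: of_real_mult power_mult_distrib c2 mult.assoc)
  then have "complex_of_real (R_kernel m x y) = omega x * omega y * of_real ((cmod (\<Sum>j<m. w ^ j))\<^sup>2)"
    using assms by (simp add: R_kernel_def)
  also have "of_real ((cmod (\<Sum>j<m. w ^ j))\<^sup>2) = (\<Sum>j<m. \<Sum>k<m. w ^ j * cnj (w ^ k))"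
    unfolding complex_norm_square cnj_sum sum_product by simp
  also have "omega x * omega y * \<dots> = (\<Sum>j<m. \<Sum>k<m. omega x * cay (int j - int k) x * cnj (omega y * cay (int j - int k) y))"
    unfolding sum_distrib_left
  proof (intro sum.cong refl)
    fix j k
    have "cay (int j - int k) t = zeta 1 t ^ j * cnj (zeta 1 t) ^ k" for t
      using cay_add[of "int j" "- int k" t] by (simp add: cay_nat cnj_zeta)
    then have "w ^ j * cnj (w ^ k) = cay (int j - int k) x * cnj (cay (int j - int k) y)"
      by (simp add: w_def power_mult_distrib mult_ac)
    moreover have "cnj (omega y) = omega y" by (simp add: omega_def)
    ultimately show "omega x * omega y * (w ^ j * cnj (w ^ k)) =
        omega x * cay (int j - int k) x * cnj (omega y * cay (int j - int k) y)"
      by (simp add: mult_ac)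
  qed
  finally show ?thesis .
qed

text \<open>The hypothesis is weighted integrability rather than square integrability, so that the
  expansion also applies to the resonance functions, which are merely bounded.\<close>

lemma R_fun_expansion:
  assumes f: "integrable lborel (\<lambda>y. omega y * f y)"
  shows "R_fun m f x = (\<Sum>j<m. \<Sum>k<m. of_real (1 / (2 * pi)) *
    (LINT y|lborel. f y * cnj (omega y * cay (int j - int k) y)) * (omega x * cay (int j - int k) x))"
proof -
  have int: "integrable lborel (\<lambda>y. f y * cnj (omega y * cay p y))" for p
  proof -
    have "f y * cnj (omega y * cay p y) = (omega y * f y) * cnj (cay p y)" for y
      by (simp add: omega_def)
    then show ?thesis
      using integrable_mult_unimodular(1)[OF f, of "\<lambda>y. cnj (cay p y)" 1] by (simp only:) simp
  qed
  have fm: "(\<lambda>y. complex_of_real (R_kernel m x y) * f y) \<in> borel_measurable borel"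
  proof -
    \<comment> \<open>Measurability of \<open>f\<close> itself is recovered by dividing by the
      nowhere vanishing weight.\<close>
    have "(\<lambda>y. (omega y * f y) / omega y) \<in> borel_measurable borel"
      using f by (intro borel_measurable_divide) (auto simp: borel_measurable_integrable)
    moreover have "omega y \<noteq> 0" for y
    proof -
      have "0 < 1 + y\<^sup>2" by (simp add: add_pos_nonneg)
      then show ?thesis unfolding omega_def of_real_eq_0_iff by simp
    qed
    ultimately have [measurable]: "f \<in> borel_measurable borel" by simp
    have "(\<lambda>y. R_kernel m x y) \<in> borel_measurable borel"
      using measurable_Pair2[OF R_kernel_measurable, of x m] by simp
    then show ?thesis by measurable
  qed
  have "(LINT y|lborel. complex_of_real (R_kernel m x y) * f y) =
      (LINT y|lborel. (\<Sum>j<m. \<Sum>k<m. (omega x * cay (int j - int k) x) * (f y * cnj (omega y * cay (int j - int k) y))))"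
  proof (rule integral_cong_AE)
    show "AE y in lborel. complex_of_real (R_kernel m x y) * f y =
        (\<Sum>j<m. \<Sum>k<m. (omega x * cay (int j - int k) x) * (f y * cnj (omega y * cay (int j - int k) y)))"
      using AE_lborel_singleton[of x]
      by eventually_elim (simp add: R_kernel_expansion sum_distrib_left sum_distrib_right mult_ac del: complex_cnj_mult)
    show "(\<lambda>y. \<Sum>j<m. \<Sum>k<m. (omega x * cay (int j - int k) x) * (f y * cnj (omega y * cay (int j - int k) y))) \<in> borel_measurable lborel"
      by (rule borel_measurable_integrable) (intro Bochner_Integration.integrable_sum integrable_mult_right int)
  qed (use fm in simp)
  also have "\<dots> = (\<Sum>j<m. \<Sum>k<m. (omega x * cay (int j - int k) x) * (LINT y|lborel. f y * cnj (omega y * cay (int j - int k) y)))"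
    by (simp add: Bochner_Integration.integral_sum Bochner_Integration.integrable_sum integrable_mult_right int del: complex_cnj_mult)
  finally show ?thesis
    unfolding R_fun_def by (simp add: sum_distrib_left mult_ac del: complex_cnj_mult)
qed

text \<open>Finite rank made explicit: only \<open>beta p\<close> with \<open>|p| < m\<close> occur,
  each \<open>m - |p|\<close> times. Range in \<open>Kspace\<close>, symmetry, boundedness and
  vanishing on the orthogonal complement are all read off from here.\<close>

lemma R_op_eq:
  "R_op m u = (\<Sum>j<m. \<Sum>k<m. (of_real (1 / (2 * pi)) * cinner u (beta (int j - int k))) *\<^sub>C beta (int j - int k))"
proof -
  obtain f where f: "square_integrable f" "u = abs_L2 f" by (metis L2_cases)
  have So: "square_integrable omega" using beta_alt(1)[of 0] by simp
  have int: "integrable lborel (\<lambda>y. omega y * f y)" by (rule square_integrable_product[OF So f(1)])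
  have "R_op m u = abs_L2 (R_fun m f)"
    using R_op.abs_eq[of f m] f by (simp add: ae_eq_refl_iff)
  also have "R_fun m f = (\<lambda>x. \<Sum>j<m. \<Sum>k<m. (of_real (1 / (2 * pi)) * cinner u (beta (int j - int k))) * (omega x * cay (int j - int k) x))"
    unfolding R_fun_expansion[OF int, abs_def] beta_alt(2) f(2) cinner_abs[OF f(1) beta_alt(1)] ..
  also have "abs_L2 \<dots> = (\<Sum>j<m. \<Sum>k<m. (of_real (1 / (2 * pi)) * cinner u (beta (int j - int k))) *\<^sub>C beta (int j - int k))"
    unfolding beta_alt(2)
    by (simp only: abs_L2_sum abs_L2_scaleC beta_alt(1) square_integrable_sum square_integrable_cmult)
  finally show ?thesis .
qed

text \<open>The origin of the Fejer weights. The bound on \<open>p\<close> is not strict because at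
  the extreme indices of the basis one of the two weights sits at \<open>|p| = m\<close>, where the
  count is 0.\<close>

lemma sum_difference_count:
  assumes "\<bar>p\<bar> \<le> int m"
  shows "(\<Sum>j<m. \<Sum>k<m. if int j - int k = p then 1 else 0 :: complex) = of_int (int m - \<bar>p\<bar>)"
proof -
  have "(\<Sum>k<m. if int j - int k = p then 1 else 0 :: complex) = (if p \<le> int j \<and> int j < int m + p then 1 else 0)" for j
  proof (cases "p \<le> int j \<and> int j < int m + p")
    case True
    have "(\<Sum>k<m. if int j - int k = p then 1 else 0 :: complex) = (\<Sum>k<m. if k = nat (int j - p) then 1 else 0)"
      by (rule sum.cong[OF refl]) (use True in auto)
    then show ?thesis using True by (auto simp: sum.delta)
  next
    case False
    then show ?thesis by (auto intro!: sum.neutral)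
  qed
  then have "(\<Sum>j<m. \<Sum>k<m. if int j - int k = p then 1 else 0 :: complex) =
      (\<Sum>j<m. if p \<le> int j \<and> int j < int m + p then 1 else 0)" by simp
  also have "\<dots> = of_nat (card {j \<in> {..<m}. p \<le> int j \<and> int j < int m + p})"
    using sum.inter_filter[of "{..<m}" "\<lambda>_. 1 :: complex" "\<lambda>j. p \<le> int j \<and> int j < int m + p"] by simp
  also have "card {j \<in> {..<m}. p \<le> int j \<and> int j < int m + p} = nat (int m - \<bar>p\<bar>)"
  proof -
    have "{j \<in> {..<m}. p \<le> int j \<and> int j < int m + p} = {nat (max 0 p)..<nat (min (int m) (int m + p))}"
      using assms by auto
    then show ?thesis using assms by (simp only: card_atLeastLessThan)
  qed
  finally show ?thesis using assms by simp
qed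

lemma cinner_basis_beta:
  "cinner (basis n) (beta p) = (if p = n then of_real pi else 0) - (if p = n + 1 then of_real pi else 0)"
  by (auto simp: beta_def cinner_diff_right cinner_basis)

lemma R_op_basis:
  assumes "\<bar>n\<bar> \<le> int m" "\<bar>n + 1\<bar> \<le> int m"
  shows "R_op m (basis n) = (1/2) *\<^sub>C (of_int (int m - \<bar>n\<bar>) *\<^sub>C beta n - of_int (int m - \<bar>n + 1\<bar>) *\<^sub>C beta (n + 1))"
proof -
  have eq: "(of_real (1 / (2 * pi)) * cinner (basis n) (beta p)) *\<^sub>C beta p =
      (1/2) *\<^sub>C ((if p = n then 1 else 0) *\<^sub>C beta n - (if p = n + 1 then 1 else 0) *\<^sub>C beta (n + 1))" for p
    by (auto simp: cinner_basis_beta scaleC_scaleC complex_vector.scale_right_diff_distrib)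
  have "R_op m (basis n) = (1/2) *\<^sub>C ((\<Sum>j<m. \<Sum>k<m. if int j - int k = n then 1 else 0) *\<^sub>C beta n -
      (\<Sum>j<m. \<Sum>k<m. if int j - int k = n + 1 then 1 else 0) *\<^sub>C beta (n + 1))"
    unfolding R_op_eq eq
    by (simp only: complex_vector.scale_sum_left complex_vector.scale_sum_right sum_subtractf[symmetric])
  then show ?thesis by (simp only: sum_difference_count[OF assms(1)] sum_difference_count[OF assms(2)])
qed

lemma L_plus_add: "u \<in> H1 \<Longrightarrow> v \<in> H1 \<Longrightarrow> L_plus m (u + v) = L_plus m u + L_plus m v"
  by (simp add: L_plus_def abs_nabla_add potential_op_eq mul_L2_add scaleC_add_right)

lemma L_plus_scaleC: "u \<in> H1 \<Longrightarrow> L_plus m (c *\<^sub>C u) = c *\<^sub>C L_plus m u"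
  by (simp add: L_plus_def abs_nabla_scaleC potential_op_eq mul_L2_scaleC complex_vector.scale_right_diff_distrib
      complex_vector.scale_left_commute)

lemma R_op_add: "R_op m (u + v) = R_op m u + R_op m v"
  unfolding R_op_eq cinner_add_left distrib_left scaleC_add_left by (simp add: sum.distrib)

lemma R_op_scaleC: "R_op m (c *\<^sub>C u) = c *\<^sub>C R_op m u"
  unfolding R_op_eq cinner_scaleC_left complex_vector.scale_sum_right scaleC_scaleC by (simp add: mult.left_commute)

lemma L_minus_add: "u \<in> H1 \<Longrightarrow> v \<in> H1 \<Longrightarrow> L_minus m (u + v) = L_minus m u + L_minus m v"
  by (simp add: L_minus_def L_plus_add R_op_add)

lemma L_minus_scaleC: "u \<in> H1 \<Longrightarrow> L_minus m (c *\<^sub>C u) = c *\<^sub>C L_minus m u"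
  by (simp add: L_minus_def L_plus_scaleC R_op_scaleC scaleC_add_right)

text \<open>Both operators act as tridiagonal matrices on the basis, and the entries of \<open>R\<close> (the Fejer
  weights \<open>m - |n|\<close>) cancel those of \<open>L\<^sub>+\<close>.\<close>

lemma tridiagonal_cancel:
  fixes a b c :: "'a::complex_normed_vector" and \<alpha> \<beta> \<gamma> \<delta> :: complex
  assumes "\<gamma> = \<alpha> - 1" "\<delta> = - \<alpha>"
  shows "(1/2) *\<^sub>C (b - c) + \<delta> *\<^sub>C (b - (1/2) *\<^sub>C (c + a)) + (1/2) *\<^sub>C (\<alpha> *\<^sub>C (b - a) - \<gamma> *\<^sub>C (c - b)) = 0"
proof -
  have "(1/2) *\<^sub>C (b - c) + \<delta> *\<^sub>C (b - (1/2) *\<^sub>C (c + a)) + (1/2) *\<^sub>C (\<alpha> *\<^sub>C (b - a) - \<gamma> *\<^sub>C (c - b)) =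
      (1/2 + \<delta> + \<alpha>/2 + \<gamma>/2) *\<^sub>C b + (- 1/2 - \<delta>/2 - \<gamma>/2) *\<^sub>C c + (- \<delta>/2 - \<alpha>/2) *\<^sub>C a"
    by (simp add: complex_vector.scale_right_diff_distrib complex_vector.scale_left_diff_distrib
        scaleC_add_left scaleC_add_right scaleC_scaleC complex_vector.scale_minus_left algebra_simps)
  also have "\<dots> = 0" unfolding assms by (simp add: field_simps)
  finally show ?thesis .
qed

text \<open>The vector is the k-th of its half, with \<open>k = n\<close> or
  \<open>k = - 1 - n\<close>, and the cancellation requires \<open>k < m\<close>. This produces the
  asymmetric range of \<open>n\<close>.\<close>

lemma L_minus_basis:
  assumes "- int m \<le> n" "n < int m"
  shows "L_minus m (basis n) = 0"
proof (cases "n \<ge> 0")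
  case True
  define k where "k = nat n"
  have k: "n = int k" "k < m" using True assms by (auto simp: k_def)
  have "L_minus m (basis n) = (1/2) *\<^sub>C (basis n - basis (n + 1)) +
      (of_nat k - of_nat m) *\<^sub>C (basis n - (1/2) *\<^sub>C (basis (n + 1) + basis (n - 1))) +
      (1/2) *\<^sub>C ((of_nat m - of_nat k) *\<^sub>C (basis n - basis (n - 1)) - (of_nat m - of_nat k - 1) *\<^sub>C (basis (n + 1) - basis n))"
  proof -
    have c: "of_int (int m - \<bar>n\<bar>) = (of_nat m - of_nat k :: complex)"
      "of_int (int m - \<bar>n + 1\<bar>) = (of_nat m - of_nat k - 1 :: complex)"
      using k by simp_all
    have A: "abs_nabla (basis n) = (1/2) *\<^sub>C (basis n - basis (n + 1)) + of_nat k *\<^sub>C mul_L2 omega (basis n)"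
      using abs_nabla_basis_nonneg[of k] k by simp
    have B: "R_op m (basis n) = (1/2) *\<^sub>C ((of_nat m - of_nat k) *\<^sub>C beta n - (of_nat m - of_nat k - 1) *\<^sub>C beta (n + 1))"
      by (rule R_op_basis[of n m, unfolded c]) (use k in auto)
    show ?thesis
      unfolding L_minus_def L_plus_def potential_op_eq A B mul_omega_basis
      by (simp add: beta_def complex_vector.scale_left_diff_distrib[of "of_nat k" "of_nat m"])
  qed
  also have "\<dots> = 0" by (rule tridiagonal_cancel) simp_all
  finally show ?thesis .
next
  case False
  define k where "k = nat (- n - 1)"
  have k: "n = - 1 - int k" "k < m" using False assms by (auto simp: k_def)
  have "L_minus m (basis n) = (1/2) *\<^sub>C (basis n - basis (n - 1)) +
      (of_nat k - of_nat m) *\<^sub>C (basis n - (1/2) *\<^sub>C (basis (n - 1) + basis (n + 1))) +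
      (1/2) *\<^sub>C ((of_nat m - of_nat k) *\<^sub>C (basis n - basis (n + 1)) - (of_nat m - of_nat k - 1) *\<^sub>C (basis (n - 1) - basis n))"
  proof -
    have c: "of_int (int m - \<bar>n\<bar>) = (of_nat m - of_nat k - 1 :: complex)"
      "of_int (int m - \<bar>n + 1\<bar>) = (of_nat m - of_nat k :: complex)"
      using k by simp_all
    have "- 2 - int k = n - 1" using k by simp
    then have A: "abs_nabla (basis n) = (1/2) *\<^sub>C (basis n - basis (n - 1)) + of_nat k *\<^sub>C mul_L2 omega (basis n)"
      using abs_nabla_basis_neg[of k] unfolding k(1) by simp
    have B: "R_op m (basis n) = (1/2) *\<^sub>C ((of_nat m - of_nat k - 1) *\<^sub>C beta n - (of_nat m - of_nat k) *\<^sub>C beta (n + 1))"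
      by (rule R_op_basis[of n m, unfolded c]) (use k in auto)
    \<comment> \<open>In the lower half the outward neighbour is \<open>n - 1\<close>. Exchanging
      the two differences brings \<open>R\<close> into the form that
      \<open>tridiagonal_cancel\<close> expects.\<close>
    have swap: "\<alpha> *\<^sub>C (b - a) - \<gamma> *\<^sub>C (c - b) = \<gamma> *\<^sub>C (b - c) - \<alpha> *\<^sub>C (a - b)" for \<alpha> \<gamma> and a b c :: L2
      by (simp add: complex_vector.scale_right_diff_distrib)
    have B': "R_op m (basis n) = (1/2) *\<^sub>C ((of_nat m - of_nat k) *\<^sub>C (basis n - basis (n + 1)) - (of_nat m - of_nat k - 1) *\<^sub>C (basis (n - 1) - basis n))"
      using swap[of "of_nat m - of_nat k - 1" "basis n" "basis (n - 1)" "of_nat m - of_nat k" "basis (n + 1)"] B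
      by (simp only: beta_def add_diff_cancel_right')
    show ?thesis
      unfolding L_minus_def L_plus_def potential_op_eq A B' mul_omega_basis
      by (simp add: complex_vector.scale_left_diff_distrib[of "of_nat k" "of_nat m"] add.commute)
  qed
  also have "\<dots> = 0" by (rule tridiagonal_cancel) simp_all
  finally show ?thesis .
qed

section \<open>The kernel and its complement\<close>

definition Kspace :: "nat \<Rightarrow> L2 set" where
  "Kspace m = cspan (basis ` {- int m..<int m})"

definition W_op :: "nat \<Rightarrow> L2 \<Rightarrow> L2" where
  "W_op m u = zeta_pow 1 m (half_proj 1 u) + zeta_pow (- 1) m (half_proj (- 1) u)"

lemma Kspace_subspace: "complex_vector.subspace (Kspace m)"
  unfolding Kspace_def by (rule complex_vector.subspace_span)

lemmas Kspace_zero = complex_vector.subspace_0[OF Kspace_subspace]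
  and Kspace_add = complex_vector.subspace_add[OF Kspace_subspace]
  and Kspace_diff = complex_vector.subspace_diff[OF Kspace_subspace]
  and Kspace_scaleC = complex_vector.subspace_scale[OF Kspace_subspace]
  and Kspace_sum = complex_vector.subspace_sum[OF Kspace_subspace]
  and Kspace_neg = complex_vector.subspace_neg[OF Kspace_subspace]

lemma basis_in_Kspace: "- int m \<le> n \<Longrightarrow> n < int m \<Longrightarrow> basis n \<in> Kspace m"
  unfolding Kspace_def by (rule complex_vector.span_base) auto

lemma beta_in_Kspace: "\<bar>p\<bar> < int m \<Longrightarrow> beta p \<in> Kspace m"
  unfolding beta_def by (intro Kspace_diff basis_in_Kspace) auto

lemma Kspace_expand:
  assumes "u \<in> Kspace m"
  shows "u = (\<Sum>n\<in>{- int m..<int m}. (cinner u (basis n) / of_real pi) *\<^sub>C basis n)" (is "?P u")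
  using assms unfolding Kspace_def
proof (rule complex_vector.span_induct)
  show "complex_vector.subspace {x. ?P x}"
  proof (rule complex_vector.subspaceI)
    fix x y assume "x \<in> {x. ?P x}" "y \<in> {x. ?P x}"
    then have "x = (\<Sum>n\<in>{- int m..<int m}. (cinner x (basis n) / of_real pi) *\<^sub>C basis n)"
      "y = (\<Sum>n\<in>{- int m..<int m}. (cinner y (basis n) / of_real pi) *\<^sub>C basis n)" by blast+
    then have "x + y = (\<Sum>n\<in>{- int m..<int m}. (cinner x (basis n) / of_real pi) *\<^sub>C basis n) +
        (\<Sum>n\<in>{- int m..<int m}. (cinner y (basis n) / of_real pi) *\<^sub>C basis n)" by argo
    also have "\<dots> = (\<Sum>n\<in>{- int m..<int m}. (cinner (x + y) (basis n) / of_real pi) *\<^sub>C basis n)"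
      by (simp add: cinner_add_left add_divide_distrib scaleC_add_left sum.distrib)
    finally show "x + y \<in> {x. ?P x}" by blast
  next
    fix c x assume "x \<in> {x. ?P x}"
    then have "x = (\<Sum>n\<in>{- int m..<int m}. (cinner x (basis n) / of_real pi) *\<^sub>C basis n)" by blast
    then have "c *\<^sub>C x = c *\<^sub>C (\<Sum>n\<in>{- int m..<int m}. (cinner x (basis n) / of_real pi) *\<^sub>C basis n)" by argo
    also have "\<dots> = (\<Sum>n\<in>{- int m..<int m}. (cinner (c *\<^sub>C x) (basis n) / of_real pi) *\<^sub>C basis n)"
      by (simp add: cinner_scaleC_left complex_vector.scale_sum_right scaleC_scaleC)
    finally show "c *\<^sub>C x \<in> {x. ?P x}" by blast
  qed simp
  fix u assume "u \<in> basis ` {- int m..<int m}"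
  then obtain k where k: "k \<in> {- int m..<int m}" "u = basis k" by blast
  have "(\<Sum>n\<in>{- int m..<int m}. (cinner u (basis n) / of_real pi) *\<^sub>C basis n) =
      (\<Sum>n\<in>{- int m..<int m}. if n = k then basis k else 0)"
    by (rule sum.cong[OF refl]) (auto simp: k cinner_basis scaleC_one)
  then show "?P u" using k by simp
qed

lemma H1_subspace: "complex_vector.subspace H1"
  by (rule complex_vector.subspaceI) (auto intro: H1_zero H1_add H1_scaleC)

lemma Kspace_H1: "u \<in> Kspace m \<Longrightarrow> u \<in> H1"
  unfolding Kspace_def
  by (rule subsetD[OF complex_vector.span_minimal[OF _ H1_subspace]]) (auto intro: basis_H1)

lemma L_minus_Kspace:
  assumes "u \<in> Kspace m" shows "L_minus m u = 0"
proof -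
  have "complex_vector.subspace {u \<in> H1. L_minus m u = 0}"
    using L_minus_scaleC[OF H1_zero, of m 0]
    by (intro complex_vector.subspaceI)
      (auto simp: L_minus_add L_minus_scaleC intro: H1_zero H1_add H1_scaleC)
  then have "Kspace m \<subseteq> {u \<in> H1. L_minus m u = 0}"
    unfolding Kspace_def by (rule complex_vector.span_minimal[rotated]) (auto intro: basis_H1 L_minus_basis)
  then show ?thesis using assms by blast
qed

text \<open>Replaces the unbounded operator on \<open>Kspace\<close> by one of finite rank, so
  invariance, symmetry and boundedness there are inherited from \<open>R_op\<close>.\<close>

lemma L_plus_Kspace:
  assumes "u \<in> Kspace m" shows "L_plus m u = - R_op m u"
  using L_minus_Kspace[OF assms] by (simp add: L_minus_def eq_neg_iff_add_eq_0)

lemma R_op_in_Kspace: "R_op m u \<in> Kspace m"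
  unfolding R_op_eq by (intro Kspace_sum Kspace_scaleC beta_in_Kspace) auto

lemma L_plus_in_Kspace: "u \<in> Kspace m \<Longrightarrow> L_plus m u \<in> Kspace m"
  by (simp add: L_plus_Kspace Kspace_neg R_op_in_Kspace)

lemma R_op_symmetric: "cinner (R_op m u) v = cinner u (R_op m v)"
  unfolding R_op_eq cinner_sum_left cinner_sum_right cinner_scaleC_left cinner_scaleC_right
  by (intro sum.cong refl) (simp add: cinner_commute[of "beta _" v])

lemma R_op_bounded: "\<exists>C\<ge>0. \<forall>u. norm (R_op m u) \<le> C * norm u"
proof (intro exI conjI allI)
  let ?C = "\<Sum>j<m. \<Sum>k<m. 1 / (2 * pi) * (norm (beta (int j - int k)) * norm (beta (int j - int k)))"
  show "0 \<le> ?C" by (intro sum_nonneg) simp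
  fix u
  have "norm (R_op m u) \<le> (\<Sum>j<m. \<Sum>k<m. 1 / (2 * pi) * (norm u * norm (beta (int j - int k))) * norm (beta (int j - int k)))"
    unfolding R_op_eq
    by (intro sum_norm_le) (auto simp: norm_scaleC norm_mult norm_divide intro!: mult_right_mono divide_right_mono cinner_Cauchy_Schwarz)
  also have "\<dots> = ?C * norm u"
    unfolding sum_distrib_right by (intro sum.cong refl) simp
  finally show "norm (R_op m u) \<le> ?C * norm u" .
qed

text \<open>The sum telescopes, since \<open>zeta 1 x - 1 = - 2 * rho 1 x\<close>: it is
  \<open>-1/2\<close> times the difference of \<open>zeta 1 ^ m\<close> and its inverse. This is the
  square-integrable companion of the resonance among combinations of these two powers.\<close>

definition null_vector :: "nat \<Rightarrow> L2" where
  "null_vector m = (\<Sum>n\<in>{- int m..<int m}. basis n)"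

lemma null_vector_in_Kspace: "null_vector m \<in> Kspace m"
  unfolding null_vector_def by (intro Kspace_sum basis_in_Kspace) auto

lemma cinner_null_vector: "- int m \<le> n \<Longrightarrow> n < int m \<Longrightarrow> cinner (null_vector m) (basis n) = of_real pi"
  unfolding null_vector_def cinner_sum_left cinner_basis by (subst sum.delta) auto

text \<open>\<open>\<langle>R u, u\<rangle>\<close> is a sum of squares \<open>|\<langle>u, \<beta>\<^sub>p\<rangle>|\<^sup>2\<close>, and \<open>\<beta>\<^sub>p\<close> is a difference of neighbouring basis
  vectors, so \<open>R u = 0\<close> forces all coefficients of \<open>u\<close> to agree.\<close>

lemma L_plus_Kspace_kernel:
  assumes "u \<in> Kspace m" "m \<ge> 1"
  shows "L_plus m u = 0 \<longleftrightarrow> (\<exists>c. u = c *\<^sub>C null_vector m)"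
proof
  assume "\<exists>c. u = c *\<^sub>C null_vector m"
  then obtain c where c: "u = c *\<^sub>C null_vector m" by blast
  have "cinner (null_vector m) (beta (int j - int k)) = 0" if "j < m" "k < m" for j k
    using that by (simp add: beta_def cinner_diff_right cinner_null_vector)
  then have "R_op m (null_vector m) = 0" unfolding R_op_eq by simp
  then show "L_plus m u = 0" using assms by (simp add: L_plus_Kspace c R_op_scaleC)
next
  assume "L_plus m u = 0"
  then have R0: "R_op m u = 0" using L_plus_Kspace[OF assms(1)] by simp
  define q where "q j k = 1 / (2 * pi) * (cmod (cinner u (beta (int j - int k))))\<^sup>2" for j k
  have t: "of_real (1 / (2 * pi)) * cinner u b * cinner b u = complex_of_real (1 / (2 * pi) * (cmod (cinner u b))\<^sup>2)" for b
  proof -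
    have "cinner u b * cinner b u = of_real ((cmod (cinner u b))\<^sup>2)"
      by (subst cinner_commute[of b u]) (rule complex_norm_square[symmetric])
    then show ?thesis by (simp only: mult.assoc of_real_mult)
  qed
  have "cinner (R_op m u) u = (\<Sum>j<m. \<Sum>k<m. of_real (q j k))"
    unfolding R_op_eq cinner_sum_left cinner_scaleC_left q_def by (intro sum.cong refl t)
  then have "complex_of_real (\<Sum>j<m. \<Sum>k<m. q j k) = 0" by (simp add: R0)
  then have "(\<Sum>j<m. \<Sum>k<m. q j k) = 0" by (simp only: of_real_eq_0_iff)
  moreover have q: "0 \<le> q j k" for j k by (simp add: q_def)
  ultimately have "\<forall>j\<in>{..<m}. (\<Sum>k<m. q j k) = 0"
    by (subst (asm) sum_nonneg_eq_0_iff) (auto intro!: sum_nonneg)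
  then have "q j k = 0" if "j < m" "k < m" for j k
    using that q by (auto simp: sum_nonneg_eq_0_iff)
  then have b0: "cinner u (beta (int j - int k)) = 0" if "j < m" "k < m" for j k
    using that by (force simp: q_def)
  have neighbour: "cinner u (basis p) = cinner u (basis (p - 1))" if "- int m < p" "p < int m" for p
  proof -
    \<comment> \<open>The positive and the negative part of \<open>p\<close> exhibit it as a
      difference of two indices below \<open>m\<close>.\<close>
    have p: "int (nat p) - int (nat (- p)) = p" by auto
    have "nat p < m" "nat (- p) < m" using that by auto
    then have "cinner u (beta p) = 0" using b0[of "nat p" "nat (- p)"] p by simp
    then show ?thesis by (simp add: beta_def cinner_diff_right)
  qed
  have const: "cinner u (basis n) = cinner u (basis (- int m))" if "- int m \<le> n" "n < int m" for n
    using that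
  proof (induction n rule: int_ge_induct)
    case (step i)
    then show ?case using neighbour[of "i + 1"] by simp
  qed simp
  have "u = (\<Sum>n\<in>{- int m..<int m}. (cinner u (basis (- int m)) / of_real pi) *\<^sub>C basis n)"
  proof -
    have "(\<Sum>n\<in>{- int m..<int m}. (cinner u (basis n) / of_real pi) *\<^sub>C basis n) =
        (\<Sum>n\<in>{- int m..<int m}. (cinner u (basis (- int m)) / of_real pi) *\<^sub>C basis n)"
      by (rule sum.cong[OF refl]) (simp only: const atLeastLessThan_iff)
    then show ?thesis using Kspace_expand[OF assms(1)] by argo
  qed
  then show "\<exists>c. u = c *\<^sub>C null_vector m"
    unfolding null_vector_def complex_vector.scale_sum_right by blast
qed

section \<open>The isometry \<open>W_op\<close> and the orthogonal decomposition\<close>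

lemma half_proj_hardy:
  assumes s: "s = 1 \<or> s = -1"
  shows "u \<in> hardy s \<Longrightarrow> half_proj s u = u" "u \<in> hardy (- s) \<Longrightarrow> half_proj s u = 0"
proof -
  have F: "fourier (half_proj s u) = mul_L2 (\<lambda>\<xi>. if s * \<xi> > 0 then 1 else 0) (fourier u)"
    by (simp add: half_proj_def)
  note A = AE_rep_mul_L2[OF bounded_multiplier_half, of s "fourier u"]
  show "half_proj s u = u" if "u \<in> hardy s"
  proof -
    have "fourier (half_proj s u) = fourier u"
      unfolding F L2_eq_iff using A hardyD[OF that] AE_lborel_singleton[of 0]
      by eventually_elim (use s in auto)
    then show ?thesis by simp
  qed
  show "half_proj s u = 0" if "u \<in> hardy (- s)"
  proof -
    have "fourier (half_proj s u) = fourier 0"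
      unfolding F fourier_zero L2_eq_iff using A hardyD[OF that] AE_rep_L2_zero
      by eventually_elim auto
    then show ?thesis by (simp only: fourier_inject)
  qed
qed

lemma half_proj_decomp:
  assumes "a \<in> hardy 1" "b \<in> hardy (- 1)"
  shows "half_proj 1 (a + b) = a" "half_proj (- 1) (a + b) = b"
  using half_proj_hardy[of 1] half_proj_hardy[of "- 1"] assms by (simp_all add: half_proj_add)

lemma H1_half_proj:
  assumes "u \<in> H1" shows "half_proj s u \<in> H1"
proof (rule H1I)
  let ?h = "\<lambda>\<xi>. (if s * \<xi> > 0 then 1 else 0 :: complex)"
  show "fourier (half_proj s u) = abs_L2 (\<lambda>\<xi>. ?h \<xi> * rep_L2 (fourier u) \<xi>)"
    by (simp add: half_proj_def mul_L2_def)
  show "square_integrable (\<lambda>\<xi>. ?h \<xi> * rep_L2 (fourier u) \<xi>)"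
    by (intro square_integrable_multiplier bounded_multiplier_half square_integrable_rep_L2)
  show "square_integrable (\<lambda>\<xi>. of_real \<xi> * (?h \<xi> * rep_L2 (fourier u) \<xi>))"
    using square_integrable_multiplier[OF bounded_multiplier_half assms[unfolded H1_iff], of s]
    by (simp add: mult.left_commute)
qed

lemma abs_nabla_half_proj:
  assumes "u \<in> H1"
  shows "half_proj 1 (abs_nabla u) = abs_nabla (half_proj 1 u)"
    "half_proj (- 1) (abs_nabla u) = abs_nabla (half_proj (- 1) u)"
proof -
  have "abs_nabla u = abs_nabla (half_proj 1 u + half_proj (- 1) u)" by (simp add: half_proj_sum)
  also have "\<dots> = abs_nabla (half_proj 1 u) + abs_nabla (half_proj (- 1) u)"
    by (rule abs_nabla_add) (simp_all add: H1_half_proj assms)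
  finally have eq: "abs_nabla u = abs_nabla (half_proj 1 u) + abs_nabla (half_proj (- 1) u)" .
  have h: "abs_nabla (half_proj s u) \<in> hardy s" for s
    by (rule abs_nabla_in_hardy[OF half_proj_in_hardy H1_half_proj[OF assms]])
  show "half_proj 1 (abs_nabla u) = abs_nabla (half_proj 1 u)"
    "half_proj (- 1) (abs_nabla u) = abs_nabla (half_proj (- 1) u)"
    unfolding eq by (rule half_proj_decomp[OF h h])+
qed

lemma W_op_add: "W_op m (u + v) = W_op m u + W_op m v"
  by (simp add: W_op_def half_proj_add mul_L2_add)

lemma W_op_scaleC: "W_op m (c *\<^sub>C u) = c *\<^sub>C W_op m u"
  by (simp add: W_op_def half_proj_scaleC mul_L2_scaleC scaleC_add_right)

lemma W_op_minus: "W_op m (- u) = - W_op m u"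
  using W_op_scaleC[of m "-1" u] by (simp add: scaleC_minus1)

lemma W_op_diff: "W_op m (u - v) = W_op m u - W_op m v"
  using W_op_add[of m u "- v"] by (simp add: W_op_minus)

text \<open>The powers are unimodular and each keeps its own Hardy space, so the two halves stay
  orthogonal and Pythagoras applies before and after.\<close>

lemma norm_W_op: "norm (W_op m u) = norm u"
proof -
  have o: "cinner a b = 0" if "a \<in> hardy 1" "b \<in> hardy (- 1)" for a b
    by (rule hardy_orthogonal[of 1]) (use that in auto)
  have h: "zeta_pow s m (half_proj s u) \<in> hardy s" if "s = 1 \<or> s = - 1" for s
    by (rule hardy_zeta_pow[OF that half_proj_in_hardy])
  have "(norm (W_op m u))\<^sup>2 = (norm (half_proj 1 u))\<^sup>2 + (norm (half_proj (- 1) u))\<^sup>2"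
    unfolding W_op_def using norm_add_orthogonal[OF o[OF h h]] by (simp add: norm_zeta_pow)
  also have "\<dots> = (norm (half_proj 1 u + half_proj (- 1) u))\<^sup>2"
    by (rule norm_add_orthogonal[symmetric], rule o) (rule half_proj_in_hardy)+
  finally show ?thesis by (simp add: half_proj_sum)
qed

lemma W_op_eq_0 [simp]: "W_op m u = 0 \<longleftrightarrow> u = 0"
  using norm_W_op[of m u] by (metis norm_eq_zero)

text \<open>Moving the powers to the other side shifts \<open>n\<close> to \<open>n - m < 0\<close>
  against the upper half and to \<open>n + m \<ge> 0\<close> against the lower half: opposite Hardy
  spaces in both cases.\<close>

lemma W_op_orthogonal_basis:
  assumes "- int m \<le> n" "n < int m"
  shows "cinner (W_op m u) (basis n) = 0"
proof -
  have c: "cinner (zeta_pow s m v) (basis n) = cinner v (zeta_pow (- s) m (basis n))" for s v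
    by (simp add: cinner_mul_L2 cnj_zeta)
  have "cinner (half_proj 1 u) (basis (n - int m)) = 0"
    by (rule hardy_orthogonal[of 1]) (use assms in \<open>auto intro: half_proj_in_hardy basis_hardy\<close>)
  moreover have "cinner (half_proj (- 1) u) (basis (n + int m)) = 0"
    by (rule hardy_orthogonal[of "- 1"]) (use assms in \<open>auto intro: half_proj_in_hardy basis_hardy\<close>)
  ultimately show ?thesis
    unfolding W_op_def cinner_add_left c by (simp add: zeta_pow_basis)
qed

lemma W_op_orthogonal:
  assumes "k \<in> Kspace m" shows "cinner (W_op m u) k = 0"
proof -
  have "complex_vector.subspace {k. cinner (W_op m u) k = 0}"
    by (rule complex_vector.subspaceI) (auto simp: cinner_add_right cinner_scaleC_right)
  then have "Kspace m \<subseteq> {k. cinner (W_op m u) k = 0}"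
    unfolding Kspace_def by (rule complex_vector.span_minimal[rotated]) (auto intro: W_op_orthogonal_basis)
  then show ?thesis using assms by blast
qed

lemma norm_decomposition:
  assumes "k \<in> Kspace m"
  shows "norm k \<le> norm (k + W_op m u)" "norm u \<le> norm (k + W_op m u)"
proof -
  have "cinner k (W_op m u) = 0"
    using W_op_orthogonal[OF assms] cinner_commute[of k "W_op m u"] by simp
  then have "(norm (k + W_op m u))\<^sup>2 = (norm k)\<^sup>2 + (norm u)\<^sup>2"
    by (simp add: norm_add_orthogonal norm_W_op)
  then show "norm k \<le> norm (k + W_op m u)" "norm u \<le> norm (k + W_op m u)"
    by (auto intro: power2_le_imp_le)
qed

lemma decomposition_zero:
  assumes "k \<in> Kspace m" "k + W_op m u = 0"
  shows "k = 0" "u = 0"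
  using norm_decomposition[OF assms(1), of u] assms(2) by simp_all

lemma decomposition_unique:
  assumes "k \<in> Kspace m" "k' \<in> Kspace m" "k + W_op m u = k' + W_op m u'"
  shows "k = k'" "u = u'"
proof -
  have "(k - k') + W_op m (u - u') = 0" using assms(3) by (simp add: W_op_diff algebra_simps)
  from decomposition_zero[OF Kspace_diff[OF assms(1,2)] this] show "k = k'" "u = u'" by simp_all
qed

text \<open>A Wold decomposition for multiplication by \<open>zeta s\<close>: at each step the part
  orthogonal to \<open>rho_L2 s\<close> can be divided by \<open>zeta s\<close> within the Hardy
  space, and the removed part joins the span.\<close>

lemma hardy_decomposition:
  assumes s: "s = 1 \<or> s = -1"
  shows "h \<in> hardy s \<Longrightarrow> \<exists>k\<in>cspan ((\<lambda>j. zeta_pow s j (rho_L2 s)) ` {..<n}). \<exists>h'\<in>hardy s. h = k + zeta_pow s n h'"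
proof (induction n)
  case 0
  then show ?case by (auto intro!: bexI[of _ h] complex_vector.span_zero)
next
  case (Suc n)
  then obtain k h' where k: "k \<in> cspan ((\<lambda>j. zeta_pow s j (rho_L2 s)) ` {..<n})"
    and h': "h' \<in> hardy s" "h = k + zeta_pow s n h'" by blast
  have r0: "cinner (rho_L2 s) (rho_L2 s) \<noteq> 0"
    using s cinner_basis[of 0 0] cinner_basis[of "-1" "-1"]
    by (auto simp: rho_minus_basis basis_0 cinner_minus_left cinner_minus_right)
  \<comment> \<open>The coefficient of the orthogonal projection onto \<open>rho_L2 s\<close>, which
    makes the remainder satisfy the hypothesis of \<open>hardy_mul_zeta_minus\<close>.\<close>
  define c where "c = cinner h' (rho_L2 s) / cinner (rho_L2 s) (rho_L2 s)"
  define g where "g = h' - c *\<^sub>C rho_L2 s"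
  have g: "g \<in> hardy s" unfolding g_def by (intro hardy_diff hardy_scaleC h' rho_in_hardy s)
  have "cinner g (rho_L2 s) = 0"
    using r0 by (simp add: g_def c_def cinner_diff_left cinner_scaleC_left)
  then have g': "mul_L2 (zeta (- s)) g \<in> hardy s" by (rule hardy_mul_zeta_minus[OF s g])
  have "zeta_pow s (Suc n) (mul_L2 (zeta (- s)) g) = zeta_pow s n g"
    by (simp add: mul_L2_mul_L2 bounded_multiplier_mult mult.assoc mult.left_commute[of "zeta s _" "zeta s _ ^ n"])
  then have "h = (k + c *\<^sub>C zeta_pow s n (rho_L2 s)) + zeta_pow s (Suc n) (mul_L2 (zeta (- s)) g)"
    unfolding h'(2) g_def by (simp add: mul_L2_diff mul_L2_scaleC)
  moreover have "k + c *\<^sub>C zeta_pow s n (rho_L2 s) \<in> cspan ((\<lambda>j. zeta_pow s j (rho_L2 s)) ` {..<Suc n})"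
  proof (intro complex_vector.span_add complex_vector.span_scale)
    show "k \<in> cspan ((\<lambda>j. zeta_pow s j (rho_L2 s)) ` {..<Suc n})"
      using complex_vector.span_mono[of "(\<lambda>j. zeta_pow s j (rho_L2 s)) ` {..<n}" "(\<lambda>j. zeta_pow s j (rho_L2 s)) ` {..<Suc n}"] k
      by (auto simp: image_mono lessThan_Suc)
    show "zeta_pow s n (rho_L2 s) \<in> cspan ((\<lambda>j. zeta_pow s j (rho_L2 s)) ` {..<Suc n})"
      by (rule complex_vector.span_base) auto
  qed
  ultimately show ?case using g' by blast
qed

lemma decomposition_exists: "\<exists>k\<in>Kspace m. \<exists>v. u = k + W_op m v"
proof -
  obtain k1 h1 where 1: "k1 \<in> cspan ((\<lambda>j. zeta_pow 1 j (rho_L2 1)) ` {..<m})" "h1 \<in> hardy 1"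
    "half_proj 1 u = k1 + zeta_pow 1 m h1"
    using hardy_decomposition[of 1 "half_proj 1 u" m] half_proj_in_hardy by auto
  obtain k2 h2 where 2: "k2 \<in> cspan ((\<lambda>j. zeta_pow (- 1) j (rho_L2 (- 1))) ` {..<m})" "h2 \<in> hardy (- 1)"
    "half_proj (- 1) u = k2 + zeta_pow (- 1) m h2"
    using hardy_decomposition[of "- 1" "half_proj (- 1) u" m] half_proj_in_hardy by auto
  have "cspan ((\<lambda>j. zeta_pow 1 j (rho_L2 1)) ` {..<m}) \<subseteq> Kspace m"
    by (rule complex_vector.span_minimal[OF _ Kspace_subspace])
      (auto simp: basis_nonneg[symmetric] intro: basis_in_Kspace)
  moreover have "cspan ((\<lambda>j. zeta_pow (- 1) j (rho_L2 (- 1))) ` {..<m}) \<subseteq> Kspace m"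
    by (rule complex_vector.span_minimal[OF _ Kspace_subspace])
      (auto simp: zeta_pow_rho_minus intro!: Kspace_neg basis_in_Kspace)
  ultimately have K: "k1 + k2 \<in> Kspace m" using 1 2 by (blast intro: Kspace_add)
  have "u = half_proj 1 u + half_proj (- 1) u" by (simp add: half_proj_sum)
  also have "\<dots> = (k1 + k2) + W_op m (h1 + h2)"
    unfolding W_op_def half_proj_decomp[OF 1(2) 2(2)] 1(3) 2(3) by simp
  finally show ?thesis using K by blast
qed

text \<open>The term \<open>m * omega\<close> created by the powers cancels the potential.
  \<open>R\<close> vanishes on the image because it only tests against \<open>beta p\<close> with
  \<open>|p| < m\<close>, all of which lie in \<open>Kspace\<close>.\<close>

lemma W_op_H1:
  assumes "u \<in> H1"
  shows "W_op m u \<in> H1" "L_plus m (W_op m u) = W_op m (abs_nabla u)" "L_minus m (W_op m u) = W_op m (abs_nabla u)"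
proof -
  note h = H1_half_proj[OF assms]
  have z: "zeta_pow s m (half_proj s u) \<in> H1" if "s = 1 \<or> s = -1" for s
    using H1_zeta_pow[OF that h] by blast
  show "W_op m u \<in> H1" unfolding W_op_def by (intro H1_add z) auto
  have n: "abs_nabla (zeta_pow s m (half_proj s u)) =
      zeta_pow s m (abs_nabla (half_proj s u)) + of_nat m *\<^sub>C mul_L2 omega (zeta_pow s m (half_proj s u))"
    if "s = 1 \<or> s = -1" for s
    by (rule abs_nabla_zeta_pow[OF that half_proj_in_hardy h])
  have "abs_nabla (W_op m u) = W_op m (abs_nabla u) + of_nat m *\<^sub>C mul_L2 omega (W_op m u)"
    unfolding W_op_def abs_nabla_half_proj[OF assms]
    using abs_nabla_add[OF z z, of 1 "-1"] n[of 1] n[of "-1"]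
    by (simp add: mul_L2_add scaleC_add_right)
  then show L: "L_plus m (W_op m u) = W_op m (abs_nabla u)"
    by (simp add: L_plus_def potential_op_eq)
  have "cinner (W_op m u) (beta (int j - int k)) = 0" if "j < m" "k < m" for j k
    by (rule W_op_orthogonal, rule beta_in_Kspace) (use that in auto)
  then have "R_op m (W_op m u) = 0" unfolding R_op_eq by simp
  then show "L_minus m (W_op m u) = W_op m (abs_nabla u)" by (simp add: L_minus_def L)
qed

text \<open>For the converse the halves of the image are separated by \<open>half_proj\<close> and
  multiplied by the inverse powers; \<open>H1_zeta_pow\<close> applies to any element of
  \<open>H1\<close>, in or out of the Hardy space. This lets the decomposition restrict to
  \<open>H1\<close>.\<close>

lemma W_op_H1_iff: "W_op m u \<in> H1 \<longleftrightarrow> u \<in> H1"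
proof
  assume W: "W_op m u \<in> H1"
  have hz: "zeta_pow s m (half_proj s u) \<in> hardy s" if "s = 1 \<or> s = -1" for s
    by (rule hardy_zeta_pow[OF that half_proj_in_hardy])
  have p: "half_proj 1 (W_op m u) = zeta_pow 1 m (half_proj 1 u)"
    "half_proj (- 1) (W_op m u) = zeta_pow (- 1) m (half_proj (- 1) u)"
    unfolding W_op_def by (rule half_proj_decomp; rule hz; simp)+
  have inv: "zeta_pow (- s) m (zeta_pow s m v) = v" for s v
    by (simp add: mul_L2_mul_L2 power_mult_distrib[symmetric])
  have "zeta_pow (- 1) m (half_proj 1 (W_op m u)) \<in> H1" "zeta_pow 1 m (half_proj (- 1) (W_op m u)) \<in> H1"
    using H1_zeta_pow[OF _ H1_half_proj[OF W]] by auto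
  then have "half_proj 1 u \<in> H1" "half_proj (- 1) u \<in> H1"
    unfolding p using inv[of 1] inv[of "- 1"] by simp_all
  then show "u \<in> H1" using H1_add(1)[of "half_proj 1 u" "half_proj (- 1) u"] by (simp add: half_proj_sum)
qed (rule W_op_H1)

lemma H1_decomposition:
  assumes "u \<in> H1"
  obtains k v where "k \<in> Kspace m" "v \<in> H1" "u = k + W_op m v"
proof -
  obtain k v where kv: "k \<in> Kspace m" "u = k + W_op m v" using decomposition_exists by blast
  have "W_op m v = u - k" using kv by simp
  then have "W_op m v \<in> H1" using H1_diff[OF assms Kspace_H1[OF kv(1)]] by simp
  then show ?thesis using that kv by (simp add: W_op_H1_iff)
qed

section \<open>The multiplication operator\<close>

text \<open>The symbol \<open>c * \<bar>\<xi>\<bar> - z\<close> can vanish only where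
  \<open>\<bar>\<xi>\<bar> = cmod z\<close>, at most two points, hence a null set.\<close>

lemma abs_nabla_no_eigenvector:
  assumes "p \<in> H1" "cmod c = 1" "c *\<^sub>C abs_nabla p = z *\<^sub>C p"
  shows "p = 0"
proof -
  have eq: "fourier (c *\<^sub>C abs_nabla p) = fourier (z *\<^sub>C p)" using assms(3) by simp
  have "fourier p = fourier 0"
    unfolding fourier_zero L2_eq_iff
    using AE_fourier_abs_nabla[OF assms(1)] AE_rep_L2_scaleC[of c "fourier (abs_nabla p)"]
      AE_rep_L2_scaleC[of z "fourier p"] eq[unfolded fourier_scaleC L2_eq_iff] AE_rep_L2_zero
      AE_lborel_singleton[of "cmod z"] AE_lborel_singleton[of "- cmod z"]
  proof eventually_elim
    case (elim \<xi>)
    have "(c * of_real \<bar>\<xi>\<bar> - z) * rep_L2 (fourier p) \<xi> = 0"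
      using elim(1-4) by (auto simp: algebra_simps)
    moreover have "c * of_real \<bar>\<xi>\<bar> - z \<noteq> 0"
    proof
      assume "c * of_real \<bar>\<xi>\<bar> - z = 0"
      then have "cmod z = cmod (c * of_real \<bar>\<xi>\<bar>)" by simp
      then have "cmod z = \<bar>\<xi>\<bar>" using assms(2) by (simp add: norm_mult)
      then show False using elim(6,7) by auto
    qed
    ultimately show ?case using elim(5) by simp
  qed
  then show ?thesis by (simp only: fourier_inject)
qed

text \<open>The quadratic form of \<open>|nabla|\<close> is real, so after multiplication by
  \<open>\<i>\<close> or \<open>- \<i>\<close> it contributes nothing to the real part of the
  pairing with \<open>p\<close>.\<close>

lemma abs_nabla_resolvent_bound:
  assumes "p \<in> H1" "c = \<i> \<or> c = - \<i>"
  shows "\<bar>Re z\<bar> * norm p \<le> norm (c *\<^sub>C abs_nabla p - z *\<^sub>C p)"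
proof (cases "p = 0")
  case False
  have "Im (cinner (abs_nabla p) p) = 0"
    using abs_nabla_symmetric[OF assms(1) assms(1)] cinner_commute[of p "abs_nabla p"]
    by (metis complex_cnj_cancel_iff complex_In_mult_cnj_zero complex_cnj_complex_of_real complex_is_Real_iff Reals_cnj_iff)
  then have "Re (cinner (c *\<^sub>C abs_nabla p - z *\<^sub>C p) p) = - Re z * (norm p)\<^sup>2"
    using assms(2) by (auto simp: cinner_diff_left cinner_scaleC_left cinner_self)
  then have "\<bar>Re z\<bar> * (norm p)\<^sup>2 \<le> cmod (cinner (c *\<^sub>C abs_nabla p - z *\<^sub>C p) p)"
    using abs_Re_le_cmod[of "cinner (c *\<^sub>C abs_nabla p - z *\<^sub>C p) p"] by (simp add: abs_mult)
  also have "\<dots> \<le> norm (c *\<^sub>C abs_nabla p - z *\<^sub>C p) * norm p" by (rule cinner_Cauchy_Schwarz)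
  finally have "(\<bar>Re z\<bar> * norm p) * norm p \<le> norm (c *\<^sub>C abs_nabla p - z *\<^sub>C p) * norm p"
    by (simp add: power2_eq_square mult.assoc)
  then show ?thesis using False by (simp add: mult_le_cancel_right)
qed simp

lemma abs_nabla_resolvent_exists:
  assumes "Re z \<noteq> 0" "c = \<i> \<or> c = - \<i>"
  obtains p where "p \<in> H1" "c *\<^sub>C abs_nabla p - z *\<^sub>C p = g"
proof -
  define d where "d \<xi> = c * of_real \<bar>\<xi>\<bar> - z" for \<xi>
  have dm [measurable]: "d \<in> borel_measurable borel" unfolding d_def by measurable
  have Re_d: "\<bar>Re z\<bar> \<le> cmod (d \<xi>)" for \<xi>
    using abs_Re_le_cmod[of "d \<xi>"] assms(2) by (auto simp: d_def)
  have d0: "d \<xi> \<noteq> 0" for \<xi> using Re_d[of \<xi>] assms(1) by auto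
  define b where "b \<xi> = 1 / d \<xi>" for \<xi>
  have bm: "b \<in> borel_measurable borel" unfolding b_def by measurable
  have b: "cmod (b \<xi>) \<le> 1 / \<bar>Re z\<bar>" for \<xi>
    unfolding b_def norm_divide using Re_d[of \<xi>] assms(1) by (simp add: frac_le)
  have bb: "bounded_multiplier b" by (rule bounded_multiplierI[OF bm b])
  \<comment> \<open>Beyond boundedness of the inverse symbol, one extra factor \<open>\<xi>\<close>
    must be controlled for the solution to lie in \<open>H1\<close>; it is, since
    \<open>\<bar>\<xi>\<bar>\<close> is at most \<open>cmod (d \<xi>) + cmod z\<close>.\<close>
  have bx: "cmod (of_real \<xi> * b \<xi>) \<le> 1 + cmod z / \<bar>Re z\<bar>" for \<xi>
  proof -
    have "\<bar>\<xi>\<bar> = cmod (d \<xi> + z)" using assms(2) by (auto simp: d_def norm_mult)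
    also have "\<dots> \<le> cmod (d \<xi>) + cmod z" by (rule norm_triangle_ineq)
    finally have "\<bar>\<xi>\<bar> * cmod (b \<xi>) \<le> (cmod (d \<xi>) + cmod z) * cmod (b \<xi>)"
      by (rule mult_right_mono) simp
    also have "\<dots> = 1 + cmod z * cmod (b \<xi>)"
      using d0[of \<xi>] by (simp add: b_def norm_divide field_simps)
    also have "\<dots> \<le> 1 + cmod z * (1 / \<bar>Re z\<bar>)"
      by (intro add_left_mono mult_left_mono b) simp
    finally show ?thesis by (simp add: norm_mult)
  qed
  let ?G = "rep_L2 (fourier g)"
  define p where "p = inv_fourier (abs_L2 (\<lambda>\<xi>. b \<xi> * ?G \<xi>))"
  have F: "fourier p = abs_L2 (\<lambda>\<xi>. b \<xi> * ?G \<xi>)" by (simp add: p_def)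
  have S: "square_integrable (\<lambda>\<xi>. b \<xi> * ?G \<xi>)"
    by (rule square_integrable_multiplier[OF bb square_integrable_rep_L2])
  have p: "p \<in> H1"
  proof (rule H1I[OF F S])
    have "square_integrable (\<lambda>\<xi>. (of_real \<xi> * b \<xi>) * ?G \<xi>)"
      by (rule square_integrable_mult_bounded[OF square_integrable_rep_L2 _ bx]) (use bm in measurable)
    then show "square_integrable (\<lambda>\<xi>. of_real \<xi> * (b \<xi> * ?G \<xi>))" by (simp add: mult.assoc)
  qed
  have "fourier (c *\<^sub>C abs_nabla p - z *\<^sub>C p) = fourier g"
    unfolding L2_eq_iff fourier_diff fourier_scaleC
    using AE_fourier_abs_nabla[OF p] AE_rep_L2_scaleC[of c "fourier (abs_nabla p)"]
      AE_rep_L2_scaleC[of z "fourier p"] AE_rep_L2_diff[of "c *\<^sub>C fourier (abs_nabla p)" "z *\<^sub>C fourier p"]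
      AE_rep_abs_L2[OF S, folded F]
  proof eventually_elim
    case (elim \<xi>)
    have "rep_L2 (c *\<^sub>C fourier (abs_nabla p) - z *\<^sub>C fourier p) \<xi> = d \<xi> * (b \<xi> * ?G \<xi>)"
      using elim by (simp add: d_def algebra_simps)
    then show ?case using d0[of \<xi>] by (simp add: b_def)
  qed
  then show ?thesis using that[OF p] by simp
qed

text \<open>A Weyl sequence: take the frequencies in \<open>[r, r + \<epsilon>]\<close>, on which
  the symbol differs from \<open>r\<close> by at most \<open>\<epsilon>\<close>.\<close>

lemma abs_nabla_approximate_eigenvector:
  assumes "r \<ge> 0" "\<epsilon> > 0"
  obtains v where "v \<in> H1" "v \<noteq> 0" "norm (abs_nabla v - complex_of_real r *\<^sub>C v) \<le> \<epsilon> * norm v"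
proof -
  define I :: "real \<Rightarrow> complex" where "I = indicator {r..r + \<epsilon>}"
  have S: "square_integrable I" unfolding I_def by (rule square_integrable_indicator)
  define v where "v = inv_fourier (abs_L2 I)"
  have F: "fourier v = abs_L2 I" by (simp add: v_def)
  have S': "square_integrable (\<lambda>\<xi>. of_real \<xi> * I \<xi>)"
    by (rule square_integrable_bound[OF S, where C = "r + \<epsilon>"])
      (use assms in \<open>auto simp: I_def norm_mult indicator_def\<close>)
  have v: "v \<in> H1" by (rule H1I[OF F S S'])
  have "(norm (abs_L2 I))\<^sup>2 = \<epsilon>"
  proof -
    have "(\<lambda>x. (cmod (I x))\<^sup>2) = (indicator {r..r + \<epsilon>} :: real \<Rightarrow> real)" by (auto simp: I_def indicator_def)
    then show ?thesis using norm_abs_L2_square[OF S] assms by simp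
  qed
  then have "fourier v \<noteq> 0" using assms F by auto
  then have v0: "v \<noteq> 0" by auto
  have Ff: "fourier (abs_nabla v - complex_of_real r *\<^sub>C v) = abs_L2 (\<lambda>\<xi>. (of_real \<bar>\<xi>\<bar> - of_real r) * I \<xi>)"
    unfolding fourier_diff fourier_scaleC
  proof (rule L2_eqI_abs)
    show "square_integrable (\<lambda>\<xi>. (of_real \<bar>\<xi>\<bar> - of_real r) * I \<xi>)"
      by (rule square_integrable_bound[OF S, where C = "\<epsilon>"])
        (auto simp: I_def norm_mult indicator_def simp flip: of_real_diff, (use assms in linarith)+)
    show "AE x in lborel. rep_L2 (fourier (abs_nabla v) - complex_of_real r *\<^sub>C fourier v) x = (of_real \<bar>x\<bar> - of_real r) * I x"
      using AE_fourier_abs_nabla[OF v] AE_rep_L2_scaleC[of "of_real r" "fourier v"]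
        AE_rep_L2_diff[of "fourier (abs_nabla v)" "of_real r *\<^sub>C fourier v"] AE_rep_abs_L2[OF S, folded F]
      by eventually_elim (simp add: algebra_simps)
  qed
  have "norm (fourier (abs_nabla v - complex_of_real r *\<^sub>C v)) \<le> \<epsilon> * norm (fourier v)"
    unfolding Ff F
  proof (rule norm_L2_le_pointwise)
    show S2: "square_integrable (\<lambda>\<xi>. (of_real \<bar>\<xi>\<bar> - of_real r) * I \<xi>)"
      by (rule square_integrable_bound[OF S, where C = "\<epsilon>"])
        (auto simp: I_def norm_mult indicator_def simp flip: of_real_diff, (use assms in linarith)+)
    show "AE x in lborel. cmod ((of_real \<bar>x\<bar> - of_real r) * I x) \<le> \<epsilon> * cmod (I x)"
      using assms by (intro AE_I2) (auto simp: I_def norm_mult indicator_def simp flip: of_real_diff)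
  qed (use S assms in auto)
  then have "sqrt (2 * pi) * norm (abs_nabla v - complex_of_real r *\<^sub>C v) \<le> sqrt (2 * pi) * (\<epsilon> * norm v)"
    unfolding norm_fourier by (simp add: mult.left_commute)
  then have "norm (abs_nabla v - complex_of_real r *\<^sub>C v) \<le> \<epsilon> * norm v"
    by (rule mult_left_le_imp_le) simp
  then show ?thesis using that v v0 by blast
qed

section \<open>The linearized operator\<close>

lemma W_op_zero [simp]: "W_op m 0 = 0"
  by simp

lemma L_dom_decomposition:
  assumes "w \<in> L_dom"
  obtains k1 k2 x y where "k1 \<in> Kspace m" "k2 \<in> Kspace m" "x \<in> H1" "y \<in> H1"
    "w = (k1 + W_op m x, k2 + W_op m y)"
proof -
  obtain u1 u2 where w: "w = (u1, u2)" "u1 \<in> H1" "u2 \<in> H1" using assms by (auto simp: L_dom_def)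
  obtain k1 x where 1: "k1 \<in> Kspace m" "x \<in> H1" "u1 = k1 + W_op m x" by (rule H1_decomposition[OF w(2)])
  obtain k2 y where 2: "k2 \<in> Kspace m" "y \<in> H1" "u2 = k2 + W_op m y" by (rule H1_decomposition[OF w(3)])
  show ?thesis using that 1 2 w(1) by blast
qed

text \<open>The decomposition reduces the operator to two blocks. On the \<open>Kspace\<close> part
  it sends the first slot to the second and kills the second; on the complement it acts like a
  rotation generated by \<open>|nabla|\<close>.\<close>

lemma L_op_decomposed:
  assumes "k1 \<in> Kspace m" "k2 \<in> Kspace m" "x \<in> H1" "y \<in> H1"
  shows "(k1 + W_op m x, k2 + W_op m y) \<in> L_dom"
    "L_op m (k1 + W_op m x, k2 + W_op m y) = (W_op m (- abs_nabla y), L_plus m k1 + W_op m (abs_nabla x))"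
proof -
  note K = Kspace_H1[OF assms(1)] Kspace_H1[OF assms(2)]
  note X = W_op_H1[OF assms(3), of m] and Y = W_op_H1[OF assms(4), of m]
  show "(k1 + W_op m x, k2 + W_op m y) \<in> L_dom"
    by (auto simp: L_dom_def intro!: H1_add K X Y)
  show "L_op m (k1 + W_op m x, k2 + W_op m y) = (W_op m (- abs_nabla y), L_plus m k1 + W_op m (abs_nabla x))"
    by (simp add: L_op_def L_minus_add[OF K(2) Y(1)] L_plus_add[OF K(1) X(1)] X Y
        L_minus_Kspace[OF assms(2)] W_op_minus)
qed

lemma scaleC_pair: "c *\<^sub>C (a, b) = (c *\<^sub>C a, c *\<^sub>C b)"
  by (simp add: scaleC_prod_def)

lemma norm_pair_le: "norm (a, b) \<le> norm a + norm b" "norm a \<le> norm (a, b)" "norm b \<le> norm (a, b)"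
  by (simp_all add: norm_prod_def sqrt_sum_squares_le_sum real_le_rsqrt)

lemma L_op_diff:
  assumes "u \<in> L_dom" "v \<in> L_dom"
  shows "u - v \<in> L_dom" "L_op m (u - v) = L_op m u - L_op m v"
proof -
  obtain u1 u2 v1 v2 where *: "u = (u1, u2)" "v = (v1, v2)" "u1 \<in> H1" "u2 \<in> H1" "v1 \<in> H1" "v2 \<in> H1"
    using assms by (auto simp: L_dom_def)
  then show "u - v \<in> L_dom" by (auto simp: L_dom_def intro: H1_diff)
  have P: "L_plus m (a - b) = L_plus m a - L_plus m b" if "a \<in> H1" "b \<in> H1" for a b
    using L_plus_add[OF that(1) H1_minus[OF that(2)], of m] L_plus_scaleC[OF that(2), of m "-1"]
    by (simp add: scaleC_minus1)
  have M: "L_minus m (a - b) = L_minus m a - L_minus m b" if "a \<in> H1" "b \<in> H1" for a b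
    using L_minus_add[OF that(1) H1_minus[OF that(2)], of m] L_minus_scaleC[OF that(2), of m "-1"]
    by (simp add: scaleC_minus1)
  show "L_op m (u - v) = L_op m u - L_op m v" using * by (simp add: L_op_def P M)
qed

lemma L_op_resolvent_equation:
  assumes "k1 \<in> Kspace m" "k2 \<in> Kspace m" "x \<in> H1" "y \<in> H1"
  shows "L_op m (k1 + W_op m x, k2 + W_op m y) - z *\<^sub>C (k1 + W_op m x, k2 + W_op m y) =
    (- z *\<^sub>C k1 + W_op m (- abs_nabla y - z *\<^sub>C x), (L_plus m k1 - z *\<^sub>C k2) + W_op m (abs_nabla x - z *\<^sub>C y))"
  unfolding L_op_decomposed(2)[OF assms] scaleC_pair
  by (simp add: W_op_diff W_op_scaleC W_op_minus scaleC_add_right complex_vector.scale_minus_left)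

text \<open>On the complement of \<open>Kspace\<close> the change of variables \<open>p = x + \<i>y\<close>, \<open>q = x - \<i>y\<close> diagonalizes the
  operator into \<open>\<i>|\<nabla>|\<close> and \<open>-\<i>|\<nabla>|\<close>.\<close>

lemma diagonalization:
  assumes "x \<in> H1" "y \<in> H1" "c * c = - 1"
  shows "c *\<^sub>C abs_nabla (x + c *\<^sub>C y) - z *\<^sub>C (x + c *\<^sub>C y) =
    (- abs_nabla y - z *\<^sub>C x) + c *\<^sub>C (abs_nabla x - z *\<^sub>C y)"
  unfolding abs_nabla_add[OF assms(1) H1_scaleC(1)[OF assms(2)]] abs_nabla_scaleC[OF assms(2)]
    scaleC_add_right scaleC_scaleC complex_vector.scale_right_diff_distrib assms(3) scaleC_minus1
  by (simp add: mult.commute)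

lemma half_sum_difference:
  fixes x y :: "'a::complex_normed_vector"
  shows "x = (1/2) *\<^sub>C ((x + \<i> *\<^sub>C y) + (x + (- \<i>) *\<^sub>C y))"
    "y = (- \<i>/2) *\<^sub>C ((x + \<i> *\<^sub>C y) - (x + (- \<i>) *\<^sub>C y))"
proof -
  have "(1/2) *\<^sub>C ((x + \<i> *\<^sub>C y) + (x + (- \<i>) *\<^sub>C y)) = (1/2 + 1/2) *\<^sub>C x + (\<i>/2 - \<i>/2) *\<^sub>C y"
    by (simp only: scaleC_add_right scaleC_add_left scaleC_scaleC diff_conv_add_uminus)
      (simp add: algebra_simps complex_vector.scale_minus_left)
  then show "x = (1/2) *\<^sub>C ((x + \<i> *\<^sub>C y) + (x + (- \<i>) *\<^sub>C y))" by (simp add: scaleC_one)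
  have "(x + \<i> *\<^sub>C y) - (x + (- \<i>) *\<^sub>C y) = (2 * \<i>) *\<^sub>C y"
    using scaleC_add_left[of \<i> \<i> y] by (simp add: complex_vector.scale_minus_left)
  then have "(- \<i>/2) *\<^sub>C ((x + \<i> *\<^sub>C y) - (x + (- \<i>) *\<^sub>C y)) = ((- \<i>/2) * (2 * \<i>)) *\<^sub>C y"
    by (simp only: scaleC_scaleC)
  then show "y = (- \<i>/2) *\<^sub>C ((x + \<i> *\<^sub>C y) - (x + (- \<i>) *\<^sub>C y))" by (simp add: scaleC_one)
qed

section \<open>The resolvent set and the spectrum\<close>

lemma resolvent_bound:
  assumes z: "Re z \<noteq> 0"
  shows "\<exists>C. \<forall>w\<in>L_dom. norm w \<le> C * norm (L_op m w - z *\<^sub>C w)"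
proof -
  obtain B where B: "B \<ge> 0" "\<And>u. norm (R_op m u) \<le> B * norm u" using R_op_bounded by blast
  have z0: "z \<noteq> 0" using z by auto
  define A where "A = 1 / cmod z"
  define r where "r = 1 / \<bar>Re z\<bar>"
  have A0: "A > 0" and r0: "r > 0" using z0 z by (simp_all add: A_def r_def)
  have "norm w \<le> (A + A * (1 + B * A) + 4 * r) * norm (L_op m w - z *\<^sub>C w)" if wd: "w \<in> L_dom" for w
  proof -
    obtain k1 k2 x y where kx: "k1 \<in> Kspace m" "k2 \<in> Kspace m" "x \<in> H1" "y \<in> H1"
      and w: "w = (k1 + W_op m x, k2 + W_op m y)" by (rule L_dom_decomposition[OF wd, of m])
    define a where "a = - abs_nabla y - z *\<^sub>C x"
    define b where "b = abs_nabla x - z *\<^sub>C y"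
    define N where "N = norm (L_op m w - z *\<^sub>C w)"
    have eq: "L_op m w - z *\<^sub>C w = (- z *\<^sub>C k1 + W_op m a, (L_plus m k1 - z *\<^sub>C k2) + W_op m b)"
      unfolding w a_def b_def by (rule L_op_resolvent_equation[OF kx])
    have K1: "- z *\<^sub>C k1 \<in> Kspace m" and K2: "L_plus m k1 - z *\<^sub>C k2 \<in> Kspace m"
      by (intro Kspace_scaleC Kspace_diff L_plus_in_Kspace kx)+
    have N1: "norm (- z *\<^sub>C k1 + W_op m a) \<le> N" "norm ((L_plus m k1 - z *\<^sub>C k2) + W_op m b) \<le> N"
      unfolding N_def eq by (rule norm_pair_le)+
    have a: "norm a \<le> N" and n1: "norm (- z *\<^sub>C k1) \<le> N"
      using norm_decomposition[OF K1, of a] N1(1) by linarith+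
    have b: "norm b \<le> N" and n2: "norm (L_plus m k1 - z *\<^sub>C k2) \<le> N"
      using norm_decomposition[OF K2, of b] N1(2) by linarith+
    have k1: "norm k1 \<le> A * N"
      using n1 z0 by (simp add: norm_scaleC A_def field_simps)
    \<comment> \<open>The \<open>Kspace\<close> block is triangular: the first row bounds
      \<open>k1\<close>, and \<open>k2\<close> follows from the second row since
      \<open>L_plus\<close> is bounded on \<open>Kspace\<close>.\<close>
    have "cmod z * norm k2 = norm (L_plus m k1 - (L_plus m k1 - z *\<^sub>C k2))" by (simp add: norm_scaleC)
    also have "\<dots> \<le> norm (L_plus m k1) + norm (L_plus m k1 - z *\<^sub>C k2)" by (rule norm_triangle_ineq4)
    also have "norm (L_plus m k1) \<le> B * (A * N)"
      using B(2)[of k1] mult_left_mono[OF k1 B(1)] by (simp add: L_plus_Kspace[OF kx(1)])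
    finally have "cmod z * norm k2 \<le> (1 + B * A) * N" using n2 by (simp add: algebra_simps)
    then have k2: "norm k2 \<le> A * (1 + B * A) * N"
      using z0 by (simp add: A_def field_simps)
    \<comment> \<open>Applied to \<open>x + \<i> y\<close> and \<open>x - \<i> y\<close>, where the
      complement block is diagonal; the factor 2 comes from combining both rows of the right-hand
      side.\<close>
    have pq: "norm p \<le> r * (2 * N)" if "p \<in> H1" "c = \<i> \<or> c = - \<i>" "c *\<^sub>C abs_nabla p - z *\<^sub>C p = a + c *\<^sub>C b" for p c
    proof -
      have "\<bar>Re z\<bar> * norm p \<le> norm (a + c *\<^sub>C b)"
        using abs_nabla_resolvent_bound[OF that(1,2), of z] that(3) by simp
      also have "\<dots> \<le> norm a + norm b"
        using norm_triangle_ineq[of a "c *\<^sub>C b"] that(2) by (auto simp: norm_scaleC)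
      also have "\<dots> \<le> 2 * N" using a b by simp
      finally show ?thesis using z by (simp add: r_def field_simps)
    qed
    have p: "norm (x + \<i> *\<^sub>C y) \<le> r * (2 * N)"
      by (rule pq[of _ \<i>]) (use diagonalization[OF kx(3,4), of \<i> z] kx in \<open>auto simp: a_def b_def intro: H1_add H1_scaleC\<close>)
    have q: "norm (x + (- \<i>) *\<^sub>C y) \<le> r * (2 * N)"
      by (rule pq[of _ "- \<i>"])
        (use diagonalization[OF kx(3,4), of "- \<i>" z] H1_add(1)[OF kx(3) H1_scaleC(1)[OF kx(4)], of "- \<i>"] in \<open>simp_all add: a_def b_def\<close>)
    have "norm x \<le> r * (2 * N)"
      using norm_triangle_ineq[of "x + \<i> *\<^sub>C y" "x + (- \<i>) *\<^sub>C y"] p q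
      by (subst half_sum_difference(1)[of x y]) (simp add: norm_scaleC norm_divide del: complex_vector.scale_minus_left)
    moreover have "norm y \<le> r * (2 * N)"
      using norm_triangle_ineq4[of "x + \<i> *\<^sub>C y" "x + (- \<i>) *\<^sub>C y"] p q
      by (subst half_sum_difference(2)[of y x]) (simp add: norm_scaleC norm_divide del: complex_vector.scale_minus_left)
    moreover have "norm w \<le> (norm k1 + norm x) + (norm k2 + norm y)"
      unfolding w
      using norm_pair_le(1)[of "k1 + W_op m x" "k2 + W_op m y"] norm_triangle_ineq[of k1 "W_op m x"]
        norm_triangle_ineq[of k2 "W_op m y"] by (simp add: norm_W_op)
    ultimately show ?thesis using k1 k2 by (simp add: N_def[symmetric] algebra_simps)
  qed
  then show ?thesis by blast
qed

lemma resolvent_surjective: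
  assumes z: "Re z \<noteq> 0"
  shows "\<exists>w\<in>L_dom. L_op m w - z *\<^sub>C w = g"
proof -
  have z0: "z \<noteq> 0" using z by auto
  obtain g1 g2 where g: "g = (g1, g2)" by (cases g)
  obtain \<kappa>1 a where 1: "\<kappa>1 \<in> Kspace m" "g1 = \<kappa>1 + W_op m a" using decomposition_exists by blast
  obtain \<kappa>2 b where 2: "\<kappa>2 \<in> Kspace m" "g2 = \<kappa>2 + W_op m b" using decomposition_exists by blast
  obtain p where p: "p \<in> H1" "\<i> *\<^sub>C abs_nabla p - z *\<^sub>C p = a + \<i> *\<^sub>C b"
    using abs_nabla_resolvent_exists[OF z, of \<i>] by blast
  obtain q where q: "q \<in> H1" "(- \<i>) *\<^sub>C abs_nabla q - z *\<^sub>C q = a + (- \<i>) *\<^sub>C b"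
    using abs_nabla_resolvent_exists[OF z, of "- \<i>"] by blast
  define x where "x = (1/2) *\<^sub>C (p + q)"
  define y where "y = (- \<i>/2) *\<^sub>C (p - q)"
  have xy: "x \<in> H1" "y \<in> H1"
    unfolding x_def y_def by (intro H1_scaleC H1_add H1_diff p q)+
  have pe: "x + \<i> *\<^sub>C y = p" and qe: "x + (- \<i>) *\<^sub>C y = q"
  proof -
    have y1: "\<i> *\<^sub>C y = (1/2) *\<^sub>C (p - q)" and y2: "(- \<i>) *\<^sub>C y = (1/2) *\<^sub>C (q - p)"
      by (simp_all only: y_def scaleC_scaleC complex_vector.scale_right_diff_distrib)
        (simp_all add: complex_vector.scale_minus_left)
    have h: "(1/2) *\<^sub>C u + (1/2) *\<^sub>C u = (u :: L2)" for u
      using scaleC_add_left[of "1/2" "1/2" u] by (simp add: scaleC_one)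
    show "x + \<i> *\<^sub>C y = p"
      unfolding y1 x_def using h[of p] by (simp add: scaleC_add_right complex_vector.scale_right_diff_distrib)
    show "x + (- \<i>) *\<^sub>C y = q"
      unfolding y2 x_def using h[of q] by (simp add: scaleC_add_right complex_vector.scale_right_diff_distrib)
  qed
  define a' where "a' = - abs_nabla y - z *\<^sub>C x"
  define b' where "b' = abs_nabla x - z *\<^sub>C y"
  have e1: "a' + \<i> *\<^sub>C b' = a + \<i> *\<^sub>C b"
    using diagonalization[OF xy, of \<i> z] p(2) unfolding pe a'_def b'_def by simp
  have e2: "a' + (- \<i>) *\<^sub>C b' = a + (- \<i>) *\<^sub>C b"
    using diagonalization[OF xy, of "- \<i>" z] q(2) unfolding qe a'_def b'_def by simp
  have a: "a' = a" using half_sum_difference(1)[of a' b'] half_sum_difference(1)[of a b] e1 e2 by metis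
  have b: "b' = b" using half_sum_difference(2)[of b' a'] half_sum_difference(2)[of b a] e1 e2 by metis
  \<comment> \<open>Back substitution in the triangular block, possible because \<open>z\<close> is
    nonzero.\<close>
  define k1 where "k1 = (- 1 / z) *\<^sub>C \<kappa>1"
  define k2 where "k2 = (1 / z) *\<^sub>C (L_plus m k1 - \<kappa>2)"
  have k: "k1 \<in> Kspace m" "k2 \<in> Kspace m"
    unfolding k2_def k1_def by (intro Kspace_scaleC Kspace_diff L_plus_in_Kspace 1 2)+
  have "- z *\<^sub>C k1 = \<kappa>1" "L_plus m k1 - z *\<^sub>C k2 = \<kappa>2"
    using z0 by (simp_all add: k1_def k2_def scaleC_scaleC scaleC_one del: complex_vector.scale_minus_left)
  then have "L_op m (k1 + W_op m x, k2 + W_op m y) - z *\<^sub>C (k1 + W_op m x, k2 + W_op m y) = g"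
    using L_op_resolvent_equation[OF k xy, of z] a b 1 2 g by (simp only: a'_def b'_def)
  then show ?thesis using L_op_decomposed(1)[OF k xy] by blast
qed

lemma resolvent_off_axis:
  assumes "Re z \<noteq> 0" shows "z \<in> resolvent_set L_dom (L_op m)"
  unfolding resolvent_set_def mem_Collect_eq
proof
  obtain C where C: "\<And>w. w \<in> L_dom \<Longrightarrow> norm w \<le> C * norm (L_op m w - z *\<^sub>C w)"
    using resolvent_bound[OF assms] by blast
  then show "\<exists>C. \<forall>u\<in>L_dom. norm u \<le> C * norm (L_op m u - z *\<^sub>C u)" by blast
  have "inj_on (\<lambda>u. L_op m u - z *\<^sub>C u) L_dom"
  proof (rule inj_onI)
    fix u v assume uv: "u \<in> L_dom" "v \<in> L_dom" "L_op m u - z *\<^sub>C u = L_op m v - z *\<^sub>C v"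
    then have "L_op m (u - v) - z *\<^sub>C (u - v) = 0"
      by (simp add: L_op_diff complex_vector.scale_right_diff_distrib algebra_simps)
    then show "u = v" using C[OF L_op_diff(1)[OF uv(1,2)]] by simp
  qed
  moreover have "(\<lambda>u. L_op m u - z *\<^sub>C u) ` L_dom = UNIV"
    using resolvent_surjective[OF assms] by (auto simp: image_iff) metis
  ultimately show "bij_betw (\<lambda>u. L_op m u - z *\<^sub>C u) L_dom UNIV" by (simp add: bij_betw_def)
qed

text \<open>An approximate eigenvector of \<open>|nabla|\<close>, placed in the complement,
  contradicts the lower bound contained in the definition of the resolvent set.\<close>

lemma spectrum_on_axis:
  assumes "Re z = 0" shows "z \<notin> resolvent_set L_dom (L_op m)"
proof
  assume "z \<in> resolvent_set L_dom (L_op m)"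
  then obtain C where C: "\<And>w. w \<in> L_dom \<Longrightarrow> norm w \<le> C * norm (L_op m w - z *\<^sub>C w)"
    unfolding resolvent_set_def by blast
  define r where "r = \<bar>Im z\<bar>"
  \<comment> \<open>The sign selects the branch of the diagonalization: \<open>z = - c * r\<close>
    with \<open>r \<ge> 0\<close>, so \<open>(v, c v)\<close> is nearly an eigenvector for
    \<open>z\<close> when \<open>v\<close> is nearly one for \<open>r\<close>.\<close>
  define c where "c = (if Im z \<ge> 0 then - \<i> else \<i>)"
  have zc: "c * z = of_real r" "- c * of_real r = z" "cmod c = 1" "c * c = - 1"
    using assms by (auto simp: c_def r_def complex_eq_iff)
  \<comment> \<open>Chosen so that \<open>\<bar>C\<bar> * 2 * \<epsilon>\<close> stays below 1; the
    added 1 covers \<open>C = 0\<close>.\<close>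
  define \<epsilon> where "\<epsilon> = 1 / (4 * (\<bar>C\<bar> + 1))"
  have e: "\<epsilon> > 0" by (simp add: \<epsilon>_def add_nonneg_pos)
  obtain v where v: "v \<in> H1" "v \<noteq> 0" "norm (abs_nabla v - of_real r *\<^sub>C v) \<le> \<epsilon> * norm v"
    using abs_nabla_approximate_eigenvector[OF _ e, of r] by (auto simp: r_def)
  define d where "d = abs_nabla v - of_real r *\<^sub>C v"
  define w where "w = (0 + W_op m v, 0 + W_op m (c *\<^sub>C v))"
  have cv: "c *\<^sub>C v \<in> H1" using v(1) by (rule H1_scaleC)
  have w: "w \<in> L_dom" unfolding w_def by (rule L_op_decomposed(1)[OF Kspace_zero Kspace_zero v(1) cv])
  have L0: "L_plus m 0 = 0" using L_plus_scaleC[OF H1_zero, of m 0] by simp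
  have "- abs_nabla (c *\<^sub>C v) - z *\<^sub>C v = (- c) *\<^sub>C d"
    using zc(2)[symmetric] by (simp add: d_def abs_nabla_scaleC[OF v(1)] complex_vector.scale_right_diff_distrib scaleC_scaleC complex_vector.scale_minus_left)
  moreover have "abs_nabla v - z *\<^sub>C c *\<^sub>C v = d"
    using zc(1) by (simp add: d_def scaleC_scaleC mult.commute)
  ultimately have "L_op m w - z *\<^sub>C w = (W_op m ((- c) *\<^sub>C d), W_op m d)"
    unfolding w_def L_op_resolvent_equation[OF Kspace_zero Kspace_zero v(1) cv] by (simp add: L0)
  then have "norm (L_op m w - z *\<^sub>C w) \<le> norm d + norm d"
    using norm_pair_le(1)[of "W_op m ((- c) *\<^sub>C d)" "W_op m d"] zc(3) by (simp add: norm_W_op norm_scaleC del: complex_vector.scale_minus_left)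
  also have "\<dots> \<le> 2 * (\<epsilon> * norm v)" using v(3) by (simp add: d_def)
  finally have le: "norm (L_op m w - z *\<^sub>C w) \<le> 2 * \<epsilon> * norm v" by simp
  have "norm v \<le> norm w" using norm_pair_le(2)[of "W_op m v" "W_op m (c *\<^sub>C v)"] by (simp add: w_def norm_W_op)
  also have "\<dots> \<le> C * norm (L_op m w - z *\<^sub>C w)" by (rule C[OF w])
  also have "\<dots> \<le> \<bar>C\<bar> * norm (L_op m w - z *\<^sub>C w)" by (rule mult_right_mono) auto
  also have "\<dots> \<le> \<bar>C\<bar> * (2 * \<epsilon> * norm v)" by (rule mult_left_mono[OF le]) simp
  also have "\<dots> = (\<bar>C\<bar> * 2 * \<epsilon>) * norm v" by simp
  finally have "1 \<le> \<bar>C\<bar> * 2 * \<epsilon>" using v(2) by simp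
  moreover have "\<bar>C\<bar> * 2 * \<epsilon> < 1" by (simp add: \<epsilon>_def divide_less_eq)
  ultimately show False by simp
qed

lemma spectrum_L_op: "spectrum L_dom (L_op m) = {z. Re z = 0}"
  unfolding spectrum_def using resolvent_off_axis spectrum_on_axis by auto

section \<open>Eigenvalues, kernel and generalized nullspace\<close>

lemma eigenvector_complement_zero:
  assumes "x \<in> H1" "y \<in> H1" "- abs_nabla y - z *\<^sub>C x = 0" "abs_nabla x - z *\<^sub>C y = 0"
  shows "x = 0" "y = 0"
proof -
  have "x + \<i> *\<^sub>C y = 0"
    by (rule abs_nabla_no_eigenvector[where c = \<i> and z = z])
      (use diagonalization[OF assms(1,2), of \<i> z] assms in \<open>auto intro: H1_add H1_scaleC\<close>)
  moreover have "x + (- \<i>) *\<^sub>C y = 0"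
  proof (rule abs_nabla_no_eigenvector[where c = "- \<i>" and z = z])
    show "x + (- \<i>) *\<^sub>C y \<in> H1" by (intro H1_add H1_scaleC assms)
    show "(- \<i>) *\<^sub>C abs_nabla (x + (- \<i>) *\<^sub>C y) = z *\<^sub>C (x + (- \<i>) *\<^sub>C y)"
      using diagonalization[OF assms(1,2), of "- \<i>" z] unfolding assms(3,4) by simp
  qed simp
  ultimately show "x = 0" "y = 0" using half_sum_difference[of x y] half_sum_difference(2)[of y x] by simp_all
qed

lemma L_op_kernel:
  "{w \<in> L_dom. L_op m w = 0} = {(k1, k2). k1 \<in> Kspace m \<and> k2 \<in> Kspace m \<and> L_plus m k1 = 0}"
proof (intro set_eqI iffI)
  fix w assume "w \<in> {w \<in> L_dom. L_op m w = 0}"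
  then have w: "w \<in> L_dom" "L_op m w = 0" by auto
  obtain k1 k2 x y where kx: "k1 \<in> Kspace m" "k2 \<in> Kspace m" "x \<in> H1" "y \<in> H1"
    and we: "w = (k1 + W_op m x, k2 + W_op m y)" by (rule L_dom_decomposition[OF w(1), of m])
  have 0: "W_op m (- abs_nabla y) = 0" "L_plus m k1 + W_op m (abs_nabla x) = 0"
    using w(2) unfolding we L_op_decomposed(2)[OF kx] by (simp_all add: zero_prod_def)
  have "L_plus m k1 = 0" "abs_nabla x = 0"
    using decomposition_zero[OF L_plus_in_Kspace[OF kx(1)] 0(2)] by auto
  moreover have "x = 0" "y = 0"
    using eigenvector_complement_zero[OF kx(3,4), of 0] 0(1) \<open>abs_nabla x = 0\<close> by simp_all
  ultimately show "w \<in> {(k1, k2). k1 \<in> Kspace m \<and> k2 \<in> Kspace m \<and> L_plus m k1 = 0}"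
    using kx by (simp add: we)
next
  fix w assume "w \<in> {(k1, k2). k1 \<in> Kspace m \<and> k2 \<in> Kspace m \<and> L_plus m k1 = 0}"
  then show "w \<in> {w \<in> L_dom. L_op m w = 0}"
    by (auto simp: L_dom_def Kspace_H1 L_op_def L_minus_Kspace zero_prod_def)
qed

lemma orthogonal_scalars_zero:
  fixes \<phi> :: "'i \<Rightarrow> L2"
  assumes "finite I" "(\<Sum>i\<in>I. a i *\<^sub>C \<phi> i) = 0" "\<And>i j. i \<in> I \<Longrightarrow> j \<in> I \<Longrightarrow> i \<noteq> j \<Longrightarrow> cinner (\<phi> i) (\<phi> j) = 0"
    "i \<in> I" "\<phi> i \<noteq> 0"
  shows "a i = 0"
proof -
  have "0 = cinner (\<Sum>j\<in>I. a j *\<^sub>C \<phi> j) (\<phi> i)" by (simp add: assms(2))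
  also have "\<dots> = (\<Sum>j\<in>I. if j = i then a i * cinner (\<phi> i) (\<phi> i) else 0)"
    unfolding cinner_sum_left cinner_scaleC_left by (rule sum.cong[OF refl]) (use assms in auto)
  also have "\<dots> = a i * cinner (\<phi> i) (\<phi> i)" using assms by simp
  finally show ?thesis using assms(5) by simp
qed

lemma basis_nonzero: "basis n \<noteq> 0"
  using cinner_basis[of n n] by auto

lemma inj_basis: "inj basis"
  using cinner_basis by (intro injI) (metis of_real_eq_0_iff pi_neq_zero)

lemma null_vector_nonzero: "m \<ge> 1 \<Longrightarrow> null_vector m \<noteq> 0"
  using cinner_null_vector[of m 0] by auto

text \<open>The second slot is all of \<open>Kspace\<close> and contributes \<open>2 * m\<close>;
  the first slot is restricted to multiples of \<open>null_vector m\<close> and contributes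
  1.\<close>

lemma cdim_kernel:
  assumes m: "m \<ge> 1"
  shows "cdim {w \<in> L_dom. L_op m w = 0} = 2 * m + 1"
proof -
  define I where "I = {- int m..<int m}"
  have fI: "finite I" "card I = 2 * m" by (simp_all add: I_def)
  define g where "g n = (0 :: L2, basis n)" for n
  have ig: "inj_on g I" using inj_basis by (auto simp: g_def inj_on_def)
  define B where "B = insert (null_vector m, 0) (g ` I)"
  have notin: "(null_vector m, 0) \<notin> g ` I"
    using null_vector_nonzero[OF m] by (auto simp: g_def)
  have V: "{w \<in> L_dom. L_op m w = 0} = {(k1, k2). (\<exists>c. k1 = c *\<^sub>C null_vector m) \<and> k2 \<in> Kspace m}"
    unfolding L_op_kernel using L_plus_Kspace_kernel[OF _ m] null_vector_in_Kspace Kspace_scaleC by auto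
  show ?thesis
  proof (rule complex_vector.dim_unique)
    have "\<exists>c. null_vector m = c *\<^sub>C null_vector m" by (rule exI[of _ 1]) (simp add: scaleC_one)
    moreover have "\<exists>c. 0 = c *\<^sub>C null_vector m" by (rule exI[of _ 0]) simp
    ultimately show "B \<subseteq> {w \<in> L_dom. L_op m w = 0}"
      unfolding V B_def g_def I_def using Kspace_zero[of m] basis_in_Kspace[of m] by auto
    show "{w \<in> L_dom. L_op m w = 0} \<subseteq> cspan B"
    proof
      fix w assume "w \<in> {w \<in> L_dom. L_op m w = 0}"
      then obtain c k2 where w: "w = (c *\<^sub>C null_vector m, k2)" "k2 \<in> Kspace m" unfolding V by auto
      define a where "a n = cinner k2 (basis n) / of_real pi" for n
      have "k2 = (\<Sum>n\<in>I. a n *\<^sub>C basis n)" unfolding I_def a_def by (rule Kspace_expand[OF w(2)])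
      then have "w = c *\<^sub>C (null_vector m, 0) + (\<Sum>n\<in>I. a n *\<^sub>C g n)"
        by (simp add: w(1) prod_eq_iff fst_sum snd_sum g_def scaleC_pair)
      also have "\<dots> \<in> cspan B"
        by (intro complex_vector.span_add complex_vector.span_scale complex_vector.span_sum complex_vector.span_base)
          (auto simp: B_def)
      finally show "w \<in> cspan B" .
    qed
    show "card B = 2 * m + 1"
      unfolding B_def using notin fI card_image[OF ig] by simp
    show "complex_vector.independent B"
    proof (rule complex_vector.independent_if_scalars_zero)
      show "finite B" using fI by (simp add: B_def)
      fix f v assume 0: "(\<Sum>x\<in>B. f x *\<^sub>C x) = 0" and v: "v \<in> B"
      have "(\<Sum>x\<in>B. f x *\<^sub>C x) = f (null_vector m, 0) *\<^sub>C (null_vector m, 0) + (\<Sum>n\<in>I. f (g n) *\<^sub>C g n)"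
        unfolding B_def using notin fI by (simp add: sum.reindex[OF ig])
      then have "f (null_vector m, 0) *\<^sub>C null_vector m = 0" "(\<Sum>n\<in>I. f (g n) *\<^sub>C basis n) = 0"
        using 0 by (simp_all add: prod_eq_iff fst_sum snd_sum g_def scaleC_pair)
      moreover have "f (g n) = 0" if "n \<in> I" for n
        by (rule orthogonal_scalars_zero[OF fI(1) \<open>(\<Sum>n\<in>I. f (g n) *\<^sub>C basis n) = 0\<close> _ that])
          (auto simp: cinner_basis basis_nonzero)
      ultimately show "f v = 0" using v null_vector_nonzero[OF m] by (auto simp: B_def)
    qed
  qed
qed

text \<open>For \<open>z\<close> nonzero the \<open>Kspace\<close> block is invertible by
  triangularity and the complement has no eigenvectors at all. For \<open>z = 0\<close> any basis
  vector of \<open>Kspace\<close> in the second slot serves.\<close>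

lemma eigenvalues_L_op:
  assumes m: "m \<ge> 1"
  shows "eigenvalues L_dom (L_op m) = {0}"
proof
  show "{0} \<subseteq> eigenvalues L_dom (L_op m)"
  proof -
    have "(0, basis 0) \<in> {w \<in> L_dom. L_op m w = 0}"
      unfolding L_op_kernel using m L_plus_scaleC[OF H1_zero, of m 0] by (auto intro: Kspace_zero basis_in_Kspace)
    then show ?thesis
      unfolding eigenvalues_def eigenspace_def using basis_nonzero[of 0] by (auto simp: zero_prod_def intro!: bexI[of _ "(0, basis 0)"])
  qed
  show "eigenvalues L_dom (L_op m) \<subseteq> {0}"
  proof
    fix z assume "z \<in> eigenvalues L_dom (L_op m)"
    then obtain w where w: "w \<in> L_dom" "L_op m w = z *\<^sub>C w" "w \<noteq> 0"
      by (auto simp: eigenvalues_def eigenspace_def)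
    show "z \<in> {0}"
    proof (rule ccontr)
      assume "z \<notin> {0}"
      then have z: "z \<noteq> 0" by simp
      obtain k1 k2 x y where kx: "k1 \<in> Kspace m" "k2 \<in> Kspace m" "x \<in> H1" "y \<in> H1"
        and we: "w = (k1 + W_op m x, k2 + W_op m y)" by (rule L_dom_decomposition[OF w(1), of m])
      have "L_op m w - z *\<^sub>C w = 0" using w(2) by simp
      then have 1: "- z *\<^sub>C k1 + W_op m (- abs_nabla y - z *\<^sub>C x) = 0"
        and 2: "(L_plus m k1 - z *\<^sub>C k2) + W_op m (abs_nabla x - z *\<^sub>C y) = 0"
        unfolding we L_op_resolvent_equation[OF kx] by (simp_all add: zero_prod_def)
      have K1: "- z *\<^sub>C k1 \<in> Kspace m" and K2: "L_plus m k1 - z *\<^sub>C k2 \<in> Kspace m"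
        by (intro Kspace_scaleC Kspace_diff L_plus_in_Kspace kx)+
      note D1 = decomposition_zero[OF K1 1] and D2 = decomposition_zero[OF K2 2]
      have k1: "k1 = 0" using D1(1) z by simp
      have "L_plus m 0 = 0" using L_plus_scaleC[OF H1_zero, of m 0] by simp
      then have k2: "k2 = 0" using D2(1) z k1 by simp
      have "x = 0" "y = 0" using eigenvector_complement_zero[OF kx(3,4) D1(2) D2(2)] by auto
      then have "w = 0" using k1 k2 W_op_eq_0[of m 0] by (simp add: we zero_prod_def)
      then show False using w(3) by simp
    qed
  qed
qed

lemma power_kernel_Suc:
  "u \<in> power_kernel D T (Suc n) \<longleftrightarrow> u \<in> D \<and> T u \<in> power_kernel D T n"
  by (auto simp: power_kernel_def funpow_swap1)

text \<open>If the image of \<open>w\<close> lies in \<open>Kspace\<close> in both slots, its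
  \<open>W_op\<close> components vanish by uniqueness of the decomposition. Then
  \<open>|nabla|\<close> kills the complement parts of \<open>w\<close>, so these are zero.\<close>

lemma power_kernel_subset: "power_kernel L_dom (L_op m) n \<subseteq> Kspace m \<times> Kspace m"
proof (induction n)
  case 0
  then show ?case by (auto simp: power_kernel_def zero_prod_def Kspace_zero)
next
  case (Suc n)
  show ?case
  proof
    fix w assume "w \<in> power_kernel L_dom (L_op m) (Suc n)"
    then have w: "w \<in> L_dom" "L_op m w \<in> Kspace m \<times> Kspace m" using Suc by (auto simp: power_kernel_Suc)
    obtain k1 k2 x y where kx: "k1 \<in> Kspace m" "k2 \<in> Kspace m" "x \<in> H1" "y \<in> H1"
      and we: "w = (k1 + W_op m x, k2 + W_op m y)" by (rule L_dom_decomposition[OF w(1), of m])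
    have a: "W_op m (- abs_nabla y) \<in> Kspace m" and b: "L_plus m k1 + W_op m (abs_nabla x) \<in> Kspace m"
      using w(2) unfolding we L_op_decomposed(2)[OF kx] by auto
    have "- abs_nabla y = 0" "abs_nabla x = 0"
      using decomposition_unique(2)[OF Kspace_zero a, of "- abs_nabla y" 0]
        decomposition_unique(2)[OF L_plus_in_Kspace[OF kx(1)] b, of "abs_nabla x" 0] by simp_all
    then have "x = 0" "y = 0" using eigenvector_complement_zero[OF kx(3,4), of 0] by simp_all
    then show "w \<in> Kspace m \<times> Kspace m" using kx by (simp add: we)
  qed
qed

text \<open>One application moves the first slot into the second and erases the old second slot, a
  second application erases the rest; \<open>L_plus\<close> keeps the intermediate vector in
  \<open>Kspace\<close>.\<close>

lemma power_kernel_2: "power_kernel L_dom (L_op m) 2 = Kspace m \<times> Kspace m"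
proof
  show "power_kernel L_dom (L_op m) 2 \<subseteq> Kspace m \<times> Kspace m" by (rule power_kernel_subset)
  show "Kspace m \<times> Kspace m \<subseteq> power_kernel L_dom (L_op m) 2"
  proof
    fix w assume "w \<in> Kspace m \<times> Kspace m"
    then obtain k1 k2 where w: "w = (k1, k2)" "k1 \<in> Kspace m" "k2 \<in> Kspace m" by auto
    have "L_plus m 0 = 0" using L_plus_scaleC[OF H1_zero, of m 0] by simp
    then have 0: "(0, u) \<in> power_kernel L_dom (L_op m) (Suc 0)" if "u \<in> Kspace m" for u
      using that by (simp add: power_kernel_def L_op_def L_dom_def L_minus_Kspace Kspace_H1 H1_zero zero_prod_def)
    have "w \<in> power_kernel L_dom (L_op m) (Suc (Suc 0))"
      unfolding power_kernel_Suc[of w _ _ "Suc 0"]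
      using w 0[OF L_plus_in_Kspace[OF w(2)]] by (simp add: L_op_def L_dom_def L_minus_Kspace Kspace_H1)
    then show "w \<in> power_kernel L_dom (L_op m) 2" by (simp add: numeral_2_eq_2)
  qed
qed

lemma generalized_nullspace:
  "(\<Union>n\<in>{1..}. power_kernel L_dom (L_op m) n) = power_kernel L_dom (L_op m) 2"
  using power_kernel_subset unfolding power_kernel_2[symmetric] by force

text \<open>The complement part of an eigenvector of \<open>L_plus\<close> would be an eigenvector
  of \<open>|nabla|\<close>, so all \<open>\<phi> k\<close> lie in \<open>Kspace\<close>. Being
  orthogonal and nonzero, \<open>2 * m\<close> of them fill that space of dimension
  \<open>2 * m\<close>.\<close>

lemma eigensystem_span:
  assumes m: "m \<ge> 1" and sys: "L_plus_eigensystem m E \<phi>"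
  shows "cspan (\<phi> ` {..<2 * m}) = Kspace m"
proof -
  have E: "strict_mono_on {..<2 * m} E" using sys by (simp add: L_plus_eigensystem_def)
  have \<phi>: "\<phi> k \<in> H1" "L_plus m (\<phi> k) = complex_of_real (E k) *\<^sub>C \<phi> k" "norm (\<phi> k) = 1" if "k < 2 * m" for k
    using sys that by (auto simp: L_plus_eigensystem_def eigenspace_def)
  have K: "\<phi> k \<in> Kspace m" if k: "k < 2 * m" for k
  proof -
    obtain \<kappa> x where *: "\<kappa> \<in> Kspace m" "x \<in> H1" "\<phi> k = \<kappa> + W_op m x" by (rule H1_decomposition[OF \<phi>(1)[OF k]])
    have "L_plus m \<kappa> + W_op m (abs_nabla x) = of_real (E k) *\<^sub>C \<kappa> + W_op m (of_real (E k) *\<^sub>C x)"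
      using \<phi>(2)[OF k] unfolding *(3)
      by (simp add: L_plus_add[OF Kspace_H1[OF *(1)] W_op_H1(1)[OF *(2)]] W_op_H1[OF *(2)] scaleC_add_right W_op_scaleC)
    then have "abs_nabla x = of_real (E k) *\<^sub>C x"
      by (rule decomposition_unique(2)[OF L_plus_in_Kspace[OF *(1)] Kspace_scaleC[OF *(1)]])
    then have "x = 0" using abs_nabla_no_eigenvector[OF *(2), of 1 "of_real (E k)"] by (simp add: scaleC_one)
    then show ?thesis using * by simp
  qed
  \<comment> \<open>Both vectors lie in \<open>Kspace\<close>, where \<open>L_plus\<close> is
    \<open>- R\<close>, so the symmetry of \<open>R_op\<close> and the distinctness of the real
    numbers \<open>E k\<close> suffice.\<close>
  have orth: "cinner (\<phi> j) (\<phi> k) = 0" if "j < 2 * m" "k < 2 * m" "j \<noteq> k" for j k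
  proof -
    have "of_real (E j) * cinner (\<phi> j) (\<phi> k) = cinner (L_plus m (\<phi> j)) (\<phi> k)"
      by (simp add: \<phi>(2)[OF that(1)] cinner_scaleC_left)
    also have "\<dots> = cinner (\<phi> j) (L_plus m (\<phi> k))"
      by (simp add: L_plus_Kspace[OF K] that cinner_minus_left cinner_minus_right R_op_symmetric)
    also have "\<dots> = of_real (E k) * cinner (\<phi> j) (\<phi> k)"
      by (simp add: \<phi>(2)[OF that(2)] cinner_scaleC_right)
    finally have "E j = E k \<or> cinner (\<phi> j) (\<phi> k) = 0" by auto
    moreover have "E j \<noteq> E k"
      using strict_mono_on_imp_inj_on[OF E] that by (auto simp: inj_on_def)
    ultimately show ?thesis by simp
  qed
  have nz: "\<phi> k \<noteq> 0" if "k < 2 * m" for k using \<phi>(3)[OF that] by auto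
  have inj: "inj_on \<phi> {..<2 * m}"
    using orth nz by (intro inj_onI) (metis cinner_self_eq_0 lessThan_iff)
  define S where "S = \<phi> ` {..<2 * m}"
  define T where "T = basis ` {- int m..<int m}"
  have fT: "finite T" "card T = 2 * m"
    unfolding T_def using card_image[OF inj_on_subset[OF inj_basis subset_UNIV], of "{- int m..<int m}"] by simp_all
  have cS: "finite S" "card S = 2 * m" unfolding S_def using card_image[OF inj] by simp_all
  have ind: "complex_vector.independent S"
  proof (rule complex_vector.independent_if_scalars_zero[OF cS(1)])
    fix f v assume "(\<Sum>x\<in>S. f x *\<^sub>C x) = 0" "v \<in> S"
    then have 0: "(\<Sum>k<2 * m. f (\<phi> k) *\<^sub>C \<phi> k) = 0" by (simp add: S_def sum.reindex[OF inj])
    have "f (\<phi> k) = 0" if "k < 2 * m" for k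
      by (rule orthogonal_scalars_zero[OF _ 0]) (use that orth nz in auto)
    then show "f v = 0" using \<open>v \<in> S\<close> by (auto simp: S_def)
  qed
  have ST: "S \<subseteq> cspan T" unfolding S_def T_def using K by (auto simp: Kspace_def)
  \<comment> \<open>Exchange argument: a vector outside the span of \<open>S\<close> would enlarge
    \<open>S\<close> to \<open>2 * m + 1\<close> independent vectors inside the span of
    \<open>2 * m\<close>.\<close>
  have "cspan T \<subseteq> cspan S"
  proof
    fix v assume v: "v \<in> cspan T"
    show "v \<in> cspan S"
    proof (rule ccontr)
      assume n: "v \<notin> cspan S"
      then have "complex_vector.independent (insert v S)"
        using ind by (simp add: complex_vector.independent_insert)
      then have "card (insert v S) \<le> card T"
        using complex_vector.independent_span_bound[OF fT(1)] v ST by blast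
      moreover have "v \<notin> S" using n complex_vector.span_base by blast
      ultimately show False using cS fT by simp
    qed
  qed
  moreover have "cspan S \<subseteq> cspan T" by (rule complex_vector.span_minimal[OF ST complex_vector.subspace_span])
  ultimately show ?thesis by (simp add: S_def T_def Kspace_def)
qed

lemma cspan_pairs:
  "cspan ((\<lambda>k. (\<phi> k, 0)) ` I \<union> (\<lambda>k. (0, \<phi> k)) ` I) = cspan (\<phi> ` I) \<times> (cspan (\<phi> ` I) :: L2 set)"
proof
  let ?S = "(\<lambda>k. (\<phi> k, 0)) ` I \<union> (\<lambda>k. (0, \<phi> k)) ` I"
  have sub: "complex_vector.subspace (cspan (\<phi> ` I) \<times> cspan (\<phi> ` I))"
    by (rule complex_vector.subspaceI)
      (auto simp: zero_prod_def scaleC_pair intro: complex_vector.span_zero complex_vector.span_add complex_vector.span_scale)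
  show "cspan ?S \<subseteq> cspan (\<phi> ` I) \<times> cspan (\<phi> ` I)"
    by (rule complex_vector.span_minimal[OF _ sub])
      (auto intro: complex_vector.span_zero complex_vector.span_base)
  have "complex_vector.subspace {u. (u, 0) \<in> cspan ?S}"
    using complex_vector.span_zero[of ?S] complex_vector.span_add[of _ ?S] complex_vector.span_scale[of _ ?S]
    by (intro complex_vector.subspaceI) (force simp: zero_prod_def scaleC_pair)+
  then have 1: "cspan (\<phi> ` I) \<subseteq> {u. (u, 0) \<in> cspan ?S}"
    by (rule complex_vector.span_minimal[rotated]) (auto intro: complex_vector.span_base)
  have "complex_vector.subspace {u. (0, u) \<in> cspan ?S}"
    using complex_vector.span_zero[of ?S] complex_vector.span_add[of _ ?S] complex_vector.span_scale[of _ ?S]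
    by (intro complex_vector.subspaceI) (force simp: zero_prod_def scaleC_pair)+
  then have 2: "cspan (\<phi> ` I) \<subseteq> {u. (0, u) \<in> cspan ?S}"
    by (rule complex_vector.span_minimal[rotated]) (auto intro: complex_vector.span_base)
  show "cspan (\<phi> ` I) \<times> cspan (\<phi> ` I) \<subseteq> cspan ?S"
  proof
    fix w assume "w \<in> cspan (\<phi> ` I) \<times> cspan (\<phi> ` I)"
    then obtain a b where "w = (a, b)" "(a, 0) \<in> cspan ?S" "(0, b) \<in> cspan ?S" using 1 2 by auto
    then show "w \<in> cspan ?S" using complex_vector.span_add[of "(a, 0)" ?S "(0, b)"] by simp
  qed
qed

section \<open>Test functions\<close>

text \<open>Only the function itself is assumed to vanish far out. Its derivatives do too, because
  the exterior is open and the derivative of zero there is zero; \<open>r\<close> is enlarged to be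
  positive.\<close>

lemma test_function_derivatives:
  assumes "test_function \<psi>"
  obtains D :: "nat \<Rightarrow> real \<Rightarrow> complex" and r where "D 0 = \<psi>" "r > 0"
    "\<And>n x. (D n has_vector_derivative D (Suc n) x) (at x)" "\<And>n x. \<bar>x\<bar> > r \<Longrightarrow> D n x = 0"
proof -
  obtain D r0 where D: "D 0 = \<psi>" "\<And>n x. (D n has_vector_derivative D (Suc n) x) (at x)"
    "\<And>x. \<bar>x\<bar> > r0 \<Longrightarrow> \<psi> x = 0"
    using assms unfolding test_function_def by blast
  define r where "r = max r0 1"
  have "D n x = 0" if "\<bar>x\<bar> > r" for n x
    using that
  proof (induction n arbitrary: x)
    case 0
    then show ?case using D by (simp add: r_def)
  next
    case (Suc n)
    have op: "open {x :: real. \<bar>x\<bar> > r}"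
      by (intro open_Collect_less continuous_intros)
    have "((\<lambda>x. 0) has_vector_derivative D (Suc n) x) (at x)"
      by (rule has_vector_derivative_transform_within_open[OF D(2) op]) (use Suc in auto)
    then show ?case using vector_derivative_unique_at has_vector_derivative_const by blast
  qed
  then show ?thesis using that[of D r] D by (simp add: r_def)
qed

lemma test_function_cnj: 
  assumes "test_function \<psi>" shows "test_function (\<lambda>x. cnj (\<psi> x))"
proof -
  obtain D r where D: "D 0 = \<psi>" "\<And>n x. (D n has_vector_derivative D (Suc n) x) (at x)"
    "\<And>x. \<bar>x\<bar> > r \<Longrightarrow> \<psi> x = 0"
    using assms unfolding test_function_def by blast
  have "((\<lambda>x. cnj (D n x)) has_vector_derivative cnj (D (Suc n) x)) (at x)" for n x
    by (rule has_vector_derivative_cnj) (rule D(2))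
  then show ?thesis
    unfolding test_function_def using D by (intro conjI exI[of _ "\<lambda>n x. cnj (D n x)"] exI[of _ r]) auto
qed

lemma compactly_supported_integrable:
  fixes f :: "real \<Rightarrow> complex"
  assumes c: "continuous_on UNIV f" and z: "\<And>x. \<bar>x\<bar> > r \<Longrightarrow> f x = 0"
  shows "integrable lborel f" "square_integrable f"
proof -
  have eq: "f = (\<lambda>x. indicator {-r..r} x *\<^sub>R f x)" using z by (auto simp: indicator_def fun_eq_iff abs_if)
  have "integrable lborel (\<lambda>x. indicator {-r..r} x *\<^sub>R f x)"
    by (rule borel_integrable_compact) (auto intro: continuous_on_subset[OF c])
  then show i: "integrable lborel f" using eq by simp
  have "bounded (f ` {-r..r})"
    by (intro compact_imp_bounded compact_continuous_image continuous_on_subset[OF c]) auto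
  then obtain C where "\<And>x. x \<in> {-r..r} \<Longrightarrow> cmod (f x) \<le> C" unfolding bounded_iff by blast
  then have "cmod (f x) \<le> max C 0" for x using z[of x] by (cases "\<bar>x\<bar> > r") (auto simp: le_max_iff_disj abs_if split: if_splits)
  then show "square_integrable f" by (rule square_integrable_of_bounded[OF i])
qed

lemma FT_derivative:
  fixes f f' :: "real \<Rightarrow> complex"
  assumes d: "\<And>x. (f has_vector_derivative f' x) (at x)" and c: "continuous_on UNIV f'"
    and z: "\<And>x. \<bar>x\<bar> > r \<Longrightarrow> f x = 0" "\<And>x. \<bar>x\<bar> > r \<Longrightarrow> f' x = 0" and r: "r > 0"
  shows "FT f' \<xi> = \<i> * of_real \<xi> * FT f \<xi>"
proof -
  define e where "e x = exp (- (\<i> * complex_of_real (x * \<xi>)))" for x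
  have cf: "continuous_on UNIV f"
    using d by (intro continuous_at_imp_continuous_on ballI) (rule has_vector_derivative_continuous)
  have ce: "continuous_on UNIV e" unfolding e_def by (intro continuous_intros)
  have de: "(e has_vector_derivative - (\<i> * of_real \<xi>) * e x) (at x)" for x
  proof -
    have "((\<lambda>z. exp (- (\<i> * (z * of_real \<xi>)))) has_field_derivative - (\<i> * of_real \<xi>) * exp (- (\<i> * (of_real x * of_real \<xi>)))) (at (of_real x))"
      by (auto intro!: derivative_eq_intros)
    from has_vector_derivative_real_field[OF this] show ?thesis by (simp add: e_def[abs_def])
  qed
  have df: "((\<lambda>x. f x * e x) has_vector_derivative (f' x * e x - (\<i> * of_real \<xi>) * (f x * e x))) (at x)" for x
    using has_vector_derivative_mult[OF d de, of x] by (simp add: algebra_simps)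
  let ?g = "\<lambda>x. f' x * e x - (\<i> * of_real \<xi>) * (f x * e x)"
  have gz: "?g x = 0" if "\<bar>x\<bar> > r" for x using z that by simp
  \<comment> \<open>The functions are known to vanish only strictly outside \<open>[-r, r]\<close>;
    enlarging the interval by 1 makes the boundary terms zero.\<close>
  have "(LINT x|lborel. ?g x) = (LINT x|lborel. indicator {- (r + 1)..r + 1} x *\<^sub>R ?g x)"
  proof (rule Bochner_Integration.integral_cong)
    fix x
    show "?g x = indicator {- (r + 1)..r + 1} x *\<^sub>R ?g x"
      using gz[of x] r by (cases "\<bar>x\<bar> > r") (simp_all add: indicator_def abs_le_iff not_less)
  qed simp
  also have "\<dots> = f (r + 1) * e (r + 1) - f (- (r + 1)) * e (- (r + 1))"
  proof (rule integral_FTC_Icc)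
    show "continuous_on {- (r + 1)..r + 1} ?g"
      by (intro continuous_intros continuous_on_subset[OF c] continuous_on_subset[OF cf] continuous_on_subset[OF ce]) auto
  qed (use r df in \<open>auto intro: has_vector_derivative_at_within\<close>)
  also have "\<dots> = 0" using z r by simp
  finally have 0: "(LINT x|lborel. ?g x) = 0" .
  have i1: "integrable lborel (\<lambda>x. f' x * e x)"
    by (rule compactly_supported_integrable[where r = r]) (use z c ce in \<open>auto intro: continuous_intros\<close>)
  have i2: "integrable lborel (\<lambda>x. f x * e x)"
    by (rule compactly_supported_integrable[where r = r]) (use z cf ce in \<open>auto intro: continuous_intros\<close>)
  have "(LINT x|lborel. ?g x) = FT f' \<xi> - \<i> * of_real \<xi> * FT f \<xi>"
    using i1 i2 by (simp add: FT_def e_def del: of_real_mult)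
  then show ?thesis using 0 by simp
qed

lemma test_function_facts:
  assumes "test_function \<psi>"
  shows "integrable lborel \<psi>" "square_integrable \<psi>" "abs_L2 \<psi> \<in> H1"
    "integrable lborel (\<lambda>\<xi>. of_real \<bar>\<xi>\<bar> * FT \<psi> \<xi>)" "square_integrable (\<lambda>\<xi>. of_real \<bar>\<xi>\<bar> * FT \<psi> \<xi>)"
proof -
  obtain D r where D: "D 0 = \<psi>" "r > 0"
    "\<And>n x. (D n has_vector_derivative D (Suc n) x) (at x)" "\<And>n x. \<bar>x\<bar> > r \<Longrightarrow> D n x = 0"
    by (rule test_function_derivatives[OF assms]) blast
  have c: "continuous_on UNIV (D n)" for n
    using D(3) by (intro continuous_at_imp_continuous_on ballI) (rule has_vector_derivative_continuous)
  have I: "integrable lborel (D n)" "square_integrable (D n)" for n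
    by (rule compactly_supported_integrable[OF c], erule D(4))+
  show "integrable lborel \<psi>" "square_integrable \<psi>" using I[of 0] D(1) by auto
  note \<psi> = this
  have F: "FT (D (Suc n)) \<xi> = \<i> * of_real \<xi> * FT (D n) \<xi>" for n \<xi>
    by (rule FT_derivative[OF D(3) c D(4) D(4) D(2)])
  have F1: "FT (D (Suc 0)) \<xi> = \<i> * of_real \<xi> * FT \<psi> \<xi>" for \<xi> using F[of 0] D(1) by simp
  have F3: "FT (D 3) \<xi> = - (\<i> * of_real (\<xi> ^ 3) * FT \<psi> \<xi>)" for \<xi>
    using F[of 2] F[of 1] F1 by (simp add: numeral_3_eq_3 numeral_2_eq_2 mult_ac)
  have [measurable]: "\<psi> \<in> borel_measurable borel" using \<psi>(2) by measurable
  have FS: "square_integrable (FT \<psi>)" by (rule FT_square_integrable[OF \<psi>])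
  show "abs_L2 \<psi> \<in> H1"
  proof (rule H1I[OF fourier_eq_FT[OF \<psi>] FS])
    show "square_integrable (\<lambda>\<xi>. of_real \<xi> * FT \<psi> \<xi>)"
      by (rule square_integrable_bound[OF FT_square_integrable(1)[OF I[of "Suc 0"]], where C = 1])
        (measurable, simp only: F1 norm_mult, simp)
  qed
  define C where "C n = (LINT x|lborel. cmod (D n x))" for n
  \<comment> \<open>The first derivative bounds \<open>\<bar>\<xi>\<bar>\<close> times the
    transform, the third bounds the cube. Their sum supplies the decay
    \<open>1 / (1 + \<xi>^2)\<close> after one factor \<open>\<bar>\<xi>\<bar>\<close> has been
    spent.\<close>
  have bound: "cmod (of_real \<bar>\<xi>\<bar> * FT \<psi> \<xi>) \<le> (C 1 + C 3) * (1 / (1 + \<xi>\<^sup>2))" for \<xi>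
  proof -
    have 1: "\<bar>\<xi>\<bar> * cmod (FT \<psi> \<xi>) \<le> C 1"
      using FT_bound[OF I(1)[of "Suc 0"], of \<xi>] by (simp add: F1 norm_mult C_def)
    have 3: "\<bar>\<xi>\<bar> ^ 3 * cmod (FT \<psi> \<xi>) \<le> C 3"
      using FT_bound[OF I(1)[of 3], of \<xi>] by (simp add: F3 norm_mult norm_power C_def)
    have "(1 + \<xi>\<^sup>2) * (\<bar>\<xi>\<bar> * cmod (FT \<psi> \<xi>)) = \<bar>\<xi>\<bar> * cmod (FT \<psi> \<xi>) + \<bar>\<xi>\<bar> ^ 3 * cmod (FT \<psi> \<xi>)"
      by (simp add: distrib_right power3_eq_cube power2_eq_square)
    also have "\<dots> \<le> C 1 + C 3" using 1 3 by simp
    finally show ?thesis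
      by (simp add: norm_mult pos_le_divide_eq add_pos_nonneg mult.commute)
  qed
  show i: "integrable lborel (\<lambda>\<xi>. of_real \<bar>\<xi>\<bar> * FT \<psi> \<xi>)"
  proof (rule Bochner_Integration.integrable_bound)
    show "integrable lborel (\<lambda>\<xi>. (C 1 + C 3) * (1 / (1 + \<xi>\<^sup>2)))"
      by (intro integrable_mult_right integrable_inverse_1_plus_square)
    show "AE \<xi> in lborel. norm (of_real \<bar>\<xi>\<bar> * FT \<psi> \<xi>) \<le> norm ((C 1 + C 3) * (1 / (1 + \<xi>\<^sup>2)))"
      unfolding real_norm_def by (rule AE_I2) (rule order_trans[OF bound abs_ge_self])
  qed measurable
  have "0 \<le> C n" for n by (simp add: C_def)
  then have "(C 1 + C 3) * (1 / (1 + \<xi>\<^sup>2)) \<le> (C 1 + C 3) * 1" for \<xi>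
    by (intro mult_left_mono) (auto simp: divide_le_eq add_pos_nonneg)
  then show "square_integrable (\<lambda>\<xi>. of_real \<bar>\<xi>\<bar> * FT \<psi> \<xi>)"
    by (intro square_integrable_of_bounded[OF i]) (rule order_trans[OF bound])
qed

section \<open>The half-Laplacian of a test function\<close>

lemma abs_nabla_test_eq: "abs_nabla_test \<psi> x = of_real (1 / (2 * pi)) * FT (\<lambda>\<xi>. of_real \<bar>\<xi>\<bar> * FT \<psi> \<xi>) (- x)"
  unfolding abs_nabla_test_def FT_def
  by (simp add: mult_ac)

lemma abs_nabla_test_cnj: "abs_nabla_test (\<lambda>x. cnj (\<psi> x)) x = cnj (abs_nabla_test \<psi> x)"
proof -
  have eq: "(\<lambda>\<xi>. of_real \<bar>\<xi>\<bar> * FT (\<lambda>x. cnj (\<psi> x)) \<xi>) = (\<lambda>\<xi>. cnj (of_real \<bar>- \<xi>\<bar> * FT \<psi> (- \<xi>)))"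
    by (simp add: FT_cnj)
  show ?thesis
    unfolding abs_nabla_test_eq eq FT_cnj[of "\<lambda>\<xi>. of_real \<bar>- \<xi>\<bar> * FT \<psi> (- \<xi>)"]
      FT_reflect[of "\<lambda>\<xi>. of_real \<bar>\<xi>\<bar> * FT \<psi> \<xi>"] by simp
qed

text \<open>Reconciles the pointwise integral used for distributions with the operator defined
  through Plancherel: both apply the inverse transform to the same integrable and square-integrable
  function.\<close>

lemma abs_nabla_test_L2:
  assumes "test_function \<psi>"
  shows "square_integrable (abs_nabla_test \<psi>)" "abs_L2 (abs_nabla_test \<psi>) = abs_nabla (abs_L2 \<psi>)"
proof -
  note T = test_function_facts[OF assms]
  define a where "a \<xi> = of_real \<bar>\<xi>\<bar> * FT \<psi> \<xi>" for \<xi>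
  have a: "integrable lborel a" "square_integrable a" using T(4,5) by (simp_all add: a_def[abs_def])
  have ac: "integrable lborel (\<lambda>\<xi>. cnj (a \<xi>))" using a(1) by simp
  have eq: "abs_nabla_test \<psi> = (\<lambda>x. of_real (1 / (2 * pi)) * cnj (FT (\<lambda>\<xi>. cnj (a \<xi>)) x))"
    by (rule ext) (simp only: abs_nabla_test_eq FT_cnj a_def[abs_def] complex_cnj_cnj)
  have S: "square_integrable (\<lambda>x. cnj (FT (\<lambda>\<xi>. cnj (a \<xi>)) x))"
    by (intro square_integrable_cnj FT_square_integrable ac a(2))
  show "square_integrable (abs_nabla_test \<psi>)" unfolding eq by (rule square_integrable_cmult[OF S])
  have "abs_L2 (abs_nabla_test \<psi>) = inv_fourier (abs_L2 a)"
    unfolding eq inv_fourier_def cnj_L2_abs[OF a(2)] fourier_eq_FT[OF ac square_integrable_cnj[OF a(2)]]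
      cnj_L2_abs[OF FT_square_integrable(1)[OF ac square_integrable_cnj[OF a(2)]]]
    by (rule abs_L2_scaleC[OF S])
  also have "abs_L2 a = fourier (abs_nabla (abs_L2 \<psi>))"
    unfolding fourier_abs_nabla(2)[OF T(3)]
  proof (subst abs_L2_eq_iff[OF a(2) fourier_abs_nabla(1)[OF T(3)]])
    show "AE x in lborel. a x = of_real \<bar>x\<bar> * rep_L2 (fourier (abs_L2 \<psi>)) x"
      unfolding fourier_eq_FT[OF T(1,2)] a_def
      using AE_rep_abs_L2[OF FT_square_integrable(1)[OF T(1,2)]] by eventually_elim simp
  qed
  finally show "abs_L2 (abs_nabla_test \<psi>) = abs_nabla (abs_L2 \<psi>)" by simp
qed

text \<open>For a test function \<open>u = rho 1 \<cdot> v\<close> this makes \<open>|\<nabla>|u\<close> a product of two square-integrable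
  functions, hence integrable. Removing a multiple of \<open>rho (-1)\<close> from \<open>v\<close> keeps its lower half in the
  lower Hardy space after multiplication by \<open>rho 1\<close>, and \<open>|\<nabla>|\<close> is a derivation on each half.\<close>

lemma abs_nabla_mul_rho:
  assumes "v \<in> H1"
  shows "\<exists>g. abs_nabla (mul_L2 (rho 1) v) = mul_L2 (rho 1) g"
proof -
  define a where "a = half_proj 1 v"
  define b where "b = half_proj (- 1) v"
  define c where "c = cinner b (rho_L2 (- 1)) / cinner (rho_L2 (- 1)) (rho_L2 (- 1))"
  define d where "d = b - c *\<^sub>C rho_L2 (- 1)"
  have a: "a \<in> hardy 1" "a \<in> H1" and b: "b \<in> hardy (- 1)" "b \<in> H1"
    unfolding a_def b_def using half_proj_in_hardy H1_half_proj[OF assms] by auto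
  have r: "rho_L2 (- 1) \<in> hardy (- 1)" "rho_L2 (- 1) \<in> H1" by (simp_all add: rho_in_hardy rho_H1)
  have d: "d \<in> hardy (- 1)" "d \<in> H1"
    unfolding d_def by (intro hardy_diff hardy_scaleC H1_diff H1_scaleC b r)+
  have "cinner (rho_L2 (- 1)) (rho_L2 (- 1)) \<noteq> 0"
    using cinner_basis[of "-1" "-1"] by (simp add: rho_minus_basis cinner_minus_left cinner_minus_right)
  then have "cinner d (rho_L2 (- 1)) = 0"
    by (simp add: d_def c_def cinner_diff_left cinner_scaleC_left)
  then have d1: "mul_L2 (rho 1) d \<in> hardy (- 1)"
    using hardy_mul_rho_minus[of "- 1" d] d by simp
  have a1: "mul_L2 (rho 1) a \<in> hardy 1" by (rule hardy_mul_rho) (use a in auto)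
  note Ha = H1_mul_rho[of 1 a] and Hd = H1_mul_rho[of 1 d]
  have sq: "mul_L2 (\<lambda>x. (rho 1 x)\<^sup>2) u = mul_L2 (rho 1) (mul_L2 (rho 1) u)" for u
    by (simp add: mul_L2_mul_L2 power2_eq_square)
  have na: "abs_nabla (mul_L2 (rho 1) a) = mul_L2 (rho 1) (D_op a + mul_L2 (rho 1) a)"
    using abs_nabla_hardy[OF _ a1] Ha a by (simp add: scaleC_one mul_L2_add sq)
  have nd: "abs_nabla (mul_L2 (rho 1) d) = mul_L2 (rho 1) (- (D_op d + mul_L2 (rho 1) d))"
    using abs_nabla_hardy[OF _ d1] Hd d by (simp add: scaleC_one scaleC_minus1 mul_L2_add mul_L2_minus mul_L2_diff sq)
  have half: "mul_L2 (rho 1) u = (1/2) *\<^sub>C (u - mul_L2 (zeta 1) u)" for u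
    unfolding mul_zeta_eq by (simp add: scaleC_scaleC scaleC_one)
  \<comment> \<open>The product of \<open>rho 1\<close> and \<open>rho (- 1)\<close> is
    \<open>omega / 2\<close>, half of \<open>beta 0\<close>. It belongs to neither half, so its
    image is computed on the basis to exhibit the factor \<open>rho 1\<close>.\<close>
  have b2: "mul_L2 (rho 1) (rho_L2 (- 1)) = (1/2) *\<^sub>C (basis 0 - basis (- 1))"
    unfolding half using zeta_pow_basis(1)[of 1 "-1"] by (simp add: rho_minus_basis mul_L2_minus)
  have rH: "mul_L2 (rho 1) (rho_L2 (- 1)) \<in> H1" by (rule H1_mul_rho) (use r in auto)
  have nr: "abs_nabla (mul_L2 (rho 1) (rho_L2 (- 1))) = mul_L2 (rho 1) ((1/2) *\<^sub>C (basis 0 + basis (- 2)))"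
  proof -
    have "abs_nabla (basis 0 - basis (- 1)) = abs_nabla (basis 0) + (- 1) *\<^sub>C abs_nabla (basis (- 1))"
      using abs_nabla_add[OF basis_H1 H1_minus[OF basis_H1], of 0 "-1"] abs_nabla_scaleC[OF basis_H1, of "-1" "-1"]
      by (simp add: scaleC_minus1)
    also have "\<dots> = (1/2) *\<^sub>C (basis 0 - basis 1) - (1/2) *\<^sub>C (basis (- 1) - basis (- 2))"
      using abs_nabla_basis_nonneg[of 0] abs_nabla_basis_neg[of 0] by (simp add: scaleC_minus1)
    also have "\<dots> = mul_L2 (rho 1) (basis 0 + basis (- 2))"
      unfolding half cay_1[symmetric] mul_L2_add[OF bounded_multiplier_cay] mul_cay_basis
      by (simp add: complex_vector.scale_right_diff_distrib scaleC_add_right)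
    finally show ?thesis
      unfolding b2 by (simp add: abs_nabla_scaleC H1_diff basis_H1 mul_L2_scaleC)
  qed
  have "v = a + (d + c *\<^sub>C rho_L2 (- 1))" by (simp add: d_def a_def b_def half_proj_sum)
  then have v: "mul_L2 (rho 1) v = mul_L2 (rho 1) a + (mul_L2 (rho 1) d + c *\<^sub>C mul_L2 (rho 1) (rho_L2 (- 1)))"
    by (simp add: mul_L2_add mul_L2_scaleC)
  have H: "mul_L2 (rho 1) a \<in> H1" "mul_L2 (rho 1) d \<in> H1" using Ha(1) Hd(1) a d by auto
  have "abs_nabla (mul_L2 (rho 1) v) =
      abs_nabla (mul_L2 (rho 1) a) + (abs_nabla (mul_L2 (rho 1) d) + c *\<^sub>C abs_nabla (mul_L2 (rho 1) (rho_L2 (- 1))))"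
    unfolding v using H rH by (simp add: abs_nabla_add abs_nabla_scaleC H1_add H1_scaleC)
  also have "\<dots> = mul_L2 (rho 1) ((D_op a + mul_L2 (rho 1) a) +
      (- (D_op d + mul_L2 (rho 1) d) + c *\<^sub>C ((1/2) *\<^sub>C (basis 0 + basis (- 2)))))"
    unfolding na nd nr by (simp only: mul_L2_add[OF bounded_multiplier_rho] mul_L2_scaleC[OF bounded_multiplier_rho])
  finally show ?thesis by blast
qed

text \<open>The linear factor is the reciprocal of \<open>rho 1\<close>: every test function is
  thereby \<open>rho 1\<close> times another test function.\<close>

lemma test_function_times_linear:
  assumes "test_function \<psi>" shows "test_function (\<lambda>x. (1 - \<i> * of_real x) * \<psi> x)"
proof -
  obtain D r where D: "D 0 = \<psi>" "\<And>n x. (D n has_vector_derivative D (Suc n) x) (at x)"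
    "\<And>x. \<bar>x\<bar> > r \<Longrightarrow> \<psi> x = 0"
    using assms unfolding test_function_def by blast
  \<comment> \<open>Leibniz' formula for a linear factor. At \<open>n = 0\<close> the index
    \<open>n - 1\<close> is truncated to 0, but its coefficient vanishes.\<close>
  define G where "G n x = (1 - \<i> * of_real x) * D n x - of_nat n * \<i> * D (n - 1) x" for n x
  have lin: "((\<lambda>x. 1 - \<i> * complex_of_real x) has_vector_derivative - \<i>) (at x)" for x
  proof -
    have "((\<lambda>z. 1 - \<i> * z) has_field_derivative - \<i>) (at (of_real x))"
      by (auto intro!: derivative_eq_intros)
    then show ?thesis by (rule has_vector_derivative_real_field)
  qed
  have "(G n has_vector_derivative G (Suc n) x) (at x)" for n x
  proof -
    have 1: "((\<lambda>x. (1 - \<i> * of_real x) * D n x) has_vector_derivative (1 - \<i> * of_real x) * D (Suc n) x + (- \<i>) * D n x) (at x)"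
      by (rule has_vector_derivative_mult[OF lin D(2)])
    have 2: "((\<lambda>x. of_nat n * \<i> * D (n - 1) x) has_vector_derivative of_nat n * \<i> * D n x) (at x)"
    proof (cases n)
      case (Suc k)
      then show ?thesis using has_vector_derivative_mult_right[OF D(2)[of k x]] by simp
    qed simp
    show ?thesis
      using has_vector_derivative_diff[OF 1 2] by (simp add: G_def[abs_def] algebra_simps)
  qed
  then show ?thesis
    unfolding test_function_def using D
    by (intro conjI exI[of _ G] exI[of _ r]) (auto simp: G_def)
qed

text \<open>Needed because \<open>cay\<close> is bounded but not square integrable: its pairing with
  \<open>|nabla|\<close> of a test function converges absolutely only through integrability.\<close>

lemma abs_nabla_test_integrable:
  assumes "test_function \<psi>" shows "integrable lborel (abs_nabla_test \<psi>)"
proof -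
  define v where "v x = (1 - \<i> * of_real x) * \<psi> x" for x
  have v: "square_integrable v" "abs_L2 v \<in> H1"
    using test_function_facts[OF test_function_times_linear[OF assms]] by (simp_all add: v_def[abs_def])
  have "rho 1 x * v x = \<psi> x" for x
    using rho_denom_nonzero(1)[of x] by (simp add: v_def rho_def)
  then have "mul_L2 (rho 1) (abs_L2 v) = abs_L2 \<psi>" by (simp add: mul_L2_abs v)
  then obtain g where g: "abs_nabla (abs_L2 \<psi>) = mul_L2 (rho 1) g" using abs_nabla_mul_rho[OF v(2)] by metis
  note T = abs_nabla_test_L2[OF assms]
  have S: "square_integrable (\<lambda>x. rho 1 x * rep_L2 g x)"
    by (intro square_integrable_multiplier square_integrable_rep_L2 bounded_multiplier_rho)
  have ae: "AE x in lborel. rho 1 x * rep_L2 g x = abs_nabla_test \<psi> x"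
    using T(2) abs_L2_eq_iff[OF S T(1)] unfolding g mul_L2_def by simp
  have i: "integrable lborel (\<lambda>x. rho 1 x * rep_L2 g x)"
    by (intro square_integrable_product square_integrable_rep_L2 square_integrable_rho) simp
  have "abs_nabla_test \<psi> \<in> borel_measurable lborel" using T(1) by (simp add: square_integrable_measurable)
  then show ?thesis using integrable_cong_AE_imp[OF i _ ae] by blast
qed

lemma AE_interval_point:
  fixes a b :: real
  assumes "AE x in lborel. P x" "a < b"
  shows "\<exists>x\<in>{a<..<b}. P x"
proof (rule ccontr)
  assume "\<not> (\<exists>x\<in>{a<..<b}. P x)"
  then have "AE x in lborel. x \<notin> {a<..<b}" using assms(1) by (auto elim: eventually_mono)
  then have "emeasure lborel {a<..<b} = 0"
    by (subst (asm) AE_iff_measurable[of "{a<..<b}"]) auto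
  then show False using assms(2) by simp
qed

text \<open>The integral is the transform at frequency 0, and \<open>\<bar>\<xi>\<bar>\<close> times
  a bounded function tends to 0 there. In distributional terms, \<open>|nabla|\<close> annihilates
  constants.\<close>

lemma integral_abs_nabla_test:
  assumes "test_function \<psi>" shows "(LINT x|lborel. abs_nabla_test \<psi> x) = 0"
proof -
  note P = test_function_facts[OF assms]
  note i = abs_nabla_test_integrable[OF assms]
  note T = abs_nabla_test_L2[OF assms]
  have [measurable]: "abs_nabla_test \<psi> \<in> borel_measurable borel" using T(1) by measurable
  have "abs_L2 (FT (abs_nabla_test \<psi>)) = fourier (abs_nabla (abs_L2 \<psi>))"
    using fourier_eq_FT[OF i T(1)] T(2) by simp
  note eq = this
  have "AE \<xi> in lborel. FT (abs_nabla_test \<psi>) \<xi> = of_real \<bar>\<xi>\<bar> * FT \<psi> \<xi>"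
    using AE_rep_abs_L2[OF FT_square_integrable(1)[OF i T(1)], unfolded eq] AE_fourier_abs_nabla[OF P(3), unfolded fourier_eq_FT[OF P(1,2)]]
      AE_rep_abs_L2[OF FT_square_integrable(1)[OF P(1,2)]]
    by eventually_elim simp
  \<comment> \<open>The two transforms agree only almost everywhere, so the value at 0 is approached
    along frequencies at which they do agree.\<close>
  then have "\<exists>\<xi>\<in>{0<..<1 / real (Suc n)}. FT (abs_nabla_test \<psi>) \<xi> = of_real \<bar>\<xi>\<bar> * FT \<psi> \<xi>" for n
    by (rule AE_interval_point) simp
  then obtain X where X: "\<And>n. X n \<in> {0<..<1 / real (Suc n)}"
    "\<And>n. FT (abs_nabla_test \<psi>) (X n) = of_real \<bar>X n\<bar> * FT \<psi> (X n)" by metis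
  have X0: "X \<longlonglongrightarrow> 0"
  proof (rule real_tendsto_sandwich[OF _ _ tendsto_const])
    show "(\<lambda>n. 1 / real (Suc n)) \<longlonglongrightarrow> 0" using LIMSEQ_inverse_real_of_nat by (simp add: inverse_eq_divide)
  qed (use X(1) in \<open>auto intro!: always_eventually less_imp_le\<close>)
  have "(\<lambda>n. FT (abs_nabla_test \<psi>) (X n)) \<longlonglongrightarrow> (LINT x|lborel. abs_nabla_test \<psi> x)"
    unfolding FT_def
  proof (rule integral_dominated_convergence)
    show "integrable lborel (\<lambda>x. cmod (abs_nabla_test \<psi> x))" using i by (rule integrable_norm)
    show "AE x in lborel. (\<lambda>n. abs_nabla_test \<psi> x * exp (- (\<i> * complex_of_real (x * X n)))) \<longlonglongrightarrow> abs_nabla_test \<psi> x"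
    proof (rule AE_I2)
      fix x
      have "(\<lambda>n. abs_nabla_test \<psi> x * exp (- (\<i> * complex_of_real (x * X n)))) \<longlonglongrightarrow>
          abs_nabla_test \<psi> x * exp (- (\<i> * complex_of_real (x * 0)))"
        by (intro tendsto_intros X0)
      then show "(\<lambda>n. abs_nabla_test \<psi> x * exp (- (\<i> * complex_of_real (x * X n)))) \<longlonglongrightarrow> abs_nabla_test \<psi> x" by simp
    qed
  qed (simp_all add: norm_mult del: of_real_mult)
  moreover have "(\<lambda>n. FT (abs_nabla_test \<psi>) (X n)) \<longlonglongrightarrow> 0"
    unfolding X(2)
  proof (rule Lim_null_comparison)
    show "\<forall>\<^sub>F n in sequentially. norm (of_real \<bar>X n\<bar> * FT \<psi> (X n)) \<le> \<bar>X n\<bar> * (LINT x|lborel. cmod (\<psi> x))"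
      by (rule always_eventually) (auto simp: norm_mult intro!: mult_left_mono FT_bound P)
    show "(\<lambda>n. \<bar>X n\<bar> * (LINT x|lborel. cmod (\<psi> x))) \<longlonglongrightarrow> 0"
      using X0 by (intro tendsto_mult_left_zero tendsto_rabs_zero)
  qed
  ultimately show ?thesis by (rule LIMSEQ_unique)
qed

section \<open>The resonance\<close>

lemma scaleC_double: "(n * 2) *\<^sub>C (u :: L2) = n *\<^sub>C u + n *\<^sub>C u"
  by (simp only: mult_2_right scaleC_add_left)

text \<open>In terms of functions this reads
  \<open>|nabla| (zeta ^ m - 1) = m * omega * zeta ^ m\<close>, see \<open>cay_minus_1\<close> and
  \<open>beta_alt\<close>. Induction works because each further basis vector contributes exactly the
  increment of the right-hand side.\<close>

lemma abs_nabla_cay: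
  "(- 2) *\<^sub>C (\<Sum>j<m. basis (int j)) \<in> H1 \<and> abs_nabla ((- 2) *\<^sub>C (\<Sum>j<m. basis (int j))) = of_nat m *\<^sub>C beta (int m)"
proof (induction m)
  case 0
  have "abs_nabla 0 = 0" using abs_nabla_scaleC[OF H1_zero, of 0] by simp
  then show ?case by (simp add: H1_zero)
next
  case (Suc m)
  let ?S = "(- 2) *\<^sub>C (\<Sum>j<m. basis (int j))"
  have b: "(- 2) *\<^sub>C basis (int m) \<in> H1" by (intro H1_scaleC basis_H1)
  have eq: "(- 2) *\<^sub>C (\<Sum>j<Suc m. basis (int j)) = ?S + (- 2) *\<^sub>C basis (int m)"
    by (simp only: sum.lessThan_Suc scaleC_add_right)
  have "abs_nabla (?S + (- 2) *\<^sub>C basis (int m)) = of_nat m *\<^sub>C beta (int m) + (- 2) *\<^sub>C abs_nabla (basis (int m))"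
    unfolding abs_nabla_add[OF conjunct1[OF Suc.IH] b] conjunct2[OF Suc.IH] abs_nabla_scaleC[OF basis_H1] ..
  also have "\<dots> = of_nat (Suc m) *\<^sub>C beta (int (Suc m))"
  proof -
    have "n *\<^sub>C (b - a) + (- 2) *\<^sub>C ((1/2) *\<^sub>C (b - c) + n *\<^sub>C (b - (1/2) *\<^sub>C (c + a))) = (1 + n) *\<^sub>C (c - b)"
      for n :: complex and a b c :: L2
    proof -
      have "n *\<^sub>C (b - a) + (- 2) *\<^sub>C ((1/2) *\<^sub>C (b - c) + n *\<^sub>C (b - (1/2) *\<^sub>C (c + a))) =
          (n - 1 - (n + n)) *\<^sub>C b + (1 + n) *\<^sub>C c + (n - n) *\<^sub>C a"
        by (simp add: complex_vector.scale_right_diff_distrib complex_vector.scale_left_diff_distrib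
            scaleC_add_left scaleC_add_right scaleC_scaleC scaleC_one complex_vector.scale_minus_left
            complex_vector.scale_minus_right algebra_simps scaleC_double)
      then show ?thesis
        by (simp add: complex_vector.scale_right_diff_distrib complex_vector.scale_left_diff_distrib
            scaleC_add_left scaleC_one algebra_simps complex_vector.scale_minus_left)
    qed
    from this[of "of_nat m" "basis (int m)" "basis (int m - 1)" "basis (int m + 1)"]
    show ?thesis
      unfolding abs_nabla_basis_nonneg mul_omega_basis beta_def by (simp add: add.commute)
  qed
  finally show ?case unfolding eq using H1_add(1)[OF conjunct1[OF Suc.IH] b] by simp
qed

text \<open>Subtracting the limit at infinity gains square integrability: the geometric sum has the
  factor \<open>zeta 1 - 1 = - 2 * rho 1\<close>.\<close>

lemma cay_minus_1:
  "square_integrable (\<lambda>x. cay (int m) x - 1)"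
  "abs_L2 (\<lambda>x. cay (int m) x - 1) = (- 2) *\<^sub>C (\<Sum>j<m. basis (int j))"
proof -
  have eq: "cay (int m) x - 1 = (- 2) * (\<Sum>j<m. cay (int j) x * rho 1 x)" for x
  proof -
    have "zeta 1 x ^ m - 1 = (zeta 1 x - 1) * (\<Sum>j<m. zeta 1 x ^ j)"
      by (rule power_diff_1_eq)
    also have "zeta 1 x - 1 = (- 2) * rho 1 x" by (simp add: zeta_def)
    also have "(- 2) * rho 1 x * (\<Sum>j<m. zeta 1 x ^ j) = (- 2) * (\<Sum>j<m. cay (int j) x * rho 1 x)"
      unfolding cay_nat sum_distrib_right[symmetric] by (simp only: mult_ac)
    finally show ?thesis by (simp add: cay_nat)
  qed
  have S: "square_integrable (\<lambda>x. cay (int j) x * rho 1 x)" for j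
    by (intro square_integrable_multiplier square_integrable_rho) auto
  show "square_integrable (\<lambda>x. cay (int m) x - 1)"
    unfolding eq by (intro square_integrable_cmult square_integrable_sum S)
  have b: "abs_L2 (\<lambda>x. cay (int j) x * rho 1 x) = basis (int j)" for j
    unfolding basis_def rho_L2_def by (subst mul_L2_abs) (auto intro: square_integrable_rho)
  show "abs_L2 (\<lambda>x. cay (int m) x - 1) = (- 2) *\<^sub>C (\<Sum>j<m. basis (int j))"
    unfolding eq abs_L2_scaleC[OF square_integrable_sum[OF S]] abs_L2_sum[OF S] b ..
qed

lemma L_plus_distr_cay:
  assumes "test_function \<psi>" shows "L_plus_distr m (cay (int m)) \<psi> = 0"
proof -
  let ?\<psi>' = "\<lambda>x. cnj (\<psi> x)"
  note t' = test_function_cnj[OF assms]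
  note P = test_function_facts[OF assms] and P' = test_function_facts[OF t']
  note i = abs_nabla_test_integrable[OF assms]
  note T = abs_nabla_test_L2[OF assms] and T' = abs_nabla_test_L2[OF t']
  note H = abs_nabla_cay[of m, folded cay_minus_1(2)]
  have iH: "integrable lborel (\<lambda>x. (cay (int m) x - 1) * abs_nabla_test \<psi> x)"
    by (rule square_integrable_product[OF cay_minus_1(1) T(1)])
  \<comment> \<open>The constant 1 is split off; its pairing vanishes by
    \<open>integral_abs_nabla_test\<close>, and what remains is a pairing in
    \<open>L2\<close>.\<close>
  have "(LINT x|lborel. cay (int m) x * abs_nabla_test \<psi> x) =
      (LINT x|lborel. (cay (int m) x - 1) * abs_nabla_test \<psi> x + abs_nabla_test \<psi> x)"
    by (rule Bochner_Integration.integral_cong) (simp_all add: algebra_simps)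
  also have "\<dots> = (LINT x|lborel. (cay (int m) x - 1) * abs_nabla_test \<psi> x)"
    using iH i integral_abs_nabla_test[OF assms] by simp
  \<comment> \<open>The distributional pairing is bilinear and \<open>cinner\<close> is not, so the
    conjugated test function enters on the right.\<close>
  also have "\<dots> = cinner (abs_L2 (\<lambda>x. cay (int m) x - 1)) (abs_L2 (abs_nabla_test ?\<psi>'))"
    unfolding cinner_abs[OF cay_minus_1(1) T'(1)] by (simp add: abs_nabla_test_cnj)
  also have "\<dots> = cinner (of_nat m *\<^sub>C beta (int m)) (abs_L2 ?\<psi>')"
    unfolding T'(2) H[THEN conjunct2, symmetric] by (rule abs_nabla_symmetric[symmetric]) (use H P' in auto)
  also have "\<dots> = of_nat m * (LINT x|lborel. omega x * cay (int m) x * \<psi> x)"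
    unfolding cinner_scaleC_left beta_alt(2) cinner_abs[OF beta_alt(1) P'(2)] by simp
  also have "\<dots> = (LINT x|lborel. potential m x * cay (int m) x * \<psi> x)"
    unfolding integral_mult_right_zero[symmetric]
    by (rule Bochner_Integration.integral_cong) (simp_all add: potential_def omega_def)
  finally show ?thesis by (simp add: L_plus_distr_def)
qed

text \<open>The operator is real, so it annihilates the conjugate of \<open>cay\<close> along with
  \<open>cay\<close>; the real and imaginary parts of a multiple of \<open>zeta ^ m\<close> are such
  combinations.\<close>

lemma L_plus_distr_combination:
  assumes t: "test_function \<psi>"
  shows "L_plus_distr m (\<lambda>x. a * cay (int m) x + b * cnj (cay (int m) x)) \<psi> = 0"
proof -
  let ?\<psi>' = "\<lambda>x. cnj (\<psi> x)"
  note P = test_function_facts[OF t]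
  have i: "integrable lborel (\<lambda>x. f x * abs_nabla_test \<psi> x)" if "f \<in> borel_measurable borel" "\<And>x. cmod (f x) \<le> 1" for f
    by (rule integrable_mult_unimodular(2)[OF abs_nabla_test_integrable[OF t] that])
  have j: "integrable lborel (\<lambda>x. potential m x * f x * \<psi> x)" if "f \<in> borel_measurable borel" "\<And>x. cmod (f x) \<le> 1" for f
  proof -
    have "integrable lborel (\<lambda>x. of_nat m * ((omega x * \<psi> x) * f x))"
      by (intro integrable_mult_right integrable_mult_unimodular(1)[OF _ that] square_integrable_product P)
        (use beta_alt(1)[of 0] in simp)
    moreover have "of_nat m * ((omega x * \<psi> x) * f x) = potential m x * f x * \<psi> x" for x
      by (simp add: potential_def omega_def)
    ultimately show ?thesis by simp
  qed
  have cm: "cay (int m) \<in> borel_measurable borel" "(\<lambda>x. cnj (cay (int m) x)) \<in> borel_measurable borel" by measurable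
  have 1: "L_plus_distr m (cay (int m)) \<psi> = 0" by (rule L_plus_distr_cay[OF t])
  have "cnj (L_plus_distr m (\<lambda>x. cnj (cay (int m) x)) \<psi>) = L_plus_distr m (cay (int m)) ?\<psi>'"
    unfolding L_plus_distr_def complex_cnj_diff Bochner_Integration.integral_cnj[symmetric]
    by (simp add: abs_nabla_test_cnj potential_def)
  then have 2: "L_plus_distr m (\<lambda>x. cnj (cay (int m) x)) \<psi> = 0"
    using L_plus_distr_cay[OF test_function_cnj[OF t], of m] by simp
  have "(LINT x|lborel. (a * cay (int m) x + b * cnj (cay (int m) x)) * abs_nabla_test \<psi> x) =
      a * (LINT x|lborel. cay (int m) x * abs_nabla_test \<psi> x) + b * (LINT x|lborel. cnj (cay (int m) x) * abs_nabla_test \<psi> x)"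
    using i[OF cm(1)] i[OF cm(2)] by (simp add: distrib_right mult.assoc)
  moreover have "(LINT x|lborel. potential m x * (a * cay (int m) x + b * cnj (cay (int m) x)) * \<psi> x) =
      a * (LINT x|lborel. potential m x * cay (int m) x * \<psi> x) + b * (LINT x|lborel. potential m x * cnj (cay (int m) x) * \<psi> x)"
  proof -
    have "(LINT x|lborel. potential m x * (a * cay (int m) x + b * cnj (cay (int m) x)) * \<psi> x) =
        (LINT x|lborel. a * (potential m x * cay (int m) x * \<psi> x) + b * (potential m x * cnj (cay (int m) x) * \<psi> x))"
      by (rule Bochner_Integration.integral_cong) (simp_all add: algebra_simps)
    also have "\<dots> = a * (LINT x|lborel. potential m x * cay (int m) x * \<psi> x) + b * (LINT x|lborel. potential m x * cnj (cay (int m) x) * \<psi> x)"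
      using j[OF cm(1)] j[OF cm(2)] by simp
    finally show ?thesis .
  qed
  ultimately show ?thesis
    using 1 2 by (simp add: L_plus_distr_def)
qed

lemma integrable_omega: "integrable lborel omega"
proof -
  have "integrable lborel (\<lambda>x. complex_of_real (2 * (1 / (1 + x\<^sup>2))))"
    by (intro integrable_of_real integrable_mult_right integrable_inverse_1_plus_square)
  then show ?thesis by (simp add: omega_def[abs_def])
qed

text \<open>The integrand is twice the product of \<open>basis n\<close> with the conjugate of
  \<open>basis 0\<close>, so this is their orthogonality.\<close>

lemma integral_omega_cay:
  assumes "n \<noteq> 0" shows "(LINT x|lborel. omega x * cay n x) = 0"
proof -
  have S: "square_integrable (\<lambda>x. cay n x * rho 1 x)"
    by (intro square_integrable_multiplier square_integrable_rho) auto
  have "basis n = abs_L2 (\<lambda>x. cay n x * rho 1 x)"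
    unfolding basis_def rho_L2_def by (rule mul_L2_abs) (auto intro: square_integrable_rho)
  then have "cinner (basis n) (basis 0) = (LINT x|lborel. cay n x * rho 1 x * cnj (rho 1 x))"
    using cinner_abs[OF S square_integrable_rho[of 1]] by (simp add: basis_0 rho_L2_def)
  then have "(LINT x|lborel. cay n x * rho 1 x * rho (- 1) x) = 0"
    using assms by (simp add: cinner_basis cnj_rho)
  then have "(LINT x|lborel. 2 * (cay n x * rho 1 x * rho (- 1) x)) = 0" by simp
  then show ?thesis by (simp add: omega_eq_rho[of 1] mult_ac)
qed

text \<open>\<open>R\<close> only tests against modes \<open>p\<close> with \<open>|p| < m\<close>,
  while the function has modes \<open>m\<close> and \<open>- m\<close>. The shifted modes are never
  0, so every coefficient vanishes by \<open>integral_omega_cay\<close>.\<close>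

lemma R_fun_combination:
  "R_fun m (\<lambda>x. a * cay (int m) x + b * cnj (cay (int m) x)) x = 0"
proof -
  let ?f = "\<lambda>x. a * cay (int m) x + b * cay (- int m) x"
  have cm: "integrable lborel (\<lambda>y. omega y * cay n y)" for n
    by (rule integrable_mult_unimodular(1)[OF integrable_omega, where C = 1]) auto
  have int: "integrable lborel (\<lambda>y. omega y * ?f y)"
  proof -
    have "integrable lborel (\<lambda>y. a * (omega y * cay (int m) y) + b * (omega y * cay (- int m) y))"
      using cm by (intro Bochner_Integration.integrable_add integrable_mult_right)
    then show ?thesis by (simp add: algebra_simps)
  qed
  have "(LINT y|lborel. ?f y * cnj (omega y * cay p y)) = 0" if "\<bar>p\<bar> < int m" for p
  proof -
    have "cnj (omega y) = omega y" for y by (simp add: omega_def)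
    then have "?f y * cnj (omega y * cay p y) = a * (omega y * cay (int m - p) y) + b * (omega y * cay (- int m - p) y)" for y
      using cay_add[of "int m" "- p" y] cay_add[of "- int m" "- p" y]
      by (simp only: diff_conv_add_uminus complex_cnj_mult cnj_cay) (simp add: algebra_simps del: minus_add_distrib add_uminus_conv_diff)
    then show ?thesis using cm integral_omega_cay[of "int m - p"] integral_omega_cay[of "- int m - p"] that by simp
  qed
  then have "R_fun m ?f x = 0"
    unfolding R_fun_expansion[OF int] by (intro sum.neutral ballI) auto
  then show ?thesis by (simp add: cnj_cay)
qed

section \<open>The components of the half-harmonic map as resonances\<close>

lemma component_combination:
  "complex_of_real (f_comp m x) = \<i> ^ m / 2 * cay (int m) x + (- \<i>) ^ m / 2 * cnj (cay (int m) x)"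
  "complex_of_real (g_comp m x) = \<i> ^ m / (2 * \<i>) * cay (int m) x + - ((- \<i>) ^ m) / (2 * \<i>) * cnj (cay (int m) x)"
proof -
  define w where "w = (\<i> * zeta 1 x) ^ m"
  have "complex_of_real x + \<i> \<noteq> 0" by (auto simp: complex_eq_iff)
  then have z: "(complex_of_real x - \<i>) / (of_real x + \<i>) = zeta 1 x"
    using rho_denom_nonzero(1)[of x] by (simp add: zeta_alt field_simps)
  have w: "w = \<i> ^ m * cay (int m) x" "cnj w = (- \<i>) ^ m * cnj (cay (int m) x)"
    by (simp_all add: w_def cay_nat power_mult_distrib)
  have "complex_of_real (Re w) = (w + cnj w) / 2" by (simp add: complex_add_cnj)
  then show "complex_of_real (f_comp m x) = \<i> ^ m / 2 * cay (int m) x + (- \<i>) ^ m / 2 * cnj (cay (int m) x)"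
    unfolding f_comp_def z w_def[symmetric] w by (simp add: add_divide_distrib)
  have "complex_of_real (Im w) = (w - cnj w) / (2 * \<i>)" by (simp add: complex_eq_iff Re_divide Im_divide)
  then show "complex_of_real (g_comp m x) = \<i> ^ m / (2 * \<i>) * cay (int m) x + - ((- \<i>) ^ m) / (2 * \<i>) * cnj (cay (int m) x)"
    unfolding g_comp_def z w_def[symmetric] w(2) unfolding w(1)
    by (simp only: diff_divide_distrib times_divide_eq_left diff_conv_add_uminus minus_divide_left mult_minus_left add_divide_distrib)
qed

lemma component_difference_le:
  "\<bar>f_comp m x - f_comp m y\<bar>\<^sup>2 / \<bar>x - y\<bar>\<^sup>2 \<le> R_kernel m x y"
  "\<bar>g_comp m x - g_comp m y\<bar>\<^sup>2 / \<bar>x - y\<bar>\<^sup>2 \<le> R_kernel m x y"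
  unfolding R_kernel_def
  by (intro divide_right_mono; simp add: Q_map_def norm_prod_def)+

lemma component_bounded: "\<bar>f_comp m x\<bar> \<le> 1" "\<bar>g_comp m x\<bar> \<le> 1"
proof -
  have "complex_of_real x + \<i> \<noteq> 0" by (auto simp: complex_eq_iff)
  then have "(complex_of_real x - \<i>) / (of_real x + \<i>) = zeta 1 x"
    using rho_denom_nonzero(1)[of x] by (simp add: zeta_alt field_simps)
  then have "cmod ((\<i> * ((complex_of_real x - \<i>) / (of_real x + \<i>))) ^ m) = 1"
    by (simp add: norm_power norm_mult)
  then show "\<bar>f_comp m x\<bar> \<le> 1" "\<bar>g_comp m x\<bar> \<le> 1"
    unfolding f_comp_def g_comp_def by (metis abs_Re_le_cmod, metis abs_Im_le_cmod)
qed

text \<open>The seminorm integrand is dominated by the kernel of \<open>R\<close>, which is at most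
  a constant times a product of integrable weights in \<open>x\<close> and in \<open>y\<close>; the
  double integral therefore factors.\<close>

lemma in_H_half_dot:
  fixes h :: "real \<Rightarrow> real"
  assumes [measurable]: "h \<in> borel_measurable borel" and b: "\<And>x. \<bar>h x\<bar> \<le> 1"
    and le: "\<And>x y. \<bar>h x - h y\<bar>\<^sup>2 / \<bar>x - y\<bar>\<^sup>2 \<le> R_kernel m x y"
  shows "(\<lambda>x. complex_of_real (h x)) \<in> H_half_dot"
  unfolding H_half_dot_def mem_Collect_eq
proof (intro conjI allI)
  show "(\<lambda>x. complex_of_real (h x)) \<in> borel_measurable lborel" by simp
  show "set_integrable lborel {- r..r} (\<lambda>x. complex_of_real (h x))" for r
    unfolding set_integrable_def
  proof (rule Bochner_Integration.integrable_bound)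
    show "integrable lborel (indicator {- r..r} :: real \<Rightarrow> real)"
      by (auto intro!: integrable_real_indicator simp: emeasure_lborel_Icc_eq)
    show "AE x in lborel. norm (indicator {- r..r} x *\<^sub>R complex_of_real (h x)) \<le> norm (indicat_real {- r..r} x)"
      using b by (intro AE_I2) (auto simp: indicator_def)
  qed measurable
  show "integrable lborel (\<lambda>x. cmod (complex_of_real (h x)) / (1 + x\<^sup>2))"
  proof (rule integrable_dominated[OF integrable_inverse_1_plus_square])
    show "cmod (complex_of_real (h x)) / (1 + x\<^sup>2) \<le> 1 / (1 + x\<^sup>2)" for x
      using b[of x] by (intro divide_right_mono) auto
  qed simp_all
  define J where "J = (LINT x|lborel. 1 / (1 + (x::real)\<^sup>2))"
  have J: "(\<integral>\<^sup>+x. ennreal (1 / (1 + x\<^sup>2)) \<partial>lborel) = ennreal J"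
    unfolding J_def by (rule nn_integral_eq_integral[OF integrable_inverse_1_plus_square]) simp
  have "(\<integral>\<^sup>+ x. \<integral>\<^sup>+ y. ennreal ((cmod (complex_of_real (h x) - complex_of_real (h y)))\<^sup>2 / \<bar>x - y\<bar>\<^sup>2) \<partial>lborel \<partial>lborel) \<le>
      (\<integral>\<^sup>+ x. \<integral>\<^sup>+ y. ennreal (4 * (real m)\<^sup>2) * ennreal (1 / (1 + x\<^sup>2)) * ennreal (1 / (1 + y\<^sup>2)) \<partial>lborel \<partial>lborel)"
  proof (intro nn_integral_mono)
    fix x y :: real
    have "(cmod (complex_of_real (h x) - complex_of_real (h y)))\<^sup>2 / \<bar>x - y\<bar>\<^sup>2 = \<bar>h x - h y\<bar>\<^sup>2 / \<bar>x - y\<bar>\<^sup>2"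
      by (simp only: of_real_diff[symmetric] norm_of_real)
    also have "\<dots> \<le> 4 * (real m)\<^sup>2 / ((1 + x\<^sup>2) * (1 + y\<^sup>2))"
      by (rule order_trans[OF le R_kernel_bounds(2)])
    also have "\<dots> = 4 * (real m)\<^sup>2 * (1 / (1 + x\<^sup>2)) * (1 / (1 + y\<^sup>2))" by simp
    finally show "ennreal ((cmod (complex_of_real (h x) - complex_of_real (h y)))\<^sup>2 / \<bar>x - y\<bar>\<^sup>2) \<le>
        ennreal (4 * (real m)\<^sup>2) * ennreal (1 / (1 + x\<^sup>2)) * ennreal (1 / (1 + y\<^sup>2))"
      by (simp only: ennreal_mult'[symmetric] ennreal_mult[symmetric] mult_nonneg_nonneg zero_le_power2 zero_le_numeral
          zero_le_divide_1_iff add_nonneg_nonneg zero_le_one) (rule ennreal_leI, simp)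
  qed
  also have "\<dots> = (\<integral>\<^sup>+ x. ennreal (4 * (real m)\<^sup>2) * ennreal (1 / (1 + x\<^sup>2)) * ennreal J \<partial>lborel)"
    by (rule nn_integral_cong) (subst nn_integral_cmult, simp, simp only: J)
  also have "\<dots> = ennreal (4 * (real m)\<^sup>2) * ennreal J * ennreal J"
    by (subst nn_integral_multc, simp, subst nn_integral_cmult, simp, simp only: J)
  also have "\<dots> < \<infinity>" by (simp add: ennreal_mult_less_top)
  finally show "ennreal (1 / (2 * pi)) * (\<integral>\<^sup>+ x. \<integral>\<^sup>+ y. ennreal ((cmod (complex_of_real (h x) - complex_of_real (h y)))\<^sup>2 / \<bar>x - y\<bar>\<^sup>2) \<partial>lborel \<partial>lborel) < \<infinity>"
    by (simp add: ennreal_mult_less_top)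
qed

text \<open>Up to square-integrable terms (\<open>cay_minus_1\<close>) the function is the constant
  \<open>a + b\<close>, and a nonzero constant is not square integrable on the line.\<close>

lemma combination_not_square_integrable:
  assumes "a + b \<noteq> 0"
  shows "\<not> square_integrable (\<lambda>x. a * cay (int m) x + b * cnj (cay (int m) x))"
proof
  assume "square_integrable (\<lambda>x. a * cay (int m) x + b * cnj (cay (int m) x))"
  then have "square_integrable (\<lambda>x. (a * cay (int m) x + b * cnj (cay (int m) x)) -
      (a * (cay (int m) x - 1) + b * cnj (cay (int m) x - 1)))"
    by (rule square_integrable_diff[OF _ square_integrable_add[OF square_integrable_cmult[OF cay_minus_1(1)]
            square_integrable_cmult[OF square_integrable_cnj[OF cay_minus_1(1)]]]])
  moreover have "(\<lambda>x. (a * cay (int m) x + b * cnj (cay (int m) x)) -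
      (a * (cay (int m) x - 1) + b * cnj (cay (int m) x - 1))) = (\<lambda>x. a + b)"
    by (auto simp: algebra_simps)
  ultimately have "square_integrable (\<lambda>x. a + b)" by (simp only:)
  then have "integrable lborel (\<lambda>x::real. (cmod (a + b))\<^sup>2)"
    by (rule square_integrable_norm_square)
  then show False using assms by (simp add: integrable_iff_bounded ennreal_mult_less_top ennreal_mult_eq_top_iff)
qed

lemma resonances:
  fixes \<phi> :: "real \<Rightarrow> complex"
  assumes H: "\<phi> \<in> H_half_dot" and \<phi>: "\<phi> = (\<lambda>x. a * cay (int m) x + b * cnj (cay (int m) x))" and "a + b \<noteq> 0"
  shows "\<not> square_integrable \<phi>" "is_resonance_at_0 m (\<phi>, \<lambda>x. 0)" "is_resonance_at_0 m (\<lambda>x. 0, \<phi>)"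
    "ae_independent (\<phi>, \<lambda>x. 0) (\<lambda>x. 0, \<phi>)"
proof -
  show n: "\<not> square_integrable \<phi>" unfolding \<phi> by (rule combination_not_square_integrable[OF assms(3)])
  have z: "(\<lambda>x. 0) \<in> H_half_dot" by (simp add: H_half_dot_def set_integrable_def)
  have P: "L_plus_distr m \<phi> \<psi> = 0" if "test_function \<psi>" for \<psi>
    unfolding \<phi> by (rule L_plus_distr_combination[OF that])
  have M: "L_minus_distr m \<phi> \<psi> = 0" if "test_function \<psi>" for \<psi>
    using P[OF that] R_fun_combination[of m a b] by (simp add: L_minus_distr_def \<phi>)
  have P0: "L_plus_distr m (\<lambda>x. 0) \<psi> = 0" for \<psi> by (simp add: L_plus_distr_def)
  have M0: "L_minus_distr m (\<lambda>x. 0) \<psi> = 0" for \<psi> by (simp add: L_minus_distr_def P0 R_fun_def)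
  show "is_resonance_at_0 m (\<phi>, \<lambda>x. 0)" "is_resonance_at_0 m (\<lambda>x. 0, \<phi>)"
    using H z n P M P0 M0 by (simp_all add: is_resonance_at_0_def)
  have ae: "c = 0" if "AE x in lborel. c * \<phi> x = 0" for c
  proof (rule ccontr)
    assume c: "c \<noteq> 0"
    have "AE x in lborel. 0 = \<phi> x" using that c by auto
    moreover have "\<phi> \<in> borel_measurable borel" unfolding \<phi> by measurable
    ultimately show False using square_integrable_cong_AE[OF square_integrable_zero] n by blast
  qed
  show "ae_independent (\<phi>, \<lambda>x. 0) (\<lambda>x. 0, \<phi>)"
    unfolding ae_independent_def by (auto intro: ae)
qed

theorem theorem6:
  fixes m :: nat
  assumes "m \<ge> 1"
  shows
    "spectrum L_dom (L_op m) = {z. Re z = 0} \<and>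
     (eigenvalues L_dom (L_op m) = {0} \<and>
      cdim {w\<in>L_dom. L_op m w = 0} = 2 * m + 1 \<and>
      (\<forall>z. Re z = 0 \<and> z \<noteq> 0 \<longrightarrow> z \<notin> eigenvalues L_dom (L_op m))) \<and>
     ((\<Union>n\<in>{1..}. power_kernel L_dom (L_op m) n) = power_kernel L_dom (L_op m) 2 \<and>
      (\<forall>E \<phi>. L_plus_eigensystem m E \<phi> \<longrightarrow>
         power_kernel L_dom (L_op m) 2 =
           cspan ((\<lambda>k. (\<phi> k, 0)) ` {..<2 * m} \<union> (\<lambda>k. (0, \<phi> k)) ` {..<2 * m}))) \<and>
     (let \<phi> = (\<lambda>x. complex_of_real (if odd m then g_comp m x else f_comp m x)) in
        \<phi> \<in> H_half_dot \<and> \<not> square_integrable \<phi> \<and>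
        is_resonance_at_0 m (\<phi>, \<lambda>x. 0) \<and>
        is_resonance_at_0 m (\<lambda>x. 0, \<phi>) \<and>
        ae_independent (\<phi>, \<lambda>x. 0) (\<lambda>x. 0, \<phi>))"
proof -
  let ?\<phi> = "\<lambda>x. complex_of_real (if odd m then g_comp m x else f_comp m x)"
  have kernel: "power_kernel L_dom (L_op m) 2 =
      cspan ((\<lambda>k. (\<phi> k, 0)) ` {..<2 * m} \<union> (\<lambda>k. (0, \<phi> k)) ` {..<2 * m})"
    if "L_plus_eigensystem m E \<phi>" for E \<phi>
    unfolding cspan_pairs eigensystem_span[OF assms that] by (rule power_kernel_2)
  \<comment> \<open>Parity selects the component whose limit at infinity is nonzero:
    \<open>a + b\<close> is \<open>\<i> ^ m / \<i>\<close> for odd \<open>m\<close> and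
    \<open>\<i> ^ m\<close> for even \<open>m\<close>. The other component has limit 0 and is a
    multiple of the null vector.\<close>
  obtain a b where \<phi>: "?\<phi> = (\<lambda>x. a * cay (int m) x + b * cnj (cay (int m) x))" "a + b \<noteq> 0"
  proof (cases "odd m")
    case True
    have "\<i> ^ m / (2 * \<i>) + - ((- \<i>) ^ m) / (2 * \<i>) = \<i> ^ m / \<i>"
      using True by (simp add: power_minus_odd)
    then show ?thesis
      using that[of "\<i> ^ m / (2 * \<i>)" "- ((- \<i>) ^ m) / (2 * \<i>)"] True
      by (simp add: component_combination(2))
  next
    case False
    have "\<i> ^ m / 2 + (- \<i>) ^ m / 2 = \<i> ^ m" using False by simp
    then show ?thesis
      using that[of "\<i> ^ m / 2" "(- \<i>) ^ m / 2"] False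
      by (simp add: component_combination(1))
  qed
  have "?\<phi> \<in> H_half_dot"
  proof (cases "odd m")
    case True
    have "g_comp m \<in> borel_measurable borel" unfolding g_comp_def[abs_def] by measurable
    then show ?thesis
      using True in_H_half_dot[OF _ component_bounded(2) component_difference_le(2)] by simp
  next
    case False
    have "f_comp m \<in> borel_measurable borel" unfolding f_comp_def[abs_def] by measurable
    then show ?thesis
      using False in_H_half_dot[OF _ component_bounded(1) component_difference_le(1)] by simp
  qed
  note resonances = this resonances[OF this \<phi>]
  show ?thesis
    unfolding Let_def spectrum_L_op eigenvalues_L_op[OF assms] cdim_kernel[OF assms] generalized_nullspace
    using kernel resonances by blast
qed

end
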